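(* For every $w\in\mathfrak H^2$ and every $\tau$ in the upper half plane, with $q=e^{2\pi\sqrt{-1}\tau}$, $$G(w;\tau)=(\zeta\star g)(w;q),\qquad\text{where } \zeta\star g=m\circ(\zeta\otimes g)\circ\Delta_\mu .$$
   Context: Fix an integer $N\ge1$ and $\eta=e^{2\pi\sqrt{-1}/N}$. Let $\mathfrak H=\mathbb Q\langle x,y_a\ (a\in\mathbb Z/N\mathbb Z)\rangle$ be the non-commutative polynomial ring, $z_{n,a}=y_ax^{n-1}$ ($n\ge1$). Let $\mathfrak H^1$ (resp. $\mathfrak H^2$) be the subalgebra (for concatenation) generated by all $z_{n,a}$ (resp. by the $z_{n,a}$ with $n\ge2$). A word $z_{n_1,a_1}\cdots z_{n_r,a_r}$ is written $\binom{n_1,\dots,n_r}{a_1,\dots,a_r}$; the empty word is $1$. Let $\widetilde{\mathfrak H}^0=\mathbb Q+\sum_{n\ge2,\,a}\mathfrak H^1z_{n,a}$. The shuffle product $\sqcup\!\sqcup$ on $\mathfrak H$ is the $\mathbb Q$-bilinear product with $w\sqcup\!\sqcup1=1\sqcup\!\sqcup w=w$ and $u_1w_1\sqcup\!\sqcup u_2w_2=u_1(w_1\sqcup\!\sqcup u_2w_2)+u_2(u_1w_1\sqcup\!\sqcup w_2)$ for letters $u_1,u_2$ and words $w_1,w_2$. Let $\rho:\mathfrak H^1\to\mathfrak H^1$ be the $\mathbb Q$-linear bijection $\rho(z_{n_1,a_1}\cdots z_{n_r,a_r})=z_{n_1,a_1}z_{n_2,a_2-a_1}\cdots z_{n_r,a_r-a_{r-1}}$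 and $w_1\mathbin{\widetilde{\sqcup\!\sqcup}}w_2=\rho^{-1}(\rho(w_1)\sqcup\!\sqcup\rho(w_2))$. MZVs of level $N$: $\zeta:\widetilde{\mathfrak H}^0\to\mathbb R$ is $\mathbb Q$-linear with $\zeta(1)=1$ and $\zeta\binom{n_1,\dots,n_r}{a_1,\dots,a_r}=\sum_{0<k_1<\dots<k_r,\ k_i\equiv a_i \bmod N}k_1^{-n_1}\cdots k_r^{-n_r}$ ($n_1,\dots,n_{r-1}\ge1$, $n_r\ge2$). Multiple divisor functions: $g:\mathfrak H^1\to\mathbb C[[q]]$ is $\mathbb Q$-linear, $g(1)=1$, $g\big(\binom{n_1,\dots,n_r}{a_1,\dots,a_r};q\big)=\big(\tfrac{-2\pi\sqrt{-1}}{N}\big)^{n_1+\dots+n_r}\sum_{0<d_1<\dots<d_r,\ c_1,\dots,c_r>0}\prod_{i=1}^r\frac{\eta^{a_ic_i}c_i^{n_i-1}}{(n_i-1)!}q^{c_id_i}$. Multiple Eisenstein series of level $N$: for $n_i\ge2$, $G\big(\binom{n_1,\dots,n_r}{a_1,\dots,a_r};\tau\big)=\lim_{L\to\infty}\lim_{M\to\infty}\sum\prod_{i=1}^r(l_iN\tau+m_i)^{-n_i}$, the sum over integers $|l_i|\le L$, $|m_i|\le M$, $m_i\equiv a_i\bmod N$ with $0\prec l_1N\tau+m_1\prec\dots\prec l_rN\tau+m_r$, where $lN\tau+m\prec l'N\tau+m'$ iff $l<l'$, or $l=l'$ and $m<m'$; $G(1;\tau)=1$; extended $\mathbb Q$-linearly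 to $\mathfrak H^2$. Goncharov's algebra: let $S=\{\eta,\eta^2,\dots,\eta^N,0\}$. $\mathcal I(S)$ is the commutative $\mathbb Q$-algebra generated by symbols $\mathbb I(b_0;b_1,\dots,b_m;b_{m+1})$ ($m\ge0$, $b_i\in S$, degree $m$) modulo: (i) $\mathbb I(b;c)=1$; (ii) $\mathbb I(b;b_1,\dots,b_n;c)\mathbb I(b;b_{n+1},\dots,b_{n+m};c)=\sum_\sigma\mathbb I(b;b_{\sigma^{-1}(1)},\dots,b_{\sigma^{-1}(n+m)};c)$, summed over $\sigma\in\mathfrak S_{n+m}$ with $\sigma(1)<\dots<\sigma(n)$, $\sigma(n+1)<\dots<\sigma(n+m)$; (iii) $\mathbb I(b_0;b_1,\dots,b_m;b_{m+1})=\sum_{i=0}^m\mathbb I(b_0;b_1,\dots,b_i;c)\mathbb I(c;b_{i+1},\dots,b_m;b_{m+1})$ for all $c\in S$; (iv) $\mathbb I(b;b_1,\dots,b_m;b)=0$ for $m\ge1$. Its coproduct is the algebra homomorphism $\Delta\,\mathbb I(b_0;b_1,\dots,b_m;b_{m+1})=\sum_{0=i_0<i_1<\dots<i_k<i_{k+1}=m+1}\prod_{p=0}^k\mathbb I(b_{i_p};b_{i_p+1},\dots,b_{i_{p+1}-1};b_{i_{p+1}})\otimes\mathbb I(b_0;b_{i_1},\dots,b_{i_k};b_{m+1})$. Let $\mathcal I^0$ be the quotient by the ideal generated by $\mathbb I(0;0;b)$, $b\in S\setminus\{0\}$. Put $\mathbb I_c\binom{n_1,\dots,n_r}{a_1,\dots,a_r}=\mathbb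 I(0;\eta^{a_1},\{0\}^{n_1-1},\dots,\eta^{a_r},\{0\}^{n_r-1};\eta^c)$ ($\{0\}^k$ denotes $k$ entries $0$), $\mathbb I=\mathbb I_0$; let $\mathcal I^1$ be the $\mathbb Q$-span of the $\mathbb I\binom{\cdot}{\cdot}$ in $\mathcal I^0$ and $\mu:\mathcal I^0\to\mathcal I^1$ the algebra homomorphism with $\mu(\mathbb I_c\binom{n_1,\dots,n_r}{a_1,\dots,a_r})=\mathbb I\binom{n_1,\dots,n_r}{a_1-c,\dots,a_r-c}$. Put $\Delta_\mu=(\mu\otimes\mu)\circ\Delta|_{\mathcal I^1}$, extended $\mathbb Q(\eta)$-linearly. Put $\widetilde{\mathbb I}\binom{n_1,\dots,n_r}{a_1,\dots,a_r}=\frac{(-1)^r}{N^r}\sum_{b_1,\dots,b_r\in\mathbb Z/N\mathbb Z}\eta^{a_1b_1+(a_2-a_1)b_2+\dots+(a_r-a_{r-1})b_r}\mathbb I\binom{n_1,\dots,n_r}{b_1,\dots,b_r}$, $\widetilde{\mathbb I}(\emptyset)=1$, and let $\widetilde{\mathcal I}^1$ be their $\mathbb Q$-span. The paper identifies $(\mathfrak H^1,\widetilde{\sqcup\!\sqcup})$ with $\widetilde{\mathcal I}^1$ via $\binom{n_1,\dots,n_r}{a_1,\dots,a_r}\mapsto\widetilde{\mathbb I}\binom{n_1,\dots,n_r}{a_1,\dots,a_r}$; since $\Delta_\mu$ maps $\widetilde{\mathcal I}^1$ into $\widetilde{\mathcal I}^1\otimes\widetilde{\mathcal I}^1$, this gives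 a coproduct $\Delta_\mu$ on $\mathfrak H^1$. In $\zeta\star g$, $m$ is multiplication in $\mathbb C[[q]]$ ($\zeta$ is applied to the left tensor factors, which for $w\in\mathfrak H^2$ lie in $\widetilde{\mathfrak H}^0$). *)

theory Defs
  imports
    "HOL-Analysis.Analysis"
    "HOL-Library.Poly_Mapping"
    "HOL-Library.Multiset"
    "HOL-Combinatorics.Permutations"
    "Berlekamp_Zassenhaus.Finite_Field"
begin

text \<open>
  The level is \<open>N = CARD('N)\<close> for a type \<open>'N\<close> of class \<open>finite\<close>, so that \<open>'N mod_ring\<close> is the ring of
  integers modulo \<open>N\<close> (the case \<open>N = 1\<close> included).
\<close>

section \<open>Free modules and monoid algebras\<close>

text \<open>
  \<open>'b \<Rightarrow>\<^sub>0 'k\<close> is the free \<open>'k\<close>-module with basis \<open>'b\<close>; if \<open>'b\<close> is an additively written monoid, it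
  is the monoid algebra. The tensor product of the free modules on \<open>'b\<close> and \<open>'c\<close> is the free module
  on \<open>'b \<times> 'c\<close>, as an algebra as well.
\<close>

definition const :: "'k::zero \<Rightarrow> ('b::zero \<Rightarrow>\<^sub>0 'k)" where
  "const c = Poly_Mapping.single 0 c"

definition scal :: "'k::semiring_0 \<Rightarrow> ('b::monoid_add \<Rightarrow>\<^sub>0 'k) \<Rightarrow> ('b \<Rightarrow>\<^sub>0 'k)" where
  "scal c p = const c * p"

definition tensor :: "('b \<Rightarrow>\<^sub>0 'k) \<Rightarrow> ('c \<Rightarrow>\<^sub>0 'k) \<Rightarrow> ('b \<times> 'c \<Rightarrow>\<^sub>0 'k::semiring_0)" where
  "tensor p q = (\<Sum>u\<in>Poly_Mapping.keys p. \<Sum>v\<in>Poly_Mapping.keys q.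
     Poly_Mapping.single (u, v) (Poly_Mapping.lookup p u * Poly_Mapping.lookup q v))"

text \<open>
  \<open>tensor_map e f g\<close> is \<open>f \<otimes> g\<close> for maps \<open>f\<close> and \<open>g\<close> that are linear along the embedding of
  coefficients \<open>e\<close>.
\<close>

definition tensor_map ::
  "('r::zero_neq_one \<Rightarrow> 'k::semiring_0) \<Rightarrow> (('b \<Rightarrow>\<^sub>0 'r) \<Rightarrow> ('d::monoid_add \<Rightarrow>\<^sub>0 'k)) \<Rightarrow>
    (('c \<Rightarrow>\<^sub>0 'r) \<Rightarrow> ('e::monoid_add \<Rightarrow>\<^sub>0 'k)) \<Rightarrow> ('b \<times> 'c \<Rightarrow>\<^sub>0 'r) \<Rightarrow> ('d \<times> 'e \<Rightarrow>\<^sub>0 'k)" where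
  "tensor_map e f g t = (\<Sum>(u, v)\<in>Poly_Mapping.keys t. scal (e (Poly_Mapping.lookup t (u, v)))
     (tensor (f (Poly_Mapping.single u 1)) (g (Poly_Mapping.single v 1))))"

definition alg_hom :: "(('b::monoid_add \<Rightarrow>\<^sub>0 'k::semiring_1) \<Rightarrow> ('c::monoid_add \<Rightarrow>\<^sub>0 'k)) \<Rightarrow> bool" where
  "alg_hom f \<longleftrightarrow> (\<forall>c. f (const c) = const c) \<and> (\<forall>p q. f (p + q) = f p + f q) \<and>
     (\<forall>p q. f (p * q) = f p * f q)"

inductive_set subalgebra :: "('b::monoid_add \<Rightarrow>\<^sub>0 'k::semiring_0) set \<Rightarrow> ('b \<Rightarrow>\<^sub>0 'k) set"
  for X :: "('b \<Rightarrow>\<^sub>0 'k) set" where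
  const: "const c \<in> subalgebra X"
| gen: "p \<in> X \<Longrightarrow> p \<in> subalgebra X"
| add: "p \<in> subalgebra X \<Longrightarrow> q \<in> subalgebra X \<Longrightarrow> p + q \<in> subalgebra X"
| mult: "p \<in> subalgebra X \<Longrightarrow> q \<in> subalgebra X \<Longrightarrow> p * q \<in> subalgebra X"

definition ideal_generated :: "'r::comm_ring_1 set \<Rightarrow> 'r set" where
  "ideal_generated X = module.span (*) X"


section \<open>Roots of unity and the field they generate\<close>

definition eta_pow :: "'N::finite mod_ring \<Rightarrow> complex" where
  "eta_pow a = exp (2 * pi * \<i> / CARD('N)) ^ nat (to_int_mod_ring a)"

definition complex_subfield :: "complex set \<Rightarrow> bool" where
  "complex_subfield K \<longleftrightarrow> 0 \<in> K \<and> 1 \<in> K \<and>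
     (\<forall>x\<in>K. \<forall>y\<in>K. x - y \<in> K \<and> x * y \<in> K) \<and> (\<forall>x\<in>K. inverse x \<in> K)"

typedef (overloaded) ('N::finite) cyclotomic =
  "{z. \<forall>K. complex_subfield K \<and> exp (2 * pi * \<i> / CARD('N)) \<in> K \<longrightarrow> z \<in> K}"
  by (rule exI[of _ 0]) (simp add: complex_subfield_def)

setup_lifting type_definition_cyclotomic

lemma complex_subfield_closed:
  assumes "complex_subfield K"
  shows "0 \<in> K" "1 \<in> K" "x \<in> K \<Longrightarrow> y \<in> K \<Longrightarrow> x - y \<in> K" "x \<in> K \<Longrightarrow> - x \<in> K"
    "x \<in> K \<Longrightarrow> y \<in> K \<Longrightarrow> x + y \<in> K" "x \<in> K \<Longrightarrow> y \<in> K \<Longrightarrow> x * y \<in> K"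
    "x \<in> K \<Longrightarrow> inverse x \<in> K" "x \<in> K \<Longrightarrow> y \<in> K \<Longrightarrow> x / y \<in> K" "x \<in> K \<Longrightarrow> x ^ n \<in> K"
proof -
  show 0: "0 \<in> K" and 1: "1 \<in> K" using assms by (auto simp: complex_subfield_def)
  show d: "x - y \<in> K" if "x \<in> K" "y \<in> K" for x y
    using assms that by (auto simp: complex_subfield_def)
  show m: "- x \<in> K" if "x \<in> K" for x using d[OF 0 that] by simp
  show "x + y \<in> K" if "x \<in> K" "y \<in> K" using d[OF that(1) m[OF that(2)]] by simp
  show t: "x * y \<in> K" if "x \<in> K" "y \<in> K" for x y
    using assms that by (auto simp: complex_subfield_def)
  show i: "inverse x \<in> K" if "x \<in> K" for x
    using assms that by (auto simp: complex_subfield_def)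
  show "x / y \<in> K" if "x \<in> K" "y \<in> K"
    using t[OF that(1) i[OF that(2)]] by (simp add: divide_inverse)
  show "x ^ n \<in> K" if "x \<in> K" by (induction n) (use 1 t that in auto)
qed

instantiation cyclotomic :: (finite) comm_ring_1
begin

lift_definition zero_cyclotomic :: "'a cyclotomic" is 0
  by (simp add: complex_subfield_closed)
lift_definition one_cyclotomic :: "'a cyclotomic" is 1
  by (simp add: complex_subfield_closed)
lift_definition plus_cyclotomic :: "'a cyclotomic \<Rightarrow> 'a cyclotomic \<Rightarrow> 'a cyclotomic" is "(+)"
  by (simp add: complex_subfield_closed)
lift_definition minus_cyclotomic :: "'a cyclotomic \<Rightarrow> 'a cyclotomic \<Rightarrow> 'a cyclotomic" is "(-)"
  by (simp add: complex_subfield_closed)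
lift_definition uminus_cyclotomic :: "'a cyclotomic \<Rightarrow> 'a cyclotomic" is uminus
  by (simp add: complex_subfield_closed)
lift_definition times_cyclotomic :: "'a cyclotomic \<Rightarrow> 'a cyclotomic \<Rightarrow> 'a cyclotomic" is "(*)"
  by (simp add: complex_subfield_closed)
instance
proof
  fix a b c :: "'a cyclotomic"
  show "a + b + c = a + (b + c)" "a + b = b + a" "0 + a = a" "- a + a = 0" "a - b = a + - b"
    "a * b * c = a * (b * c)" "a * b = b * a" "1 * a = a" "(a + b) * c = a * c + b * c"
    "(0::'a cyclotomic) \<noteq> 1"
    by (transfer; simp add: algebra_simps)+
qed

end

instantiation cyclotomic :: (finite) inverse
begin

lift_definition inverse_cyclotomic :: "'a cyclotomic \<Rightarrow> 'a cyclotomic" is inverse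
  by (simp add: complex_subfield_closed)
lift_definition divide_cyclotomic :: "'a cyclotomic \<Rightarrow> 'a cyclotomic \<Rightarrow> 'a cyclotomic" is "(/)"
  by (simp add: complex_subfield_closed)

instance ..

end

instance cyclotomic :: (finite) field
proof
  fix a b :: "'a cyclotomic"
  show "inverse a * a = 1" if "a \<noteq> 0" using that by (transfer; simp)
  show "a / b = a * inverse b" "inverse (0::'a cyclotomic) = 0"
    by (transfer; simp add: divide_inverse)+
qed

instance cyclotomic :: (finite) field_char_0
proof
  have "Rep_cyclotomic (of_nat n :: 'a cyclotomic) = of_nat n" for n
    by (induction n) (simp_all add: zero_cyclotomic.rep_eq one_cyclotomic.rep_eq plus_cyclotomic.rep_eq)
  then show "inj (of_nat :: nat \<Rightarrow> 'a cyclotomic)" by (metis injI of_nat_eq_iff)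
qed

lift_definition eta_cyc :: "'N::finite mod_ring \<Rightarrow> 'N cyclotomic" is eta_pow
  by (auto simp: eta_pow_def complex_subfield_closed)


section \<open>The non-commutative polynomial ring\<close>

datatype 'a letter = X | Y 'a

datatype 'a xyword = Word (letters: "'a letter list")

instantiation xyword :: (type) monoid_add
begin
definition "0 = Word []"
definition "u + v = Word (letters u @ letters v)"
instance
  by standard (auto simp: zero_xyword_def plus_xyword_def)
end

type_synonym 'N H = "'N mod_ring xyword \<Rightarrow>\<^sub>0 rat"
type_synonym 'N HH = "'N mod_ring xyword \<times> 'N mod_ring xyword \<Rightarrow>\<^sub>0 rat"

definition var :: "'N mod_ring letter \<Rightarrow> 'N H" where
  "var l = Poly_Mapping.single (Word [l]) 1"

definition zgen :: "nat \<Rightarrow> 'N mod_ring \<Rightarrow> 'N H" where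
  "zgen n a = var (Y a) * var X ^ (n - 1)"

definition H1 :: "'N H set" where
  "H1 = subalgebra {zgen n a | n a. n \<ge> 1}"

definition H2 :: "'N H set" where
  "H2 = subalgebra {zgen n a | n a. n \<ge> 2}"

definition H1H1 :: "'N HH set" where
  "H1H1 = module.span scal {tensor u v | u v. u \<in> H1 \<and> v \<in> H1}"

text \<open>
  The array with upper row \<open>n\<^sub>1, \<dots>, n\<^sub>r\<close> and lower row \<open>a\<^sub>1, \<dots>, a\<^sub>r\<close> is the list of its columns.
\<close>

type_synonym 'N array = "(nat \<times> 'N mod_ring) list"

definition is_array :: "'N array \<Rightarrow> bool" where
  "is_array v \<longleftrightarrow> (\<forall>(n, a)\<in>set v. n \<ge> 1)"

definition array_of :: "'N mod_ring xyword \<Rightarrow> 'N array" where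
  "array_of u = (THE v. is_array v \<and> prod_list (map (\<lambda>(n, a). zgen n a) v) = Poly_Mapping.single u 1)"


section \<open>Multiple zeta values, multiple divisor functions, multiple Eisenstein series\<close>

text \<open>
  The three functions are meaningful on the span of the arrays with last upper entry at least 2, on
  \<open>H1\<close> and on \<open>H2\<close>, respectively.
\<close>

definition zeta_array :: "'N::finite array \<Rightarrow> real" where
  "zeta_array v = (\<Sum>\<^sub>\<infinity>ks\<in>{ks. length ks = length v \<and> sorted_wrt (<) (0 # ks) \<and>
       (\<forall>i<length v. of_int_mod_ring (int (ks ! i)) = snd (v ! i))}.
     \<Prod>i<length v. 1 / real (ks ! i) ^ fst (v ! i))"

definition zeta :: "'N::finite H \<Rightarrow> real" where
  "zeta w = (\<Sum>u\<in>Poly_Mapping.keys w. of_rat (Poly_Mapping.lookup w u) * zeta_array (array_of u))"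

definition g_array :: "'N::finite array \<Rightarrow> complex fps" where
  "g_array v = fps_const ((- 2 * pi * \<i> / CARD('N)) ^ sum_list (map fst v)) *
     Abs_fps (\<lambda>k. \<Sum>(ds, cs)\<in>{(ds, cs). length ds = length v \<and> length cs = length v \<and>
         sorted_wrt (<) (0 # ds) \<and> (\<forall>c\<in>set cs. 0 < c) \<and> (\<Sum>i<length v. cs ! i * ds ! i) = k}.
       \<Prod>i<length v. eta_pow (snd (v ! i)) ^ (cs ! i) * of_nat (cs ! i) ^ (fst (v ! i) - 1) /
         fact (fst (v ! i) - 1))"

definition g_fps :: "'N::finite H \<Rightarrow> complex fps" where
  "g_fps w = (\<Sum>u\<in>Poly_Mapping.keys w.
     fps_const (of_rat (Poly_Mapping.lookup w u)) * g_array (array_of u))"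

text \<open>The pair \<open>(l, m)\<close> stands for the lattice point \<open>l N \<tau> + m\<close>.\<close>

definition lattice_less :: "int \<times> int \<Rightarrow> int \<times> int \<Rightarrow> bool" where
  "lattice_less p p' \<longleftrightarrow> fst p < fst p' \<or> fst p = fst p' \<and> snd p < snd p'"

definition Eisenstein_partial :: "'N::finite array \<Rightarrow> complex \<Rightarrow> nat \<Rightarrow> nat \<Rightarrow> complex" where
  "Eisenstein_partial v \<tau> L M =
     (\<Sum>ps\<in>{ps. length ps = length v \<and> sorted_wrt lattice_less ((0, 0) # ps) \<and>
         (\<forall>i<length v. \<bar>fst (ps ! i)\<bar> \<le> int L \<and> \<bar>snd (ps ! i)\<bar> \<le> int M \<and>
           of_int_mod_ring (snd (ps ! i)) = snd (v ! i))}.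
       \<Prod>i<length v. 1 / (of_int (fst (ps ! i)) * of_nat CARD('N) * \<tau> + of_int (snd (ps ! i))) ^
         fst (v ! i))"

definition Eisenstein_array :: "'N::finite array \<Rightarrow> complex \<Rightarrow> complex" where
  "Eisenstein_array v \<tau> = lim (\<lambda>L. lim (\<lambda>M. Eisenstein_partial v \<tau> L M))"

definition Eisenstein :: "'N::finite H \<Rightarrow> complex \<Rightarrow> complex" where
  "Eisenstein w \<tau> = (\<Sum>u\<in>Poly_Mapping.keys w. of_rat (Poly_Mapping.lookup w u) * Eisenstein_array (array_of u) \<tau>)"


section \<open>Goncharov's algebra\<close>

text \<open>
  The set \<open>S\<close> consists of \<open>Zero\<close> and of the \<open>Eta a\<close>, which stand for the pairwise distinct numbers
  \<open>\<eta>\<^sup>a\<close>. Elements of the algebra generated by the symbols are represented by polynomials in them,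
  and an equation holds in a quotient if the difference lies in the ideal. The definitions are
  stated for any ring of coefficients: \<open>rat\<close> gives Goncharov's algebra itself and
  \<open>'N cyclotomic\<close> its extension of scalars.
\<close>

datatype 'a point = Zero | Eta 'a

datatype 'a symb = Symb "'a point" "'a point list" "'a point"

type_synonym ('N, 'k) spoly = "'N mod_ring symb multiset \<Rightarrow>\<^sub>0 'k"
type_synonym ('N, 'k) spoly2 =
  "'N mod_ring symb multiset \<times> 'N mod_ring symb multiset \<Rightarrow>\<^sub>0 'k"

definition II ::
  "'N mod_ring point \<Rightarrow> 'N mod_ring point list \<Rightarrow> 'N mod_ring point \<Rightarrow> ('N, 'k::comm_ring_1) spoly" where
  "II b bs b' = Poly_Mapping.single {#Symb b bs b'#} 1"

definition shuffle_perms :: "nat \<Rightarrow> nat \<Rightarrow> (nat \<Rightarrow> nat) set" where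
  "shuffle_perms n m = {\<sigma>. \<sigma> permutes {..<n + m} \<and>
     strict_mono_on {..<n} \<sigma> \<and> strict_mono_on {n..<n + m} \<sigma>}"

definition goncharov_relations :: "('N, 'k::comm_ring_1) spoly set" where
  "goncharov_relations =
     {II b [] c - 1 | b c. True} \<union>
     {II b us c * II b vs c - (\<Sum>\<sigma>\<in>shuffle_perms (length us) (length vs).
        II b (map (\<lambda>i. (us @ vs) ! (inv_into UNIV \<sigma> i)) [0..<length us + length vs]) c) | b us vs c. True} \<union>
     {II b bs b' - (\<Sum>i\<le>length bs. II b (take i bs) c * II c (drop i bs) b') | b bs b' c. True} \<union>
     {II b bs b | b bs. bs \<noteq> []}"

text \<open>The quotient by \<open>I0_ideal\<close> is \<open>\<I>\<^sup>0\<close>.\<close>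

definition I0_ideal :: "('N, 'k::comm_ring_1) spoly set" where
  "I0_ideal = ideal_generated (goncharov_relations \<union> {II Zero [Zero] b | b. b \<noteq> Zero})"

text \<open>If \<open>A\<close> is an algebra and \<open>J\<close> an ideal, \<open>A/J \<otimes> A/J\<close> is the quotient of \<open>A \<otimes> A\<close> by \<open>J \<otimes> A + A \<otimes> J\<close>.\<close>

definition I0I0_ideal :: "('N, 'k::comm_ring_1) spoly2 set" where
  "I0I0_ideal = ideal_generated ({tensor r 1 | r. r \<in> I0_ideal} \<union> {tensor 1 r | r. r \<in> I0_ideal})"

text \<open>
  In the summand for \<open>0 = i\<^sub>0 < i\<^sub>1 < \<dots> < i\<^sub>k < i\<^sub>k\<^sub>+\<^sub>1 = m + 1\<close>, the list \<open>js\<close> is \<open>i\<^sub>1, \<dots>, i\<^sub>k\<close> and \<open>is\<close> is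
  \<open>i\<^sub>0, \<dots>, i\<^sub>k\<^sub>+\<^sub>1\<close>.
\<close>

definition coproduct_symb :: "'N mod_ring symb \<Rightarrow> ('N, 'k::comm_ring_1) spoly2" where
  "coproduct_symb s = (case s of Symb b bs b' \<Rightarrow>
     let m = length bs; B = b # bs @ [b'] in
     \<Sum>js\<in>{js. sorted_wrt (<) js \<and> set js \<subseteq> {1..m}}.
       let is = 0 # js @ [m + 1] in
       tensor
         (\<Prod>p\<le>length js.
            II (B ! (is ! p)) (map (\<lambda>i. B ! i) [is ! p + 1..<is ! (p + 1)]) (B ! (is ! (p + 1))))
         (II b (map (\<lambda>i. B ! i) js) b'))"

definition coproduct :: "('N, 'k::comm_ring_1) spoly \<Rightarrow> ('N, 'k) spoly2" where
  "coproduct p = (\<Sum>M\<in>Poly_Mapping.keys p.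
     scal (Poly_Mapping.lookup p M) (\<Prod>s\<in>#M. coproduct_symb s))"

definition I_array :: "'N::finite mod_ring \<Rightarrow> 'N array \<Rightarrow> ('N, 'k::comm_ring_1) spoly" where
  "I_array c v = II Zero (concat (map (\<lambda>(n, a). Eta a # replicate (n - 1) Zero) v)) (Eta c)"

definition I1 :: "('N::finite, 'k::comm_ring_1) spoly set" where
  "I1 = module.span scal {I_array 0 v | v. is_array v}"

text \<open>
  \<open>is_mu f\<close>: the homomorphism \<open>f\<close> of polynomial rings induces \<open>\<mu>\<close> on the quotient \<open>\<I>\<^sup>0\<close>. This fixes
  \<open>f\<close> modulo \<open>I0_ideal\<close>, as the \<open>I_array c v\<close> generate the quotient.
\<close>

definition is_mu :: "(('N::finite, 'k::comm_ring_1) spoly \<Rightarrow> ('N, 'k) spoly) \<Rightarrow> bool" where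
  "is_mu f \<longleftrightarrow> alg_hom f \<and> (\<forall>p\<in>I0_ideal. f p \<in> I0_ideal) \<and>
     (\<forall>p. \<exists>p'\<in>I1. f p - p' \<in> I0_ideal) \<and>
     (\<forall>c v. is_array v \<longrightarrow> f (I_array c v) - I_array 0 (map (\<lambda>(n, a). (n, a - c)) v) \<in> I0_ideal)"

definition mu :: "('N::finite, 'k::comm_ring_1) spoly \<Rightarrow> ('N, 'k) spoly" where
  "mu = (SOME f. is_mu f)"

definition Delta_mu_I :: "('N::finite, 'k::comm_ring_1) spoly \<Rightarrow> ('N, 'k) spoly2" where
  "Delta_mu_I p = tensor_map id mu mu (coproduct p)"


section \<open>The coproduct on \<open>H1\<close>\<close>

definition I_tilde_array :: "'N::finite array \<Rightarrow> ('N, 'N cyclotomic) spoly" where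
  "I_tilde_array v = scal ((- 1) ^ length v / of_nat CARD('N) ^ length v)
     (\<Sum>bs\<in>{bs. length bs = length v}.
       scal (eta_cyc (\<Sum>i<length v. (snd (v ! i) - (if i = 0 then 0 else snd (v ! (i - 1)))) * bs ! i))
         (I_array 0 (zip (map fst v) bs)))"

text \<open>
  \<open>I_tilde\<close> is the identification of \<open>H1\<close> with the rational span of the \<open>I_tilde_array v\<close> in \<open>\<I>\<^sup>0\<close>.
\<close>

definition I_tilde :: "'N::finite H \<Rightarrow> ('N, 'N cyclotomic) spoly" where
  "I_tilde w = (\<Sum>u\<in>Poly_Mapping.keys w.
     scal (of_rat (Poly_Mapping.lookup w u)) (I_tilde_array (array_of u)))"

text \<open>
  The tensor is unique since the \<open>I_tilde_array v\<close> are linearly independent over the cyclotomic field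
  modulo \<open>I0_ideal\<close>; it is taken over the rationals, as \<open>\<mu> \<otimes> \<mu>\<close> applied to the coproduct maps the
  rational span of the \<open>I_tilde_array v\<close> to its rational tensor square.
\<close>

definition Delta_mu :: "'N::finite H \<Rightarrow> 'N HH" where
  "Delta_mu w = (THE t. t \<in> H1H1 \<and>
     tensor_map of_rat I_tilde I_tilde t - Delta_mu_I (I_tilde w) \<in> I0I0_ideal)"

definition zeta_star_g :: "'N::finite H \<Rightarrow> complex fps" where
  "zeta_star_g w = (let t = Delta_mu w in
     \<Sum>(u, v)\<in>Poly_Mapping.keys t. fps_const (of_rat (Poly_Mapping.lookup t (u, v))) *
       (fps_const (of_real (zeta (Poly_Mapping.single u 1))) * g_fps (Poly_Mapping.single v 1)))"

end

theory Submission
  imports Defs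
begin

text \<open>
  Write \<open>\<rho>(z\<^sub>n\<^sub>,\<^sub>a \<dots>)\<close> in letters \<open>X\<close> and \<open>Y k\<close>. A Fourier transform over \<open>\<int>/N\<close> that sends \<open>Y k\<close> to a
  combination of the points \<open>\<eta>\<^sup>b\<close> identifies the shuffle algebra of these words, modulo the letter
  \<open>X\<close>, with Goncharov's algebra: the symbols have values there that satisfy all relations, so \<open>\<mu>\<close>
  exists, the \<open>I_tilde_array v\<close> are linearly independent, and \<open>Delta_mu\<close> is given by a recursion
  that cuts a word at the letters \<open>Y k\<close> of the right factor.

  On the analytic side an Eisenstein sum splits by the values of \<open>l\<close>. The sum over \<open>m\<close> on one level
  is expanded in partial fractions; the residues are regularized multiple zeta values and the poles
  sum to the \<open>q\<close>-series of the Lipschitz formula. The poles of order one converge only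
  conditionally, so the expansion is compared at \<open>x\<close> and \<open>x + iT\<close>, and \<open>T\<close> tends to infinity.
  The convolution satisfies the same recursion by levels as the Eisenstein sums.
\<close>

section \<open>Shuffles and splittings of lists\<close>

text \<open>Both sides are compared before the last limit. Cutting the Eisenstein sum at
  \<open>|l| \<le> L\<close> corresponds exactly to cutting the divisor sums at
  \<open>d \<le> L\<close>; so an identity holds for every \<open>L\<close>, and \<open>L\<close>
  tends to infinity only at the very end. The two sides meet in the regularized zeta values. At a
  pole the other factors of a level are nested sums with denominators \<open>k + X\<close>, expanded
  in a local parameter \<open>X\<close>. Their Taylor coefficients obey the recursion that shuffling
  with the letter \<open>X\<close> imposes on words with leading \<open>X\<close>. So the residues
  are the values of the pieces that the coproduct cuts off; factors below the pole appear in
  reversed order and with the sign of the antipode. \<open>mu\<close> and \<open>Delta_mu\<close>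
  are given by choice and by definite description, so they must first be tied to explicit maps. A
  homomorphism to the shuffle algebra that kills all relations yields independence, and a linear map
  back to the quotient yields formulas. Summation over the cut points turns roots of unity into
  conditions on sums of letters, which is why the coproduct is rational.\<close>

fun shuffle_list :: "'a list \<Rightarrow> 'a list \<Rightarrow> 'a list list" where
  "shuffle_list [] vs = [vs]"
| "shuffle_list us [] = [us]"
| "shuffle_list (u # us) (v # vs) =
     map ((#) u) (shuffle_list us (v # vs)) @ map ((#) v) (shuffle_list (u # us) vs)"

lemma shuffle_list_Nil2 [simp]: "shuffle_list us [] = [us]"
  by (cases us) simp_all

text \<open>\<open>shuffle_list\<close> counts shuffles with multiplicity, as a product of words
  with repeated letters requires; the set \<open>shuffles\<close> forgets it.\<close>

lemma set_shuffle_list: "set (shuffle_list us vs) = shuffles us vs"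
  by (induction us vs rule: shuffle_list.induct) auto

lemma length_shuffle_list: "ws \<in> set (shuffle_list us vs) \<Longrightarrow> length ws = length us + length vs"
  using length_shuffles set_shuffle_list by blast

lemma shuffle_list_map: "shuffle_list (map f us) (map f vs) = map (map f) (shuffle_list us vs)"
  by (induction us vs rule: shuffle_list.induct) auto

lemma distinct_shuffle_list:
  "set us \<inter> set vs = {} \<Longrightarrow> distinct (shuffle_list us vs)"
proof (induction us vs rule: shuffle_list.induct)
  case (3 u us v vs)
  then show ?case by (auto simp: distinct_map inj_on_def)
qed auto

text \<open>Sum over all deconcatenations \<open>w = u @ v\<close>, empty parts included. Passing
  letters on to the summand keeps indices out of the inductions.\<close>

fun split_sum :: "('a list \<Rightarrow> 'a list \<Rightarrow> 'b::comm_monoid_add) \<Rightarrow> 'a list \<Rightarrow> 'b" where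
  "split_sum f [] = f [] []"
| "split_sum f (a # w) = f [] (a # w) + split_sum (\<lambda>u v. f (a # u) v) w"

lemma split_sum_add: "split_sum (\<lambda>u v. f u v + g u v) w = split_sum f w + split_sum g w"
  by (induction w arbitrary: f g) (simp_all add: ac_simps)

lemma split_sum_zero [simp]: "split_sum (\<lambda>u v. 0) w = 0"
  by (induction w) simp_all

lemma split_sum_hom:
  assumes "\<And>x y. h (x + y) = h x + h y"
  shows "h (split_sum f w) = split_sum (\<lambda>u v. h (f u v)) w"
  by (induction w arbitrary: f) (simp_all add: assms)

lemma split_sum_sum: "split_sum (\<lambda>u v. \<Sum>i\<in>I. f i u v) w = (\<Sum>i\<in>I. split_sum (f i) w)"
  by (induction w arbitrary: f) (simp_all add: sum.distrib)

lemma split_sum_mult_left: "split_sum (\<lambda>u v. c * f u v) w = (c::'b::semiring_0) * split_sum f w"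
  by (induction w arbitrary: f) (simp_all add: algebra_simps)

lemma split_sum_mult_right: "split_sum (\<lambda>u v. f u v * c) w = split_sum f w * (c::'b::semiring_0)"
  by (induction w arbitrary: f) (simp_all add: algebra_simps)

lemma split_sum_atMost: "split_sum f w = (\<Sum>i\<le>length w. f (take i w) (drop i w))"
  by (induction w arbitrary: f) (simp_all add: sum.atMost_Suc_shift del: sum.atMost_Suc)

lemma split_sum_cong:
  assumes "\<And>u v. w = u @ v \<Longrightarrow> f u v = g u v"
  shows "split_sum f w = split_sum g w"
  unfolding split_sum_atMost by (intro sum.cong refl assms) simp

text \<open>Coassociativity of deconcatenation: both sides run over the decompositions of
  \<open>w\<close> into three parts.\<close>

lemma split_sum_assoc:
  "split_sum (\<lambda>u v. split_sum (\<lambda>a b. f a b v) u) w = split_sum (\<lambda>u v. split_sum (\<lambda>a b. f u a b) v) w"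
  by (induction w arbitrary: f) (simp_all add: split_sum_add ac_simps)

lemma split_sum_first: "split_sum (\<lambda>u v. if u = [] then f v else 0) w = f w"
  by (cases w) simp_all

text \<open>Compatibility of the two structures of the shuffle bialgebra: a prefix of a shuffle is a
  shuffle of prefixes, and what remains is a shuffle of the remaining suffixes.\<close>

lemma split_sum_shuffle_list:
  "(\<Sum>w\<leftarrow>shuffle_list us vs. split_sum h w) =
     split_sum (\<lambda>u1 u2. split_sum (\<lambda>v1 v2.
       \<Sum>w1\<leftarrow>shuffle_list u1 v1. \<Sum>w2\<leftarrow>shuffle_list u2 v2. h w1 w2) vs) us"
proof (induction us vs arbitrary: h rule: shuffle_list.induct)
  case (1 vs)
  then show ?case by simp
next
  case (2 u us)
  then show ?case by simp
next
  case (3 u us v vs)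
  have 1: "(\<Sum>w\<leftarrow>shuffle_list us (v # vs). split_sum (\<lambda>a. h (u # a)) w) =
      split_sum (\<lambda>u1 u2. \<Sum>w2\<leftarrow>shuffle_list u2 (v # vs). h (u # u1) w2) us +
      split_sum (\<lambda>u1 u2. split_sum (\<lambda>v1 v2. \<Sum>w1\<leftarrow>shuffle_list u1 (v # v1).
        \<Sum>w2\<leftarrow>shuffle_list u2 v2. h (u # w1) w2) vs) us"
    unfolding 3 by (simp add: split_sum_add)
  have 2: "(\<Sum>w\<leftarrow>shuffle_list (u # us) vs. split_sum (\<lambda>a. h (v # a)) w) =
      split_sum (\<lambda>v1 v2. \<Sum>w2\<leftarrow>shuffle_list (u # us) v2. h (v # v1) w2) vs +
      split_sum (\<lambda>u1 u2. split_sum (\<lambda>v1 v2. \<Sum>w1\<leftarrow>shuffle_list (u # u1) v1.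
        \<Sum>w2\<leftarrow>shuffle_list u2 v2. h (v # w1) w2) vs) us"
    unfolding 3 by simp
  have "(\<Sum>w\<leftarrow>shuffle_list (u # us) (v # vs). split_sum h w) =
      (\<Sum>w\<leftarrow>shuffle_list (u # us) (v # vs). h [] w) +
      (\<Sum>w\<leftarrow>shuffle_list us (v # vs). split_sum (\<lambda>a. h (u # a)) w) +
      (\<Sum>w\<leftarrow>shuffle_list (u # us) vs. split_sum (\<lambda>a. h (v # a)) w)"
    by (simp add: sum_list_addf o_def add_ac)
  also have "\<dots> = split_sum (\<lambda>u1 u2. split_sum (\<lambda>v1 v2.
       \<Sum>w1\<leftarrow>shuffle_list u1 v1. \<Sum>w2\<leftarrow>shuffle_list u2 v2. h w1 w2) (v # vs)) (u # us)"
    unfolding 1 2 by (simp add: split_sum_add o_def add_ac)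
  finally show ?case .
qed

section \<open>Shuffle permutations and shuffles of index lists\<close>

lemma sorted_wrt_filter_nth:
  assumes "sorted_wrt R (filter P l)" "j < i" "i < length l" "P (l ! j)" "P (l ! i)"
  shows "R (l ! j) (l ! i)"
proof -
  have "sorted_wrt R (filter P (take i l) @ filter P (drop i l))"
    using assms(1) by (simp flip: filter_append)
  moreover have "l ! j \<in> set (filter P (take i l))"
    using assms nth_mem[of j "take i l"] by simp
  moreover have "l ! i \<in> set (filter P (drop i l))"
    using assms nth_mem[of 0 "drop i l"] by simp
  ultimately show ?thesis unfolding sorted_wrt_append by blast
qed

text \<open>The inverse of a shuffle permutation tells for each position which entry is placed
  there. Monotonicity on the two blocks means that the entries of each block appear in their
  original order.\<close>

lemma bij_betw_shuffle_perms:
  "bij_betw (\<lambda>\<sigma>. map (inv_into UNIV \<sigma>) [0..<n + m]) (shuffle_perms n m) (shuffles [0..<n] [n..<n + m])"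
proof (rule bij_betw_imageI)
  show "inj_on (\<lambda>\<sigma>. map (inv_into UNIV \<sigma>) [0..<n + m]) (shuffle_perms n m)"
  proof (rule inj_onI)
    fix \<sigma> \<sigma>'
    assume s: "\<sigma> \<in> shuffle_perms n m" "\<sigma>' \<in> shuffle_perms n m"
      and e: "map (inv_into UNIV \<sigma>) [0..<n + m] = map (inv_into UNIV \<sigma>') [0..<n + m]"
    have p: "\<sigma> permutes {..<n + m}" "\<sigma>' permutes {..<n + m}" using s by (auto simp: shuffle_perms_def)
    have "inv_into UNIV \<sigma> i = inv_into UNIV \<sigma>' i" for i
    proof (cases "i < n + m")
      case True
      then show ?thesis using e by (auto simp: map_eq_conv)
    next
      case False
      then show ?thesis using permutes_inv[OF p(1)] permutes_inv[OF p(2)] by (simp add: permutes_def)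
    qed
    then have "inv_into UNIV \<sigma> = inv_into UNIV \<sigma>'" by blast
    then show "\<sigma> = \<sigma>'" using p by (metis permutes_inv_inv)
  qed
  show "(\<lambda>\<sigma>. map (inv_into UNIV \<sigma>) [0..<n + m]) ` shuffle_perms n m = shuffles [0..<n] [n..<n + m]"
  proof (intro equalityI subsetI)
    fix l assume "l \<in> (\<lambda>\<sigma>. map (inv_into UNIV \<sigma>) [0..<n + m]) ` shuffle_perms n m"
    then obtain \<sigma> where s: "\<sigma> permutes {..<n + m}" "strict_mono_on {..<n} \<sigma>"
        "strict_mono_on {n..<n + m} \<sigma>" and l: "l = map (inv_into UNIV \<sigma>) [0..<n + m]"
      by (auto simp: shuffle_perms_def)
    have p: "inv_into UNIV \<sigma> permutes {..<n + m}" using permutes_inv[OF s(1)] .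
    have sl: "set l = {..<n + m}" using permutes_image[OF p] by (simp add: l atLeast0LessThan)
    have dl: "distinct l" using permutes_inj_on[OF p] by (simp add: l distinct_map)
    \<comment> \<open>\<open>P\<close> selects one of the two blocks. On a block
      \<open>\<sigma>\<close> is increasing, so positions and entries are ordered alike.\<close>
    have srt: "sorted_wrt (<) (filter P l)"
      if mono: "\<And>a b. P a \<Longrightarrow> P b \<Longrightarrow> a < b \<Longrightarrow> a < n + m \<Longrightarrow> b < n + m \<Longrightarrow> \<sigma> a < \<sigma> b" for P
    proof -
      have lt: "inv_into UNIV \<sigma> i < inv_into UNIV \<sigma> j" if "i < j" "j < n + m" "P (inv_into UNIV \<sigma> i)" "P (inv_into UNIV \<sigma> j)" for i j
      proof (rule ccontr)
        assume "\<not> inv_into UNIV \<sigma> i < inv_into UNIV \<sigma> j"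
        moreover have "inv_into UNIV \<sigma> i \<noteq> inv_into UNIV \<sigma> j" using that(1) permutes_inj[OF p] by (auto dest: injD)
        ultimately have "inv_into UNIV \<sigma> j < inv_into UNIV \<sigma> i" by simp
        moreover have "inv_into UNIV \<sigma> i < n + m" "inv_into UNIV \<sigma> j < n + m"
          using that permutes_in_image[OF p] by (metis lessThan_iff order.strict_trans)+
        ultimately have "\<sigma> (inv_into UNIV \<sigma> j) < \<sigma> (inv_into UNIV \<sigma> i)" using mono that by blast
        then show False using that(1) s(1) by (simp add: permutes_inverses)
      qed
      have "sorted_wrt (\<lambda>x y. inv_into UNIV \<sigma> x < inv_into UNIV \<sigma> y)
          (filter (P \<circ> inv_into UNIV \<sigma>) [0..<n + m])"
      proof (rule sorted_wrt_mono_rel[OF _ sorted_wrt_filter[OF sorted_wrt_upt]])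
        fix x y
        assume "x \<in> set (filter (P \<circ> inv_into UNIV \<sigma>) [0..<n + m])"
          "y \<in> set (filter (P \<circ> inv_into UNIV \<sigma>) [0..<n + m])" "x < y"
        then show "inv_into UNIV \<sigma> x < inv_into UNIV \<sigma> y" by (intro lt) simp_all
      qed
      then show ?thesis unfolding l filter_map sorted_wrt_map .
    qed
    have a: "filter (\<lambda>x. x < n) l = [0..<n]"
    proof (rule sorted_distinct_set_unique)
      show "sorted (filter (\<lambda>x. x < n) l)"
        by (rule strict_sorted_imp_sorted, rule srt, rule strict_mono_onD[OF s(2)]) simp_all
    qed (simp_all add: sl dl set_eq_iff, linarith)
    have b: "filter (\<lambda>x. \<not> x < n) l = [n..<n + m]"
    proof (rule sorted_distinct_set_unique)
      show "sorted (filter (\<lambda>x. \<not> x < n) l)"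
        by (rule strict_sorted_imp_sorted, rule srt, rule strict_mono_onD[OF s(3)]) simp_all
    qed (simp_all add: sl dl set_eq_iff, linarith)
    show "l \<in> shuffles [0..<n] [n..<n + m]"
      using partition_in_shuffles[of l "\<lambda>x. x < n"] by (simp only: a b)
  next
    fix l assume l: "l \<in> shuffles [0..<n] [n..<n + m]"
    have len: "length l = n + m" using length_shuffles[OF l] by simp
    have sl: "set l = {..<n + m}"
      unfolding set_shuffles[OF l] set_upt atLeast0LessThan[symmetric] by (rule ivl_disj_un_two(3)) simp_all
    have dl: "distinct l" using distinct_disjoint_shuffles[OF _ _ _ l] by simp
    \<comment> \<open>A shuffle of the index lists, continued by the identity, is a permutation; its
      inverse is the required shuffle permutation.\<close>
    define \<pi> where "\<pi> = (\<lambda>i. if i < n + m then l ! i else i)"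
    have p: "\<pi> permutes {..<n + m}"
    proof (rule bij_imp_permutes)
      have "bij_betw ((!) l) {..<length l} (set l)" using dl by (rule bij_betw_nth) auto
      then have "bij_betw ((!) l) {..<n + m} {..<n + m}" using len sl by simp
      then show "bij_betw \<pi> {..<n + m} {..<n + m}" by (rule bij_betw_cong[THEN iffD1, rotated]) (simp add: \<pi>_def)
    qed (simp add: \<pi>_def)
    have pos: "inv_into UNIV \<pi> a < n + m \<and> l ! (inv_into UNIV \<pi> a) = a" if "a < n + m" for a
    proof -
      have "inv_into UNIV \<pi> a < n + m" using permutes_in_image[OF permutes_inv[OF p]] that by blast
      moreover have "\<pi> (inv_into UNIV \<pi> a) = a" using p by (simp add: permutes_inverses)
      ultimately show ?thesis by (simp add: \<pi>_def)
    qed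
    have mono: "inv_into UNIV \<pi> a < inv_into UNIV \<pi> b"
      if srt: "sorted_wrt (<) (filter P l)" and ab: "P a" "P b" "a < b" "a < n + m" "b < n + m" for P a b
    proof (rule ccontr)
      assume "\<not> inv_into UNIV \<pi> a < inv_into UNIV \<pi> b"
      moreover have "inv_into UNIV \<pi> a \<noteq> inv_into UNIV \<pi> b" using pos[OF ab(4)] pos[OF ab(5)] ab(3) by auto
      ultimately have "inv_into UNIV \<pi> b < inv_into UNIV \<pi> a" by simp
      from sorted_wrt_filter_nth[OF srt this] pos[OF ab(4)] pos[OF ab(5)] ab(1-3) len
      show False by simp
    qed
    have a: "filter (\<lambda>x. x < n) l = [0..<n]"
    proof -
      have "filter (\<lambda>x. x \<in> set [0..<n]) l = [0..<n]" by (rule filter_shuffles_disjoint1(1)[OF _ l]) auto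
      then show ?thesis by simp
    qed
    have b: "filter (\<lambda>x. \<not> x < n) l = [n..<n + m]"
    proof -
      have "filter (\<lambda>x. x \<notin> set [0..<n]) l = [n..<n + m]" by (rule filter_shuffles_disjoint1(2)[OF _ l]) auto
      then show ?thesis by simp
    qed
    have "strict_mono_on {..<n} (inv_into UNIV \<pi>)"
      by (rule strict_mono_onI, rule mono[of "\<lambda>x. x < n"]) (simp_all add: a)
    moreover have "strict_mono_on {n..<n + m} (inv_into UNIV \<pi>)"
      by (rule strict_mono_onI, rule mono[of "\<lambda>x. \<not> x < n"]) (simp_all add: b)
    ultimately have "inv_into UNIV \<pi> \<in> shuffle_perms n m"
      using permutes_inv[OF p] by (simp add: shuffle_perms_def)
    moreover have "l = map (inv_into UNIV (inv_into UNIV \<pi>)) [0..<n + m]"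
      unfolding permutes_inv_inv[OF p] by (rule nth_equalityI) (simp_all add: len \<pi>_def)
    ultimately show "l \<in> (\<lambda>\<sigma>. map (inv_into UNIV \<sigma>) [0..<n + m]) ` shuffle_perms n m" by blast
  qed
qed

text \<open>The detour through index lists takes care of multiplicities: indices are pairwise
  distinct, so each of their shuffles occurs once, and coincidences arise only when indices are
  replaced by letters.\<close>

lemma sum_shuffle_perms:
  "(\<Sum>\<sigma>\<in>shuffle_perms (length us) (length vs).
      F (map (\<lambda>i. (us @ vs) ! (inv_into UNIV \<sigma> i)) [0..<length us + length vs])) =
    (\<Sum>w\<leftarrow>shuffle_list us vs. F w :: 'b::comm_monoid_add)"
proof -
  have u: "map ((!) (us @ vs)) [0..<length us] = us"
    by (rule nth_equalityI) (simp_all add: nth_append)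
  have v: "map ((!) (us @ vs)) [length us..<length us + length vs] = vs"
    by (rule nth_equalityI) (simp_all add: nth_append)
  let ?n = "length us" and ?m = "length vs" and ?G = "\<lambda>l. F (map ((!) (us @ vs)) l)"
  have d: "distinct (shuffle_list [0..<?n] [?n..<?n + ?m])"
    by (rule distinct_shuffle_list) simp
  have "(\<Sum>\<sigma>\<in>shuffle_perms ?n ?m.
      F (map (\<lambda>i. (us @ vs) ! (inv_into UNIV \<sigma> i)) [0..<?n + ?m])) =
     (\<Sum>\<sigma>\<in>shuffle_perms ?n ?m. ?G (map (inv_into UNIV \<sigma>) [0..<?n + ?m]))"
    by (simp add: o_def)
  also have "\<dots> = sum ?G (shuffles [0..<?n] [?n..<?n + ?m])"
    by (rule sum.reindex_bij_betw[OF bij_betw_shuffle_perms])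
  also have "\<dots> = (\<Sum>l\<leftarrow>shuffle_list [0..<?n] [?n..<?n + ?m]. ?G l)"
    unfolding sum_list_distinct_conv_sum_set[OF d] set_shuffle_list ..
  also have "\<dots> = (\<Sum>w\<leftarrow>map (map ((!) (us @ vs))) (shuffle_list [0..<?n] [?n..<?n + ?m]). F w)"
    by (simp add: o_def)
  also have "map (map ((!) (us @ vs))) (shuffle_list [0..<?n] [?n..<?n + ?m]) = shuffle_list us vs"
    unfolding shuffle_list_map[symmetric] u v ..
  finally show ?thesis .
qed

section \<open>The shuffle algebra\<close>

text \<open>
  Elements are coefficient functions on words. In this form the operators that strip a first letter
  or a last letter are derivations, and the product is determined by the former.
\<close>

fun shprod :: "('a list \<Rightarrow> 'k) \<Rightarrow> ('a list \<Rightarrow> 'k) \<Rightarrow> 'a list \<Rightarrow> 'k::comm_ring_1" where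
  "shprod f g [] = f [] * g []"
| "shprod f g (a # w) = shprod (\<lambda>v. f (a # v)) g w + shprod f (\<lambda>v. g (a # v)) w"

lemma shprod_commute: "shprod f g w = shprod g f w"
  by (induction w arbitrary: f g) (simp_all add: ac_simps)

lemma shprod_add: "shprod (\<lambda>v. f v + g v) h w = shprod f h w + shprod g h w"
  by (induction w arbitrary: f g h) (simp_all add: algebra_simps)

lemma shprod_add_right: "shprod h (\<lambda>v. f v + g v) w = shprod h f w + shprod h g w"
  by (subst (1 2 3) shprod_commute) (rule shprod_add)

text \<open>Both sides obey the same Leibniz rule when a first letter is removed.\<close>

lemma shprod_assoc: "shprod (shprod f g) h w = shprod f (shprod g h) w"
proof (induction w arbitrary: f g h)
  case (Cons a w)
  have "shprod (shprod f g) h (a # w) =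
      shprod (\<lambda>v. shprod (\<lambda>v. f (a # v)) g v + shprod f (\<lambda>v. g (a # v)) v) h w +
      shprod (shprod f g) (\<lambda>v. h (a # v)) w"
    by simp
  also have "\<dots> = shprod (\<lambda>v. f (a # v)) (shprod g h) w + shprod f (shprod (\<lambda>v. g (a # v)) h) w +
      shprod f (shprod g (\<lambda>v. h (a # v))) w"
    by (simp only: shprod_add Cons.IH)
  also have "\<dots> = shprod f (shprod g h) (a # w)"
    using shprod_add_right[of f "shprod (\<lambda>v. g (a # v)) h" "shprod g (\<lambda>v. h (a # v))" w] by simp
  finally show ?case .
qed (simp add: ac_simps)

lemma shprod_zero: "shprod (\<lambda>v. 0) g w = 0"
  by (induction w arbitrary: g) simp_all

lemma shprod_one: "shprod (\<lambda>v. if v = [] then c else 0) g w = c * g w"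
  by (induction w arbitrary: g) (simp_all add: shprod_zero)

text \<open>The product is defined through first letters. This Leibniz rule at the other end is what
  regularization and the polylogarithms rely on.\<close>

lemma shprod_snoc:
  "shprod f g (w @ [a]) = shprod (\<lambda>v. f (v @ [a])) g w + shprod f (\<lambda>v. g (v @ [a])) w"
  by (induction w arbitrary: f g) (simp_all add: algebra_simps)

text \<open>Lengths of words add under shuffling. This keeps products inside the type
  \<open>sh\<close>.\<close>

lemma shprod_bounded:
  "\<forall>v. d \<le> length v \<longrightarrow> f v = 0 \<Longrightarrow> \<forall>v. e \<le> length v \<longrightarrow> g v = 0 \<Longrightarrow>
    d + e \<le> length w \<Longrightarrow> shprod f g w = 0"
proof (induction w arbitrary: f g d e)
  case (Cons a w)
  have "shprod (\<lambda>v. f (a # v)) g w = 0"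
  proof (cases d)
    case 0
    then have "f = (\<lambda>v. 0)" using Cons.prems by auto
    then show ?thesis by (simp add: shprod_zero)
  next
    case (Suc d')
    then show ?thesis using Cons.prems by (intro Cons.IH[of d' _ e]) auto
  qed
  moreover have "shprod f (\<lambda>v. g (a # v)) w = 0"
  proof (cases e)
    case 0
    then have "g = (\<lambda>v. 0)" using Cons.prems by auto
    then show ?thesis by (simp add: shprod_commute[of f] shprod_zero)
  next
    case (Suc e')
    then show ?thesis using Cons.prems by (intro Cons.IH[of d _ e']) auto
  qed
  ultimately show ?case by simp
qed simp

text \<open>Bounded length replaces finite support: over the finite alphabets that occur below the
  two agree by \<open>finite_coef\<close>, and a bound is easy to propagate through all
  operations.\<close>

typedef (overloaded) ('a, 'k) sh =
  "{f :: 'a list \<Rightarrow> 'k::comm_ring_1. \<exists>d. \<forall>w. d \<le> length w \<longrightarrow> f w = 0}" morphisms coef Abs_sh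
  by (rule exI[of _ "\<lambda>w. 0"]) simp

setup_lifting type_definition_sh

lemma sh_eqI: "(\<And>w. coef f w = coef g w) \<Longrightarrow> f = g"
  by (metis coef_inject ext)

instantiation sh :: (type, comm_ring_1) comm_ring_1
begin

lift_definition zero_sh :: "('a, 'b) sh" is "\<lambda>w. 0" by simp
lift_definition one_sh :: "('a, 'b) sh" is "\<lambda>w. if w = [] then 1 else 0"
  by (rule exI[of _ 1]) auto
lift_definition plus_sh :: "('a, 'b) sh \<Rightarrow> ('a, 'b) sh \<Rightarrow> ('a, 'b) sh" is "\<lambda>f g w. f w + g w"
proof -
  fix f g :: "'a list \<Rightarrow> 'b"
  assume "\<exists>d. \<forall>w. d \<le> length w \<longrightarrow> f w = 0" "\<exists>d. \<forall>w. d \<le> length w \<longrightarrow> g w = 0"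
  then obtain d e where "\<forall>w. d \<le> length w \<longrightarrow> f w = 0" "\<forall>w. e \<le> length w \<longrightarrow> g w = 0" by blast
  then show "\<exists>d. \<forall>w. d \<le> length w \<longrightarrow> f w + g w = 0" by (intro exI[of _ "max d e"]) simp
qed
lift_definition uminus_sh :: "('a, 'b) sh \<Rightarrow> ('a, 'b) sh" is "\<lambda>f w. - f w" by simp
lift_definition minus_sh :: "('a, 'b) sh \<Rightarrow> ('a, 'b) sh \<Rightarrow> ('a, 'b) sh" is "\<lambda>f g w. f w - g w"
proof -
  fix f g :: "'a list \<Rightarrow> 'b"
  assume "\<exists>d. \<forall>w. d \<le> length w \<longrightarrow> f w = 0" "\<exists>d. \<forall>w. d \<le> length w \<longrightarrow> g w = 0"
  then obtain d e where "\<forall>w. d \<le> length w \<longrightarrow> f w = 0" "\<forall>w. e \<le> length w \<longrightarrow> g w = 0" by blast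
  then show "\<exists>d. \<forall>w. d \<le> length w \<longrightarrow> f w - g w = 0" by (intro exI[of _ "max d e"]) simp
qed
lift_definition times_sh :: "('a, 'b) sh \<Rightarrow> ('a, 'b) sh \<Rightarrow> ('a, 'b) sh" is shprod
  using shprod_bounded by blast

instance
proof
  fix a b c :: "('a, 'b) sh"
  show "a * b * c = a * (b * c)" by transfer (simp add: shprod_assoc fun_eq_iff)
  show "a * b = b * a" by transfer (simp add: shprod_commute fun_eq_iff)
  show "1 * a = a" by transfer (simp add: shprod_one fun_eq_iff)
  show "(a + b) * c = a * c + b * c" by transfer (simp add: shprod_add fun_eq_iff)
  show "(0::('a, 'b) sh) \<noteq> 1" by transfer (metis zero_neq_one)
qed (transfer; simp add: algebra_simps)+

end

lemma coef_simps [simp]: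
  "coef 0 w = 0" "coef 1 w = (if w = [] then 1 else 0)" "coef (f + g) w = coef f w + coef g w"
  "coef (- f) w = - coef f w" "coef (f - g) w = coef f w - coef g w"
  "coef (f * g) [] = coef f [] * coef g []"
  by (simp_all add: zero_sh.rep_eq one_sh.rep_eq plus_sh.rep_eq uminus_sh.rep_eq minus_sh.rep_eq
      times_sh.rep_eq)

lemma coef_sum: "coef (sum f A) w = (\<Sum>x\<in>A. coef (f x) w)"
  by (induction A rule: infinite_finite_induct) simp_all

lemma coef_sum_list: "coef (sum_list fs) w = (\<Sum>f\<leftarrow>fs. coef f w)"
  by (induction fs) simp_all

lift_definition emb :: "'k \<Rightarrow> ('a, 'k::comm_ring_1) sh" is "\<lambda>c w. if w = [] then c else 0"
  by (rule exI[of _ 1]) auto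

lemma coef_emb [simp]: "coef (emb c) w = (if w = [] then c else 0)"
  by (simp add: emb.rep_eq)

lemma coef_emb_mult [simp]: "coef (emb c * f) w = c * coef f w"
  by (simp add: emb.rep_eq times_sh.rep_eq shprod_one)

lemma emb_hom: "emb (a + b) = emb a + emb b" "emb (a * b) = emb a * emb b" "emb 0 = 0" "emb 1 = 1"
  "emb (- a) = - emb a"
  by (rule sh_eqI; simp)+

lemma emb_of_nat: "emb (of_nat n) = of_nat n"
  by (induction n) (simp_all add: emb_hom)

lift_definition dl :: "'a \<Rightarrow> ('a, 'k::comm_ring_1) sh \<Rightarrow> ('a, 'k) sh" is "\<lambda>a f w. f (a # w)"
  by (metis le_Suc_eq length_Cons)
lift_definition dr :: "'a \<Rightarrow> ('a, 'k::comm_ring_1) sh \<Rightarrow> ('a, 'k) sh" is "\<lambda>a f w. f (w @ [a])"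
  by (metis le_Suc_eq length_append_singleton)

lemma coef_dl [simp]: "coef (dl a f) w = coef f (a # w)" by (simp add: dl.rep_eq)
lemma coef_dr [simp]: "coef (dr a f) w = coef f (w @ [a])" by (simp add: dr.rep_eq)

lemma coef_mult_Cons: "coef (f * g) (a # w) = coef (dl a f * g) w + coef (f * dl a g) w"
  by (simp add: times_sh.rep_eq dl.rep_eq)

lemma coef_mult_snoc: "coef (f * g) (w @ [a]) = coef (dr a f * g) w + coef (f * dr a g) w"
  by (simp add: times_sh.rep_eq dr.rep_eq shprod_snoc)

lemma dl_mult: "dl a (f * g) = dl a f * g + f * dl a g"
  by (rule sh_eqI) (simp add: coef_mult_Cons)

lemma dr_mult: "dr a (f * g) = dr a f * g + f * dr a g"
  by (rule sh_eqI) (simp add: coef_mult_snoc)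

lemma dl_linear [simp]: "dl a 0 = 0" "dl a 1 = 0" "dl a (f + g) = dl a f + dl a g"
  "dl a (f - g) = dl a f - dl a g" "dl a (- f) = - dl a f" "dl a (emb c) = 0"
  by (rule sh_eqI; simp)+

lemma dr_linear [simp]: "dr a 0 = 0" "dr a 1 = 0" "dr a (f + g) = dr a f + dr a g"
  "dr a (f - g) = dr a f - dr a g" "dr a (- f) = - dr a f" "dr a (emb c) = 0"
  by (rule sh_eqI; simp)+

lemma sh_eq_dlI:
  assumes "coef f [] = coef g []" "\<And>a. dl a f = dl a g"
  shows "f = g"
proof (rule sh_eqI)
  fix w show "coef f w = coef g w"
    by (cases w) (use assms(1) arg_cong[OF assms(2), of "\<lambda>h. coef h _"] in auto)
qed

section \<open>Reversal, words of linear forms, and the antipode\<close>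

lift_definition rv :: "('a, 'k::comm_ring_1) sh \<Rightarrow> ('a, 'k) sh" is "\<lambda>f w. f (rev w)"
  by (metis length_rev)

lemma coef_rv [simp]: "coef (rv f) w = coef f (rev w)" by (simp add: rv.rep_eq)

lemma rv_linear: "rv (f + g) = rv f + rv g" "rv (- f) = - rv f" "rv 0 = 0" "rv 1 = 1"
  by (rule sh_eqI; simp)+

text \<open>Reversal exchanges the derivations at the two ends of a word, and the product obeys the
  Leibniz rule at either end.\<close>

lemma rv_mult: "rv (f * g) = rv f * rv g"
proof (rule sh_eqI)
  have d: "dl a (rv h) = rv (dr a h)" for a and h :: "('a, 'b) sh" by (rule sh_eqI) simp
  fix w show "coef (rv (f * g)) w = coef (rv f * rv g) w"
  proof (induction w arbitrary: f g)
    case (Cons a w)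
    have "coef (rv (f * g)) (a # w) = coef (rv (dr a f * g)) w + coef (rv (f * dr a g)) w"
      by (simp add: coef_mult_snoc)
    then show ?case by (simp only: Cons.IH coef_mult_Cons d)
  qed simp
qed

text \<open>\<open>lw us\<close> is the expansion of a word whose letters are linear combinations of letters.\<close>

fun lwf :: "('a \<Rightarrow> 'k) list \<Rightarrow> 'a list \<Rightarrow> 'k::comm_ring_1" where
  "lwf [] [] = 1"
| "lwf (u # us) (a # w) = u a * lwf us w"
| "lwf _ _ = 0"

lemma lwf_length: "length us \<noteq> length w \<Longrightarrow> lwf us w = 0"
  by (induction us w rule: lwf.induct) auto

lemma lwf_Nil [simp]: "lwf [] w = (if w = [] then 1 else 0)" "lwf us [] = (if us = [] then 1 else 0)"
  by (cases w, simp_all) (cases us, simp_all)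

lemma lwf_append: "length us = length w \<Longrightarrow> lwf (us @ us') (w @ w') = lwf us w * lwf us' w'"
  by (induction us w rule: list_induct2) (simp_all add: ac_simps)

lemma lwf_rev: "lwf (rev us) w = lwf us (rev w)"
proof (cases "length us = length w")
  case True
  have "length us = length v \<Longrightarrow> lwf (rev us) (rev v) = lwf us v" for v
    by (induction us v rule: list_induct2) (simp_all add: lwf_append ac_simps)
  from this[of "rev w"] True show ?thesis by simp
qed (simp add: lwf_length)

lift_definition lw :: "('a \<Rightarrow> 'k::comm_ring_1) list \<Rightarrow> ('a, 'k) sh" is lwf
proof -
  fix us :: "('a \<Rightarrow> 'k) list"
  show "\<exists>d. \<forall>w. d \<le> length w \<longrightarrow> lwf us w = 0"
    by (rule exI[of _ "Suc (length us)"]) (auto intro: lwf_length)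
qed

lemma coef_lw: "coef (lw us) w = lwf us w" by (simp add: lw.rep_eq)

lemma lw_Nil [simp]: "lw [] = 1" by (rule sh_eqI) (simp add: coef_lw)

lemma dl_lw [simp]: "dl a (lw (u # us)) = emb (u a) * lw us"
  by (rule sh_eqI) (simp add: coef_lw)

lemma rv_lw: "rv (lw us) = lw (rev us)"
  by (rule sh_eqI) (simp add: coef_lw lwf_rev)

text \<open>Removing the first letter of a word of linear forms leaves a scalar and a shorter word,
  so the induction is the same as for ordinary words.\<close>

lemma lw_mult: "lw us * lw vs = (\<Sum>ws\<leftarrow>shuffle_list us vs. lw ws)"
proof (induction us vs rule: shuffle_list.induct)
  case (3 u us v vs)
  show ?case
  proof (rule sh_eqI)
    fix w show "coef (lw (u # us) * lw (v # vs)) w =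
        coef (\<Sum>ws\<leftarrow>shuffle_list (u # us) (v # vs). lw ws) w"
    proof (cases w)
      case Nil
      have "sum_list (map (\<lambda>f. coef (lw f) []) ws) = 0" if "[] \<notin> set ws" for ws :: "('a \<Rightarrow> 'b) list list"
        using that by (induction ws) (auto simp: coef_lw)
      moreover have "[] \<notin> set (shuffle_list (u # us) (v # vs))" by auto
      ultimately have "sum_list (map (\<lambda>f. coef (lw f) []) (shuffle_list (u # us) (v # vs))) = 0" by blast
      then show ?thesis using Nil by (simp add: coef_lw coef_sum_list o_def del: shuffle_list.simps)
    next
      case (Cons a w')
      have "coef (lw (u # us) * lw (v # vs)) w =
          u a * coef (lw us * lw (v # vs)) w' + v a * coef (lw (u # us) * lw vs) w'"
        by (simp add: Cons coef_mult_Cons mult.assoc mult.left_commute[of _ "emb (v a)"])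
      also have "\<dots> = coef (\<Sum>ws\<leftarrow>shuffle_list (u # us) (v # vs). lw ws) w"
        unfolding 3
        by (simp add: Cons coef_sum_list o_def coef_lw sum_list_const_mult)
      finally show ?thesis .
    qed
  qed
qed simp_all

definition delta :: "'a list \<Rightarrow> ('a, 'k::comm_ring_1) sh" where
  "delta w = lw (map (\<lambda>a b. if b = a then 1 else 0) w)"

lemma coef_delta: "coef (delta w) v = (if v = w then 1 else 0)"
proof -
  have "lwf (map (\<lambda>a b. if b = a then 1 else 0) w) v = (if v = w then 1 else 0)"
    by (induction w arbitrary: v) (auto split: list.splits, case_tac v, auto)
  then show ?thesis by (simp add: delta_def coef_lw)
qed

lemma delta_Nil [simp]: "delta [] = 1" by (simp add: delta_def)

lemma delta_mult: "delta u * delta v = (\<Sum>w\<leftarrow>shuffle_list u v. delta w)"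
  by (simp add: delta_def lw_mult shuffle_list_map o_def)

text \<open>Over a finite alphabet a bound on the length leaves finitely many words.\<close>

lemma finite_coef: "finite {w :: 'a::finite list. coef f w \<noteq> 0}"
proof -
  have "\<exists>d. \<forall>w. d \<le> length w \<longrightarrow> coef f w = 0" using coef[of f] by simp
  then obtain d where d: "\<forall>w. d \<le> length w \<longrightarrow> coef f w = 0" ..
  have "{w. coef f w \<noteq> 0} \<subseteq> {w. set w \<subseteq> UNIV \<and> length w \<le> d}"
  proof
    fix w assume "w \<in> {w. coef f w \<noteq> 0}"
    then have "\<not> d \<le> length w" using d by blast
    then show "w \<in> {w. set w \<subseteq> UNIV \<and> length w \<le> d}" by simp
  qed
  then show ?thesis by (rule finite_subset) (rule finite_lists_length_le, simp)
qed

lemma sh_expand: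
  assumes "finite A" "\<And>w. coef f w \<noteq> 0 \<Longrightarrow> w \<in> A"
  shows "f = (\<Sum>w\<in>A. emb (coef f w) * delta w)"
proof (rule sh_eqI)
  fix v
  have "coef (\<Sum>w\<in>A. emb (coef f w) * delta w) v = (\<Sum>w\<in>A. if v = w then coef f w else 0)"
    by (simp add: coef_sum coef_delta if_distrib cong: if_cong)
  also have "\<dots> = coef f v" using assms by (auto simp: sum.delta)
  finally show "coef f v = coef (\<Sum>w\<in>A. emb (coef f w) * delta w) v" by simp
qed

text \<open>The antipode of the shuffle Hopf algebra reverses words, with the sign of the length.
  Every left derivative of the sum telescopes: a letter taken off the reversed prefix cancels the
  same letter taken off the suffix in the neighbouring decomposition.\<close>

lemma antipode_left:
  "ws \<noteq> [] \<Longrightarrow> split_sum (\<lambda>u v. (- 1) ^ length u * (lw (rev u) * lw v)) ws = (0 :: ('a, 'k::comm_ring_1) sh)"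
proof -
  text \<open>The words \<open>us\<close> have been moved to the left factor already.\<close>
  have gen: "dl a (split_sum (\<lambda>u v. (- 1) ^ length u * (lw (rev u @ us) * lw v)) ws) =
     (case us of [] \<Rightarrow> 0 | u' # us' \<Rightarrow> emb (u' a) * (lw us' * lw ws))"
    for a and us ws :: "('a \<Rightarrow> 'k) list"
  proof (induction ws arbitrary: us)
    case Nil
    then show ?case by (cases us) (simp_all add: dl_mult)
  next
    case (Cons w ws)
    have "split_sum (\<lambda>u v. (- 1) ^ length (w # u) * (lw (rev (w # u) @ us) * lw v)) ws =
        - split_sum (\<lambda>u v. (- 1) ^ length u * (lw (rev u @ w # us) * lw v)) ws"
      by (subst split_sum_hom[of uminus]) (simp_all add: split_sum_hom)
    then have "dl a (split_sum (\<lambda>u v. (- 1) ^ length u * (lw (rev u @ us) * lw v)) (w # ws)) =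
       dl a (lw us * lw (w # ws)) - emb (w a) * (lw us * lw ws)"
      using Cons.IH[of "w # us"] by simp
    then show ?case by (cases us) (simp_all add: dl_mult algebra_simps)
  qed
  assume "ws \<noteq> []"
  show ?thesis
  proof (rule sh_eq_dlI)
    have "coef (split_sum (\<lambda>u v. (- 1) ^ length u * (lw (rev u) * lw v)) ws) [] =
       split_sum (\<lambda>u v. coef ((- 1) ^ length u * (lw (rev u) * lw v)) []) ws"
      by (rule split_sum_hom) simp
    also have "\<dots> = split_sum (\<lambda>u v. 0) ws"
      using \<open>ws \<noteq> []\<close> by (intro split_sum_cong) (auto simp: coef_lw)
    finally show "coef (split_sum (\<lambda>u v. (- 1) ^ length u * (lw (rev u) * lw v)) ws) [] = coef 0 []"
      by simp
    show "dl a (split_sum (\<lambda>u v. (- 1) ^ length u * (lw (rev u) * lw v)) ws) = dl a 0" for a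
      using gen[of a "[]" ws] by simp
  qed
qed

text \<open>Obtained from \<open>antipode_left\<close> by reversing all words; the two alternating
  signs differ by the constant sign of the total length.\<close>

lemma antipode_right:
  assumes "ws \<noteq> []"
  shows "split_sum (\<lambda>u v. (- 1) ^ length v * (lw u * lw (rev v))) ws = (0 :: ('a, 'k::comm_ring_1) sh)"
proof -
  have sg: "rv ((- 1) ^ n * f) = (- 1) ^ n * rv f" for n and f :: "('a, 'k) sh"
    by (induction n arbitrary: f) (simp_all add: rv_linear)
  have sq: "(- 1) ^ n * ((- 1) ^ n * f) = f" for n and f :: "('a, 'k) sh"
    by (simp add: mult.assoc[symmetric] flip: power_mult_distrib)
  have "split_sum (\<lambda>u v. (- 1) ^ length v * (lw u * lw (rev v))) ws =
     rv (split_sum (\<lambda>u v. (- 1) ^ length v * (lw (rev u) * lw v)) ws)"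
    by (subst split_sum_hom[of rv]) (simp_all only: rv_linear sg, simp_all only: rv_mult rv_lw rev_rev_ident)
  also have "split_sum (\<lambda>u v. (- 1) ^ length v * (lw (rev u) * lw v)) ws =
     split_sum (\<lambda>u v. (- 1) ^ length ws * ((- 1) ^ length u * (lw (rev u) * lw v))) ws"
    by (intro split_sum_cong) (simp add: power_add mult.assoc, metis mult.left_commute sq)
  also have "\<dots> = 0" by (simp only: split_sum_mult_left antipode_left[OF assms] mult_zero_right)
  finally show ?thesis by (simp only: rv_linear)
qed

subsection \<open>Regularization\<close>

text \<open>
  Regularization is the homomorphism with image the elements without words starting with \<open>X\<close> that
  is the identity there and maps the letter \<open>X\<close> to 0. Its recursion over the last letter uses the
  derivations \<open>rd\<close>, which makes multiplicativity immediate.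
\<close>

definition rd :: "'b letter \<Rightarrow> ('b letter, 'k::comm_ring_1) sh \<Rightarrow> ('b letter, 'k) sh" where
  "rd l f = dr l f - (if l = X then dl X f else 0)"

text \<open>The word is given backwards, since the recursion removes last letters. For the letter
  \<open>X\<close>, removal at the end is corrected by removal at the front.\<close>

fun regf :: "('b letter list \<Rightarrow> 'k::comm_ring_1) \<Rightarrow> 'b letter list \<Rightarrow> 'k" where
  "regf f [] = f []"
| "regf f (l # v) = regf (\<lambda>w. f (w @ [l]) - (if l = X then f (X # w) else 0)) v"

lemma regf_zero: "(\<And>w. length w = length v \<Longrightarrow> f w = 0) \<Longrightarrow> regf f v = 0"
  by (induction v arbitrary: f) simp_all

lift_definition reg :: "('b letter, 'k::comm_ring_1) sh \<Rightarrow> ('b letter, 'k) sh" is "\<lambda>f w. regf f (rev w)"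
proof -
  fix f :: "'b letter list \<Rightarrow> 'k"
  assume "\<exists>d. \<forall>w. d \<le> length w \<longrightarrow> f w = 0"
  then obtain d where "\<forall>w. d \<le> length w \<longrightarrow> f w = 0" ..
  then have "\<forall>w. d \<le> length w \<longrightarrow> regf f (rev w) = 0" by (auto intro!: regf_zero)
  then show "\<exists>d. \<forall>w. d \<le> length w \<longrightarrow> regf f (rev w) = 0" ..
qed

lemma coef_reg_Nil [simp]: "coef (reg f) [] = coef f []"
  by (simp add: reg.rep_eq)

lemma coef_reg_snoc: "coef (reg f) (w @ [l]) = coef (reg (rd l f)) w"
proof -
  have "coef (rd l f) = (\<lambda>w. coef f (w @ [l]) - (if l = X then coef f (X # w) else 0))"
    by (auto simp: rd_def)
  then show ?thesis by (simp add: reg.rep_eq)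
qed

lemma rd_linear: "rd l (f + g) = rd l f + rd l g" "rd l (- f) = - rd l f" "rd l (emb c) = 0"
  "rd l (emb c * f) = emb c * rd l f"
  by (auto simp: rd_def dr_mult dl_mult algebra_simps)

lemma rd_mult: "rd l (f * g) = rd l f * g + f * rd l g"
  by (simp add: rd_def dr_mult dl_mult algebra_simps)

lemma reg_add: "reg (f + g) = reg f + reg g"
proof (rule sh_eqI)
  fix w show "coef (reg (f + g)) w = coef (reg f + reg g) w"
    by (induction w arbitrary: f g rule: rev_induct) (simp_all add: coef_reg_snoc rd_linear)
qed

lemma reg_minus: "reg (- f) = - reg f"
proof (rule sh_eqI)
  fix w show "coef (reg (- f)) w = coef (- reg f) w"
    by (induction w arbitrary: f rule: rev_induct) (simp_all add: coef_reg_snoc rd_linear)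
qed

lemma reg_emb_mult: "reg (emb c * f) = emb c * reg f"
proof (rule sh_eqI)
  fix w show "coef (reg (emb c * f)) w = coef (emb c * reg f) w"
    by (induction w arbitrary: f rule: rev_induct) (simp_all add: coef_reg_snoc rd_linear)
qed

lemma dr_reg: "dr l (reg f) = reg (rd l f)"
  by (rule sh_eqI) (simp add: coef_reg_snoc)

lemma reg_mult: "reg (f * g) = reg f * reg g"
proof (rule sh_eqI)
  fix w show "coef (reg (f * g)) w = coef (reg f * reg g) w"
  proof (induction w arbitrary: f g rule: rev_induct)
    case (snoc l w)
    have "coef (reg (f * g)) (w @ [l]) = coef (reg (rd l f * g)) w + coef (reg (f * rd l g)) w"
      by (simp add: coef_reg_snoc rd_mult reg_add)
    then show ?case by (simp only: snoc.IH coef_mult_snoc dr_reg)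
  qed simp
qed

text \<open>On the word \<open>[X]\<close> the two terms of \<open>rd X\<close> cancel, and longer
  words reduce to it by removing last letters. So the image of \<open>reg\<close> has no word with
  leading \<open>X\<close>.\<close>

lemma dl_X_reg: "dl X (reg f) = 0"
proof (rule sh_eqI)
  fix w show "coef (dl X (reg f)) w = coef 0 w"
  proof (induction w arbitrary: f rule: rev_induct)
    case Nil
    have "coef (reg f) ([] @ [X]) = 0" by (subst coef_reg_snoc) (simp add: rd_def)
    then show ?case by simp
  next
    case (snoc l w)
    have "coef (reg f) ((X # w) @ [l]) = 0" by (subst coef_reg_snoc) (use snoc in simp)
    then show ?case by simp
  qed
qed

lemma reg_id: "dl X f = 0 \<Longrightarrow> reg f = f"
proof -
  have "coef (reg f) w = coef f w" if "dl X f = 0" for w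
    using that
  proof (induction w arbitrary: f rule: rev_induct)
    case (snoc l w)
    have "coef f (X # v) = 0" for v
      using arg_cong[OF snoc.prems, of "\<lambda>h. coef h v"] by simp
    then have "dl X (dr l f) = 0" by (intro sh_eqI) simp
    then show ?case using snoc by (simp add: coef_reg_snoc rd_def)
  qed simp
  then show "dl X f = 0 \<Longrightarrow> reg f = f" by (auto intro: sh_eqI)
qed

lemma reg_0 [simp]: "reg 0 = 0" and reg_1 [simp]: "reg 1 = 1" and reg_emb: "reg (emb c) = emb c"
  by (simp_all add: reg_id)

lemma reg_reg: "reg (reg f) = reg f" by (simp add: reg_id dl_X_reg)

lemma reg_sum_list: "reg (sum_list fs) = (\<Sum>f\<leftarrow>fs. reg f)"
  by (induction fs) (simp_all add: reg_add)

lemma reg_power: "reg (f ^ n) = reg f ^ n" by (induction n) (simp_all add: reg_mult)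

lemma reg_sign: "reg ((- 1) ^ n * f) = (- 1) ^ n * reg f"
  by (simp add: reg_mult reg_power reg_minus)

lemma rd_delta_X: "rd l (delta [X]) = 0"
  by (rule sh_eqI) (auto simp: rd_def coef_delta)

lemma reg_delta_X [simp]: "reg (delta [X]) = 0"
proof (rule sh_eqI)
  show "coef (reg (delta [X])) w = coef 0 w" for w :: "'a letter list"
    by (cases w rule: rev_cases) (simp_all add: coef_reg_snoc rd_delta_X coef_delta)
qed

text \<open>The derivation \<open>dl X\<close> is locally nilpotent and maps
  \<open>delta [X]\<close> to 1. In characteristic 0 the highest nonzero derivative can therefore be
  removed by subtracting a divided power of \<open>delta [X]\<close>, and \<open>reg\<close> kills
  what is subtracted. So the kernel of \<open>reg\<close> is the ideal of the letter
  \<open>X\<close>.\<close>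

lemma reg_decomposition:
  fixes f :: "('b letter, 'k::field_char_0) sh"
  shows "\<exists>g. f = reg f + delta [X] * g"
proof -
  let ?x = "delta [X] :: ('b letter, 'k) sh"
  have dx: "dl X ?x = 1" by (rule sh_eqI) (simp add: coef_delta)
  \<comment> \<open>With coefficients killed by \<open>dl X\<close>, powers of
    \<open>delta [X]\<close> are differentiated like powers of a polynomial variable.\<close>
  have pw: "(dl X ^^ d) (?x ^ d * u) = emb (fact d) * u" if "dl X u = 0" for u d
  proof -
    have "dl X (?x ^ Suc n * v) = emb (of_nat (Suc n)) * ?x ^ n * v" if "dl X v = 0" for n v
    proof (induction n)
      case (Suc n)
      have "dl X (?x ^ Suc (Suc n) * v) = ?x ^ Suc n * v + ?x * dl X (?x ^ Suc n * v)"
        by (simp add: dl_mult dx mult.assoc)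
      then show ?case unfolding Suc by (simp add: emb_of_nat algebra_simps del: of_nat_Suc) (simp add: algebra_simps)
    qed (use that in \<open>simp add: dl_mult dx emb_hom\<close>)
    then have st: "dl X (?x ^ Suc n * v) = ?x ^ n * (emb (of_nat (Suc n)) * v)" if "dl X v = 0" for n v
      using that by (simp add: mult.commute mult.left_commute)
    show ?thesis using that
    proof (induction d arbitrary: u)
      case (Suc d)
      have "(dl X ^^ Suc d) (?x ^ Suc d * u) = (dl X ^^ d) (?x ^ d * (emb (of_nat (Suc d)) * u))"
        by (simp only: funpow_Suc_right o_apply st[OF Suc.prems])
      also have "\<dots> = emb (fact d) * (emb (of_nat (Suc d)) * u)"
        by (rule Suc.IH) (simp add: dl_mult Suc.prems)
      finally show ?case by (simp add: emb_hom mult_ac)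
    qed (simp add: emb_hom)
  qed
  have "\<exists>g. f = reg f + ?x * g" if "(dl X ^^ Suc d) f = 0" for d f
    using that
  proof (induction d arbitrary: f)
    case 0
    then have "f = reg f + ?x * 0" by (simp add: reg_id)
    then show ?case ..
  next
    case (Suc d)
    define u where "u = (dl X ^^ Suc d) f"
    have u: "dl X u = 0" using Suc.prems by (simp add: u_def)
    \<comment> \<open>Division by the factorial makes the derivative of order \<open>Suc d\<close>
      of the subtracted term equal to \<open>u\<close>, so that it vanishes on
      \<open>f1\<close>.\<close>
    define f1 where "f1 = f - ?x ^ Suc d * (emb (1 / fact (Suc d)) * u)"
    have sub: "(dl X ^^ n) (a - b) = (dl X ^^ n) a - (dl X ^^ n) b" for n and a b :: "('b letter, 'k) sh"
      by (induction n) simp_all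
    have "(dl X ^^ Suc d) f1 = u - emb (fact (Suc d)) * (emb (1 / fact (Suc d)) * u)"
      unfolding f1_def sub by (subst pw) (simp_all only: u_def[symmetric] dl_mult dl_linear u mult_zero_left mult_zero_right add_0)
    also have "\<dots> = 0" by (simp add: mult.assoc[symmetric] del: fact_Suc flip: emb_hom(2)) (simp add: emb_hom)
    finally obtain g where g: "f1 = reg f1 + ?x * g" using Suc.IH by blast
    have "reg f = reg f1" by (simp add: f1_def reg_add reg_minus reg_mult diff_conv_add_uminus del: add_uminus_conv_diff)
    then have "f = reg f + ?x * (g + ?x ^ d * (emb (1 / fact (Suc d)) * u))"
      using g by (simp add: f1_def algebra_simps del: fact_Suc)
    then show ?case ..
  qed
  moreover have "\<exists>d. (dl X ^^ Suc d) f = 0"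
  proof -
    have "\<exists>d. \<forall>w. d \<le> length w \<longrightarrow> coef f w = 0" using coef[of f] by simp
    then obtain d where d: "\<forall>w. d \<le> length w \<longrightarrow> coef f w = 0" ..
    have "coef ((dl X ^^ n) f) w = coef f (replicate n X @ w)" for n w
      by (induction n arbitrary: w) (simp_all add: replicate_app_Cons_same)
    then have "(dl X ^^ Suc d) f = 0" by (intro sh_eqI) (simp add: d del: replicate.simps funpow.simps)
    then show ?thesis ..
  qed
  ultimately show ?thesis by blast
qed

section \<open>The model of Goncharov's algebra\<close>

lemma root_power_mod: "exp (2 * pi * \<i> / CARD('N::finite)) ^ (k mod CARD('N)) = exp (2 * pi * \<i> / CARD('N)) ^ k"
proof -
  have "exp (2 * pi * \<i> / CARD('N)) ^ CARD('N) = exp (of_nat CARD('N) * (2 * pi * \<i> / CARD('N)))"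
    by (simp only: exp_of_nat_mult)
  also have "\<dots> = 1" by simp
  finally have "exp (2 * pi * \<i> / CARD('N)) ^ CARD('N) = 1" .
  then have "exp (2 * pi * \<i> / CARD('N)) ^ (CARD('N) * (k div CARD('N)) + k mod CARD('N)) =
      exp (2 * pi * \<i> / CARD('N)) ^ (k mod CARD('N))"
    unfolding power_add power_mult by simp
  then show ?thesis unfolding mult_div_mod_eq by (rule sym)
qed

lemma to_int_mod_ring_add:
  "to_int_mod_ring (a + b :: 'N::finite mod_ring) = (to_int_mod_ring a + to_int_mod_ring b) mod int CARD('N)"
  by transfer simp

lemma to_int_mod_ring_ge_0: "to_int_mod_ring (a :: 'N::finite mod_ring) \<ge> 0"
  by transfer simp

lemma eta_pow_add: "eta_pow (a + b) = eta_pow a * eta_pow (b :: 'N::finite mod_ring)"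
proof -
  let ?z = "exp (2 * pi * \<i> / CARD('N))"
  have "nat ((to_int_mod_ring a + to_int_mod_ring b) mod int CARD('N)) =
      (nat (to_int_mod_ring a) + nat (to_int_mod_ring b)) mod CARD('N)"
    using to_int_mod_ring_ge_0[of a] to_int_mod_ring_ge_0[of b]
    by (simp add: nat_mod_distrib nat_add_distrib)
  then have "eta_pow (a + b) = ?z ^ ((nat (to_int_mod_ring a) + nat (to_int_mod_ring b)) mod CARD('N))"
    unfolding eta_pow_def to_int_mod_ring_add by (rule arg_cong)
  then show ?thesis unfolding root_power_mod power_add eta_pow_def .
qed

lemma eta_pow_0 [simp]: "eta_pow 0 = 1"
  by (simp add: eta_pow_def)

lemma eta_cyc_add: "eta_cyc (a + b) = eta_cyc a * eta_cyc b"
  by transfer (rule eta_pow_add)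

lemma eta_cyc_0 [simp]: "eta_cyc 0 = 1"
  by transfer simp

subsection \<open>Convolution of functions on words\<close>

definition conv :: "('a list \<Rightarrow> 'k) \<Rightarrow> ('a list \<Rightarrow> 'k) \<Rightarrow> 'a list \<Rightarrow> 'k::comm_ring_1" where
  "conv f g = split_sum (\<lambda>u v. f u * g v)"

definition unit_fun :: "'a list \<Rightarrow> 'k::comm_ring_1" where
  "unit_fun w = (if w = [] then 1 else 0)"

lemma conv_assoc: "conv (conv f g) h = conv f (conv g h)"
  unfolding conv_def by (rule ext)
    (simp add: split_sum_mult_left[symmetric] split_sum_mult_right[symmetric] split_sum_assoc mult.assoc)

lemma conv_unit_left: "conv unit_fun g = g"
proof
  fix w
  have "conv unit_fun g w = split_sum (\<lambda>u v. if u = [] then g v else 0) w"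
    unfolding conv_def unit_fun_def by (rule arg_cong[of _ _ "\<lambda>f. split_sum f w"]) (simp add: fun_eq_iff)
  then show "conv unit_fun g w = g w" by (simp only: split_sum_first)
qed

lemma conv_unit_right: "conv f unit_fun = f"
proof
  fix w show "conv f unit_fun w = f w"
    unfolding conv_def unit_fun_def by (induction w arbitrary: f) simp_all
qed

definition shuffle_hom :: "('a list \<Rightarrow> 'k::comm_ring_1) \<Rightarrow> bool" where
  "shuffle_hom f \<longleftrightarrow> (\<forall>u v. f u * f v = (\<Sum>w\<leftarrow>shuffle_list u v. f w))"

text \<open>Functions with \<open>shuffle_hom\<close> are the characters of the shuffle algebra.
  Their convolution is a character because deconcatenation is multiplicative and the target is
  commutative.\<close>

lemma shuffle_hom_conv:
  assumes "shuffle_hom f" "shuffle_hom g"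
  shows "shuffle_hom (conv f g)"
  unfolding shuffle_hom_def
proof (intro allI)
  fix us vs
  have "(\<Sum>w\<leftarrow>shuffle_list us vs. conv f g w) =
      split_sum (\<lambda>u1 u2. split_sum (\<lambda>v1 v2. \<Sum>w1\<leftarrow>shuffle_list u1 v1. \<Sum>w2\<leftarrow>shuffle_list u2 v2. f w1 * g w2) vs) us"
    unfolding conv_def by (rule split_sum_shuffle_list)
  also have "\<dots> = split_sum (\<lambda>u1 u2. split_sum (\<lambda>v1 v2. (f u1 * g u2) * (f v1 * g v2)) vs) us"
  proof -
    have "(\<Sum>w1\<leftarrow>shuffle_list u1 v1. \<Sum>w2\<leftarrow>shuffle_list u2 v2. f w1 * g w2) = (f u1 * g u2) * (f v1 * g v2)"
      for u1 v1 u2 v2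
    proof -
      have "(\<Sum>w1\<leftarrow>shuffle_list u1 v1. \<Sum>w2\<leftarrow>shuffle_list u2 v2. f w1 * g w2) = (f u1 * f v1) * (g u2 * g v2)"
        using assms by (simp add: shuffle_hom_def sum_list_const_mult sum_list_mult_const)
      then show ?thesis by (simp add: mult_ac)
    qed
    then show ?thesis by simp
  qed
  also have "\<dots> = conv f g us * conv f g vs"
    by (simp only: conv_def split_sum_mult_left split_sum_mult_right)
  finally show "conv f g us * conv f g vs = (\<Sum>w\<leftarrow>shuffle_list us vs. conv f g w)" by simp
qed

subsection \<open>Iterated integrals in the shuffle algebra\<close>

text \<open>
  The letter \<open>Y k\<close> is the dual of the characters \<open>\<eta>\<^sup>b \<mapsto> - \<eta>\<^sup>-\<^sup>b\<^sup>k\<close> of the letters \<open>Eta b\<close>, so that words in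
  \<open>X\<close> and \<open>Y k\<close> correspond to congruence conditions on differences of summation variables. The
  argument \<open>c\<close> is the end point \<open>\<eta>\<^sup>c\<close>, by which the homomorphism \<open>\<mu>\<close> divides.
\<close>

type_synonym 'N shalg = "('N mod_ring letter, 'N cyclotomic) sh"

fun tau :: "'N::finite mod_ring \<Rightarrow> 'N mod_ring point \<Rightarrow> 'N mod_ring letter \<Rightarrow> 'N cyclotomic" where
  "tau c Zero X = 1"
| "tau c (Eta b) (Y k) = - eta_cyc ((c - b) * k)"
| "tau c _ _ = 0"

text \<open>\<open>T c w\<close> plays the role of the integral over \<open>w\<close> from 0 to
  \<open>c\<close>, which is trivial if \<open>c\<close> is 0. \<open>S b w\<close> is the integral
  from \<open>b\<close> to 0, got by reversing the path, and \<open>phi\<close> composes the two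
  paths at 0.\<close>

fun T :: "'N::finite mod_ring point \<Rightarrow> 'N mod_ring point list \<Rightarrow> 'N shalg" where
  "T Zero w = unit_fun w"
| "T (Eta c) w = reg (lw (map (tau c) w))"

definition S :: "'N::finite mod_ring point \<Rightarrow> 'N mod_ring point list \<Rightarrow> 'N shalg" where
  "S b w = (- 1) ^ length w * T b (rev w)"

definition phi :: "'N::finite mod_ring point \<Rightarrow> 'N mod_ring point list \<Rightarrow> 'N mod_ring point \<Rightarrow> 'N shalg" where
  "phi b bs c = conv (S b) (T c) bs"

lemma T_Nil [simp]: "T c [] = 1" by (cases c) (simp_all add: unit_fun_def)
lemma S_Nil [simp]: "S c [] = 1" by (simp add: S_def)
lemma phi_Nil [simp]: "phi b [] c = 1" by (simp add: phi_def conv_def)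

lemma S_Zero: "S Zero = unit_fun" by (auto simp: S_def unit_fun_def fun_eq_iff)

lemma T_Zero: "T Zero = unit_fun" by (simp add: fun_eq_iff)

lemma phi_Zero: "phi Zero = (\<lambda>bs c. T c bs)"
  by (simp add: phi_def S_Zero conv_unit_left fun_eq_iff)

lemma phi_to_Zero: "phi b bs Zero = S b bs"
  by (simp add: phi_def T_Zero conv_unit_right)

lemma shuffle_hom_unit: "shuffle_hom unit_fun"
  unfolding shuffle_hom_def
proof (intro allI)
  fix u v :: "'a list"
  have "unit_fun w = (0 :: 'b)" if "w \<in> set (shuffle_list u v)" "u \<noteq> [] \<or> v \<noteq> []" for w
    using length_shuffle_list[OF that(1)] that(2) by (auto simp: unit_fun_def)
  then have "(\<Sum>w\<leftarrow>shuffle_list u v. unit_fun w) = (\<Sum>w\<leftarrow>shuffle_list u v. 0 :: 'b)" if "u \<noteq> [] \<or> v \<noteq> []"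
    using that by (intro arg_cong[of _ _ sum_list] map_cong) auto
  then show "unit_fun u * unit_fun v = (\<Sum>w\<leftarrow>shuffle_list u v. unit_fun w :: 'b)"
    by (cases "u = [] \<and> v = []") (auto simp: unit_fun_def)
qed

lemma shuffle_hom_T: "shuffle_hom (T c)"
proof (cases c)
  case (Eta b)
  then show ?thesis
    by (simp add: shuffle_hom_def reg_mult[symmetric] lw_mult shuffle_list_map reg_sum_list o_def)
qed (simp add: T_Zero shuffle_hom_unit)

lemma shuffle_hom_S: "shuffle_hom (S c)"
proof (cases c)
  case (Eta b)
  show ?thesis unfolding shuffle_hom_def
  proof (intro allI)
    fix u v :: "'a mod_ring point list"
    let ?l = "map (tau b)"
    have 1: "S c w = (- 1) ^ length w * reg (rv (lw (?l w)))" for w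
      by (simp add: S_def Eta rv_lw rev_map)
    have "(\<Sum>w\<leftarrow>shuffle_list u v. S c w) =
        (\<Sum>w\<leftarrow>shuffle_list u v. (- 1) ^ (length u + length v) * reg (rv (lw (?l w))))"
      by (intro arg_cong[of _ _ sum_list] map_cong) (simp_all add: 1 length_shuffle_list)
    also have "\<dots> = (- 1) ^ (length u + length v) * reg (rv (\<Sum>w\<leftarrow>shuffle_list u v. lw (?l w)))"
    proof -
      have "rv (sum_list fs) = (\<Sum>f\<leftarrow>fs. rv f)" for fs :: "'a shalg list"
        by (induction fs) (simp_all add: rv_linear)
      then show ?thesis by (simp add: sum_list_const_mult reg_sum_list o_def)
    qed
    also have "(\<Sum>w\<leftarrow>shuffle_list u v. lw (?l w)) = lw (?l u) * lw (?l v)"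
      by (simp add: lw_mult shuffle_list_map o_def)
    finally show "S c u * S c v = (\<Sum>w\<leftarrow>shuffle_list u v. S c w)"
      by (simp add: 1 rv_mult reg_mult power_add mult_ac)
  qed
qed (simp add: S_Zero shuffle_hom_unit)

lemma shuffle_hom_phi: "shuffle_hom (\<lambda>bs. phi b bs c)"
  using shuffle_hom_conv[OF shuffle_hom_S shuffle_hom_T] by (simp add: phi_def)

text \<open>The path from \<open>c\<close> to 0 and back is trivial; in the algebra this is the
  antipode identity, followed by \<open>reg\<close>.\<close>

lemma conv_S_T: "conv (S c) (T c) = unit_fun"
proof (cases c)
  case (Eta b)
  show ?thesis
  proof
    fix w
    have "conv (S c) (T c) w =
        split_sum (\<lambda>u v. reg ((- 1) ^ length u * (lw (rev (map (tau b) u)) * lw (map (tau b) v)))) w"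
      unfolding conv_def S_def Eta by (simp only: reg_sign) (simp add: reg_mult rev_map mult_ac)
    also have "\<dots> = reg (split_sum (\<lambda>u v. (- 1) ^ length u * (lw (rev (map (tau b) u)) * lw (map (tau b) v))) w)"
      by (rule split_sum_hom[symmetric]) (rule reg_add)
    also have "split_sum (\<lambda>u v. (- 1) ^ length u * (lw (rev (map (tau b) u)) * lw (map (tau b) v))) w =
       split_sum (\<lambda>u v. (- 1) ^ length u * (lw (rev u) * lw v)) (map (tau b) w)"
      by (simp add: split_sum_atMost take_map drop_map)
    also have "reg \<dots> = unit_fun w"
      by (cases "w = []") (simp_all add: antipode_left unit_fun_def)
    finally show "conv (S c) (T c) w = unit_fun w" .
  qed
qed (simp add: S_Zero T_Zero conv_unit_left)

lemma conv_T_S: "conv (T c) (S c) = unit_fun"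
proof (cases c)
  case (Eta b)
  show ?thesis
  proof
    fix w
    have "conv (T c) (S c) w =
        split_sum (\<lambda>u v. reg ((- 1) ^ length v * (lw (map (tau b) u) * lw (rev (map (tau b) v))))) w"
      unfolding conv_def S_def Eta by (simp only: reg_sign) (simp add: reg_mult rev_map mult_ac)
    also have "\<dots> = reg (split_sum (\<lambda>u v. (- 1) ^ length v * (lw (map (tau b) u) * lw (rev (map (tau b) v)))) w)"
      by (rule split_sum_hom[symmetric]) (rule reg_add)
    also have "split_sum (\<lambda>u v. (- 1) ^ length v * (lw (map (tau b) u) * lw (rev (map (tau b) v)))) w =
       split_sum (\<lambda>u v. (- 1) ^ length v * (lw u * lw (rev v))) (map (tau b) w)"
      by (simp add: split_sum_atMost take_map drop_map)
    also have "reg \<dots> = unit_fun w"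
      by (cases "w = []") (simp_all add: antipode_right unit_fun_def)
    finally show "conv (T c) (S c) w = unit_fun w" .
  qed
qed (simp add: S_Zero T_Zero conv_unit_left)

lemma phi_same: "phi b bs b = unit_fun bs"
  by (simp add: phi_def conv_S_T)

text \<open>The detour through \<open>c\<close> cancels, since \<open>T c\<close> and
  \<open>S c\<close> are inverse to each other under convolution.\<close>

lemma phi_path: "phi b bs b' = conv (\<lambda>u. phi b u c) (\<lambda>v. phi c v b') bs"
proof -
  have "conv (conv (S b) (T c)) (conv (S c) (T b')) = conv (S b) (conv (conv (T c) (S c)) (T b'))"
    by (simp only: conv_assoc)
  then show ?thesis unfolding phi_def[abs_def] conv_T_S conv_unit_left by metis
qed

lemma tau_Zero: "tau c Zero = (\<lambda>l. if l = X then 1 else 0)"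
proof
  fix l show "tau c Zero l = (if l = X then 1 else 0)" by (cases l) simp_all
qed

lemma T_Eta_Zero: "T (Eta c) [Zero] = 0"
proof -
  have "lw (map (tau c) [Zero]) = delta [X]"
    by (simp add: delta_def tau_Zero)
  then show ?thesis by simp
qed

subsection \<open>Evaluation homomorphisms\<close>

text \<open>Coefficients may cancel in \<open>p + q\<close>. As \<open>F x 0 = 0\<close>, all three
  sums can be extended to the union of the supports.\<close>

lemma sum_keys_add:
  assumes "\<And>x. F x 0 = (0::'c::comm_monoid_add)" "\<And>x a b. F x (a + b) = F x a + F x b"
  shows "(\<Sum>x\<in>Poly_Mapping.keys (p + q). F x (Poly_Mapping.lookup (p + q) x)) =
    (\<Sum>x\<in>Poly_Mapping.keys p. F x (Poly_Mapping.lookup p x)) +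
    (\<Sum>x\<in>Poly_Mapping.keys q. F x (Poly_Mapping.lookup q x))"
proof -
  let ?A = "Poly_Mapping.keys p \<union> Poly_Mapping.keys q"
  have e: "(\<Sum>x\<in>Poly_Mapping.keys r. F x (Poly_Mapping.lookup r x)) = (\<Sum>x\<in>?A. F x (Poly_Mapping.lookup r x))"
    if "Poly_Mapping.keys r \<subseteq> ?A" for r
    using that by (intro sum.mono_neutral_left) (simp_all add: assms in_keys_iff)
  show ?thesis
    unfolding e[OF Poly_Mapping.keys_add] e[OF Un_upper1] e[OF Un_upper2]
    by (simp add: lookup_add assms(2) sum.distrib)
qed

lemma poly_mapping_induct [case_names zero add]:
  assumes "P 0" "\<And>x c p. P p \<Longrightarrow> P (Poly_Mapping.single x c + p)"
  shows "P (p :: 'b \<Rightarrow>\<^sub>0 'k::monoid_add)"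
proof (induction p rule: update_induct)
  case (update f a b)
  have "Poly_Mapping.update a b f = Poly_Mapping.single a b + f"
    by (rule poly_mapping_eqI)
       (use update in \<open>auto simp: lookup_update lookup_add lookup_single in_keys_iff when_def\<close>)
  then show ?case using assms(2)[OF update.IH] by simp
qed (rule assms)

definition evp :: "('r \<Rightarrow> 'k) \<Rightarrow> ('b \<Rightarrow> 'k) \<Rightarrow> ('b \<Rightarrow>\<^sub>0 'r::comm_ring_1) \<Rightarrow> 'k::comm_ring_1" where
  "evp e h p = (\<Sum>x\<in>Poly_Mapping.keys p. e (Poly_Mapping.lookup p x) * h x)"

text \<open>Universal property of a commutative monoid algebra. It is used with two targets: the
  shuffle algebra for \<open>Phi\<close>, and the polynomial ring itself for
  \<open>mu_model\<close>.\<close>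

locale evaluation =
  fixes e :: "'r::comm_ring_1 \<Rightarrow> 'k::comm_ring_1" and h :: "'b::comm_monoid_add \<Rightarrow> 'k"
  assumes e: "e (a + b) = e a + e b" "e (a * b) = e a * e b" "e 1 = 1"
    and h: "h (x + y) = h x * h y" "h 0 = 1"
begin

lemma e_0: "e 0 = 0" using e(1)[of 0 0] by simp

lemma ev_single: "evp e h (Poly_Mapping.single x c) = e c * h x"
  by (simp add: evp_def e_0)

lemma ev_add: "evp e h (p + q) = evp e h p + evp e h q"
  unfolding evp_def by (rule sum_keys_add) (simp_all add: e_0 e algebra_simps)

lemma ev_0: "evp e h 0 = 0" by (simp add: evp_def)

lemma ev_mult: "evp e h (p * q) = evp e h p * evp e h q"
proof (induction p rule: poly_mapping_induct)
  case (add x c p)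
  have "evp e h (Poly_Mapping.single x c * q) = evp e h (Poly_Mapping.single x c) * evp e h q"
  proof (induction q rule: poly_mapping_induct)
    case (add y d q)
    then show ?case by (simp add: distrib_left ev_add mult_single ev_single e h mult_ac)
  qed (simp add: ev_0)
  with add show ?case by (simp add: distrib_right ev_add)
qed (simp add: ev_0)

lemma ev_const: "evp e h (const c) = e c"
  by (simp add: const_def ev_single h)

lemma ev_1: "evp e h 1 = 1"
  using ev_const[of 1] e by (simp add: const_def)

lemma ev_uminus: "evp e h (- p) = - evp e h p"
proof -
  have "evp e h (- p) + evp e h p = 0" unfolding ev_add[symmetric] by (simp add: ev_0)
  then show ?thesis by (simp add: eq_neg_iff_add_eq_0)
qed

lemma ev_diff: "evp e h (p - q) = evp e h p - evp e h q"
  using ev_add[of p "- q"] by (simp add: ev_uminus)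

lemma ev_sum: "evp e h (sum f A) = (\<Sum>x\<in>A. evp e h (f x))"
  by (induction A rule: infinite_finite_induct) (simp_all add: ev_0 ev_add)

lemma ev_prod: "evp e h (prod f A) = (\<Prod>x\<in>A. evp e h (f x))"
  by (induction A rule: infinite_finite_induct) (simp_all add: ev_1 ev_mult)

end

lemma module_mult: "Modules.module ((*) :: 'r::comm_ring_1 \<Rightarrow> 'r \<Rightarrow> 'r)"
  by unfold_locales (simp_all add: algebra_simps)

fun phis :: "'N::finite mod_ring symb \<Rightarrow> 'N shalg" where
  "phis (Symb b bs c) = phi b bs c"

definition Phi :: "('N::finite, 'N cyclotomic) spoly \<Rightarrow> 'N shalg" where
  "Phi = evp emb (\<lambda>M. \<Prod>s\<in>#M. phis s)"

interpretation Phi: evaluation emb "\<lambda>M :: 'N::finite mod_ring symb multiset. \<Prod>s\<in>#M. phis s"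
  rewrites "evp emb (\<lambda>M :: 'N::finite mod_ring symb multiset. \<Prod>s\<in>#M. phis s) = Phi"
  by unfold_locales (simp_all add: emb_hom Phi_def)

lemma Phi_II [simp]: "Phi (II b bs c) = phi b bs c"
  by (simp add: II_def Phi.ev_single emb_hom)

text \<open>The relations are, in turn: value 1 on the empty list, the character property,
  composition of paths, triviality of closed paths. The extra generators are killed because
  \<open>reg\<close> kills the letter \<open>X\<close>.\<close>

lemma Phi_relations:
  assumes "p \<in> goncharov_relations \<union> {II Zero [Zero] b | b. b \<noteq> Zero}"
  shows "Phi p = 0"
  using assms unfolding goncharov_relations_def
proof (elim UnE)
  assume "p \<in> {II b [] c - 1 | b c. True}"
  then show ?thesis by (auto simp: Phi.ev_diff Phi.ev_1)
next
  assume "p \<in> {II b us c * II b vs c - (\<Sum>\<sigma>\<in>shuffle_perms (length us) (length vs).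
        II b (map (\<lambda>i. (us @ vs) ! (inv_into UNIV \<sigma> i)) [0..<length us + length vs]) c) | b us vs c. True}"
  then obtain b us vs c where p: "p = II b us c * II b vs c - (\<Sum>\<sigma>\<in>shuffle_perms (length us) (length vs).
        II b (map (\<lambda>i. (us @ vs) ! (inv_into UNIV \<sigma> i)) [0..<length us + length vs]) c)" by blast
  have "Phi p = phi b us c * phi b vs c - (\<Sum>w\<leftarrow>shuffle_list us vs. phi b w c)"
    unfolding p Phi.ev_diff Phi.ev_mult Phi.ev_sum Phi_II
    by (simp only: sum_shuffle_perms[where F = "\<lambda>w. phi b w c"])
  also have "\<dots> = 0" using shuffle_hom_phi[of b c] by (simp add: shuffle_hom_def)
  finally show ?thesis .
next
  assume "p \<in> {II b bs b' - (\<Sum>i\<le>length bs. II b (take i bs) c * II c (drop i bs) b') | b bs b' c. True}"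
  then obtain b bs b' c where p: "p = II b bs b' - (\<Sum>i\<le>length bs. II b (take i bs) c * II c (drop i bs) b')"
    by blast
  show ?thesis unfolding p Phi.ev_diff Phi.ev_sum Phi.ev_mult Phi_II
    using phi_path[of b bs b' c] by (simp add: conv_def split_sum_atMost)
next
  assume "p \<in> {II b bs b | b bs. bs \<noteq> []}"
  then show ?thesis by (auto simp: phi_same unit_fun_def)
next
  assume "p \<in> {II Zero [Zero] b | b. b \<noteq> Zero}"
  then obtain b where "p = II Zero [Zero] b" "b \<noteq> Zero" by blast
  then show ?thesis by (cases b) (simp_all add: phi_Zero T_Eta_Zero del: T.simps)
qed

text \<open>A polynomial with nonzero value under \<open>Phi\<close> is nonzero in the quotient.
  From this it follows that the quotient is not the zero ring and that the coproduct is uniquely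
  determined.\<close>

lemma Phi_I0_ideal: "p \<in> I0_ideal \<Longrightarrow> Phi p = 0"
  unfolding I0_ideal_def ideal_generated_def
proof (induction rule: module.span_induct_alt[OF module_mult, consumes 1])
  case (2 c x y)
  then show ?case by (simp add: Phi.ev_add Phi.ev_mult Phi_relations)
qed (simp add: Phi.ev_0)

section \<open>Fourier transform of letters\<close>

instance letter :: (finite) finite
proof
  have "(UNIV :: 'a letter set) = insert X (range Y)" by (auto intro: letter.exhaust)
  then show "finite (UNIV :: 'a letter set)" by (metis finite_insert finite_imageI finite_class.finite_UNIV)
qed

lemma sum_letter: "sum F (UNIV :: 'a::finite letter set) = F X + (\<Sum>k\<in>UNIV. F (Y k))"
proof -
  have "(UNIV :: 'a letter set) = insert X (range Y)" by (auto intro: letter.exhaust)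
  then have "sum F (UNIV :: 'a letter set) = sum F (insert X (range Y))" by (rule arg_cong)
  also have "\<dots> = F X + sum F (range Y)" by (rule sum.insert) auto
  finally have "sum F (UNIV :: 'a letter set) = F X + sum F (range Y)" .
  then show ?thesis by (simp add: sum.reindex inj_on_def)
qed

lemma finite_words: "finite {W :: 'a::finite list. length W = n}"
  using finite_lists_length_eq[of "UNIV :: 'a set" n] by simp

lemma sum_words_Suc:
  "(\<Sum>W | length (W :: 'a::finite list) = Suc n. F W) = (\<Sum>l\<in>UNIV. \<Sum>W | length W = n. F (l # W))"
proof -
  let ?A = "UNIV \<times> {W :: 'a list. length W = n}" and ?g = "\<lambda>x. fst x # snd x"
  have "{W :: 'a list. length W = Suc n} = ?g ` ?A"
    by (force simp: length_Suc_conv)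
  then have "(\<Sum>W | length (W :: 'a list) = Suc n. F W) = sum F (?g ` ?A)" by (rule arg_cong)
  also have "\<dots> = sum (F \<circ> ?g) ?A" by (rule sum.reindex) (auto simp: inj_on_def)
  also have "\<dots> = (\<Sum>l\<in>UNIV. \<Sum>W | length W = n. F (l # W))"
    by (simp add: sum.cartesian_product case_prod_beta)
  finally show ?thesis .
qed

text \<open>Representatives lie below \<open>N\<close>, and the root of unity is primitive.\<close>

lemma eta_pow_eq_1_iff: "eta_pow a = 1 \<longleftrightarrow> a = (0 :: 'N::finite mod_ring)"
proof
  assume e: "eta_pow a = 1"
  define n where "n = nat (to_int_mod_ring a)"
  have n: "n < CARD('N)" unfolding n_def by transfer (simp add: nat_less_iff)
  have "exp (2 * of_real pi * \<i> * of_nat n / of_nat CARD('N)) = exp (of_nat n * (2 * pi * \<i> / CARD('N)))"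
    by (simp add: mult_ac)
  also have "\<dots> = 1" using e by (simp only: eta_pow_def exp_of_nat_mult n_def)
  finally have "exp (2 * of_real pi * \<i> * of_nat n / of_nat CARD('N)) =
      exp (2 * of_real pi * \<i> * of_nat 0 / of_nat CARD('N))" by simp
  then have "n mod CARD('N) = 0 mod CARD('N)"
    by (subst (asm) complex_root_unity_eq) (simp_all add: cong_def)
  then have "n = 0" using n by simp
  then have "to_int_mod_ring a = 0" using to_int_mod_ring_ge_0[of a] by (simp add: n_def)
  then show "a = 0" by transfer simp
qed simp

lemma eta_cyc_eq_1_iff: "eta_cyc a = 1 \<longleftrightarrow> a = 0"
  by transfer (rule eta_pow_eq_1_iff)

lemma eta_cyc_orthogonality:
  "(\<Sum>b\<in>UNIV. eta_cyc (k * b :: 'N::finite mod_ring)) = (if k = 0 then of_nat CARD('N) else 0)"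
proof (cases "k = 0")
  case True
  have "CARD('N mod_ring) = CARD('N)" by simp
  then show ?thesis using True by simp
next
  case False
  \<comment> \<open>\<open>?e\<close> is the unit of the integers modulo \<open>N\<close>, in a form
    that includes \<open>N = 1\<close>. Translating the summation variable by it multiplies the sum
    by a number different from 1.\<close>
  let ?e = "of_int_mod_ring 1 :: 'N mod_ring"
  have "k * ?e = k" by transfer (simp add: mod_mult_right_eq)
  then have e: "eta_cyc (k * ?e) \<noteq> 1" using False by (simp add: eta_cyc_eq_1_iff)
  have "(\<Sum>b\<in>UNIV. eta_cyc (k * b)) = (\<Sum>b\<in>UNIV. eta_cyc (k * (b + ?e)))"
    by (rule sum.reindex_bij_witness[of _ "\<lambda>b. b + ?e" "\<lambda>b. b - ?e"]) auto
  also have "\<dots> = eta_cyc (k * ?e) * (\<Sum>b\<in>UNIV. eta_cyc (k * b))"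
    by (simp add: distrib_left eta_cyc_add sum_distrib_left mult.commute)
  finally have "(1 - eta_cyc (k * ?e)) * (\<Sum>b\<in>UNIV. eta_cyc (k * b)) = 0"
    by (simp add: left_diff_distrib)
  then show ?thesis using False e by simp
qed

lemma eta_cyc_orthogonality_diff:
  "(\<Sum>b\<in>UNIV. eta_cyc (k * b) * eta_cyc ((c - b) * k')) / of_nat CARD('N) =
    (if k = k' then eta_cyc (c * k) else 0)" for k :: "'N::finite mod_ring"
proof -
  have "eta_cyc (k * b) * eta_cyc ((c - b) * k') = eta_cyc (c * k') * eta_cyc ((k - k') * b)" for b
    unfolding eta_cyc_add[symmetric] by (rule arg_cong[of _ _ eta_cyc]) (simp add: algebra_simps)
  then have "(\<Sum>b\<in>UNIV. eta_cyc (k * b) * eta_cyc ((c - b) * k')) =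
      eta_cyc (c * k') * (\<Sum>b\<in>UNIV. eta_cyc ((k - k') * b))"
    by (simp add: sum_distrib_left)
  then show ?thesis by (simp add: eta_cyc_orthogonality)
qed

text \<open>
  \<open>four \<kappa> W f\<close> evaluates at the word \<open>W\<close> in \<open>X\<close> and \<open>Y k\<close> the multilinear function that is \<open>f\<close> on the
  words in the points; \<open>\<kappa>\<close> embeds the cyclotomic field into the ring of values.
\<close>

fun four :: "('N::finite cyclotomic \<Rightarrow> 'r::comm_ring_1) \<Rightarrow> 'N mod_ring letter list \<Rightarrow> ('N mod_ring point list \<Rightarrow> 'r) \<Rightarrow> 'r"
where
  "four \<kappa> [] f = f []"
| "four \<kappa> (X # W) f = four \<kappa> W (\<lambda>bs. f (Zero # bs))"
| "four \<kappa> (Y k # W) f = (\<Sum>b\<in>UNIV. \<kappa> (- eta_cyc (k * b) / of_nat CARD('N)) * four \<kappa> W (\<lambda>bs. f (Eta b # bs)))"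

lemma four_hom:
  fixes \<kappa> :: "'N::finite cyclotomic \<Rightarrow> 'r::comm_ring_1" and \<kappa>' :: "'N cyclotomic \<Rightarrow> 's::comm_ring_1"
    and h :: "'r \<Rightarrow> 's"
  assumes "\<And>x y. h (x + y) = h x + h y" "h 0 = 0" "\<And>c x. h (\<kappa> c * x) = \<kappa>' c * h x"
  shows "h (four \<kappa> W f) = four \<kappa>' W (\<lambda>bs. h (f bs))"
proof -
  have s: "h (sum F A) = (\<Sum>x\<in>A. h (F x))" for F :: "'N mod_ring \<Rightarrow> 'r" and A
    by (induction A rule: infinite_finite_induct) (simp_all add: assms)
  show ?thesis
  proof (induction W arbitrary: f)
    case (Cons l W)
    then show ?case by (cases l) (simp_all add: s assms)
  qed simp
qed

lemma four_add: "four \<kappa> W (\<lambda>bs. f bs + g bs) = four \<kappa> W f + four \<kappa> W g"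
  by (induction \<kappa> W f arbitrary: g rule: four.induct) (simp_all add: sum.distrib distrib_left)

lemma four_mult: "x * four \<kappa> W f = four \<kappa> W (\<lambda>bs. x * f bs)"
  by (rule four_hom) (simp_all add: algebra_simps)

lemma four_mult': "four \<kappa> W f * x = four \<kappa> W (\<lambda>bs. f bs * x)"
  by (rule four_hom) (simp_all add: algebra_simps)

lemma four_zero [simp]: "four \<kappa> W (\<lambda>bs. 0) = 0"
  using four_mult[of 0 \<kappa> W "\<lambda>_. 0"] by simp

lemma four_sum: "four \<kappa> W (\<lambda>bs. \<Sum>i\<in>I. f i bs) = (\<Sum>i\<in>I. four \<kappa> W (f i))"
  by (induction I rule: infinite_finite_induct) (simp_all add: four_add)

lemma four_split:
  fixes \<kappa> :: "'N::finite cyclotomic \<Rightarrow> 'r::comm_ring_1"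
  shows "four \<kappa> W (split_sum h) = split_sum (\<lambda>U V. four \<kappa> U (\<lambda>u. four \<kappa> V (h u))) W"
proof (induction W arbitrary: h)
  case (Cons l W)
  have IH: "four \<kappa> W (split_sum (\<lambda>u. h (p # u))) =
      split_sum (\<lambda>U V. four \<kappa> U (\<lambda>u. four \<kappa> V (h (p # u)))) W" for p
    by (rule Cons.IH)
  show ?case
  proof (cases l)
    case X
    then show ?thesis by (simp add: four_add IH)
  next
    case (Y k)
    have "four \<kappa> (l # W) (split_sum h) = four \<kappa> (l # W) (h []) +
       (\<Sum>b\<in>UNIV. \<kappa> (- eta_cyc (k * b) / of_nat CARD('N)) * split_sum (\<lambda>U V. four \<kappa> U (\<lambda>u. four \<kappa> V (h (Eta b # u)))) W)"
      by (simp add: Y four_add distrib_left sum.distrib IH)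
    then show ?thesis by (simp add: Y split_sum_sum split_sum_mult_left)
  qed
qed simp

text \<open>\<open>four\<close> looks at a function only on the lists that have 0 exactly where the
  word has \<open>X\<close>. In particular a word without leading \<open>X\<close> sees only lists
  without leading 0.\<close>

definition same_shape :: "'a letter list \<Rightarrow> 'a point list \<Rightarrow> bool" where
  "same_shape = list_all2 (\<lambda>l p. l = X \<longleftrightarrow> p = Zero)"

lemma four_cong:
  assumes "\<And>bs. same_shape W bs \<Longrightarrow> f bs = g bs"
  shows "four \<kappa> W f = four \<kappa> W g"
  using assms
proof (induction \<kappa> W f arbitrary: g rule: four.induct)
  case (2 \<kappa> W f)
  show ?case using 2(1)[of "\<lambda>bs. g (Zero # bs)"] 2(2) by (simp add: same_shape_def)
next
  case (3 \<kappa> k W f)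
  have "four \<kappa> W (\<lambda>bs. f (Eta b # bs)) = four \<kappa> W (\<lambda>bs. g (Eta b # bs))" for b
    using 3(1)[of b "\<lambda>bs. g (Eta b # bs)"] 3(2) by (simp add: same_shape_def)
  then show ?case by simp
qed (simp add: same_shape_def)

fun weight :: "'N::finite mod_ring letter \<Rightarrow> 'N mod_ring" where
  "weight X = 0" | "weight (Y k) = k"

text \<open>The weight under rotations: rotating all points multiplies the transform at
  \<open>W\<close> by a character value at \<open>cont W\<close>, as in
  \<open>four_shift\<close>.\<close>

definition cont :: "'N::finite mod_ring letter list \<Rightarrow> 'N mod_ring" where
  "cont W = (\<Sum>l\<leftarrow>W. weight l)"

lemma cont_simps [simp]: "cont [] = 0" "cont (l # W) = weight l + cont W" "cont (V @ W) = cont V + cont W"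
  "cont (rev W) = cont W"
  by (simp_all add: cont_def sum_list_rev flip: rev_map)

text \<open>Orthogonality letter by letter: the transform inverts the substitution
  \<open>tau c\<close>, up to the character value that comes from the end point.\<close>

lemma four_lwf:
  "four (\<lambda>c. c) W (\<lambda>bs. lwf (map (tau c) bs) V) = (if V = W then eta_cyc (c * cont W) else 0)"
proof (induction W arbitrary: V)
  case (Cons l W)
  show ?case
  proof (cases V)
    case Nil
    then show ?thesis by (cases l) simp_all
  next
    case V: (Cons m V')
    show ?thesis
    proof (cases l)
      case X
      then show ?thesis using Cons.IH[of V'] by (simp add: V tau_Zero four_mult[symmetric])
    next
      case (Y k)
      have "four (\<lambda>c. c) (l # W) (\<lambda>bs. lwf (map (tau c) bs) V) =
          (\<Sum>b\<in>UNIV. - eta_cyc (k * b) / of_nat CARD('a) * tau c (Eta b) m) *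
            (if V' = W then eta_cyc (c * cont W) else 0)"
        using Cons.IH[of V'] by (simp add: Y V four_mult[symmetric] sum_distrib_right mult.assoc)
      also have "(\<Sum>b\<in>UNIV. - eta_cyc (k * b) / of_nat CARD('a) * tau c (Eta b) m) =
          (if m = Y k then eta_cyc (c * k) else 0)"
      proof (cases m)
        case (Y k')
        then show ?thesis using eta_cyc_orthogonality_diff[of k c k']
          by (auto simp: sum_divide_distrib)
      qed simp
      finally show ?thesis by (auto simp: V Y distrib_left eta_cyc_add)
    qed
  qed
qed simp

lemma four_coef: "coef (four emb W f) V = four (\<lambda>c. c) W (\<lambda>bs. coef (f bs) V)"
  by (rule four_hom) simp_all

lemma four_lw: "four emb W (\<lambda>bs. lw (map (tau c) bs)) = emb (eta_cyc (c * cont W)) * delta W"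
  by (rule sh_eqI) (simp add: four_coef coef_lw four_lwf coef_delta)

lemma four_lw_rev: "four emb W (\<lambda>bs. lw (map (tau c) (rev bs))) = emb (eta_cyc (c * cont W)) * delta (rev W)"
proof -
  have "four emb W (\<lambda>bs. lw (map (tau c) (rev bs))) = four emb W (\<lambda>bs. rv (lw (map (tau c) bs)))"
    by (simp add: rv_lw rev_map)
  also have "\<dots> = rv (four emb W (\<lambda>bs. lw (map (tau c) bs)))"
  proof (rule four_hom[symmetric])
    show "rv (emb c * x) = emb c * rv x" for c :: "'a cyclotomic" and x by (rule sh_eqI) simp
  qed (rule rv_linear)+
  also have "\<dots> = emb (eta_cyc (c * cont W)) * delta (rev W)"
    by (rule sh_eqI) (simp add: four_lw coef_delta rev_swap)
  finally show ?thesis .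
qed

text \<open>Inversion in the other order: the transform, weighted by the expansion of
  \<open>bs\<close> and summed over all words, gives back \<open>f bs\<close>. The signs of
  \<open>tau\<close> and \<open>four\<close> cancel, and the factor \<open>1 / N\<close> normalizes
  the orthogonality relation.\<close>

lemma sum_coef_four:
  assumes \<kappa>: "\<And>a b. \<kappa> (a + b) = \<kappa> a + \<kappa> b" "\<And>a b. \<kappa> (a * b) = \<kappa> a * \<kappa> b" "\<kappa> 1 = 1"
  shows "(\<Sum>W | length W = length bs. \<kappa> (lwf (map (tau 0) bs) W) * four \<kappa> W f) = f bs"
proof (induction bs arbitrary: f)
  case Nil
  have "{W :: 'a mod_ring letter list. length W = length ([] :: 'a mod_ring point list)} = {[]}" by auto
  then show ?case using \<kappa>(3) by simp
next
  case (Cons p bs)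
  have \<kappa>0: "\<kappa> 0 = 0" using \<kappa>(1)[of 0 0] by simp
  have \<kappa>s: "\<kappa> (sum F A) = (\<Sum>x\<in>A. \<kappa> (F x))" for F :: "'a mod_ring \<Rightarrow> _" and A
    by (induction A rule: infinite_finite_induct) (simp_all add: \<kappa> \<kappa>0)
  have "(\<Sum>W | length W = length (p # bs). \<kappa> (lwf (map (tau 0) (p # bs)) W) * four \<kappa> W f) =
      (\<Sum>l\<in>UNIV. \<kappa> (tau 0 p l) * (\<Sum>W | length W = length bs. \<kappa> (lwf (map (tau 0) bs) W) * four \<kappa> (l # W) f))"
    by (simp add: sum_words_Suc \<kappa> sum_distrib_left mult.assoc)
  also have "\<dots> = f (p # bs)"
  proof (cases p)
    case Zero
    then show ?thesis using Cons.IH[of "\<lambda>bs. f (Zero # bs)"] by (simp add: sum_letter \<kappa> \<kappa>0)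
  next
    case (Eta b)
    have "(\<Sum>W | length W = length bs. \<kappa> (lwf (map (tau 0) bs) W) * four \<kappa> (Y k # W) f) =
        (\<Sum>b'\<in>UNIV. \<kappa> (- eta_cyc (k * b') / of_nat CARD('a)) * f (Eta b' # bs))" for k
    proof -
      have "(\<Sum>W | length W = length bs. \<kappa> (lwf (map (tau 0) bs) W) * four \<kappa> (Y k # W) f) =
        (\<Sum>b'\<in>UNIV. \<Sum>W | length W = length bs. \<kappa> (- eta_cyc (k * b') / of_nat CARD('a)) *
          (\<kappa> (lwf (map (tau 0) bs) W) * four \<kappa> W (\<lambda>bs. f (Eta b' # bs))))"
        by (subst sum.swap) (simp add: sum_distrib_left mult.left_commute)
      then show ?thesis by (simp add: sum_distrib_left[symmetric] Cons.IH)
    qed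
    then have "(\<Sum>l\<in>UNIV. \<kappa> (tau 0 p l) * (\<Sum>W | length W = length bs. \<kappa> (lwf (map (tau 0) bs) W) * four \<kappa> (l # W) f)) =
        (\<Sum>k\<in>UNIV. \<kappa> (- eta_cyc ((0 - b) * k)) * (\<Sum>b'\<in>UNIV. \<kappa> (- eta_cyc (k * b') / of_nat CARD('a)) * f (Eta b' # bs)))"
      by (simp only: sum_letter Eta \<kappa>0 tau.simps mult_zero_left add_0_left)
    also have "\<dots> = (\<Sum>k\<in>UNIV. \<Sum>b'\<in>UNIV. \<kappa> (- eta_cyc ((0 - b) * k) * (- eta_cyc (k * b') / of_nat CARD('a))) * f (Eta b' # bs))"
      by (simp only: sum_distrib_left mult.assoc \<kappa>(2))
    \<comment> \<open>Index and point enter only through their product, so the same orthogonality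
      relation applies to the sum over indices.\<close>
    also have "\<dots> = (\<Sum>b'\<in>UNIV. \<kappa> (\<Sum>k\<in>UNIV. eta_cyc (b' * k) * eta_cyc ((0 - k) * b) / of_nat CARD('a)) * f (Eta b' # bs))"
      by (subst sum.swap, simp only: \<kappa>s sum_distrib_right,
          intro sum.cong refl arg_cong2[where f = "(*)"] arg_cong[where f = \<kappa>]) (simp add: mult_ac)
    also have "\<dots> = (\<Sum>b'\<in>UNIV. \<kappa> (if b' = b then 1 else 0) * f (Eta b' # bs))"
    proof -
      have "(\<Sum>k\<in>UNIV. eta_cyc (b' * k) * eta_cyc ((0 - k) * b) / of_nat CARD('a)) = (if b' = b then 1 else 0)" for b'
        using eta_cyc_orthogonality_diff[of b' 0 b] by (simp add: sum_divide_distrib)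
      then show ?thesis by simp
    qed
    also have "\<dots> = (\<Sum>b'\<in>UNIV. if b' = b then f (Eta b' # bs) else 0)"
      by (intro sum.cong refl) (simp add: \<kappa>0 \<kappa>)
    also have "\<dots> = f (p # bs)" by (simp add: Eta)
    finally show ?thesis .
  qed
  finally show ?case .
qed

section \<open>The quotient algebra and the homomorphism \<mu>\<close>

lemma I0_ideal_zero: "0 \<in> I0_ideal"
  unfolding I0_ideal_def ideal_generated_def by (rule module.span_zero[OF module_mult])

lemma I0_ideal_add: "p \<in> I0_ideal \<Longrightarrow> q \<in> I0_ideal \<Longrightarrow> p + q \<in> I0_ideal"
  unfolding I0_ideal_def ideal_generated_def by (rule module.span_add[OF module_mult])

lemma I0_ideal_mult: "p \<in> I0_ideal \<Longrightarrow> q * p \<in> I0_ideal"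
  unfolding I0_ideal_def ideal_generated_def by (rule module.span_scale[OF module_mult])

lemma I0_ideal_uminus: "p \<in> I0_ideal \<Longrightarrow> - p \<in> I0_ideal"
  using I0_ideal_mult[of p "- 1"] by simp

lemma I0_ideal_base: "p \<in> goncharov_relations \<union> {II Zero [Zero] b | b. b \<noteq> Zero} \<Longrightarrow> p \<in> I0_ideal"
  unfolding I0_ideal_def ideal_generated_def by (rule module.span_base[OF module_mult])

\<comment> \<open>As a commutative ring type the quotient turns congruences into equations, so
  convolution and the antipode can be used over it.\<close>
quotient_type (overloaded) 'N I0 = "('N::finite, 'N cyclotomic) spoly" / "\<lambda>p q. p - q \<in> I0_ideal"
  morphisms rep_I0 cls
proof (rule equivpI)
  show "reflp (\<lambda>p q :: ('N, 'N cyclotomic) spoly. p - q \<in> I0_ideal)"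
    by (rule reflpI) (simp add: I0_ideal_zero)
  show "symp (\<lambda>p q :: ('N, 'N cyclotomic) spoly. p - q \<in> I0_ideal)"
    by (rule sympI) (metis I0_ideal_uminus minus_diff_eq)
  show "transp (\<lambda>p q :: ('N, 'N cyclotomic) spoly. p - q \<in> I0_ideal)"
  proof (rule transpI)
    fix p q r :: "('N, 'N cyclotomic) spoly"
    assume "p - q \<in> I0_ideal" "q - r \<in> I0_ideal"
    from I0_ideal_add[OF this] show "p - r \<in> I0_ideal" by simp
  qed
qed

lemma cls_eq_iff: "cls p = cls q \<longleftrightarrow> p - q \<in> I0_ideal"
  by (rule I0.abs_eq_iff)

instantiation I0 :: (finite) comm_ring_1
begin

lift_definition zero_I0 :: "'a I0" is 0 .
lift_definition one_I0 :: "'a I0" is 1 .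
lift_definition plus_I0 :: "'a I0 \<Rightarrow> 'a I0 \<Rightarrow> 'a I0" is "(+)"
  using I0_ideal_add by (metis add_diff_add)
lift_definition minus_I0 :: "'a I0 \<Rightarrow> 'a I0 \<Rightarrow> 'a I0" is "(-)"
proof -
  fix p q r s :: "('a, 'a cyclotomic) spoly"
  assume "p - q \<in> I0_ideal" "r - s \<in> I0_ideal"
  from I0_ideal_add[OF this(1) I0_ideal_uminus[OF this(2)]]
  show "p - r - (q - s) \<in> I0_ideal" by (simp add: algebra_simps)
qed
lift_definition uminus_I0 :: "'a I0 \<Rightarrow> 'a I0" is uminus
proof -
  fix p q :: "('a, 'a cyclotomic) spoly"
  assume "p - q \<in> I0_ideal"
  from I0_ideal_uminus[OF this] show "- p - - q \<in> I0_ideal" by (simp add: algebra_simps)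
qed
lift_definition times_I0 :: "'a I0 \<Rightarrow> 'a I0 \<Rightarrow> 'a I0" is "(*)"
proof -
  fix p q r s :: "('a, 'a cyclotomic) spoly"
  assume "p - q \<in> I0_ideal" "r - s \<in> I0_ideal"
  from I0_ideal_add[OF I0_ideal_mult[OF this(1), of r] I0_ideal_mult[OF this(2), of q]]
  show "p * r - q * s \<in> I0_ideal" by (simp add: algebra_simps)
qed

instance
proof
  fix a b c :: "'a I0"
  show "a * b * c = a * (b * c)" "a * b = b * a" "1 * a = a" "(a + b) * c = a * c + b * c"
    "a + b + c = a + (b + c)" "a + b = b + a" "0 + a = a" "- a + a = 0" "a - b = a + - b"
    by (transfer, simp add: algebra_simps I0_ideal_zero)+
  \<comment> \<open>This is where the model enters: \<open>Phi\<close> maps 1 to 1 and the ideal to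
    0.\<close>
  show "(0 :: 'a I0) \<noteq> 1"
  proof transfer
    show "\<not> 0 - 1 \<in> (I0_ideal :: ('a, 'a cyclotomic) spoly set)"
      using Phi_I0_ideal[of "0 - 1 :: ('a, 'a cyclotomic) spoly"] by (auto simp: Phi.ev_uminus Phi.ev_1)
  qed
qed

end

lemma cls_hom: "cls 0 = 0" "cls 1 = 1" "cls (p + q) = cls p + cls q" "cls (p * q) = cls p * cls q"
  "cls (- p) = - cls p" "cls (p - q) = cls p - cls q"
  by (simp_all add: zero_I0.abs_eq one_I0.abs_eq plus_I0.abs_eq times_I0.abs_eq uminus_I0.abs_eq
      minus_I0.abs_eq)

lemma cls_sum: "cls (sum f A) = (\<Sum>x\<in>A. cls (f x))"
  by (induction A rule: infinite_finite_induct) (simp_all add: cls_hom)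

lemma cls_eq_0: "p \<in> goncharov_relations \<union> {II Zero [Zero] b | b. b \<noteq> Zero} \<Longrightarrow> cls p = 0"
  unfolding cls_hom(1)[symmetric] cls_eq_iff by (simp add: I0_ideal_base)

definition qI :: "'N::finite mod_ring point \<Rightarrow> 'N mod_ring point list \<Rightarrow> 'N mod_ring point \<Rightarrow> 'N I0" where
  "qI b bs c = cls (II b bs c)"

lemma qI_Nil [simp]: "qI b [] c = 1"
proof -
  have "cls (II b [] c - 1) = 0"
    by (rule cls_eq_0) (unfold goncharov_relations_def, blast)
  then show ?thesis by (simp add: qI_def cls_hom)
qed

lemma shuffle_hom_qI: "shuffle_hom (\<lambda>bs. qI b bs c)"
  unfolding shuffle_hom_def
proof (intro allI)
  fix us vs :: "'a mod_ring point list"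
  have "cls (II b us c * II b vs c - (\<Sum>\<sigma>\<in>shuffle_perms (length us) (length vs).
        II b (map (\<lambda>i. (us @ vs) ! (inv_into UNIV \<sigma> i)) [0..<length us + length vs]) c)) = 0"
    by (rule cls_eq_0) (unfold goncharov_relations_def, blast)
  then show "qI b us c * qI b vs c = (\<Sum>w\<leftarrow>shuffle_list us vs. qI b w c)"
    unfolding qI_def cls_hom cls_sum sum_shuffle_perms[where F = "\<lambda>w. cls (II b w c)"] by simp
qed

lemma qI_path: "qI b bs b' = conv (\<lambda>u. qI b u c) (\<lambda>v. qI c v b') bs"
proof -
  have "cls (II b bs b' - (\<Sum>i\<le>length bs. II b (take i bs) c * II c (drop i bs) b')) = 0"
    by (rule cls_eq_0) (unfold goncharov_relations_def, blast)
  then show ?thesis by (simp add: qI_def cls_hom cls_sum conv_def split_sum_atMost)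
qed

lemma qI_same: "qI b bs b = unit_fun bs"
proof (cases "bs = []")
  case False
  then have "cls (II b bs b) = 0"
    by (intro cls_eq_0) (unfold goncharov_relations_def, blast)
  then show ?thesis using False by (simp add: qI_def unit_fun_def)
qed (simp add: unit_fun_def)

lemma qI_Zero: "qI Zero [Zero] (Eta c) = 0"
  unfolding qI_def by (rule cls_eq_0) blast

section \<open>From words back to classes of symbols\<close>

definition J :: "'N::finite mod_ring \<Rightarrow> 'N mod_ring letter list \<Rightarrow> ('N, 'N cyclotomic) spoly" where
  "J c W = four const W (\<lambda>bs. II Zero bs (Eta c))"

text \<open>A linear map opposite to \<open>Phi\<close>; on words of linear forms it returns the
  symbol itself, see \<open>iota_lw\<close>. It becomes multiplicative only on classes.\<close>

definition iota :: "'N::finite mod_ring \<Rightarrow> 'N shalg \<Rightarrow> ('N, 'N cyclotomic) spoly" where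
  "iota c f = (\<Sum>W | coef f W \<noteq> 0. const (coef f W) * J c W)"

lemma const_hom: "const (a + b) = const a + const b" "const (a * b) = const a * const b" "const 0 = 0"
  "const 1 = 1" for a b :: "'k::comm_ring_1"
  by (simp_all add: const_def single_add mult_single)

lemma iota_superset:
  assumes "finite A" "\<And>W. coef f W \<noteq> 0 \<Longrightarrow> W \<in> A"
  shows "iota c f = (\<Sum>W\<in>A. const (coef f W) * J c W)"
  unfolding iota_def using assms by (intro sum.mono_neutral_left) (auto simp: const_hom)

lemma iota_add: "iota c (f + g) = iota c f + iota c g"
proof -
  let ?A = "{W. coef f W \<noteq> 0} \<union> {W. coef g W \<noteq> 0}"
  have A: "finite ?A" using finite_coef by blast
  have "iota c (f + g) = (\<Sum>W\<in>?A. const (coef (f + g) W) * J c W)"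
    by (rule iota_superset[OF A]) auto
  moreover have "iota c f = (\<Sum>W\<in>?A. const (coef f W) * J c W)"
    by (rule iota_superset[OF A]) auto
  moreover have "iota c g = (\<Sum>W\<in>?A. const (coef g W) * J c W)"
    by (rule iota_superset[OF A]) auto
  ultimately show ?thesis by (simp add: const_hom sum.distrib distrib_right)
qed

lemma iota_emb: "iota c (emb a * f) = const a * iota c f"
proof -
  have "iota c (emb a * f) = (\<Sum>W | coef f W \<noteq> 0. const (coef (emb a * f) W) * J c W)"
    by (rule iota_superset[OF finite_coef]) auto
  then show ?thesis by (simp add: iota_def const_hom sum_distrib_left mult.assoc)
qed

lemma iota_0 [simp]: "iota c 0 = 0" by (simp add: iota_def)

lemma iota_sum: "iota c (sum f A) = (\<Sum>x\<in>A. iota c (f x))"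
  by (induction A rule: infinite_finite_induct) (simp_all add: iota_add)

lemma iota_lw: "iota c (lw (map (tau 0) bs)) = II Zero bs (Eta c)"
proof -
  have "iota c (lw (map (tau 0) bs)) =
      (\<Sum>W | length W = length bs. const (coef (lw (map (tau 0) bs)) W) * J c W)"
    by (rule iota_superset[OF finite_words]) (use lwf_length in \<open>force simp: coef_lw\<close>)
  also have "\<dots> = II Zero bs (Eta c)"
    unfolding J_def coef_lw by (rule sum_coef_four) (rule const_hom)+
  finally show ?thesis .
qed

definition qiota :: "'N::finite mod_ring \<Rightarrow> 'N shalg \<Rightarrow> 'N I0" where
  "qiota c f = cls (iota c f)"

lemma qiota_linear: "qiota c (f + g) = qiota c f + qiota c g" "qiota c 0 = 0"
  "qiota c (emb a * f) = cls (const a) * qiota c f"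
  by (simp_all add: qiota_def iota_add iota_emb cls_hom)

lemma qiota_lw: "qiota c (lw (map (tau 0) bs)) = qI Zero bs (Eta c)"
  by (simp add: qiota_def iota_lw qI_def)

lemma qiota_1 [simp]: "qiota c 1 = 1"
  using qiota_lw[of c "[]"] by simp

lemma qiota_uminus: "qiota c (- f) = - qiota c f"
  using qiota_linear(1)[of c f "- f"] by (simp add: qiota_linear(2) add_eq_0_iff)

lemma qiota_sum: "qiota c (sum f A) = (\<Sum>x\<in>A. qiota c (f x))"
  by (simp add: qiota_def iota_sum cls_sum)

lemma qiota_sum_list: "qiota c (sum_list fs) = (\<Sum>f\<leftarrow>fs. qiota c f)"
  by (induction fs) (simp_all add: qiota_linear)

lemma qiota_four: "qiota c (four emb W f) = four (\<lambda>a. cls (const a)) W (\<lambda>bs. qiota c (f bs))"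
  by (rule four_hom) (rule qiota_linear)+

lemma delta_four: "delta W = four emb W (\<lambda>bs. lw (map (tau 0) bs))"
  by (simp add: four_lw emb_hom)

text \<open>The shuffle relation of the symbols, transformed in one factor after the other.\<close>

lemma qiota_delta_mult: "qiota c (delta U * delta V) = qiota c (delta U) * qiota c (delta V)"
proof -
  have "qiota c (lw (map (tau 0) bs) * lw (map (tau 0) bs')) = qI Zero bs (Eta c) * qI Zero bs' (Eta c)" for bs bs'
    using shuffle_hom_qI[of Zero "Eta c"]
    by (simp add: lw_mult shuffle_list_map qiota_sum_list o_def qiota_lw shuffle_hom_def)
  then show ?thesis
    by (simp add: delta_four four_mult' qiota_four qiota_lw) (simp add: four_mult qiota_four)
qed

lemma qiota_mult: "qiota c (f * g) = qiota c f * qiota c g"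
proof -
  have f: "f = (\<Sum>W | coef f W \<noteq> 0. emb (coef f W) * delta W)" for f :: "'a shalg"
    by (rule sh_expand[OF finite_coef]) simp
  have "qiota c (f * g) = qiota c ((\<Sum>W | coef f W \<noteq> 0. emb (coef f W) * delta W) *
      (\<Sum>W | coef g W \<noteq> 0. emb (coef g W) * delta W))"
    by (simp flip: f)
  also have "\<dots> = qiota c (\<Sum>W | coef f W \<noteq> 0. \<Sum>V | coef g V \<noteq> 0.
      emb (coef f W) * (emb (coef g V) * (delta W * delta V)))"
    by (simp add: sum_product mult_ac)
  also have "\<dots> = (\<Sum>W | coef f W \<noteq> 0. cls (const (coef f W)) * qiota c (delta W)) *
      (\<Sum>W | coef g W \<noteq> 0. cls (const (coef g W)) * qiota c (delta W))"
    by (simp add: qiota_sum qiota_linear qiota_delta_mult sum_product) (simp add: mult_ac)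
  also have "\<dots> = qiota c (\<Sum>W | coef f W \<noteq> 0. emb (coef f W) * delta W) *
      qiota c (\<Sum>W | coef g W \<noteq> 0. emb (coef g W) * delta W)"
    by (simp add: qiota_sum qiota_linear)
  finally show ?thesis by (simp flip: f)
qed

lemma qiota_sign: "qiota c ((- 1) ^ n * f) = (- 1) ^ n * qiota c f"
  by (induction n) (simp_all add: qiota_uminus)

text \<open>In the quotient the integral over the single point 0 vanishes, so the ideal of
  \<open>delta [X]\<close> is killed. By \<open>reg_decomposition\<close> only the regularized part
  survives.\<close>

lemma qiota_reg: "qiota c (reg f) = qiota c f"
proof -
  obtain g where g: "f = reg f + delta [X] * g" using reg_decomposition by blast
  have "(delta [X] :: 'a shalg) = lw (map (tau 0) [Zero])" by (simp add: delta_def tau_Zero)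
  then have "qiota c (delta [X]) = 0" by (simp only: qiota_lw qI_Zero)
  then have "qiota c (reg f + delta [X] * g) = qiota c (reg f)"
    by (simp add: qiota_linear qiota_mult)
  then show ?thesis using g by simp
qed

text \<open>A left inverse and a right inverse under convolution agree. The integral from
  \<open>b\<close> back to 0 is one of them by composition of paths; the antipode of the integral
  from 0 to \<open>b\<close> is the other.\<close>

lemma qI_reversal: "qI b w Zero = (- 1) ^ length w * qI Zero (rev w) b"
proof (cases b)
  case Zero
  then show ?thesis by (simp add: qI_same unit_fun_def)
next
  case (Eta c)
  define A where "A = (\<lambda>w. qI b w Zero)"
  define B where "B = (\<lambda>w. qI Zero w b)"
  define C where "C = (\<lambda>w. (- 1) ^ length w * qI Zero (rev w) b)"
  have BA: "conv B A = unit_fun"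
    using qI_path[of Zero _ Zero b] by (auto simp: A_def B_def qI_same fun_eq_iff)
  have CB: "conv C B = unit_fun"
  proof
    fix w
    have "conv C B w = split_sum (\<lambda>u v. qiota c ((- 1) ^ length u * (lw (rev (map (tau 0) u)) * lw (map (tau 0) v)))) w"
      by (simp only: qiota_sign, simp only: conv_def C_def B_def Eta qiota_mult qiota_lw rev_map mult.assoc)
    also have "\<dots> = qiota c (split_sum (\<lambda>u v. (- 1) ^ length u * (lw (rev (map (tau 0) u)) * lw (map (tau 0) v))) w)"
      by (rule split_sum_hom[symmetric]) (rule qiota_linear)
    also have "split_sum (\<lambda>u v. (- 1) ^ length u * (lw (rev (map (tau 0) u)) * lw (map (tau 0) v))) w =
       split_sum (\<lambda>u v. (- 1) ^ length u * (lw (rev u) * lw v)) (map (tau 0) w)"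
      by (simp add: split_sum_atMost take_map drop_map)
    also have "qiota c \<dots> = unit_fun w"
      by (cases "w = []") (simp_all add: antipode_left unit_fun_def qiota_linear)
    finally show "conv C B w = unit_fun w" .
  qed
  have "C = conv C (conv B A)" by (simp add: BA conv_unit_right)
  also have "\<dots> = A" by (simp add: conv_assoc[symmetric] CB conv_unit_left)
  finally show ?thesis by (simp add: A_def C_def fun_eq_iff)
qed

lemma spoly_hom_eqI:
  fixes f g :: "('N, 'k::comm_ring_1) spoly \<Rightarrow> 'r::comm_ring_1"
  assumes "\<And>p q. f (p + q) = f p + f q" "\<And>p q. f (p * q) = f p * f q"
    "\<And>p q. g (p + q) = g p + g q" "\<And>p q. g (p * q) = g p * g q"
    "\<And>c. f (const c) = g (const c)" "\<And>b bs c. f (II b bs c) = g (II b bs c)"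
  shows "f p = g p"
proof (induction p rule: poly_mapping_induct)
  case zero
  then show ?case using assms(5)[of 0] by (simp add: const_hom)
next
  case (add M c p)
  have "f (Poly_Mapping.single M c) = g (Poly_Mapping.single M c)"
  proof (induction M)
    case empty
    then show ?case using assms(5)[of c] by (simp add: const_def)
  next
    case (add s M)
    obtain b bs c' where s: "s = Symb b bs c'" by (cases s)
    have "Poly_Mapping.single (add_mset s M) c = II b bs c' * Poly_Mapping.single M c"
      by (simp add: II_def mult_single s)
    then show ?case using add by (simp add: assms)
  qed
  then show ?case using add by (simp add: assms)
qed

section \<open>Words of arrays, rotations, and words without leading \<open>X\<close>\<close>

definition word_of :: "'c \<Rightarrow> ('a \<Rightarrow> 'c) \<Rightarrow> (nat \<times> 'a) list \<Rightarrow> 'c list" where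
  "word_of z f v = concat (map (\<lambda>(n, a). f a # replicate (n - 1) z) v)"

lemma word_of_simps [simp]: "word_of z f [] = []"
  "word_of z f ((n, a) # v) = f a # replicate (n - 1) z @ word_of z f v"
  "word_of z f (u @ v) = word_of z f u @ word_of z f v"
  by (simp_all add: word_of_def)

lemma is_array_simps [simp]: "is_array []" "is_array ((n, a) # v) \<longleftrightarrow> n \<ge> 1 \<and> is_array v"
  "is_array (u @ v) \<longleftrightarrow> is_array u \<and> is_array v"
  by (auto simp: is_array_def)

lemma word_of_Cons: "word_of z f v = [] \<or> (\<exists>a w. word_of z f v = f a # w)"
  by (cases v) auto

text \<open>The array is built from the end of the list: another \<open>z\<close> raises the upper
  entry of the last column, any other letter opens a new column.\<close>

lemma ex_word_of:
  assumes "\<And>p. p \<noteq> z \<Longrightarrow> \<exists>a. p = f a" "bs = [] \<or> hd bs \<noteq> z"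
  shows "\<exists>v. is_array v \<and> word_of z f v = bs"
  using assms(2)
proof (induction bs rule: rev_induct)
  case Nil
  show ?case by (rule exI[of _ "[]"]) simp
next
  case (snoc p bs)
  then have "bs = [] \<or> hd bs \<noteq> z" by (cases bs) auto
  then obtain v where v: "is_array v" "word_of z f v = bs" using snoc.IH by blast
  show ?case
  proof (cases "p = z")
    case False
    then obtain a where "p = f a" using assms(1) by blast
    then show ?thesis using v by (intro exI[of _ "v @ [(1, a)]"]) simp
  next
    case True
    then have "bs \<noteq> []" using snoc.prems by auto
    then have "v \<noteq> []" using v by auto
    then obtain u n a where u: "v = u @ [(n, a)]" by (metis rev_exhaust surj_pair)
    then have "n \<ge> 1" using v by simp
    then have "replicate n z = replicate (n - 1) z @ [z]"
      by (metis Suc_diff_1 less_eq_Suc_le One_nat_def replicate_Suc replicate_append_same)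
    then show ?thesis using v u True by (intro exI[of _ "u @ [(Suc n, a)]"]) auto
  qed
qed

lemma I_array_word_of: "I_array c v = II Zero (word_of Zero Eta v) (Eta c)"
  by (simp add: I_array_def word_of_def)

lemma ex_array:
  assumes "bs = [] \<or> hd bs \<noteq> Zero"
  shows "\<exists>v. is_array v \<and> word_of Zero Eta v = bs"
  by (rule ex_word_of) (use assms in \<open>auto intro: point.exhaust\<close>)

fun shift :: "'N::finite mod_ring \<Rightarrow> 'N mod_ring point \<Rightarrow> 'N mod_ring point" where
  "shift c Zero = Zero" | "shift c (Eta b) = Eta (b - c)"

lemma word_of_shift: "word_of Zero Eta (map (\<lambda>(n, a). (n, a - c)) v) = map (shift c) (word_of Zero Eta v)"
  by (induction v) auto

lemma four_shift: "four \<kappa> W (\<lambda>bs. f (map (shift c) bs)) = four \<kappa> W (\<lambda>bs. \<kappa> (eta_cyc (c * cont W)) * f bs)"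
  if \<kappa>: "\<And>a b. \<kappa> (a * b) = \<kappa> a * \<kappa> b" "\<kappa> 1 = 1"
proof (induction W arbitrary: f)
  case (Cons l W)
  show ?case
  proof (cases l)
    case X
    then show ?thesis using Cons.IH[of "\<lambda>bs. f (Zero # bs)"] by simp
  next
    case (Y k)
    have "four \<kappa> (l # W) (\<lambda>bs. f (map (shift c) bs)) =
       (\<Sum>b\<in>UNIV. \<kappa> (- eta_cyc (k * b) / of_nat CARD('a)) *
          (\<kappa> (eta_cyc (c * cont W)) * four \<kappa> W (\<lambda>bs. f (Eta (b - c) # bs))))"
      using Cons.IH[of "\<lambda>bs. f (Eta (_ - c) # bs)"] by (simp add: Y four_mult)
    also have "\<dots> = (\<Sum>b\<in>UNIV. \<kappa> (- eta_cyc (k * (b + c)) / of_nat CARD('a)) *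
          (\<kappa> (eta_cyc (c * cont W)) * four \<kappa> W (\<lambda>bs. f (Eta b # bs))))"
      by (rule sum.reindex_bij_witness[of _ "\<lambda>b. b + c" "\<lambda>b. b - c"]) auto
    also have "\<dots> = \<kappa> (eta_cyc (c * cont (l # W))) * four \<kappa> (l # W) f"
    proof -
      have "\<kappa> (- eta_cyc (k * (b + c)) / of_nat CARD('a)) * (\<kappa> (eta_cyc (c * cont W)) * x) =
          \<kappa> (eta_cyc (c * cont (l # W))) * (\<kappa> (- eta_cyc (k * b) / of_nat CARD('a)) * x)" for b x
      proof -
        have "- eta_cyc (k * (b + c)) / of_nat CARD('a) * eta_cyc (c * cont W) =
            eta_cyc (c * cont (l # W)) * (- eta_cyc (k * b) / of_nat CARD('a))"
          by (simp add: Y distrib_left eta_cyc_add mult_ac)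
        then show ?thesis by (simp only: mult.assoc[symmetric] \<kappa>(1)[symmetric])
      qed
      then show ?thesis by (simp add: Y sum_distrib_left)
    qed
    finally show ?thesis by (simp add: four_mult)
  qed
qed (simp add: \<kappa>)

lemma tau_shift: "tau 0 (shift c p) = tau c p"
proof
  fix l show "tau 0 (shift c p) l = tau c p l"
    by (cases p; cases l) simp_all
qed

definition nonX :: "'a letter list \<Rightarrow> bool" where
  "nonX W \<longleftrightarrow> W = [] \<or> hd W \<noteq> X"

lemma nonX_simps [simp]: "nonX []" "nonX (l # W) \<longleftrightarrow> l \<noteq> X"
  by (simp_all add: nonX_def)

lemma dl_X_eq_0_iff: "dl X f = 0 \<longleftrightarrow> (\<forall>W. coef f W \<noteq> 0 \<longrightarrow> nonX W)"
proof
  assume d: "dl X f = 0"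
  show "\<forall>W. coef f W \<noteq> 0 \<longrightarrow> nonX W"
  proof (intro allI impI)
    fix W assume "coef f W \<noteq> 0"
    then show "nonX W" using arg_cong[OF d, of "\<lambda>g. coef g (tl W)"] by (cases W) auto
  qed
next
  assume "\<forall>W. coef f W \<noteq> 0 \<longrightarrow> nonX W"
  then show "dl X f = 0" by (intro sh_eqI) fastforce
qed

lemma reg_delta: "nonX W \<Longrightarrow> reg (delta W) = delta W"
  by (intro reg_id) (auto simp: dl_X_eq_0_iff coef_delta split: if_splits)

lemma reg_lw: "bs = [] \<or> hd bs \<noteq> Zero \<Longrightarrow> reg (lw (map (tau c) bs)) = lw (map (tau c) bs)"
proof (rule reg_id)
  assume "bs = [] \<or> hd bs \<noteq> Zero"
  then show "dl X (lw (map (tau c) bs)) = 0"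
  proof (cases bs)
    case (Cons p ps)
    then show ?thesis using \<open>bs = [] \<or> hd bs \<noteq> Zero\<close> by (cases p) (simp_all add: emb_hom)
  qed simp
qed

text \<open>\<open>tw c\<close> is dual to the rotation \<open>shift c\<close> of the points.\<close>

lift_definition tw :: "'N::finite mod_ring \<Rightarrow> 'N shalg \<Rightarrow> 'N shalg" is "\<lambda>c f W. eta_cyc (c * cont W) * f W"
  by (metis mult_zero_right)

lemma coef_tw [simp]: "coef (tw c f) W = eta_cyc (c * cont W) * coef f W" by (simp add: tw.rep_eq)

text \<open>Each derivation \<open>rd l\<close> commutes with \<open>tw c\<close> up to a scalar
  that depends only on the letter removed; the letter \<open>X\<close> has weight 0, so its
  correction term is compatible.\<close>

lemma reg_tw: "reg (tw c f) = tw c (reg f)"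
proof (rule sh_eqI)
  have rd_tw: "rd l (tw c f) = emb (eta_cyc (c * weight l)) * tw c (rd l f)" for l and f :: "'a shalg"
    by (rule sh_eqI, cases l) (simp_all add: rd_def eta_cyc_add distrib_left algebra_simps)
  fix W show "coef (reg (tw c f)) W = coef (tw c (reg f)) W"
    by (induction W arbitrary: f rule: rev_induct)
      (simp_all add: coef_reg_snoc rd_tw reg_emb_mult, simp add: eta_cyc_add distrib_left mult_ac)
qed

lemma tw_lw: "tw c (lw (map (tau 0) bs)) = lw (map (tau c) bs)"
proof (rule sh_eqI)
  fix W
  have t: "tau c p l = eta_cyc (c * weight l) * tau 0 p l" for p l
    by (cases p; cases l) (simp_all add: algebra_simps flip: eta_cyc_add)
  show "coef (tw c (lw (map (tau 0) bs))) W = coef (lw (map (tau c) bs)) W"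
  proof (cases "length bs = length W")
    case True
    then show ?thesis unfolding coef_tw coef_lw
      by (induction bs W rule: list_induct2) (simp_all add: t[of _ _] distrib_left eta_cyc_add mult_ac)
  qed (simp add: coef_lw lwf_length)
qed

section \<open>Uniqueness and existence of the homomorphism \<open>mu\<close>\<close>

lemma reg_phi: "reg (phi b bs c) = phi b bs c"
proof -
  have T: "reg (T c w) = T c w" for c and w :: "'a mod_ring point list"
    by (cases c) (simp_all add: reg_reg unit_fun_def)
  have "reg (S b u * T c v) = S b u * T c v" for u v
    by (simp add: S_def reg_mult reg_power reg_minus T)
  then show ?thesis unfolding phi_def conv_def by (subst split_sum_hom[of reg]) (simp_all add: reg_add)
qed

lemma reg_Phi: "reg (Phi p) = Phi p"
proof (rule spoly_hom_eqI[of "\<lambda>p. reg (Phi p)" Phi])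
qed (simp_all add: Phi.ev_add Phi.ev_mult reg_add reg_mult Phi.ev_const reg_emb reg_phi)

text \<open>Values are prescribed only for integrals from 0 over lists that do not begin with 0.
  Regularization extends them to all lists, path reversal to integrals that end in 0, and
  composition at 0 to all symbols.\<close>

lemma is_mu_cls:
  assumes "is_mu f"
  shows "cls (f p) = qiota 0 (Phi p)"
proof -
  note mu = assms[unfolded is_mu_def]
  note hom = conjunct1[OF mu, unfolded alg_hom_def]
  have f: "f (const c) = const c" "f (p + q) = f p + f q" "f (p * q) = f p * f q" for c p q
    by (rule conjunct1[OF hom, THEN spec]
        conjunct1[OF conjunct2[OF hom], THEN spec, THEN spec]
        conjunct2[OF conjunct2[OF hom], THEN spec, THEN spec])+
  have fI: "p \<in> I0_ideal \<Longrightarrow> f p \<in> I0_ideal" for p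
    by (rule conjunct1[OF conjunct2[OF mu], THEN bspec])
  have fA: "is_array v \<Longrightarrow> f (I_array c v) - I_array 0 (map (\<lambda>(n, a). (n, a - c)) v) \<in> I0_ideal" for c v
    by (rule conjunct2[OF conjunct2[OF conjunct2[OF mu]], THEN spec, THEN spec, THEN mp])
  have f0: "f 0 = 0" using f(1)[of 0] by (simp add: const_hom)
  have fm: "f (- p) = - f p" for p using f(2)[of p "- p"] by (simp add: f0 add_eq_0_iff)
  have fd: "f (p - q) = f p - f q" for p q using f(2)[of p "- q"] by (simp add: fm)
  \<comment> \<open>\<open>f\<close> respects the ideal, so it induces an endomorphism of the
    quotient; representatives serve only to write it down.\<close>
  define m where "m x = cls (f (rep_I0 x))" for x
  have m: "m (cls p) = cls (f p)" for p
  proof -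
    have "cls (rep_I0 (cls p)) = cls p" by (rule Quotient_abs_rep[OF Quotient_I0])
    then have "f (rep_I0 (cls p) - p) \<in> I0_ideal" by (intro fI) (simp only: cls_eq_iff)
    then show ?thesis by (simp add: m_def cls_eq_iff fd)
  qed
  have m_add: "m (x + y) = m x + m y" and m_mult: "m (x * y) = m x * m y" for x y
  proof -
    obtain p q where "x = cls p" "y = cls q" by (metis Quotient_abs_rep[OF Quotient_I0])
    then show "m (x + y) = m x + m y" "m (x * y) = m x * m y"
      by (simp_all add: m f flip: cls_hom)
  qed
  have m_0: "m 0 = 0" using m[of 0] by (simp add: cls_hom f0)
  have m_1: "m 1 = 1" using m[of 1] f(1)[of 1] by (simp add: cls_hom const_hom)
  have m_const: "m (cls (const a)) = cls (const a)" for a by (simp add: m f)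
  have m_uminus: "m (- x) = - m x" for x using m_add[of x "- x"] by (simp add: m_0 add_eq_0_iff)
  have m_sign: "m ((- 1) ^ n * x) = (- 1) ^ n * m x" for n x
    by (induction n) (simp_all add: m_uminus)
  have m_array: "m (qI Zero bs (Eta c)) = qI Zero (map (shift c) bs) (Eta 0)"
    if bs: "bs = [] \<or> hd bs \<noteq> Zero" for bs c
  proof -
    obtain v where v: "is_array v" "word_of Zero Eta v = bs" using ex_array[OF bs] by blast
    show ?thesis using fA[OF v(1), of c] by (simp add: qI_def m I_array_word_of word_of_shift v cls_eq_iff)
  qed
  have m_delta: "m (qiota c (delta W)) = qiota 0 (tw c (delta W))" if "nonX W" for c W
  proof -
    let ?k = "\<lambda>a. cls (const a :: ('a, 'a cyclotomic) spoly)"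
    have "m (qiota c (delta W)) = four ?k W (\<lambda>bs. m (qI Zero bs (Eta c)))"
      unfolding delta_four qiota_four qiota_lw
      by (rule four_hom) (simp_all add: m_add m_0 m_mult m_const)
    also have "\<dots> = four ?k W (\<lambda>bs. qI Zero (map (shift c) bs) (Eta 0))"
    proof (rule four_cong)
      fix bs assume "same_shape W bs"
      then have "bs = [] \<or> hd bs \<noteq> Zero"
        using that by (cases W; cases bs) (auto simp: same_shape_def)
      then show "m (qI Zero bs (Eta c)) = qI Zero (map (shift c) bs) (Eta 0)" by (rule m_array)
    qed
    also have "\<dots> = four ?k W (\<lambda>bs. ?k (eta_cyc (c * cont W)) * qI Zero bs (Eta 0))"
      by (rule four_shift) (simp_all add: const_hom cls_hom)
    also have "\<dots> = ?k (eta_cyc (c * cont W)) * qiota 0 (delta W)"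
      unfolding delta_four qiota_four qiota_lw by (simp add: four_mult)
    also have "\<dots> = qiota 0 (emb (eta_cyc (c * cont W)) * delta W)" by (simp add: qiota_linear)
    also have "emb (eta_cyc (c * cont W)) * delta W = tw c (delta W)"
      by (rule sh_eqI) (simp add: coef_delta)
    finally show ?thesis .
  qed
  have m_qiota: "m (qiota c g) = qiota 0 (tw c g)" if "dl X g = 0" for c g
  proof -
    have g: "g = (\<Sum>W | coef g W \<noteq> 0. emb (coef g W) * delta W)"
      by (rule sh_expand[OF finite_coef]) simp
    have msum: "m (sum F A) = (\<Sum>x\<in>A. m (F x))" for F :: "'a mod_ring letter list \<Rightarrow> 'a I0" and A
      by (induction A rule: infinite_finite_induct) (simp_all add: m_0 m_add)
    have "tw c g = (\<Sum>W | coef g W \<noteq> 0. emb (coef g W) * tw c (delta W))"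
      by (rule sh_eqI, subst g) (simp add: coef_sum sum_distrib_left mult.left_commute)
    moreover have "m (qiota c g) = (\<Sum>W | coef g W \<noteq> 0. cls (const (coef g W)) * m (qiota c (delta W)))"
      by (subst g) (simp add: qiota_sum qiota_linear msum m_mult m_const)
    moreover have "\<dots> = (\<Sum>W | coef g W \<noteq> 0. cls (const (coef g W)) * qiota 0 (tw c (delta W)))"
      using that by (intro sum.cong refl) (simp add: m_delta dl_X_eq_0_iff)
    ultimately show ?thesis by (simp add: qiota_sum qiota_linear)
  qed
  \<comment> \<open>Replacing the list by its regularization removes leading zeros, so that the
    prescribed values apply.\<close>
  have a: "m (qI Zero bs c) = qiota 0 (T c bs)" for bs c
  proof (cases c)
    case Zero
    then show ?thesis by (simp add: qI_same unit_fun_def m_1 m_0 qiota_linear)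
  next
    case (Eta d)
    have "qI Zero bs c = qiota d (reg (lw (map (tau 0) bs)))"
      by (simp add: Eta qiota_reg qiota_lw)
    then have "m (qI Zero bs c) = qiota 0 (tw d (reg (lw (map (tau 0) bs))))"
      by (simp add: m_qiota dl_X_reg)
    also have "\<dots> = qiota 0 (T c bs)" by (simp add: Eta tw_lw flip: reg_tw)
    finally show ?thesis .
  qed
  have b: "m (qI b bs Zero) = qiota 0 (S b bs)" for b bs
    by (simp add: qI_reversal[of b] m_sign a S_def qiota_sign)
  have II: "cls (f (II b bs c)) = qiota 0 (Phi (II b bs c))" for b bs c
  proof -
    have "cls (f (II b bs c)) = m (conv (\<lambda>u. qI b u Zero) (\<lambda>v. qI Zero v c) bs)"
      by (simp only: qI_path[of b bs c Zero, symmetric] m qI_def[of b bs c])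
    also have "\<dots> = conv (\<lambda>u. qiota 0 (S b u)) (\<lambda>v. qiota 0 (T c v)) bs"
      unfolding conv_def by (subst split_sum_hom[of m]) (simp_all add: m_add m_mult a b)
    also have "\<dots> = qiota 0 (phi b bs c)"
      unfolding conv_def phi_def by (subst split_sum_hom[of "qiota 0"]) (simp_all add: qiota_linear qiota_mult)
    finally show ?thesis by simp
  qed
  have const: "cls (f (const c)) = qiota 0 (Phi (const c))" for c
    using qiota_linear(3)[of 0 c 1] by (simp add: f(1) Phi.ev_const)
  show ?thesis
    by (rule spoly_hom_eqI[of "\<lambda>p. cls (f p)" "\<lambda>p. qiota 0 (Phi p)", OF _ _ _ _ const II])
      (simp_all only: f cls_hom Phi.ev_add Phi.ev_mult qiota_linear qiota_mult)
qed

lemma lookup_const_mult: "Poly_Mapping.lookup (const c * p) x = c * Poly_Mapping.lookup p x"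
proof (induction p rule: poly_mapping_induct)
  case (add y d p)
  then show ?case
    by (simp add: distrib_left lookup_add const_def mult_single lookup_single when_def)
qed simp

lemma module_scal: "Modules.module (scal :: 'k::comm_ring_1 \<Rightarrow> ('b::monoid_add \<Rightarrow>\<^sub>0 'k) \<Rightarrow> _)"
proof
qed (simp_all add: scal_def const_def distrib_left distrib_right single_add mult_single mult.assoc[symmetric])

lemma four_span:
  assumes "\<And>bs. same_shape W bs \<Longrightarrow> f bs \<in> module.span scal B"
  shows "four const W f \<in> module.span scal B"
  using assms
proof (induction W arbitrary: f)
  case (Cons l W)
  show ?case
  proof (cases l)
    case X
    then show ?thesis using Cons by (simp add: same_shape_def)
  next
    case (Y k)
    have "four const W (\<lambda>bs. f (Eta b # bs)) \<in> module.span scal B" for b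
      using Cons Y by (simp add: same_shape_def)
    then show ?thesis
      unfolding Y four.simps scal_def[symmetric]
      by (intro module.span_sum[OF module_scal] module.span_scale[OF module_scal])
  qed
qed (simp add: same_shape_def)

text \<open>The witness for the choice in \<open>mu\<close>: every symbol is replaced by a
  polynomial of the right class, so the homomorphism property holds in the polynomial ring and not
  merely modulo the ideal.\<close>

definition mu_model :: "('N::finite, 'N cyclotomic) spoly \<Rightarrow> ('N, 'N cyclotomic) spoly" where
  "mu_model = evp const (\<lambda>M. \<Prod>s\<in>#M. iota 0 (phis s))"

interpretation mu_model: evaluation "const :: 'N::finite cyclotomic \<Rightarrow> _" "\<lambda>M. \<Prod>s\<in>#M. iota 0 (phis s)"
  rewrites "evp const (\<lambda>M :: 'N mod_ring symb multiset. \<Prod>s\<in>#M. iota 0 (phis s)) = mu_model"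
  by unfold_locales (simp_all add: const_hom mu_model_def)

lemma cls_mu_model: "cls (mu_model p) = qiota 0 (Phi p)"
proof -
  have II: "cls (mu_model (II b bs c)) = qiota 0 (Phi (II b bs c))" for b c and bs :: "'a mod_ring point list"
  proof -
    have "mu_model (II b bs c) = iota 0 (phi b bs c)"
      by (subst II_def, subst mu_model.ev_single) (simp add: const_hom)
    then show ?thesis by (simp add: qiota_def)
  qed
  have const: "cls (mu_model (const c)) = qiota 0 (Phi (const c))" for c :: "'a cyclotomic"
    using qiota_linear(3)[of 0 c 1] by (simp add: mu_model.ev_const Phi.ev_const)
  show ?thesis
    by (rule spoly_hom_eqI[of "\<lambda>p. cls (mu_model p)" "\<lambda>p. qiota 0 (Phi p)", OF _ _ _ _ const II])
      (simp_all only: mu_model.ev_add mu_model.ev_mult cls_hom Phi.ev_add Phi.ev_mult qiota_linear qiota_mult)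
qed

lemma is_mu_model: "is_mu mu_model"
  unfolding is_mu_def
proof (intro conjI ballI allI impI)
  show "alg_hom (mu_model :: ('a, 'a cyclotomic) spoly \<Rightarrow> _)"
    unfolding alg_hom_def by (intro conjI allI mu_model.ev_const mu_model.ev_add mu_model.ev_mult)
next
  fix p :: "('a, 'a cyclotomic) spoly"
  assume "p \<in> I0_ideal"
  then have "cls (mu_model p) = cls 0" by (simp add: cls_mu_model Phi_I0_ideal qiota_linear cls_hom)
  then show "mu_model p \<in> I0_ideal" by (simp only: cls_eq_iff diff_0_right)
next
  fix p :: "('a, 'a cyclotomic) spoly"
  show "\<exists>p'\<in>I1. mu_model p - p' \<in> I0_ideal"
  proof (rule bexI)
    show "mu_model p - iota 0 (Phi p) \<in> I0_ideal"
      using cls_mu_model[of p] by (simp only: qiota_def cls_eq_iff)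
    \<comment> \<open>Values of \<open>Phi\<close> are regularized. Hence only words without leading
      \<open>X\<close> occur, and their transforms involve only lists that come from arrays.\<close>
    have "J 0 W \<in> I1" if "coef (Phi p) W \<noteq> 0" for W
      unfolding J_def I1_def
    proof (rule four_span)
      fix bs assume "same_shape W bs"
      moreover have "nonX W"
        using that dl_X_reg[of "Phi p"] unfolding reg_Phi dl_X_eq_0_iff by blast
      ultimately have "bs = [] \<or> hd bs \<noteq> Zero"
        by (cases W; cases bs) (simp_all add: same_shape_def)
      then obtain v where "is_array v" "word_of Zero Eta v = bs" using ex_array by metis
      then have "II Zero bs (Eta 0) = I_array 0 v" "is_array v" by (simp_all add: I_array_word_of)
      then have "II Zero bs (Eta 0) \<in> {I_array 0 v |v. is_array v}" by blast
      then show "II Zero bs (Eta 0) \<in> module.span scal {I_array 0 v |v. is_array v}"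
        by (rule module.span_base[OF module_scal])
    qed
    then show "iota 0 (Phi p) \<in> I1"
      unfolding I1_def iota_def scal_def[symmetric]
      by (intro module.span_sum[OF module_scal] module.span_scale[OF module_scal]) simp
  qed
next
  fix c and v :: "'a array" assume "is_array v"
  let ?w = "word_of Zero Eta v"
  have w: "?w = [] \<or> hd ?w \<noteq> Zero" using word_of_Cons[of Zero Eta v] by auto
  have "map (tau 0) (map (shift c) ?w) = map (tau c) ?w" by (simp add: tau_shift)
  then have "qI Zero (map (shift c) ?w) (Eta 0) = qiota 0 (lw (map (tau c) ?w))"
    using qiota_lw[of 0 "map (shift c) ?w"] by (simp only:)
  then have "cls (mu_model (I_array c v)) = cls (I_array 0 (map (\<lambda>(n, a). (n, a - c)) v))"
    by (simp add: cls_mu_model I_array_word_of phi_Zero reg_lw[OF w] word_of_shift flip: qI_def)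
  then show "mu_model (I_array c v) - I_array 0 (map (\<lambda>(n, a). (n, a - c)) v) \<in> I0_ideal"
    by (simp only: cls_eq_iff)
qed

lemma is_mu_mu: "is_mu (mu :: ('N::finite, 'N cyclotomic) spoly \<Rightarrow> _)"
  unfolding mu_def by (rule someI[of is_mu, OF is_mu_model])

text \<open>Together with \<open>mu_hom\<close> this is the only access to the chosen
  \<open>mu\<close> from here on.\<close>

lemma cls_mu: "cls (mu p) = cls (iota 0 (Phi p))"
  using is_mu_cls[OF is_mu_mu] by (simp add: qiota_def)

lemma mu_hom:
  fixes c :: "'N::finite cyclotomic" and p q :: "('N, 'N cyclotomic) spoly"
  shows "mu (const c) = (const c :: ('N, 'N cyclotomic) spoly)" "mu (p + q) = mu p + mu q" "mu (p * q) = mu p * mu q"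
proof -
  note hom = conjunct1[OF is_mu_mu[unfolded is_mu_def], unfolded alg_hom_def]
  show "mu (const c) = (const c :: ('N, 'N cyclotomic) spoly)" "mu (p + q) = mu p + mu q" "mu (p * q) = mu p * mu q"
    by (rule conjunct1[OF hom, THEN spec]
        conjunct1[OF conjunct2[OF hom], THEN spec, THEN spec]
        conjunct2[OF conjunct2[OF hom], THEN spec, THEN spec])+
qed

lemma mu_0: "mu 0 = (0 :: ('N::finite, 'N cyclotomic) spoly)"
  using mu_hom(1)[of 0] by (simp add: const_hom)

section \<open>Tensor products\<close>

lemma lookup_tensor: "Poly_Mapping.lookup (tensor p q) (u, v) = Poly_Mapping.lookup p u * Poly_Mapping.lookup q v"
proof -
  let ?f = "\<lambda>a b. Poly_Mapping.lookup p a * Poly_Mapping.lookup q b"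
  have "Poly_Mapping.lookup (tensor p q) (u, v) =
      (\<Sum>a\<in>Poly_Mapping.keys p. \<Sum>b\<in>Poly_Mapping.keys q. if b = v then if a = u then ?f a b else 0 else 0)"
    unfolding tensor_def lookup_sum lookup_single
    by (intro sum.cong refl) (simp add: when_def)
  also have "\<dots> = (if v \<in> Poly_Mapping.keys q then if u \<in> Poly_Mapping.keys p then ?f u v else 0 else 0)"
    by (simp add: sum.delta)
  also have "\<dots> = ?f u v" by (simp add: in_keys_iff)
  finally show ?thesis .
qed

lemma tensor_eqI: "(\<And>u v. Poly_Mapping.lookup s (u, v) = Poly_Mapping.lookup t (u, v)) \<Longrightarrow> s = t"
  by (rule poly_mapping_eqI) auto

lemma tensor_linear:
  fixes p q :: "'b \<Rightarrow>\<^sub>0 'k::comm_ring_1"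
  shows "tensor (p + p') r = tensor p r + tensor p' r" "tensor r' (q + q') = tensor r' q + tensor r' q'"
    "tensor 0 r = 0" "tensor r' 0 = 0"
    "tensor (p - p') r = tensor p r - tensor p' r" "tensor r' (q - q') = tensor r' q - tensor r' q'"
  by (rule tensor_eqI; simp add: lookup_tensor lookup_add lookup_minus algebra_simps)+

lemma tensor_const:
  fixes p :: "'b::monoid_add \<Rightarrow>\<^sub>0 'k::comm_ring_1" and q :: "'c::monoid_add \<Rightarrow>\<^sub>0 'k"
  shows "tensor (const c * p) q = const c * tensor p q" "tensor p (const c * q) = const c * tensor p q"
  by (rule tensor_eqI; simp add: lookup_tensor lookup_const_mult)+

lemma tensor_single: "tensor (Poly_Mapping.single u a) (Poly_Mapping.single v b) = Poly_Mapping.single (u, v) (a * b)"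
  by (rule tensor_eqI) (simp add: lookup_tensor lookup_single when_def)

lemma tensor_sum: "tensor (sum f A) q = (\<Sum>x\<in>A. tensor (f x) q)" "tensor q (sum f A) = (\<Sum>x\<in>A. tensor q (f x))"
  for f :: "'a \<Rightarrow> ('b \<Rightarrow>\<^sub>0 'k::comm_ring_1)"
  by (induction A rule: infinite_finite_induct) (simp_all add: tensor_linear)

lemma tensor_mult:
  fixes p p' :: "'b::comm_monoid_add \<Rightarrow>\<^sub>0 'k::comm_ring_1" and q q' :: "'c::comm_monoid_add \<Rightarrow>\<^sub>0 'k"
  shows "tensor p q * tensor p' q' = tensor (p * p') (q * q')"
proof (induction p rule: poly_mapping_induct)
  case (add u a p)
  have "tensor (Poly_Mapping.single u a) q * tensor p' q' = tensor (Poly_Mapping.single u a * p') (q * q')"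
  proof (induction q rule: poly_mapping_induct)
    case (add v b q)
    have "Poly_Mapping.single (u, v) (a * b) * tensor p' q' =
        tensor (Poly_Mapping.single u a * p') (Poly_Mapping.single v b * q')"
    proof (induction p' rule: poly_mapping_induct)
      case (add u' a' p')
      have "Poly_Mapping.single (u, v) (a * b) * tensor (Poly_Mapping.single u' a') q' =
          tensor (Poly_Mapping.single (u + u') (a * a')) (Poly_Mapping.single v b * q')"
      proof (induction q' rule: poly_mapping_induct)
        case (add v' b' q')
        then show ?case by (simp add: tensor_linear distrib_left tensor_single mult_single mult_ac add_ac)
      qed (simp add: tensor_linear)
      with add show ?case by (simp add: tensor_linear distrib_left mult_single)
    qed (simp add: tensor_linear)
    with add show ?case by (simp add: tensor_linear distrib_right tensor_single)
  qed (simp add: tensor_linear)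
  with add show ?case by (simp add: tensor_linear distrib_right)
qed (simp add: tensor_linear)

lemma tensor_map_add:
  assumes "\<And>a b. e (a + b) = e a + e b" "e 0 = 0"
  shows "tensor_map e f g (s + t) = tensor_map e f g s + tensor_map e f g (t :: _ \<Rightarrow>\<^sub>0 'r::{zero_neq_one,comm_monoid_add})"
proof -
  let ?F = "\<lambda>uv c. scal (e c) (tensor (f (Poly_Mapping.single (fst uv) 1)) (g (Poly_Mapping.single (snd uv) 1)))"
  have "tensor_map e f g t = (\<Sum>uv\<in>Poly_Mapping.keys t. ?F uv (Poly_Mapping.lookup t uv))" for t
    by (simp add: tensor_map_def case_prod_beta)
  then show ?thesis
    using sum_keys_add[of ?F s t] by (simp add: assms scal_def const_def single_add distrib_right)
qed

lemma tensor_map_0 [simp]: "tensor_map e f g 0 = 0" by (simp add: tensor_map_def)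

lemma tensor_map_single:
  assumes "e 0 = 0"
  shows "tensor_map e f g (Poly_Mapping.single (u, v) c) =
    const (e c) * tensor (f (Poly_Mapping.single u 1)) (g (Poly_Mapping.single v 1))"
  using assms by (simp add: tensor_map_def scal_def const_def)

lemma tensor_map_sum:
  assumes "\<And>a b. e (a + b) = e a + e b" "e 0 = 0"
  shows "tensor_map e f g (sum t A) = (\<Sum>x\<in>A. tensor_map e f g (t x :: _ \<Rightarrow>\<^sub>0 'r::{zero_neq_one,comm_monoid_add}))"
  by (induction A rule: infinite_finite_induct) (simp_all add: tensor_map_add[of e, OF assms])

text \<open>\<open>tensor_map\<close> is defined through pairs of monomials; that it acts on each
  factor of an arbitrary tensor uses the linearity of \<open>mu\<close>.\<close>

lemma tensor_map_mu:
  fixes p q :: "('N::finite, 'N cyclotomic) spoly"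
  shows "tensor_map (\<lambda>c. c) mu mu (tensor p q) = tensor (mu p) (mu q)"
proof -
  have s: "mu (Poly_Mapping.single u a) = const a * mu (Poly_Mapping.single u 1)"
    for u :: "'N mod_ring symb multiset" and a :: "'N cyclotomic"
  proof -
    have "Poly_Mapping.single u a = const a * Poly_Mapping.single u 1" by (simp add: const_def mult_single)
    then have "mu (Poly_Mapping.single u a) = mu (const a * Poly_Mapping.single u 1)" by (rule arg_cong)
    then show ?thesis by (simp only: mu_hom)
  qed
  show ?thesis
  proof (induction p rule: poly_mapping_induct)
    case (add u a p)
    have "tensor_map (\<lambda>c. c) mu mu (tensor (Poly_Mapping.single u a) q) = tensor (mu (Poly_Mapping.single u a)) (mu q)"
    proof (induction q rule: poly_mapping_induct)
      case (add v b q)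
      have "tensor_map (\<lambda>c. c) mu mu (Poly_Mapping.single (u, v) (a * b)) =
          tensor (mu (Poly_Mapping.single u a)) (mu (Poly_Mapping.single v b))"
        by (subst (1) s, subst (2) s) (simp add: tensor_map_single tensor_const const_hom mult_ac)
      with add show ?case
        by (simp add: tensor_linear tensor_single tensor_map_add[of "\<lambda>c. c"] mu_hom(2))
    qed (simp add: tensor_linear mu_0)
    with add show ?case by (simp add: tensor_linear mu_hom(2) tensor_map_add[of "\<lambda>c. c"])
  qed (simp add: tensor_linear mu_0)
qed

lemma Delta_mu_I_alt: "Delta_mu_I p = tensor_map (\<lambda>c. c) mu mu (coproduct p)"
  by (simp add: Delta_mu_I_def id_def)

section \<open>Congruence in the tensor square of the quotient\<close>

definition cong2 :: "('N::finite, 'N cyclotomic) spoly2 \<Rightarrow> ('N, 'N cyclotomic) spoly2 \<Rightarrow> bool" where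
  "cong2 s t \<longleftrightarrow> s - t \<in> I0I0_ideal"

lemma I0I0_add: "s \<in> I0I0_ideal \<Longrightarrow> t \<in> I0I0_ideal \<Longrightarrow> s + t \<in> I0I0_ideal"
  unfolding I0I0_ideal_def ideal_generated_def by (rule module.span_add[OF module_mult])

lemma I0I0_mult: "s \<in> I0I0_ideal \<Longrightarrow> t * s \<in> I0I0_ideal"
  unfolding I0I0_ideal_def ideal_generated_def by (rule module.span_scale[OF module_mult])

lemma I0I0_0: "0 \<in> I0I0_ideal"
  unfolding I0I0_ideal_def ideal_generated_def by (rule module.span_zero[OF module_mult])

lemma cong2_refl [simp]: "cong2 s s" by (simp add: cong2_def I0I0_0)

lemma cong2_sym: "cong2 s t \<Longrightarrow> cong2 t s"
  unfolding cong2_def using I0I0_mult[of "s - t" "- 1"] by simp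

lemma cong2_trans: "cong2 s t \<Longrightarrow> cong2 t r \<Longrightarrow> cong2 s r"
  unfolding cong2_def using I0I0_add[of "s - t" "t - r"] by simp

lemma cong2_add: "cong2 s t \<Longrightarrow> cong2 s' t' \<Longrightarrow> cong2 (s + s') (t + t')"
  unfolding cong2_def using I0I0_add[of "s - t" "s' - t'"] by (simp add: algebra_simps)

lemma cong2_mult: "cong2 s t \<Longrightarrow> cong2 (r * s) (r * t)"
  unfolding cong2_def using I0I0_mult[of "s - t" r] by (simp add: algebra_simps)

lemma cong2_sum: "(\<And>x. x \<in> A \<Longrightarrow> cong2 (f x) (g x)) \<Longrightarrow> cong2 (sum f A) (sum g A)"
  by (induction A rule: infinite_finite_induct) (simp_all add: cong2_add)

lemma cong2_four:
  assumes "\<And>bs. same_shape W bs \<Longrightarrow> cong2 (f bs) (g bs)"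
  shows "cong2 (four const W f) (four const W g)"
  using assms
proof (induction W arbitrary: f g)
  case (Cons l W)
  then show ?case
    by (cases l) (auto simp: same_shape_def intro!: cong2_sum cong2_mult)
qed (simp add: same_shape_def)

text \<open>The difference is \<open>(p - p') \<otimes> q + p' \<otimes> (q - q')\<close>.\<close>

lemma cong2_tensor:
  assumes "cls p = cls p'" "cls q = cls q'"
  shows "cong2 (tensor p q) (tensor p' q')"
proof -
  have "tensor (p - p') 1 \<in> I0I0_ideal" "tensor 1 (q - q') \<in> I0I0_ideal"
    unfolding I0I0_ideal_def ideal_generated_def
    using assms by (auto simp: cls_eq_iff intro!: module.span_base[OF module_mult])
  from I0I0_add[OF I0I0_mult[OF this(1), of "tensor 1 q"] I0I0_mult[OF this(2), of "tensor p' 1"]]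
  show ?thesis by (simp add: cong2_def tensor_mult tensor_linear right_diff_distrib)
qed

lemma coproduct_add: "coproduct (p + q) = coproduct p + coproduct q"
  unfolding coproduct_def by (rule sum_keys_add) (simp_all add: scal_def const_hom distrib_right)

lemma coproduct_0: "coproduct 0 = 0" by (simp add: coproduct_def)

lemma coproduct_const: "coproduct (const c * p) = const c * coproduct p"
proof (induction p rule: poly_mapping_induct)
  case (add M d p)
  have sg: "coproduct (Poly_Mapping.single M d) = const d * (\<Prod>s\<in>#M. coproduct_symb s)" for d :: 'b and M
    by (cases "d = 0") (simp_all add: coproduct_def scal_def const_hom)
  have "const c * Poly_Mapping.single M d = Poly_Mapping.single M (c * d)"
    by (simp add: const_def mult_single)
  then show ?case using add by (simp add: distrib_left coproduct_add sg const_hom mult.assoc)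
qed (simp add: coproduct_0)

lemma coproduct_II: "coproduct (II b bs c :: ('N, 'k::comm_ring_1) spoly) = coproduct_symb (Symb b bs c)"
  by (simp add: coproduct_def II_def scal_def const_hom)

lemma Delta_mu_I_add: "Delta_mu_I (p + q) = Delta_mu_I p + Delta_mu_I q"
  for p q :: "('N::finite, 'N cyclotomic) spoly"
  by (simp add: Delta_mu_I_alt coproduct_add tensor_map_add[of "\<lambda>c. c"])

lemma Delta_mu_I_0: "Delta_mu_I 0 = (0 :: ('N::finite, 'N cyclotomic) spoly2)"
  by (simp add: Delta_mu_I_alt coproduct_0)

lemma Delta_mu_I_const: "Delta_mu_I (const c * p) = const c * Delta_mu_I p"
  for p :: "('N::finite, 'N cyclotomic) spoly"
proof -
  have sc: "tensor_map (\<lambda>c. c) mu mu (const c * t) = const c * tensor_map (\<lambda>c. c) mu mu t"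
    for t :: "('N, 'N cyclotomic) spoly2"
  proof (induction t rule: poly_mapping_induct)
    case (add uv d t)
    obtain u v where uv: "uv = (u, v)" by (cases uv)
    have "const c * Poly_Mapping.single uv d = Poly_Mapping.single (u, v) (c * d)"
      by (simp add: const_def mult_single uv)
    then show ?case using add
      by (simp add: distrib_left tensor_map_add[of "\<lambda>c. c"] tensor_map_single uv const_hom mult.assoc)
  qed simp
  then show ?thesis by (simp add: Delta_mu_I_alt coproduct_const)
qed

lemma Delta_mu_I_four:
  fixes f :: "'N::finite mod_ring point list \<Rightarrow> ('N, 'N cyclotomic) spoly"
  shows "Delta_mu_I (four const W f) = four const W (\<lambda>bs. Delta_mu_I (f bs))"
  by (rule four_hom) (rule Delta_mu_I_add Delta_mu_I_0 Delta_mu_I_const)+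

lemma Delta_mu_I_sum: "Delta_mu_I (sum f A) = (\<Sum>x\<in>A. Delta_mu_I (f x))"
  for f :: "_ \<Rightarrow> ('N::finite, 'N cyclotomic) spoly"
  by (induction A rule: infinite_finite_induct) (simp_all add: Delta_mu_I_0 Delta_mu_I_add)

section \<open>The coproduct in the model\<close>

text \<open>Sum over the choice of one letter, with the parts before and after it. The coproduct
  cuts at such letters, and the partial fractions later choose a pole in the same way.\<close>

fun pick_sum :: "('a list \<Rightarrow> 'a \<Rightarrow> 'a list \<Rightarrow> 'b::comm_monoid_add) \<Rightarrow> 'a list \<Rightarrow> 'b" where
  "pick_sum h [] = 0"
| "pick_sum h (d # w) = h [] d w + pick_sum (\<lambda>u. h (d # u)) w"

lemma pick_sum_map_upt:
  "pick_sum h (map f [a..<n]) = (\<Sum>j\<in>{a..<n}. h (map f [a..<j]) (f j) (map f [Suc j..<n]))"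
proof (induction "n - a" arbitrary: a h)
  case (Suc k)
  then have a: "a < n" by simp
  have "pick_sum h (map f [a..<n]) = h [] (f a) (map f [Suc a..<n]) + pick_sum (\<lambda>u. h (f a # u)) (map f [Suc a..<n])"
    using a by (simp add: upt_conv_Cons)
  also have "pick_sum (\<lambda>u. h (f a # u)) (map f [Suc a..<n]) =
      (\<Sum>j\<in>{Suc a..<n}. h (f a # map f [Suc a..<j]) (f j) (map f [Suc j..<n]))"
    using Suc by (intro Suc.hyps(1)) simp
  also have "\<dots> = (\<Sum>j\<in>{Suc a..<n}. h (map f [a..<j]) (f j) (map f [Suc j..<n]))"
    by (intro sum.cong refl) (simp add: upt_conv_Cons)
  finally show ?case using a by (simp add: sum.atLeast_Suc_lessThan)
qed simp

lemma pick_sum_add: "pick_sum (\<lambda>u d v. g u d v + h u d v) w = pick_sum g w + pick_sum h w"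
  by (induction w arbitrary: g h) (simp_all add: ac_simps)

lemma pick_sum_zero [simp]: "pick_sum (\<lambda>u d v. 0) w = 0"
  by (induction w) simp_all

lemma pick_sum_sum: "pick_sum (\<lambda>u d v. \<Sum>i\<in>I. f i u d v) w = (\<Sum>i\<in>I. pick_sum (f i) w)"
  by (induction w arbitrary: f) (simp_all add: sum.distrib)

lemma pick_sum_split:
  "pick_sum (\<lambda>u d v. split_sum (\<lambda>a b. f a b d v) u) w = split_sum (\<lambda>a b. pick_sum (f a) b) w"
proof (induction w arbitrary: f)
  case (Cons d w)
  show ?case by (simp add: pick_sum_add Cons.IH[of "\<lambda>u. f (d # u)"] ac_simps)
qed simp

lemma pick_sum_cong:
  assumes "\<And>u d v. w = u @ d # v \<Longrightarrow> h u d v = h' u d v"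
  shows "pick_sum h w = pick_sum h' w"
  using assms
proof (induction w arbitrary: h h')
  case (Cons d w)
  have "pick_sum (\<lambda>u. h (d # u)) w = pick_sum (\<lambda>u. h' (d # u)) w"
    by (rule Cons.IH) (rule Cons.prems, simp)
  then show ?case using Cons.prems[of "[]" d w] by simp
qed simp

lemma pick_sum_first:
  assumes "\<And>u d v. u \<noteq> [] \<Longrightarrow> h u d v = 0"
  shows "pick_sum h w = (case w of [] \<Rightarrow> 0 | d # v \<Rightarrow> h [] d v)"
proof (cases w)
  case (Cons d v)
  have "pick_sum (\<lambda>u. h (d # u)) v = pick_sum (\<lambda>u d v. 0) v"
    by (rule pick_sum_cong) (simp add: assms)
  then show ?thesis by (simp add: Cons)
qed simp

lemma pick_sum_mult_left: "c * pick_sum h w = pick_sum (\<lambda>u d v. c * h u d v) w" for c :: "'b::semiring_0"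
  by (induction w arbitrary: h) (simp_all add: distrib_left)

lemma four_pick:
  "four \<kappa> W (pick_sum h) =
    pick_sum (\<lambda>U l V. four \<kappa> U (\<lambda>u. four \<kappa> [l] (\<lambda>d. four \<kappa> V (\<lambda>v. h u (hd d) v)))) W"
proof (induction W arbitrary: h)
  case (Cons l W)
  show ?case
  proof (cases l)
    case X
    then show ?thesis by (simp add: four_add Cons.IH)
  next
    case (Y k)
    show ?thesis
      by (simp add: Y four_add Cons.IH distrib_left sum.distrib pick_sum_sum pick_sum_mult_left)
  qed
qed simp

text \<open>
  \<open>cs b ls R\<close> is the coefficient of the word \<open>R\<close> of the right tensor factor in the coproduct of the
  integral over \<open>ls\<close> from \<open>b\<close> to 1.
\<close>

fun cs :: "'N::finite mod_ring point \<Rightarrow> 'N mod_ring point list \<Rightarrow> 'N mod_ring letter list \<Rightarrow> 'N shalg" where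
  "cs b ls [] = phi b ls (Eta 0)"
| "cs b ls (l # R) = pick_sum (\<lambda>u d v. emb (tau 0 d l) * (phi b u d * cs d v R)) ls"

lemma sum_index_lists:
  fixes G :: "nat list \<Rightarrow> 'b::comm_monoid_add" and i m :: nat
  defines "Ix \<equiv> \<lambda>i. {js. sorted_wrt (<) js \<and> set js \<subseteq> {Suc i..m}}"
  shows "sum G (Ix i) = G [] + (\<Sum>j\<in>{Suc i..m}. \<Sum>js\<in>Ix j. G (j # js))"
proof -
  have fin: "finite (Ix i)" for i
  proof (rule finite_subset)
    show "Ix i \<subseteq> {js. set js \<subseteq> {Suc i..m} \<and> distinct js}"
      by (auto simp: Ix_def strict_sorted_iff)
  qed (rule finite_subset_distinct, simp)
  have "Ix i = insert [] ((\<lambda>(j, js). j # js) ` Sigma {Suc i..m} Ix)"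
  proof (intro equalityI subsetI)
    fix js assume js: "js \<in> Ix i"
    show "js \<in> insert [] ((\<lambda>(j, js). j # js) ` Sigma {Suc i..m} Ix)"
    proof (cases js)
      case (Cons j js')
      then have "(j, js') \<in> Sigma {Suc i..m} Ix"
        using js by (auto simp: Ix_def Suc_le_eq subset_eq)
      then show ?thesis unfolding Cons by force
    qed simp
  next
    fix js assume "js \<in> insert [] ((\<lambda>(j, js). j # js) ` Sigma {Suc i..m} Ix)"
    then show "js \<in> Ix i" by (fastforce simp: Ix_def Suc_le_eq subset_eq)
  qed
  then have "sum G (Ix i) = sum G (insert [] ((\<lambda>(j, js). j # js) ` Sigma {Suc i..m} Ix))"
    by (rule arg_cong)
  also have "\<dots> = G [] + sum G ((\<lambda>(j, js). j # js) ` Sigma {Suc i..m} Ix)"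
    by (rule sum.insert) (auto intro!: finite_imageI finite_SigmaI fin)
  also have "sum G ((\<lambda>(j, js). j # js) ` Sigma {Suc i..m} Ix) = sum (G \<circ> (\<lambda>(j, js). j # js)) (Sigma {Suc i..m} Ix)"
    by (rule sum.reindex) (auto simp: inj_on_def)
  also have "\<dots> = (\<Sum>j\<in>{Suc i..m}. \<Sum>js\<in>Ix j. G (j # js))"
    by (subst sum.Sigma) (auto simp: fin case_prod_beta)
  finally show ?thesis .
qed

text \<open>Peeling off the first index of each index list turns the coefficient of \<open>R\<close>
  into the recursion of \<open>cs\<close>. Index lists whose length differs from that of
  \<open>R\<close> drop out, because \<open>lwf\<close> vanishes on them.\<close>

lemma sum_segments:
  fixes b :: "'N::finite mod_ring point" and bs
  defines "B \<equiv> b # bs @ [Eta 0]" and "m \<equiv> length bs"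
  shows "(\<Sum>js\<in>{js. sorted_wrt (<) js \<and> set js \<subseteq> {1..m}}.
      let is = 0 # js @ [m + 1] in
        emb (lwf (map (tau 0) (map (\<lambda>i. B ! i) js)) R) *
        (\<Prod>p\<le>length js. phi (B ! (is ! p)) (map (\<lambda>i. B ! i) [is ! p + 1..<is ! (p + 1)]) (B ! (is ! (p + 1))))) =
    cs b bs R"
proof -
  define F where "F i j = phi (B ! i) (map (\<lambda>i. B ! i) [i + 1..<j]) (B ! j)" for i j
  define P where "P i js = (\<Prod>p\<le>length js. F ((i # js @ [m + 1]) ! p) ((i # js @ [m + 1]) ! (p + 1)))" for i js
  define Ix where "Ix i = {js. sorted_wrt (<) js \<and> set js \<subseteq> {Suc i..m}}" for i
  have P_Nil: "P i [] = F i (m + 1)" for i by (simp add: P_def)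
  have P_Cons: "P i (j # js) = F i j * P j js" for i j js
    by (simp add: P_def prod.atMost_Suc_shift del: prod.atMost_Suc)
  have Bl: "B ! Suc m = Eta 0" by (simp add: B_def m_def nth_append)
  have main: "(\<Sum>js\<in>Ix i. emb (lwf (map (tau 0) (map (\<lambda>i. B ! i) js)) R) * P i js) =
      cs (B ! i) (map (\<lambda>i. B ! i) [Suc i..<m + 1]) R" for i
  proof (induction R arbitrary: i)
    case Nil
    have "(\<Sum>j\<in>{Suc i..m}. \<Sum>js\<in>Ix j. emb (lwf (map (tau 0) (map (\<lambda>i. B ! i) (j # js))) []) * P i (j # js)) = 0"
      by (simp add: emb_hom)
    then show ?case
      unfolding Ix_def sum_index_lists[of _ i m] unfolding Ix_def[symmetric]
      by (simp add: P_Nil F_def Bl emb_hom del: upt_Suc)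
  next
    case (Cons l R)
    have "(\<Sum>js\<in>Ix i. emb (lwf (map (tau 0) (map (\<lambda>i. B ! i) js)) (l # R)) * P i js) =
       (\<Sum>j\<in>{Suc i..m}. \<Sum>js\<in>Ix j. emb (lwf (map (tau 0) (map (\<lambda>i. B ! i) (j # js))) (l # R)) * P i (j # js))"
      unfolding Ix_def sum_index_lists[of _ i m] unfolding Ix_def[symmetric] by (simp add: emb_hom)
    also have "\<dots> = (\<Sum>j\<in>{Suc i..<m + 1}. emb (tau 0 (B ! j) l) * (F i j *
        (\<Sum>js\<in>Ix j. emb (lwf (map (tau 0) (map (\<lambda>i. B ! i) js)) R) * P j js)))"
      by (rule sum.cong) (auto simp: P_Cons emb_hom sum_distrib_left mult_ac simp flip: atLeastLessThanSuc_atLeastAtMost)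
    also have "\<dots> = (\<Sum>j\<in>{Suc i..<m + 1}. emb (tau 0 (B ! j) l) * (F i j *
        cs (B ! j) (map (\<lambda>i. B ! i) [Suc j..<m + 1]) R))"
      by (simp only: Cons.IH)
    also have "\<dots> = cs (B ! i) (map (\<lambda>i. B ! i) [Suc i..<m + 1]) (l # R)"
      unfolding cs.simps pick_sum_map_upt F_def by simp
    finally show ?case .
  qed
  have "map (\<lambda>i. B ! i) [Suc 0..<m + 1] = bs"
    by (rule nth_equalityI) (simp_all add: B_def m_def nth_append del: upt_Suc)
  then show ?thesis using main[of 0] by (simp add: P_def F_def Ix_def B_def Let_def del: upt_Suc)
qed

text \<open>Only the first segment starts at \<open>b\<close>; composing its path at 0 splits off
  the factor \<open>S b u\<close>.\<close>

lemma cs_path: "cs b ls R = split_sum (\<lambda>u v. S b u * cs Zero v R) ls"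
proof (cases R)
  case Nil
  then show ?thesis using phi_path[of b ls "Eta 0" Zero] by (simp add: conv_def phi_to_Zero)
next
  case (Cons l R')
  have "cs b ls R = pick_sum (\<lambda>u d v. split_sum (\<lambda>x y. S b x * (emb (tau 0 d l) * (phi Zero y d * cs d v R'))) u) ls"
    unfolding Cons cs.simps
    by (subst phi_path[of b _ _ Zero])
      (simp add: conv_def phi_to_Zero split_sum_mult_right[symmetric] split_sum_mult_left[symmetric] mult_ac)
  also have "\<dots> = split_sum (\<lambda>u v. S b u * cs Zero v R) ls"
    unfolding pick_sum_split Cons cs.simps by (simp only: pick_sum_mult_left)
  finally show ?thesis .
qed

text \<open>The letter \<open>X\<close> is matched only by the point 0, and a segment from 0 to 0
  vanishes unless it is empty. So the matched point must be the first one.\<close>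

lemma cs_Zero_X: "cs Zero ls (X # R) = (case ls of Zero # v \<Rightarrow> cs Zero v R | _ \<Rightarrow> 0)"
proof -
  have "emb (tau 0 d X) * (phi Zero u d * cs d v R) = 0" if "u \<noteq> []" for u d v
    using that by (cases d) (simp_all add: phi_same unit_fun_def emb_hom)
  then have "cs Zero ls (X # R) = (case ls of [] \<Rightarrow> 0 | d # v \<Rightarrow> emb (tau 0 d X) * (phi Zero [] d * cs d v R))"
    unfolding cs.simps by (subst pick_sum_first) simp_all
  also have "\<dots> = (case ls of Zero # v \<Rightarrow> cs Zero v R | _ \<Rightarrow> 0)"
    by (auto split: list.splits point.splits simp: emb_hom)
  finally show ?thesis .
qed

section \<open>The transformed coproduct and its recursion over the right word\<close>

definition csF :: "'N::finite mod_ring letter list \<Rightarrow> 'N mod_ring letter list \<Rightarrow> 'N shalg" where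
  "csF W R = four emb W (\<lambda>bs. cs Zero bs R)"

lemma four_T: "four emb W (T (Eta b)) = emb (eta_cyc (b * cont W)) * reg (delta W)"
proof -
  have "T (Eta b) = (\<lambda>bs. reg (lw (map (tau b) bs)))" by (simp add: fun_eq_iff)
  then have "four emb W (T (Eta b)) = reg (four emb W (\<lambda>bs. lw (map (tau b) bs)))"
    by (simp only: four_hom[of reg emb emb] reg_add reg_emb_mult reg_0)
  then show ?thesis by (simp add: four_lw reg_emb_mult)
qed

lemma four_S: "four emb W (S (Eta b)) = emb (eta_cyc (b * cont W)) * ((- 1) ^ length W * reg (delta (rev W)))"
proof -
  have "four emb W (S (Eta b)) = four emb W (\<lambda>bs. (- 1) ^ length W * reg (lw (map (tau b) (rev bs))))"
    by (rule four_cong) (auto simp: S_def same_shape_def dest: list_all2_lengthD)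
  also have "\<dots> = (- 1) ^ length W * reg (four emb W (\<lambda>bs. lw (map (tau b) (rev bs))))"
    by (simp add: four_hom[of reg emb emb] reg_add reg_emb_mult flip: four_mult)
  finally show ?thesis by (simp add: four_lw_rev reg_emb_mult mult.left_commute)
qed

lemma csF_Nil: "csF W [] = reg (delta W)"
  using four_T[of W 0] by (simp add: csF_def phi_Zero emb_hom del: T.simps)

lemma csF_X: "csF W (X # R) = (case W of X # W' \<Rightarrow> csF W' R | _ \<Rightarrow> 0)"
proof (cases W)
  case (Cons l W')
  then show ?thesis by (cases l) (simp_all add: csF_def cs_Zero_X del: cs.simps)
qed (simp add: csF_def cs_Zero_X del: cs.simps)

text \<open>At the letter \<open>Y \<kappa>\<close> the path is cut at a point
  \<open>\<eta>^b\<close>: the segment of \<open>U\<close> ends there and the next one starts there.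
  Composing the latter at 0 gives the reversed piece \<open>U'\<close> with its sign, and summation
  over \<open>b\<close> gives the condition on the weights by orthogonality. No root of unity
  remains.\<close>

lemma csF_Y: "csF W (Y k # R) = pick_sum (\<lambda>U l V. case l of X \<Rightarrow> 0 | Y \<kappa> \<Rightarrow>
    split_sum (\<lambda>U' V'. if cont U + \<kappa> + cont U' = k
      then (- 1) ^ length U' * (reg (delta U) * reg (delta (rev U'))) * csF V' R else 0) V) W"
proof -
  have "csF W (Y k # R) = pick_sum (\<lambda>U l V. four emb U (\<lambda>u. four emb [l] (\<lambda>d. four emb V (\<lambda>v.
      emb (tau 0 (hd d) (Y k)) * (phi Zero u (hd d) * cs (hd d) v R))))) W"
    unfolding csF_def cs.simps by (rule four_pick)
  also have "\<dots> = pick_sum (\<lambda>U l V. case l of X \<Rightarrow> 0 | Y \<kappa> \<Rightarrow>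
    split_sum (\<lambda>U' V'. if cont U + \<kappa> + cont U' = k
      then (- 1) ^ length U' * (reg (delta U) * reg (delta (rev U'))) * csF V' R else 0) V) W"
  proof (rule pick_sum_cong)
    fix U l V
    show "four emb U (\<lambda>u. four emb [l] (\<lambda>d. four emb V (\<lambda>v.
        emb (tau 0 (hd d) (Y k)) * (phi Zero u (hd d) * cs (hd d) v R)))) =
      (case l of X \<Rightarrow> 0 | Y \<kappa> \<Rightarrow>
      split_sum (\<lambda>U' V'. if cont U + \<kappa> + cont U' = k
        then (- 1) ^ length U' * (reg (delta U) * reg (delta (rev U'))) * csF V' R else 0) V)"
    proof (cases l)
      case X
      then show ?thesis by (simp add: emb_hom)
    next
      case (Y \<kappa>)
      define Q where "Q U' V' = (- 1) ^ length U' * (reg (delta U) * reg (delta (rev U'))) * csF V' R" for U' V'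
      \<comment> \<open>Moves the starting point of what follows from \<open>\<eta>^b\<close> to 0,
        at the price of a reversed piece and a power of the root of unity.\<close>
      have inner: "four emb V (\<lambda>v. cs (Eta b) v R) =
          split_sum (\<lambda>U' V'. emb (eta_cyc (b * cont U')) * ((- 1) ^ length U' * reg (delta (rev U'))) * csF V' R) V" for b
      proof -
        have "four emb V (\<lambda>v. cs (Eta b) v R) = four emb V (split_sum (\<lambda>u v. S (Eta b) u * cs Zero v R))"
          by (subst cs_path) simp
        also have "\<dots> = split_sum (\<lambda>U' V'. four emb U' (S (Eta b)) * csF V' R) V"
          unfolding four_split csF_def by (simp only: four_mult[symmetric] four_mult'[symmetric])
        finally show ?thesis by (simp only: four_S)
      qed
      have "four emb U (\<lambda>u. four emb [l] (\<lambda>d. four emb V (\<lambda>v.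
          emb (tau 0 (hd d) (Y k)) * (phi Zero u (hd d) * cs (hd d) v R)))) =
        (\<Sum>b\<in>UNIV. emb (- eta_cyc (\<kappa> * b) / of_nat CARD('a)) * (emb (tau 0 (Eta b) (Y k)) *
          (four emb U (T (Eta b)) * four emb V (\<lambda>v. cs (Eta b) v R))))"
        by (simp only: Y four.simps four_sum four_mult[symmetric] four_mult'[symmetric] list.sel phi_Zero)
      also have "\<dots> = (\<Sum>b\<in>UNIV. split_sum (\<lambda>U' V'.
          emb (eta_cyc ((cont U + \<kappa> + cont U') * b) * eta_cyc ((0 - b) * k) / of_nat CARD('a)) * Q U' V') V)"
        unfolding inner four_T split_sum_mult_left[symmetric]
      proof (intro sum.cong refl split_sum_cong)
        fix b U' V'
        have e: "- eta_cyc (\<kappa> * b) / of_nat CARD('a) * (tau 0 (Eta b) (Y k) * (eta_cyc (b * cont U) * eta_cyc (b * cont U'))) =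
          eta_cyc ((cont U + \<kappa> + cont U') * b) * eta_cyc ((0 - b) * k) / of_nat CARD('a)"
          by (simp add: distrib_left distrib_right eta_cyc_add mult_ac)
        show "emb (- eta_cyc (\<kappa> * b) / of_nat CARD('a)) * (emb (tau 0 (Eta b) (Y k)) *
            (emb (eta_cyc (b * cont U)) * reg (delta U) *
            (emb (eta_cyc (b * cont U')) * ((- 1) ^ length U' * reg (delta (rev U'))) * csF V' R))) =
          emb (eta_cyc ((cont U + \<kappa> + cont U') * b) * eta_cyc ((0 - b) * k) / of_nat CARD('a)) * Q U' V'"
          unfolding e[symmetric] Q_def emb_hom by (simp only: mult_ac)
      qed
      also have "\<dots> = split_sum (\<lambda>U' V'. emb ((\<Sum>b\<in>UNIV.
          eta_cyc ((cont U + \<kappa> + cont U') * b) * eta_cyc ((0 - b) * k)) / of_nat CARD('a)) * Q U' V') V"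
      proof -
        have "emb (sum F A) = (\<Sum>x\<in>A. emb (F x) :: 'a shalg)" for F :: "'a mod_ring \<Rightarrow> 'a cyclotomic" and A
          by (induction A rule: infinite_finite_induct) (simp_all add: emb_hom)
        then show ?thesis by (simp add: split_sum_sum[symmetric] sum_divide_distrib sum_distrib_right)
      qed
      also have "\<dots> = split_sum (\<lambda>U' V'. if cont U + \<kappa> + cont U' = k then Q U' V' else 0) V"
        unfolding eta_cyc_orthogonality_diff by (intro split_sum_cong) (simp add: emb_hom)
      finally show ?thesis unfolding Y Q_def letter.case .
    qed
  qed
  finally show ?thesis .
qed

lemma coef_reg_lw_length: "coef (reg (lw us)) R \<noteq> 0 \<Longrightarrow> length R = length us"
proof (rule ccontr)
  assume "coef (reg (lw us)) R \<noteq> 0" "length R \<noteq> length us"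
  moreover from this(2) have "regf (coef (lw us)) (rev R) = 0"
    by (intro regf_zero) (simp add: coef_lw lwf_length)
  ultimately show False by (simp add: reg.rep_eq)
qed

lemma tensor_iota:
  assumes "finite A" "\<And>R. coef g R \<noteq> 0 \<Longrightarrow> R \<in> A"
  shows "tensor (iota 0 f) (iota 0 g) = (\<Sum>R\<in>A. tensor (iota 0 (emb (coef g R) * f)) (J 0 R))"
proof -
  have g: "iota 0 g = (\<Sum>R\<in>A. const (coef g R) * J 0 R)" by (rule iota_superset) (use assms in auto)
  show ?thesis unfolding g tensor_sum tensor_const iota_emb ..
qed

text \<open>A finite set that contains all right factors and depends only on the length, so that
  sums over it commute with the transform of the left list.\<close>

definition right_words :: "nat \<Rightarrow> 'N::finite mod_ring letter list set" where
  "right_words n = {R. length R \<le> n \<and> nonX R}"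

lemma finite_right_words: "finite (right_words n)"
  using finite_lists_length_le[of "UNIV :: 'a mod_ring letter set" n]
  by (rule finite_subset[rotated]) (auto simp: right_words_def)

text \<open>Through \<open>mu\<close> the right factors enter regularized, whereas
  \<open>sum_segments\<close> takes their words as they are. The difference does not contribute: if
  the first cut is at a point 0, it is not the first point of the list, so the first segment is a
  nonempty one from 0 to 0 and vanishes.\<close>

lemma Delta_mu_I_II:
  fixes bs :: "'N::finite mod_ring point list"
  assumes "bs = [] \<or> hd bs \<noteq> Zero"
  shows "cong2 (Delta_mu_I (II Zero bs (Eta 0)))
    (\<Sum>R\<in>right_words (length bs). tensor (iota 0 (cs Zero bs R)) (J 0 R))"
proof -
  define B where "B = Zero # bs @ [Eta (0 :: 'N mod_ring)]"
  define m where "m = length bs"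
  define Ix where "Ix = {js. sorted_wrt (<) js \<and> set js \<subseteq> {1..m}}"
  define seg where "seg js = (\<lambda>f. let is = 0 # js @ [m + 1] in
     (\<Prod>p\<le>length js. f (B ! (is ! p)) (map (\<lambda>i. B ! i) [is ! p + 1..<is ! (p + 1)]) (B ! (is ! (p + 1))))
     :: 'N shalg)" for js
  define segI where "segI js = (let is = 0 # js @ [m + 1] in
     (\<Prod>p\<le>length js. II (B ! (is ! p)) (map (\<lambda>i. B ! i) [is ! p + 1..<is ! (p + 1)]) (B ! (is ! (p + 1))))
     :: ('N, 'N cyclotomic) spoly)" for js
  define r where "r js = map (\<lambda>i. B ! i) js" for js
  have len: "length js \<le> m" if "js \<in> Ix" for js
  proof -
    have "distinct js" "set js \<subseteq> {1..m}" using that by (auto simp: Ix_def strict_sorted_iff)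
    then show ?thesis by (metis card_atLeastAtMost card_mono diff_Suc_1 distinct_card finite_atLeastAtMost)
  qed
  have co: "coproduct_symb (Symb Zero bs (Eta 0)) =
      (\<Sum>js\<in>Ix. tensor (segI js) (II Zero (r js) (Eta 0)) :: ('N, 'N cyclotomic) spoly2)"
    by (simp add: coproduct_symb_def Let_def Ix_def segI_def r_def m_def B_def)
  have "Delta_mu_I (II Zero bs (Eta 0) :: ('N, 'N cyclotomic) spoly) =
      (\<Sum>js\<in>Ix. tensor (mu (segI js)) (mu (II Zero (r js) (Eta 0))))"
    by (simp add: Delta_mu_I_alt coproduct_II co tensor_map_sum[of "\<lambda>c. c"] tensor_map_mu)
  moreover have "cong2 (\<Sum>js\<in>Ix. tensor (mu (segI js)) (mu (II Zero (r js) (Eta 0))))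
      (\<Sum>js\<in>Ix. tensor (iota 0 (seg js phi)) (iota 0 (T (Eta 0) (r js))))"
  proof (rule cong2_sum, rule cong2_tensor)
    fix js
    have "Phi (segI js) = seg js phi" by (simp add: segI_def seg_def Let_def Phi.ev_prod)
    then show "cls (mu (segI js)) = cls (iota 0 (seg js phi))" by (simp add: cls_mu)
    show "cls (mu (II Zero (r js) (Eta 0))) = cls (iota 0 (T (Eta 0) (r js)))"
      unfolding cls_mu Phi_II phi_Zero ..
  qed
  moreover have "(\<Sum>js\<in>Ix. tensor (iota 0 (seg js phi)) (iota 0 (T (Eta 0) (r js)))) =
      (\<Sum>R\<in>right_words m. tensor (iota 0 (\<Sum>js\<in>Ix. emb (coef (T (Eta 0) (r js)) R) * seg js phi)) (J 0 R))"
  proof -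
    have "tensor (iota 0 (seg js phi)) (iota 0 (T (Eta 0) (r js))) =
        (\<Sum>R\<in>right_words m. tensor (iota 0 (emb (coef (T (Eta 0) (r js)) R) * seg js phi)) (J 0 R))"
      if "js \<in> Ix" for js
    proof (rule tensor_iota[OF finite_right_words])
      fix R assume R: "coef (T (Eta 0) (r js)) R \<noteq> 0"
      then have "length R = length js" using coef_reg_lw_length by (fastforce simp: r_def)
      moreover have "nonX R"
        using R dl_X_reg[of "lw (map (tau 0) (r js))"] unfolding dl_X_eq_0_iff T.simps by blast
      ultimately show "R \<in> right_words m" using len[OF that] by (simp add: right_words_def)
    qed
    then have "(\<Sum>js\<in>Ix. tensor (iota 0 (seg js phi)) (iota 0 (T (Eta 0) (r js)))) =
        (\<Sum>js\<in>Ix. \<Sum>R\<in>right_words m. tensor (iota 0 (emb (coef (T (Eta 0) (r js)) R) * seg js phi)) (J 0 R))"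
      by (intro sum.cong refl)
    then show ?thesis by (subst (asm) sum.swap) (simp add: iota_sum tensor_sum)
  qed
  moreover have "(\<Sum>js\<in>Ix. emb (coef (T (Eta 0) (r js)) R) * seg js phi) = cs Zero bs R" for R
  proof -
    have "emb (coef (T (Eta 0) (r js)) R) * seg js phi = emb (lwf (map (tau 0) (r js)) R) * seg js phi"
      if js: "js \<in> Ix" for js
    proof (cases "r js = [] \<or> hd (r js) \<noteq> Zero")
      case True
      then show ?thesis by (simp add: reg_lw coef_lw)
    next
      case False
      then obtain j js' where j: "js = j # js'" "B ! j = Zero" by (cases js) (auto simp: r_def)
      then have jm: "1 \<le> j" "j \<le> m" using js by (auto simp: Ix_def)
      have "j \<noteq> 1"
      proof
        assume "j = 1"
        then have "B ! j = hd bs" "bs \<noteq> []" using jm by (auto simp: B_def m_def nth_append hd_conv_nth)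
        then show False using assms j by simp
      qed
      then have "[0 + 1..<j] \<noteq> []" using jm by simp
      then have "phi (B ! 0) (map (\<lambda>i. B ! i) [0 + 1..<j]) (B ! j) = 0"
        unfolding j(2) by (simp add: B_def phi_same unit_fun_def)
      then have "seg js phi = 0"
        unfolding seg_def Let_def by (intro prod_zero bexI[of _ 0]) (simp_all add: j)
      then show ?thesis by simp
    qed
    then have "(\<Sum>js\<in>Ix. emb (coef (T (Eta 0) (r js)) R) * seg js phi) =
        (\<Sum>js\<in>Ix. emb (lwf (map (tau 0) (r js)) R) * seg js phi)"
      by (intro sum.cong refl)
    also have "\<dots> = cs Zero bs R"
      using sum_segments[of bs Zero R] by (simp only: Let_def seg_def r_def Ix_def m_def B_def)
    finally show ?thesis .
  qed
  ultimately show ?thesis by (simp add: m_def)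
qed

lemma Delta_J:
  assumes "nonX W"
  shows "cong2 (Delta_mu_I (J 0 W)) (\<Sum>R\<in>right_words (length W). tensor (iota 0 (csF W R)) (J 0 R))"
proof -
  have "cong2 (four const W (\<lambda>bs. Delta_mu_I (II Zero bs (Eta 0))))
      (four const W (\<lambda>bs. \<Sum>R\<in>right_words (length W). tensor (iota 0 (cs Zero bs R)) (J 0 R)))"
  proof (rule cong2_four)
    fix bs assume s: "same_shape W bs"
    then have "bs = [] \<or> hd bs \<noteq> Zero"
      using assms by (cases W; cases bs) (simp_all add: same_shape_def)
    moreover have "length bs = length W"
      using s unfolding same_shape_def by (rule list_all2_lengthD[symmetric])
    ultimately show "cong2 (Delta_mu_I (II Zero bs (Eta 0)))
        (\<Sum>R\<in>right_words (length W). tensor (iota 0 (cs Zero bs R)) (J 0 R))"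
      using Delta_mu_I_II[of bs] by simp
  qed
  moreover have "four const W (\<lambda>bs. tensor (iota 0 (cs Zero bs R)) (J 0 R)) = tensor (iota 0 (csF W R)) (J 0 R)" for R
    unfolding csF_def
    by (rule four_hom[symmetric]) (simp_all add: iota_add iota_emb tensor_linear tensor_const)
  ultimately show ?thesis
    by (simp add: J_def Delta_mu_I_four four_sum)
qed

text \<open>\<open>rho 0\<close> is the map \<open>\<rho>\<close> of the paper and \<open>irho 0\<close> its inverse.\<close>

fun rho :: "'N::finite mod_ring \<Rightarrow> 'N mod_ring letter list \<Rightarrow> 'N mod_ring letter list" where
  "rho a [] = []" | "rho a (X # W) = X # rho a W" | "rho a (Y k # W) = Y (k - a) # rho k W"

fun irho :: "'N::finite mod_ring \<Rightarrow> 'N mod_ring letter list \<Rightarrow> 'N mod_ring letter list" where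
  "irho a [] = []" | "irho a (X # W) = X # irho a W" | "irho a (Y k # W) = Y (k + a) # irho (k + a) W"

lemma rho_irho [simp]: "rho a (irho a W) = W"
  by (induction a W rule: irho.induct) simp_all

lemma irho_rho [simp]: "irho a (rho a W) = W"
  by (induction a W rule: rho.induct) simp_all

lemma nonX_rho [simp]: "nonX (rho a W) = nonX W" "nonX (irho a W) = nonX W"
  by (cases W; cases "hd W"; simp)+

lemma length_rho [simp]: "length (rho a W) = length W"
  by (induction a W rule: rho.induct) simp_all

lemma rho_replicate [simp]: "rho a (replicate n X @ W) = replicate n X @ rho a W"
  by (induction n) simp_all

lemma four_replicate: "four \<kappa> (replicate n X @ W) f = four \<kappa> W (\<lambda>bs. f (replicate n Zero @ bs))"
  by (induction n arbitrary: f) simp_all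

text \<open>The differences of lower entries in the exponent of \<open>I_tilde_array\<close> are the
  letters of the word after \<open>rho\<close>. Each letter \<open>Y\<close> contributes
  \<open>- 1 / N\<close>, which gives the sign and the power of \<open>N\<close> in front.\<close>

lemma four_word_of:
  fixes v :: "'N::finite array"
  shows "four const (rho a (word_of X Y v)) f = const ((- 1) ^ length v / of_nat CARD('N) ^ length v) *
    (\<Sum>bs | length bs = length v. const (eta_cyc (\<Sum>i<length v. (snd (v ! i) - (if i = 0 then a else snd (v ! (i - 1)))) * bs ! i)) *
       (f (word_of Zero Eta (zip (map fst v) bs)) :: ('N, 'N cyclotomic) spoly))"
proof (induction v arbitrary: a f)
  case Nil
  have "{bs :: 'N mod_ring list. length bs = 0} = {[]}" by auto
  then show ?case by (simp add: const_hom)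
next
  case (Cons x v)
  obtain n a1 where x: "x = (n, a1)" by (cases x)
  define E where "E a v bs = (\<Sum>i<length v. (snd (v ! i) - (if i = 0 then a else snd (v ! (i - 1)))) * bs ! i)"
    for a and v :: "'N array" and bs
  define C where "C = (const ((- 1) ^ length v / of_nat CARD('N) ^ length v) :: ('N, 'N cyclotomic) spoly)"
  have E: "E a (x # v) (b # bs) = (a1 - a) * b + E a1 v bs" for b bs
  proof -
    have "(\<Sum>i<length v. (snd ((x # v) ! Suc i) - (if Suc i = 0 then a else snd ((x # v) ! (Suc i - 1)))) * (b # bs) ! Suc i) =
        E a1 v bs" unfolding E_def
      by (intro sum.cong refl) (auto simp: x nth_Cons' )
    then show ?thesis by (simp add: E_def x sum.lessThan_Suc_shift del: sum.lessThan_Suc)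
  qed
  have "four const (rho a (word_of X Y (x # v))) f = (\<Sum>b\<in>UNIV. const (- eta_cyc ((a1 - a) * b) / of_nat CARD('N)) *
      (C * (\<Sum>bs | length bs = length v. const (eta_cyc (E a1 v bs)) * f (Eta b # replicate (n - 1) Zero @ word_of Zero Eta (zip (map fst v) bs)))))"
    unfolding C_def E_def by (simp add: x four_replicate Cons.IH)
  also have "\<dots> = (\<Sum>b\<in>UNIV. \<Sum>bs | length bs = length v. const ((- 1) ^ length (x # v) / of_nat CARD('N) ^ length (x # v)) *
      (const (eta_cyc (E a (x # v) (b # bs))) * f (word_of Zero Eta (zip (map fst (x # v)) (b # bs)))))"
    unfolding sum_distrib_left
  proof (intro sum.cong refl)
    fix b bs
    have "- eta_cyc ((a1 - a) * b) / of_nat CARD('N) * ((- 1) ^ length v / of_nat CARD('N) ^ length v * eta_cyc (E a1 v bs)) =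
        (- 1) ^ length (x # v) / of_nat CARD('N) ^ length (x # v) * eta_cyc (E a (x # v) (b # bs))"
      by (simp add: E eta_cyc_add)
    from arg_cong[OF this, of "\<lambda>c. const c * f (word_of Zero Eta (zip (map fst (x # v)) (b # bs)))"]
    show "const (- eta_cyc ((a1 - a) * b) / of_nat CARD('N)) * (C * (const (eta_cyc (E a1 v bs)) *
        f (Eta b # replicate (n - 1) Zero @ word_of Zero Eta (zip (map fst v) bs)))) =
      const ((- 1) ^ length (x # v) / of_nat CARD('N) ^ length (x # v)) *
      (const (eta_cyc (E a (x # v) (b # bs))) * f (word_of Zero Eta (zip (map fst (x # v)) (b # bs))))"
      unfolding const_hom(2) C_def by (simp add: x mult.assoc)
  qed
  also have "\<dots> = const ((- 1) ^ length (x # v) / of_nat CARD('N) ^ length (x # v)) *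
      (\<Sum>bs | length bs = length (x # v). const (eta_cyc (E a (x # v) bs)) * f (word_of Zero Eta (zip (map fst (x # v)) bs)))"
    unfolding length_Cons sum_words_Suc sum_distrib_left ..
  finally show ?case unfolding E_def .
qed

lemma I_tilde_array_J: "I_tilde_array v = J 0 (rho 0 (word_of X Y v))"
  unfolding J_def four_word_of I_tilde_array_def scal_def I_array_word_of ..

section \<open>Words and arrays\<close>

lemma zgen_single: "zgen n a = Poly_Mapping.single (Word (Y a # replicate (n - 1) X)) 1"
proof -
  have "var X ^ k = (Poly_Mapping.single (Word (replicate k X)) 1 :: 'a H)" for k
    by (induction k) (simp_all add: var_def mult_single plus_xyword_def zero_xyword_def flip: single_one)
  then show ?thesis by (simp add: zgen_def var_def mult_single plus_xyword_def)
qed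

lemma prod_zgen: "prod_list (map (\<lambda>(n, a). zgen n a) v) = Poly_Mapping.single (Word (word_of X Y v)) 1"
proof (induction v)
  case Nil
  have "(1 :: 'a H) = Poly_Mapping.single (Word []) 1"
    using single_one[where ?'a = "'a mod_ring xyword" and ?'b = rat] by (simp add: zero_xyword_def)
  then show ?case by simp
qed (auto simp: zgen_single mult_single plus_xyword_def)

lemma word_of_X_inj:
  "is_array u \<Longrightarrow> is_array v \<Longrightarrow> word_of X Y u = word_of X Y v \<Longrightarrow> u = v"
proof (induction u arbitrary: v)
  case Nil
  then show ?case by (cases v) auto
next
  case (Cons x u)
  obtain n a where x: "x = (n, a)" by (cases x)
  obtain m b w where v: "v = (m, b) # w" using Cons.prems x by (cases v) auto
  have tw: "takeWhile (\<lambda>l. l = X) (replicate k X @ word_of X Y u) = replicate k X"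
    "dropWhile (\<lambda>l. l = X) (replicate k X @ word_of X Y u) = word_of X Y u" for k and u :: "'a array"
    using word_of_Cons[of X Y u] by (auto simp: takeWhile_append dropWhile_append)
  have e: "replicate (n - 1) X @ word_of X Y u = replicate (m - 1) X @ word_of X Y w" "a = b"
    using Cons.prems by (simp_all add: x v)
  have "n \<ge> 1" "m \<ge> 1" using Cons.prems by (simp_all add: x v)
  moreover have "n - 1 = m - 1" using arg_cong[OF e(1), of "\<lambda>l. length (takeWhile (\<lambda>l. l = X) l)"] by (simp only: tw length_replicate)
  ultimately have "n = m" by linarith
  moreover have "word_of X Y u = word_of X Y w" using arg_cong[OF e(1), of "dropWhile (\<lambda>l. l = X)"] by (simp only: tw)
  ultimately show ?case using Cons e(2) by (simp add: x v)
qed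

lemma array_of_Word: "is_array v \<Longrightarrow> array_of (Word (word_of X Y v)) = v"
proof -
  have inj: "Poly_Mapping.single (Word U) (1 :: rat) = Poly_Mapping.single (Word V) 1 \<longleftrightarrow> U = V" for U V :: "'a mod_ring letter list"
    by (metis keys_single singleton_inject xyword.inject zero_neq_one)
  assume v: "is_array v"
  show ?thesis unfolding array_of_def prod_zgen inj
    by (rule the_equality) (use v word_of_X_inj in auto)
qed

lemma ex_array_X:
  assumes "nonX W"
  shows "\<exists>v. is_array v \<and> word_of X Y v = W"
  by (rule ex_word_of) (use assms in \<open>auto simp: nonX_def intro: letter.exhaust\<close>)

lemma nonX_word_of [simp]: "nonX (word_of X Y v)"
  using word_of_Cons[of X Y v] by auto

lemma I_tilde_array_Word: "nonX W \<Longrightarrow> I_tilde_array (array_of (Word W)) = J 0 (rho 0 W)"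
  using ex_array_X[of W] by (auto simp: array_of_Word I_tilde_array_J)

definition H1_words :: "'N mod_ring xyword set" where
  "H1_words = {Word W | W. nonX W}"

lemma keys_subalgebra:
  assumes "p \<in> subalgebra G" "0 \<in> A" "\<And>u v. u \<in> A \<Longrightarrow> v \<in> A \<Longrightarrow> u + v \<in> A"
    "\<And>g. g \<in> G \<Longrightarrow> Poly_Mapping.keys g \<subseteq> A"
  shows "Poly_Mapping.keys p \<subseteq> A"
  using assms(1)
proof (induction rule: subalgebra.induct)
  case (const c)
  then show ?case using assms(2) by (simp add: const_def)
next
  case (add p q)
  then show ?case using Poly_Mapping.keys_add[of p q] by blast
next
  case (mult p q)
  have "Poly_Mapping.keys (p * q) \<subseteq> {a + b |a b. a \<in> Poly_Mapping.keys p \<and> b \<in> Poly_Mapping.keys q}"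
    by (rule keys_mult)
  then show ?case using mult.IH assms(3) by blast
qed (rule assms(4))

lemma keys_H1: "p \<in> H1 \<Longrightarrow> Poly_Mapping.keys p \<subseteq> H1_words"
  unfolding H1_def
proof (erule keys_subalgebra)
  show "0 \<in> H1_words" by (simp add: H1_words_def zero_xyword_def)
  fix u v :: "'a mod_ring xyword"
  assume "u \<in> H1_words" "v \<in> H1_words"
  then obtain U V where "u = Word U" "v = Word V" "nonX U" "nonX V" by (auto simp: H1_words_def)
  moreover from this have "nonX (U @ V)" by (cases U) auto
  ultimately show "u + v \<in> H1_words" by (auto simp: H1_words_def plus_xyword_def)
next
  fix g :: "'a H" assume "g \<in> {zgen n a |n a. 1 \<le> n}"
  then show "Poly_Mapping.keys g \<subseteq> H1_words"
    by (force simp: H1_words_def zgen_single)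
qed

lemma keys_H2:
  assumes "w \<in> H2" "u \<in> Poly_Mapping.keys w"
  shows "\<exists>v. u = Word (word_of X Y v) \<and> (\<forall>(n, a)\<in>set v. n \<ge> 2)"
proof -
  let ?A = "{Word (word_of X Y (v :: 'a array)) | v. \<forall>(n, a)\<in>set v. n \<ge> 2}"
  have "Poly_Mapping.keys w \<subseteq> ?A"
    using assms(1) unfolding H2_def
  proof (rule keys_subalgebra)
    show "0 \<in> ?A" by (auto simp: zero_xyword_def intro!: exI[of _ "[]"])
    fix u v :: "'a mod_ring xyword" assume "u \<in> ?A" "v \<in> ?A"
    then obtain u' v' where "u = Word (word_of X Y u')" "v = Word (word_of X Y v')"
      "\<forall>(n, a)\<in>set u'. n \<ge> 2" "\<forall>(n, a)\<in>set v'. n \<ge> 2" by blast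
    then show "u + v \<in> ?A" by (auto simp: plus_xyword_def intro!: exI[of _ "u' @ v'"])
  next
    fix g :: "'a H" assume "g \<in> {zgen n a |n a. 2 \<le> n}"
    then obtain n a where "g = zgen n a" "2 \<le> n" by blast
    then show "Poly_Mapping.keys g \<subseteq> ?A"
      by (auto simp: zgen_single intro!: exI[of _ "[(n, a)]"])
  qed
  then show ?thesis using assms(2) by blast
qed

lemma single_H1: "nonX W \<Longrightarrow> Poly_Mapping.single (Word W) c \<in> H1"
proof -
  assume "nonX W"
  then obtain v where v: "is_array v" "word_of X Y v = W" using ex_array_X by blast
  have "prod_list (map (\<lambda>(n, a). zgen n a) v) \<in> H1"
    using v(1) unfolding H1_def
  proof (induction v)
    case Nil
    have "const 1 \<in> subalgebra {zgen n a |n a. 1 \<le> n}" by (rule subalgebra.const)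
    then show ?case by (simp add: const_hom const_def flip: single_one)
  next
    case (Cons x v)
    obtain n a where x: "x = (n, a)" by (cases x)
    have "zgen n a \<in> {zgen n a |n a. 1 \<le> n}" using Cons.prems by (auto simp: x)
    moreover have "prod_list (map (\<lambda>(n, a). zgen n a) v) \<in> subalgebra {zgen n a |n a. 1 \<le> n}"
      using Cons by (simp add: x)
    ultimately have "zgen n a * prod_list (map (\<lambda>(n, a). zgen n a) v) \<in> subalgebra {zgen n a |n a. 1 \<le> n}"
      by (rule subalgebra.mult[OF subalgebra.gen])
    then show ?case by (simp add: x)
  qed
  then have "const c * Poly_Mapping.single (Word W) 1 \<in> H1"
    unfolding prod_zgen v(2) H1_def by (intro subalgebra.mult subalgebra.const)
  then show ?thesis by (simp add: const_def mult_single)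
qed

lemma keys_H1H1: "t \<in> H1H1 \<Longrightarrow> Poly_Mapping.keys t \<subseteq> H1_words \<times> H1_words"
  unfolding H1H1_def
proof (induction rule: module.span_induct_alt[OF module_scal, consumes 1])
  case (2 c x y)
  then obtain u v where x: "x = tensor u v" "u \<in> H1" "v \<in> H1" by blast
  have "Poly_Mapping.keys (scal c x) \<subseteq> H1_words \<times> H1_words"
  proof
    fix z assume z: "z \<in> Poly_Mapping.keys (scal c x)"
    obtain z1 z2 where zz: "z = (z1, z2)" by (cases z)
    have "z1 \<in> Poly_Mapping.keys u" "z2 \<in> Poly_Mapping.keys v"
      using z by (auto simp: zz x scal_def in_keys_iff lookup_const_mult lookup_tensor)
    then show "z \<in> H1_words \<times> H1_words" using keys_H1 x zz by auto
  qed
  then show ?case using 2 Poly_Mapping.keys_add[of "scal c x" y] by blast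
qed simp

lemma single_H1H1:
  assumes "nonX U" "nonX V"
  shows "Poly_Mapping.single (Word U, Word V) c \<in> H1H1"
proof -
  have "scal c (tensor (Poly_Mapping.single (Word U) 1) (Poly_Mapping.single (Word V) 1)) \<in> H1H1"
    unfolding H1H1_def using single_H1 assms
    by (intro module.span_scale[OF module_scal] module.span_base[OF module_scal]) blast
  then show ?thesis by (simp add: scal_def const_def tensor_single mult_single)
qed

lemma I_tilde_single: "nonX W \<Longrightarrow> I_tilde (Poly_Mapping.single (Word W) 1) = J 0 (rho 0 W)"
  by (simp add: I_tilde_def scal_def const_hom I_tilde_array_Word)

section \<open>Existence and uniqueness of the coproduct\<close>

text \<open>Applies \<open>Phi\<close> to both tensor factors and reads off one coefficient. It is
  written on representatives and vanishes on the ideal by \<open>Psi_I0I0\<close>.\<close>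

definition Psi :: "('N::finite, 'N cyclotomic) spoly2 \<Rightarrow> 'N mod_ring letter list \<Rightarrow> 'N mod_ring letter list \<Rightarrow> 'N cyclotomic" where
  "Psi s U V = (\<Sum>x\<in>Poly_Mapping.keys s. Poly_Mapping.lookup s x *
     (coef (Phi (Poly_Mapping.single (fst x) 1)) U * coef (Phi (Poly_Mapping.single (snd x) 1)) V))"

lemma Psi_add: "Psi (s + t) U V = Psi s U V + Psi t U V"
  unfolding Psi_def by (rule sum_keys_add) (simp_all add: distrib_right)

lemma Psi_0 [simp]: "Psi 0 U V = 0" by (simp add: Psi_def)

lemma Phi_single: "Phi (Poly_Mapping.single M c) = emb c * Phi (Poly_Mapping.single M 1)"
  by (simp add: Phi.ev_single emb_hom)

lemma Psi_single: "Psi (Poly_Mapping.single (M, M') c) U V =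
    c * (coef (Phi (Poly_Mapping.single M 1)) U * coef (Phi (Poly_Mapping.single M' 1)) V)"
  by (simp add: Psi_def)

lemma Psi_tensor: "Psi (tensor p q) U V = coef (Phi p) U * coef (Phi q) V"
proof (induction p rule: poly_mapping_induct)
  case (add M a p)
  have "Psi (tensor (Poly_Mapping.single M a) q) U V = coef (Phi (Poly_Mapping.single M a)) U * coef (Phi q) V"
  proof (induction q rule: poly_mapping_induct)
    case (add M' b q)
    then show ?case
      by (simp add: tensor_linear Psi_add tensor_single Psi_single Phi.ev_add distrib_left
          Phi_single[of M a] Phi_single[of M' b] mult_ac)
  qed (simp add: tensor_linear Phi.ev_0)
  with add show ?case by (simp add: tensor_linear Psi_add Phi.ev_add distrib_right)
qed (simp add: tensor_linear Phi.ev_0)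

lemma Psi_I0I0: "s \<in> I0I0_ideal \<Longrightarrow> Psi s U V = 0"
  unfolding I0I0_ideal_def ideal_generated_def
proof (induction rule: module.span_induct_alt[OF module_mult, consumes 1])
  case (2 c x y)
  have "Psi (c * x) U V = 0"
  proof (induction c rule: poly_mapping_induct)
    case (add M d c)
    obtain M1 M2 where M: "M = (M1, M2)" by (cases M)
    have s: "Poly_Mapping.single M d = tensor (Poly_Mapping.single M1 d) (Poly_Mapping.single M2 1)"
      by (simp add: M tensor_single)
    have "Psi (Poly_Mapping.single M d * x) U V = 0"
      using 2(1) unfolding s by (auto simp: tensor_mult Psi_tensor Phi.ev_mult Phi_I0_ideal)
    then show ?case using add by (simp add: distrib_right Psi_add)
  qed simp
  then show ?case using 2 by (simp add: Psi_add)
qed simp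

lemma Phi_J: "Phi (J 0 W) = reg (delta W)"
proof -
  have "Phi (J 0 W) = four emb W (\<lambda>bs. Phi (II Zero bs (Eta 0)))"
    unfolding J_def by (rule four_hom) (simp_all add: Phi.ev_add Phi.ev_0 Phi.ev_mult Phi.ev_const)
  also have "\<dots> = four emb W (T (Eta 0))" by (simp add: phi_Zero del: T.simps)
  finally show ?thesis by (simp add: four_T emb_hom del: T.simps)
qed

text \<open>The words \<open>rho 0 U\<close> have no leading \<open>X\<close>, so \<open>Phi\<close>
  gives them back unchanged and the coefficients of \<open>t\<close> can be read off. This is the
  linear independence of the \<open>I_tilde_array v\<close>, in both factors.\<close>

lemma Psi_tensor_map:
  assumes "t \<in> H1H1" "nonX U" "nonX V"
  shows "Psi (tensor_map of_rat I_tilde I_tilde t) (rho 0 U) (rho 0 V) = of_rat (Poly_Mapping.lookup t (Word U, Word V))"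
proof -
  have inj: "rho 0 U = rho 0 U' \<longleftrightarrow> U = U'" for U U' :: "'a mod_ring letter list"
    by (metis irho_rho)
  have sum: "Psi (sum f A) P Q = (\<Sum>x\<in>A. Psi (f x) P Q)" for f :: "_ \<Rightarrow> ('a, 'a cyclotomic) spoly2" and A P Q
    by (induction A rule: infinite_finite_induct) (simp_all add: Psi_add)
  have sc: "Psi (const c * tensor p q) P Q = c * Psi (tensor p q) P Q" for c P Q and p q :: "('a, 'a cyclotomic) spoly"
    unfolding tensor_const(1)[symmetric] Psi_tensor by (simp add: Phi.ev_mult Phi.ev_const)
  have "Psi (tensor_map of_rat I_tilde I_tilde t) (rho 0 U) (rho 0 V) =
      (\<Sum>x\<in>Poly_Mapping.keys t. of_rat (Poly_Mapping.lookup t x) *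
        Psi (tensor (I_tilde (Poly_Mapping.single (fst x) 1)) (I_tilde (Poly_Mapping.single (snd x) 1))) (rho 0 U) (rho 0 V))"
    unfolding tensor_map_def scal_def by (simp add: sum sc case_prod_beta)
  also have "\<dots> = (\<Sum>x\<in>Poly_Mapping.keys t. if x = (Word U, Word V) then of_rat (Poly_Mapping.lookup t x) else 0)"
  proof (rule sum.cong)
    fix x assume "x \<in> Poly_Mapping.keys t"
    then have "x \<in> H1_words \<times> H1_words" using keys_H1H1[OF assms(1)] by blast
    then obtain U' V' where x: "x = (Word U', Word V')" "nonX U'" "nonX V'" by (auto simp: H1_words_def)
    show "of_rat (Poly_Mapping.lookup t x) *
        Psi (tensor (I_tilde (Poly_Mapping.single (fst x) 1)) (I_tilde (Poly_Mapping.single (snd x) 1))) (rho 0 U) (rho 0 V) =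
      (if x = (Word U, Word V) then of_rat (Poly_Mapping.lookup t x) else 0)"
      by (auto simp: x I_tilde_single Psi_tensor Phi_J reg_delta coef_delta inj)
  qed simp
  also have "\<dots> = of_rat (Poly_Mapping.lookup t (Word U, Word V))"
    by (simp add: sum.delta' in_keys_iff)
  finally show ?thesis .
qed

text \<open>Makes the definite description usable: it suffices to exhibit a tensor with the right
  image.\<close>

lemma Delta_mu_unique:
  assumes "t \<in> H1H1" "cong2 (tensor_map of_rat I_tilde I_tilde t) (Delta_mu_I (I_tilde w))"
  shows "Delta_mu w = t"
  unfolding Delta_mu_def
proof (rule the_equality)
  show "t \<in> H1H1 \<and> tensor_map of_rat I_tilde I_tilde t - Delta_mu_I (I_tilde w) \<in> I0I0_ideal"
    using assms by (simp add: cong2_def)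
next
  fix t' assume t': "t' \<in> H1H1 \<and> tensor_map of_rat I_tilde I_tilde t' - Delta_mu_I (I_tilde w) \<in> I0I0_ideal"
  then have "cong2 (tensor_map of_rat I_tilde I_tilde t') (tensor_map of_rat I_tilde I_tilde t)"
    using cong2_trans[OF _ cong2_sym[OF assms(2)]] by (simp add: cong2_def)
  then have eq: "Psi (tensor_map of_rat I_tilde I_tilde t') U V = Psi (tensor_map of_rat I_tilde I_tilde t) U V" for U V
    unfolding cong2_def using Psi_I0I0 Psi_add[of "_ - _" "tensor_map of_rat I_tilde I_tilde t"]
    by (metis add_0 diff_add_cancel)
  show "t' = t"
  proof (rule tensor_eqI)
    fix u v
    show "Poly_Mapping.lookup t' (u, v) = Poly_Mapping.lookup t (u, v)"
    proof (cases "u \<in> H1_words \<and> v \<in> H1_words")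
      case True
      then obtain U V where "u = Word U" "v = Word V" "nonX U" "nonX V" by (auto simp: H1_words_def)
      then show ?thesis
        using eq[of "rho 0 U" "rho 0 V"] Psi_tensor_map[of t' U V] Psi_tensor_map[of t U V] assms(1) t' by simp
    next
      case False
      then have "(u, v) \<notin> Poly_Mapping.keys t" "(u, v) \<notin> Poly_Mapping.keys t'"
        using keys_H1H1 assms(1) t' by blast+
      then show ?thesis by (simp add: in_keys_iff)
    qed
  qed
qed

section \<open>Closure properties of the coefficients; the explicit coproduct\<close>

lemma split_sum_closed:
  assumes "0 \<in> A" "\<And>x y. x \<in> A \<Longrightarrow> y \<in> A \<Longrightarrow> x + y \<in> A" "\<And>u v. w = u @ v \<Longrightarrow> f u v \<in> A"
  shows "split_sum f w \<in> A"
  using assms(3)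
proof (induction w arbitrary: f)
  case (Cons a w)
  then have "f [] (a # w) \<in> A" "split_sum (\<lambda>u. f (a # u)) w \<in> A" by simp_all
  then show ?case using assms(2) by simp
qed simp

lemma pick_sum_closed:
  assumes "0 \<in> A" "\<And>x y. x \<in> A \<Longrightarrow> y \<in> A \<Longrightarrow> x + y \<in> A" "\<And>u d v. w = u @ d # v \<Longrightarrow> h u d v \<in> A"
  shows "pick_sum h w \<in> A"
  using assms(3)
proof (induction w arbitrary: h)
  case (Cons a w)
  then have "h [] a w \<in> A" "pick_sum (\<lambda>u. h (a # u)) w \<in> A" by simp_all
  then show ?case using assms(2) by simp
qed (simp add: assms(1))

text \<open>One induction for three uses: no words with leading \<open>X\<close>, rational
  coefficients, and admissibility. \<open>P\<close> passes to suffixes and governs the pieces that a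
  cut produces: those before a letter \<open>Y\<close>, and the reversed ones after it.\<close>

lemma csF_closed:
  assumes A: "0 \<in> A" "1 \<in> A" "- 1 \<in> A" "\<And>x y. x \<in> A \<Longrightarrow> y \<in> A \<Longrightarrow> x + y \<in> A"
    "\<And>x y. x \<in> A \<Longrightarrow> y \<in> A \<Longrightarrow> x * y \<in> A"
    and P: "\<And>U V. P (U @ V) \<Longrightarrow> P V" "\<And>V. P V \<Longrightarrow> reg (delta V) \<in> A"
      "\<And>U k V. P (U @ Y k # V) \<Longrightarrow> reg (delta U) \<in> A"
      "\<And>k U V. P (Y k # U @ V) \<Longrightarrow> reg (delta (rev U)) \<in> A"
    and W: "P W"
  shows "csF W R \<in> A"
  using W
proof (induction R arbitrary: W)
  case Nil
  then show ?case by (simp add: csF_Nil P)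
next
  case (Cons l R)
  have sg: "(- 1) ^ n \<in> A" for n :: nat by (induction n) (use A(2) A(5)[OF A(3)] in auto)
  show ?case
  proof (cases l)
    case X
    have "P W' \<Longrightarrow> csF W' R \<in> A" for W' by (rule Cons.IH)
    then show ?thesis using Cons.prems P(1)[of "[X]"] A(1)
      by (auto simp: X csF_X split: list.split letter.split)
  next
    case (Y k)
    show ?thesis unfolding Y csF_Y
    proof (rule pick_sum_closed[OF A(1,4)])
      fix U l V assume W: "W = U @ l # V"
      show "(case l of X \<Rightarrow> 0 | Y \<kappa> \<Rightarrow>
          split_sum (\<lambda>U' V'. if cont U + \<kappa> + cont U' = k
            then (- 1) ^ length U' * (reg (delta U) * reg (delta (rev U'))) * csF V' R else 0) V) \<in> A"
      proof (cases l)
        case (Y \<kappa>)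
        have "split_sum (\<lambda>U' V'. if cont U + \<kappa> + cont U' = k
            then (- 1) ^ length U' * (reg (delta U) * reg (delta (rev U'))) * csF V' R else 0) V \<in> A"
        proof (rule split_sum_closed[OF A(1,4)])
          fix U' V' assume V: "V = U' @ V'"
          have "P (Y \<kappa> # U' @ V')" using Cons.prems P(1)[of U] by (simp add: W Y V)
          moreover have "P V'" using Cons.prems P(1)[of "U @ Y \<kappa> # U'"] by (simp add: W Y V)
          moreover have "reg (delta U) \<in> A" using Cons.prems P(3)[of U \<kappa> V] by (simp add: W Y)
          ultimately show "(if cont U + \<kappa> + cont U' = k
              then (- 1) ^ length U' * (reg (delta U) * reg (delta (rev U'))) * csF V' R else 0) \<in> A"
            using Cons.IH[of V'] P(4)[of \<kappa> U' V'] A(1) by (auto intro!: A(5) sg)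
        qed
        then show ?thesis by (simp add: Y)
      qed (simp add: A(1))
    qed
  qed
qed

lemma nonX_csF: "coef (csF W R) U \<noteq> 0 \<Longrightarrow> nonX U"
proof -
  have "csF W R \<in> {f. dl X f = 0}"
    by (rule csF_closed[where P = "\<lambda>_. True"]) (simp_all add: dl_mult dl_X_reg)
  then show "coef (csF W R) U \<noteq> 0 \<Longrightarrow> nonX U" by (simp add: dl_X_eq_0_iff)
qed

text \<open>The recursion of \<open>csF\<close> and that of \<open>reg\<close> involve only
  integers; the roots of unity have been summed out in \<open>csF_Y\<close>.\<close>

lemma rational_csF: "coef (csF W R) U \<in> \<rat>"
proof -
  let ?A = "{f :: 'a shalg. \<forall>U. coef f U \<in> \<rat>}"
  have "csF W R \<in> ?A"
  proof (rule csF_closed[where P = "\<lambda>_. True"])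
    fix f g :: "'a shalg" assume "f \<in> ?A" "g \<in> ?A"
    then show "f * g \<in> ?A"
    proof (simp, intro allI)
      fix w show "\<lbrakk>\<forall>U. coef f U \<in> \<rat>; \<forall>U. coef g U \<in> \<rat>\<rbrakk> \<Longrightarrow> coef (f * g) w \<in> \<rat>"
      proof (induction w arbitrary: f g)
        case (Cons a w)
        then have "coef (dl a f * g) w \<in> \<rat>" "coef (f * dl a g) w \<in> \<rat>" by simp_all
        then show ?case by (simp add: coef_mult_Cons)
      qed simp
    qed
  next
    fix V :: "'a mod_ring letter list"
    have "\<forall>U. coef f U \<in> \<rat> \<Longrightarrow> coef (reg f) w \<in> \<rat>" for f :: "'a shalg" and w
    proof (induction w arbitrary: f rule: rev_induct)
      case (snoc l w)
      then have "\<forall>U. coef (rd l f) U \<in> \<rat>" by (simp add: rd_def)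
      then show ?case using snoc.IH by (simp add: coef_reg_snoc)
    qed simp
    then show "reg (delta V) \<in> ?A" "reg (delta V) \<in> ?A" "reg (delta (rev V)) \<in> ?A"
      by (simp_all add: coef_delta)
  qed auto
  then show ?thesis by simp
qed

definition to_rat :: "'N::finite cyclotomic \<Rightarrow> rat" where
  "to_rat c = (SOME r. of_rat r = c)"

lemma of_rat_to_rat: "c \<in> \<rat> \<Longrightarrow> of_rat (to_rat c) = c"
  unfolding to_rat_def by (rule someI_ex) (auto elim: Rats_cases)

text \<open>\<open>U\<close> and \<open>R\<close> are written in differences of lower entries;
  \<open>irho 0\<close> returns to the words of \<open>H1\<close>.\<close>

definition word_coproduct :: "'N::finite mod_ring letter list \<Rightarrow> 'N HH" where
  "word_coproduct W = (\<Sum>R\<in>right_words (length W). \<Sum>U | coef (csF (rho 0 W) R) U \<noteq> 0.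
     Poly_Mapping.single (Word (irho 0 U), Word (irho 0 R)) (to_rat (coef (csF (rho 0 W) R) U)))"

lemma H1H1_sum: "(\<And>x. x \<in> A \<Longrightarrow> f x \<in> H1H1) \<Longrightarrow> sum f A \<in> H1H1"
  unfolding H1H1_def by (rule module.span_sum[OF module_scal])

lemma word_coproduct_H1H1: "word_coproduct W \<in> H1H1"
  unfolding word_coproduct_def
  by (intro H1H1_sum single_H1H1) (auto simp: right_words_def dest: nonX_csF)

lemma tensor_map_word_coproduct:
  assumes "nonX W"
  shows "cong2 (tensor_map of_rat I_tilde I_tilde (word_coproduct W)) (Delta_mu_I (J 0 (rho 0 W)))"
proof -
  have "tensor_map of_rat I_tilde I_tilde (word_coproduct W) =
     (\<Sum>R\<in>right_words (length W). \<Sum>U | coef (csF (rho 0 W) R) U \<noteq> 0.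
       const (coef (csF (rho 0 W) R) U) * tensor (J 0 U) (J 0 R))"
    unfolding word_coproduct_def
    by (simp add: tensor_map_sum[of of_rat] of_rat_add tensor_map_single rational_csF of_rat_to_rat)
      (intro sum.cong refl arg_cong2[where f = "(*)"] arg_cong2[where f = tensor]; force simp: I_tilde_single right_words_def dest: nonX_csF)
  also have "\<dots> = (\<Sum>R\<in>right_words (length W). tensor (iota 0 (csF (rho 0 W) R)) (J 0 R))"
    unfolding iota_def by (simp add: tensor_sum tensor_const)
  finally show ?thesis using Delta_J[of "rho 0 W"] assms by (simp add: cong2_sym)
qed

lemma Delta_mu_H1:
  assumes "Poly_Mapping.keys w \<subseteq> H1_words"
  shows "Delta_mu w = (\<Sum>u\<in>Poly_Mapping.keys w. scal (Poly_Mapping.lookup w u) (word_coproduct (letters u)))"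
proof (rule Delta_mu_unique)
  let ?t = "\<lambda>u. word_coproduct (letters u)"
  show "(\<Sum>u\<in>Poly_Mapping.keys w. scal (Poly_Mapping.lookup w u) (?t u)) \<in> H1H1"
  proof (rule H1H1_sum)
    fix u show "scal (Poly_Mapping.lookup w u) (?t u) \<in> H1H1"
      using word_coproduct_H1H1 unfolding H1H1_def by (rule module.span_scale[OF module_scal])
  qed
  have sc: "tensor_map of_rat I_tilde I_tilde (scal c t) = const (of_rat c) * tensor_map of_rat I_tilde I_tilde t"
    for c and t :: "'a HH"
  proof (induction t rule: poly_mapping_induct)
    case (add uv d t)
    obtain u v where uv: "uv = (u, v)" by (cases uv)
    have "scal c (Poly_Mapping.single uv d + t) = Poly_Mapping.single (u, v) (c * d) + scal c t"
      by (simp add: scal_def distrib_left const_def mult_single uv)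
    then show ?case using add
      by (simp add: uv distrib_left tensor_map_add[of of_rat] of_rat_add of_rat_mult tensor_map_single const_hom mult.assoc)
  qed (simp add: scal_def)
  have "tensor_map of_rat I_tilde I_tilde (\<Sum>u\<in>Poly_Mapping.keys w. scal (Poly_Mapping.lookup w u) (?t u)) =
      (\<Sum>u\<in>Poly_Mapping.keys w. const (of_rat (Poly_Mapping.lookup w u)) * tensor_map of_rat I_tilde I_tilde (?t u))"
    by (simp add: tensor_map_sum[of of_rat] of_rat_add sc)
  moreover have "Delta_mu_I (I_tilde w) =
      (\<Sum>u\<in>Poly_Mapping.keys w. const (of_rat (Poly_Mapping.lookup w u)) * Delta_mu_I (I_tilde_array (array_of u)))"
    by (simp add: I_tilde_def scal_def Delta_mu_I_sum Delta_mu_I_const)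
  moreover have "cong2 (tensor_map of_rat I_tilde I_tilde (?t u)) (Delta_mu_I (I_tilde_array (array_of u)))"
    if u: "u \<in> Poly_Mapping.keys w" for u
  proof -
    have "u \<in> H1_words" using assms u by blast
    then obtain W where "u = Word W" "nonX W" by (auto simp: H1_words_def)
    then show ?thesis using tensor_map_word_coproduct[of W] by (simp add: I_tilde_array_Word)
  qed
  ultimately show "cong2 (tensor_map of_rat I_tilde I_tilde (\<Sum>u\<in>Poly_Mapping.keys w. scal (Poly_Mapping.lookup w u) (?t u)))
      (Delta_mu_I (I_tilde w))"
    by (simp add: cong2_sum cong2_mult)
qed

section \<open>The convolution as a sum over right words\<close>

lemma Rep_cyclotomic_hom: "Rep_cyclotomic 0 = 0" "Rep_cyclotomic 1 = 1"
  "Rep_cyclotomic (a + b) = Rep_cyclotomic a + Rep_cyclotomic b"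
  "Rep_cyclotomic (a * b) = Rep_cyclotomic a * Rep_cyclotomic b"
  "Rep_cyclotomic (- a) = - Rep_cyclotomic a"
  "Rep_cyclotomic (a / b) = Rep_cyclotomic a / Rep_cyclotomic b"
  by (simp_all add: zero_cyclotomic.rep_eq one_cyclotomic.rep_eq plus_cyclotomic.rep_eq
      times_cyclotomic.rep_eq uminus_cyclotomic.rep_eq divide_cyclotomic.rep_eq)

lemma Rep_cyclotomic_of_rat: "Rep_cyclotomic (of_rat r) = of_rat r"
proof (cases r)
  case (Fract a b)
  have n: "Rep_cyclotomic (of_nat n :: 'a cyclotomic) = of_nat n" for n
    by (induction n) (simp_all add: Rep_cyclotomic_hom)
  have "Rep_cyclotomic (of_int z :: 'a cyclotomic) = of_int z" for z
    by (cases z) (simp_all add: n Rep_cyclotomic_hom minus_cyclotomic.rep_eq)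
  then show ?thesis using Fract by (simp add: of_rat_rat Rep_cyclotomic_hom)
qed

text \<open>Zeta values on the model, with words in difference form; meaningful on combinations of
  convergent words.\<close>

definition zeta_sh :: "'N::finite shalg \<Rightarrow> complex" where
  "zeta_sh f = (\<Sum>U | coef f U \<noteq> 0. Rep_cyclotomic (coef f U) * zeta_array (array_of (Word (irho 0 U))))"

lemma zeta_star_g_H1:
  assumes "Poly_Mapping.keys w \<subseteq> H1_words"
  shows "zeta_star_g w = (\<Sum>u\<in>Poly_Mapping.keys w. fps_const (of_rat (Poly_Mapping.lookup w u)) *
    (\<Sum>R\<in>right_words (length (letters u)).
      fps_const (zeta_sh (csF (rho 0 (letters u)) R)) * g_array (array_of (Word (irho 0 R)))))"
proof -
  define zs where "zs t = (\<Sum>x\<in>Poly_Mapping.keys t. fps_const (of_rat (Poly_Mapping.lookup t x)) *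
       (fps_const (of_real (zeta (Poly_Mapping.single (fst x) 1))) * g_fps (Poly_Mapping.single (snd x) 1)))"
    for t :: "'a HH"
  have z: "zeta_star_g w = zs (Delta_mu w)"
    by (simp add: zeta_star_g_def zs_def case_prod_beta Let_def)
  have zs_add: "zs (s + t) = zs s + zs t" for s t
    unfolding zs_def by (rule sum_keys_add) (simp_all add: of_rat_add distrib_right fps_const_add[symmetric] del: fps_const_add)
  have zs_single: "zs (Poly_Mapping.single (u, v) c) = fps_const (of_rat c) *
      (fps_const (of_real (zeta_array (array_of u))) * g_array (array_of v))" for u v c
    by (simp add: zs_def zeta_def g_fps_def)
  have zs_0: "zs 0 = 0" by (simp add: zs_def)
  have zs_sum: "zs (sum f A) = (\<Sum>x\<in>A. zs (f x))" for f :: "'b \<Rightarrow> 'a HH" and A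
    by (induction A rule: infinite_finite_induct) (simp_all add: zs_0 zs_add)
  have zs_sum': "zs (sum f A) = (\<Sum>x\<in>A. zs (f x))" for f :: "'a mod_ring letter list \<Rightarrow> 'a HH" and A
    by (induction A rule: infinite_finite_induct) (simp_all add: zs_0 zs_add)
  have zs_sum'': "zs (sum f A) = (\<Sum>x\<in>A. zs (f x))" for f :: "'a mod_ring xyword \<Rightarrow> 'a HH" and A
    by (induction A rule: infinite_finite_induct) (simp_all add: zs_0 zs_add)
  have zs_scal: "zs (scal c t) = fps_const (of_rat c) * zs t" for c t
  proof (induction t rule: poly_mapping_induct)
    case (add uv d t)
    obtain u v where uv: "uv = (u, v)" by (cases uv)
    have "scal c (Poly_Mapping.single uv d + t) = Poly_Mapping.single (u, v) (c * d) + scal c t"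
      by (simp add: scal_def distrib_left const_def mult_single uv)
    then show ?case using add
      by (simp add: uv zs_add zs_single distrib_left of_rat_mult fps_const_mult[symmetric] mult.assoc del: fps_const_mult)
  qed (simp add: scal_def zs_0)
  have wc: "zs (word_coproduct W) = (\<Sum>R\<in>right_words (length W).
      fps_const (zeta_sh (csF (rho 0 W) R)) * g_array (array_of (Word (irho 0 R))))" for W
  proof -
    have r: "of_rat (to_rat c) = Rep_cyclotomic c" if "c \<in> \<rat>" for c :: "'a cyclotomic"
      using arg_cong[OF of_rat_to_rat[OF that], of Rep_cyclotomic] by (simp add: Rep_cyclotomic_of_rat)
    have s: "fps_const (sum f A) = (\<Sum>x\<in>A. fps_const (f x))" for f :: "'a mod_ring letter list \<Rightarrow> complex" and A
      by (induction A rule: infinite_finite_induct) (simp_all add: fps_const_add[symmetric] del: fps_const_add)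
    show ?thesis unfolding word_coproduct_def zeta_sh_def
      by (simp add: zs_sum' zs_single r rational_csF s sum_distrib_right mult.assoc[symmetric])
  qed
  show ?thesis unfolding z Delta_mu_H1[OF assms] by (simp add: zs_sum'' zs_scal wc)
qed

section \<open>Nested sums\<close>

text \<open>Sum over chains in \<open>A\<close> above \<open>p\<close>, with one function for each
  member; the smallest member is the outermost summation variable.\<close>

fun nest :: "('p \<Rightarrow> 'p \<Rightarrow> bool) \<Rightarrow> 'p set \<Rightarrow> 'p \<Rightarrow> ('p \<Rightarrow> 'r::comm_ring_1) list \<Rightarrow> 'r" where
  "nest lt A p [] = 1"
| "nest lt A p (f # fs) = (\<Sum>q\<in>{q\<in>A. lt p q}. f q * nest lt A q fs)"

lemma sum_sorted_lists:
  assumes "transp lt" "finite A"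
  shows "(\<Sum>ps\<in>{ps. length ps = length fs \<and> sorted_wrt lt (p # ps) \<and> set ps \<subseteq> A}.
    \<Prod>i<length fs. (fs ! i) (ps ! i)) = nest lt A p fs"
proof (induction fs arbitrary: p)
  case Nil
  have "{ps. length ps = length ([] :: ('a \<Rightarrow> 'b) list) \<and> sorted_wrt lt (p # ps) \<and> set ps \<subseteq> A} = {[]}" by auto
  then show ?case by simp
next
  case (Cons f fs)
  define Lset where "Lset n p = {ps. length ps = n \<and> sorted_wrt lt (p # ps) \<and> set ps \<subseteq> A}" for n p
  have fin: "finite (Lset n p)" for n p
    by (rule finite_subset[OF _ finite_lists_length_eq[OF assms(2), of n]]) (auto simp: Lset_def)
  have "Lset (length (f # fs)) p = (\<lambda>(q, ps). q # ps) ` Sigma {q\<in>A. lt p q} (Lset (length fs))"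
  proof (intro equalityI subsetI)
    fix ps assume ps: "ps \<in> Lset (length (f # fs)) p"
    then obtain q qs where q: "ps = q # qs" by (auto simp: Lset_def length_Suc_conv)
    then have "(q, qs) \<in> Sigma {q\<in>A. lt p q} (Lset (length fs))" using ps by (auto simp: Lset_def)
    then show "ps \<in> (\<lambda>(q, ps). q # ps) ` Sigma {q\<in>A. lt p q} (Lset (length fs))" using q by force
  next
    fix ps assume "ps \<in> (\<lambda>(q, ps). q # ps) ` Sigma {q\<in>A. lt p q} (Lset (length fs))"
    then obtain q qs where q: "ps = q # qs" "q \<in> A" "lt p q" "qs \<in> Lset (length fs) q" by auto
    then show "ps \<in> Lset (length (f # fs)) p"
      using sorted_wrt2[OF assms(1), of p q qs] by (simp add: Lset_def del: sorted_wrt.simps)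
  qed
  then have "(\<Sum>ps\<in>Lset (length (f # fs)) p. \<Prod>i<length (f # fs). ((f # fs) ! i) (ps ! i)) =
      (\<Sum>ps\<in>(\<lambda>(q, ps). q # ps) ` Sigma {q\<in>A. lt p q} (Lset (length fs)). \<Prod>i<length (f # fs). ((f # fs) ! i) (ps ! i))"
    by (rule arg_cong)
  also have "\<dots> = (\<Sum>x\<in>Sigma {q\<in>A. lt p q} (Lset (length fs)). \<Prod>i<length (f # fs). ((f # fs) ! i) ((case x of (q, ps) \<Rightarrow> q # ps) ! i))"
    by (subst sum.reindex) (auto simp: inj_on_def)
  also have "\<dots> = (\<Sum>(q, ps)\<in>Sigma {q\<in>A. lt p q} (Lset (length fs)). f q * (\<Prod>i<length fs. (fs ! i) (ps ! i)))"
    by (rule sum.cong) (auto simp: prod.lessThan_Suc_shift simp del: prod.lessThan_Suc)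
  also have "\<dots> = (\<Sum>q\<in>{q\<in>A. lt p q}. \<Sum>ps\<in>Lset (length fs) q. f q * (\<Prod>i<length fs. (fs ! i) (ps ! i)))"
    by (rule sum.Sigma[symmetric]) (use assms(2) fin in auto)
  also have "\<dots> = nest lt A p (f # fs)"
    by (simp add: sum_distrib_left[symmetric] Cons.IH[unfolded Lset_def[symmetric]])
  finally show ?case by (simp only: Lset_def)
qed

abbreviation inZ :: "int \<Rightarrow> 'N::finite mod_ring \<Rightarrow> bool" where
  "inZ m b \<equiv> of_int_mod_ring m = b"

text \<open>Sum over increasing levels above \<open>d0\<close> and up to \<open>L\<close>, where
  every level that occurs takes a nonempty block of the list and \<open>psi B d\<close> is the
  contribution of block \<open>B\<close> on level \<open>d\<close>. Both the Eisenstein sums and the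
  convolution are brought into this form.\<close>

function XX :: "('a list \<Rightarrow> int \<Rightarrow> 'r::comm_ring_1) \<Rightarrow> int \<Rightarrow> int \<Rightarrow> 'a list \<Rightarrow> 'r" where
  "XX psi L d0 w = (if w = [] then 1 else \<Sum>d\<in>{d0<..L}. \<Sum>i\<in>{1..length w}.
     psi (take i w) d * XX psi L d (drop i w))"
  by pat_completeness auto
termination by (relation "Wellfounded.measure (\<lambda>(psi, L, d0, w). length w)") auto

declare XX.simps [simp del]

lemma XX_Nil [simp]: "XX psi L d0 [] = 1" by (simp add: XX.simps)

lemma XX_nonempty:
  assumes "w \<noteq> []"
  shows "XX psi L d0 w = (\<Sum>d\<in>{d0<..L}. split_sum (\<lambda>B V. if B = [] then 0 else psi B d * XX psi L d V) w)"
proof -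
  have "split_sum (\<lambda>B V. if B = [] then 0 else psi B d * XX psi L d V) w =
      (\<Sum>i\<in>{1..length w}. psi (take i w) d * XX psi L d (drop i w))" for d
  proof -
    have "split_sum (\<lambda>B V. if B = [] then 0 else psi B d * XX psi L d V) w =
        (\<Sum>i\<in>{..length w}. if i = 0 then 0 else psi (take i w) d * XX psi L d (drop i w))"
      unfolding split_sum_atMost using assms by (intro sum.cong refl) auto
    also have "\<dots> = (\<Sum>i\<in>{1..length w}. psi (take i w) d * XX psi L d (drop i w))"
      by (rule sum.mono_neutral_cong_right) auto
    finally show ?thesis .
  qed
  then show ?thesis using assms by (subst XX.simps) simp
qed

lemma tendsto_XX:
  fixes psi :: "nat \<Rightarrow> 'a list \<Rightarrow> int \<Rightarrow> complex"
  assumes "\<And>B d. B \<noteq> [] \<Longrightarrow> set B \<subseteq> set w \<Longrightarrow> d > d0 \<Longrightarrow> (\<lambda>M. psi M B d) \<longlonglongrightarrow> psi' B d"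
  shows "(\<lambda>M. XX (psi M) L d0 w) \<longlonglongrightarrow> XX psi' L d0 w"
  using assms
proof (induction w arbitrary: d0 rule: length_induct)
  case (1 w)
  show ?case
  proof (cases "w = []")
    case False
    have "(\<lambda>M. psi M (take i w) d * XX (psi M) L d (drop i w)) \<longlonglongrightarrow> psi' (take i w) d * XX psi' L d (drop i w)"
      if "d \<in> {d0<..L}" "i \<in> {1..length w}" for d i
    proof (rule tendsto_mult)
      show "(\<lambda>M. psi M (take i w) d) \<longlonglongrightarrow> psi' (take i w) d"
        using that False by (intro 1(2)) (auto dest: in_set_takeD)
      show "(\<lambda>M. XX (psi M) L d (drop i w)) \<longlonglongrightarrow> XX psi' L d (drop i w)"
      proof (rule 1(1)[rule_format])
        show "length (drop i w) < length w" using that False by simp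
        fix B d' assume "B \<noteq> []" "set B \<subseteq> set (drop i w)" "d < d'"
        then show "(\<lambda>M. psi M B d') \<longlonglongrightarrow> psi' B d'" using that set_drop_subset[of i w] by (intro 1(2)) auto
      qed
    qed
    then show ?thesis unfolding XX.simps[of _ L d0 w] if_not_P[OF False] by (intro tendsto_sum)
  qed simp
qed

section \<open>Decomposition of the Eisenstein sums by levels\<close>

definition lat :: "nat \<Rightarrow> complex \<Rightarrow> int \<Rightarrow> complex" where
  "lat n x m = 1 / (x + of_int m) ^ n"

definition cfun :: "(int \<Rightarrow> nat \<Rightarrow> 'r) \<Rightarrow> nat \<times> 'N::finite mod_ring \<Rightarrow> int \<Rightarrow> 'r::comm_ring_1" where
  "cfun f = (\<lambda>(n, b) m. if inZ m b then f m n else 0)"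

text \<open>The start \<open>- int M - 1\<close> lies below the whole range and imposes no
  condition.\<close>

definition PsiM :: "(int \<Rightarrow> complex) \<Rightarrow> nat \<Rightarrow> 'N::finite array \<Rightarrow> int \<Rightarrow> complex" where
  "PsiM x M B d = nest (<) {- int M..int M} (- int M - 1) (map (cfun (\<lambda>m n. lat n (x d) m)) B)"

lemma transp_lattice_less: "transp lattice_less"
  by (rule transpI) (auto simp: lattice_less_def)

text \<open>A lexicographic chain first continues on its level \<open>d0\<close>, above
  \<open>m0\<close>. It then passes to higher levels, and when it enters one there is no restriction
  on \<open>m\<close>.\<close>

lemma nest_levels:
  fixes x :: "int \<Rightarrow> complex" and v :: "'N::finite array"
  defines "F \<equiv> \<lambda>(n, b) (l, m). if inZ m b then lat n (x l) m else 0"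
  assumes "- int L \<le> d0" "d0 \<le> int L" "- int M - 1 \<le> m0"
  shows "nest lattice_less ({- int L..int L} \<times> {- int M..int M}) (d0, m0) (map F v) =
    split_sum (\<lambda>v0 v1. nest (<) {- int M..int M} m0 (map (cfun (\<lambda>m n. lat n (x d0) m)) v0) *
      XX (PsiM x M) (int L) d0 v1) v"
  using assms(2-4)
proof (induction v arbitrary: d0 m0)
  case Nil
  then show ?case by simp
next
  case (Cons y v)
  let ?A = "{- int L..int L} \<times> {- int M..int M}" and ?Z = "{- int M..int M}"
  define h where "h d = cfun (\<lambda>m n. lat n (x d) m) y" for d
  define N where "N d m v0 = nest (<) ?Z m (map (cfun (\<lambda>m n. lat n (x d) m)) v0)" for d m and v0 :: "'N array"
  define R where "R d m = split_sum (\<lambda>v0 v1. N d m v0 * XX (PsiM x M) (int L) d v1) v" for d m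
  have F: "F y (d, m) = h d m" for d m by (simp add: F_def h_def cfun_def case_prod_beta)
  have IH: "nest lattice_less ?A (d, m) (map F v) = R d m" if "d \<in> {- int L..int L}" "m \<in> ?Z" for d m
    unfolding R_def N_def using that by (intro Cons.IH) auto
  have set: "{q\<in>?A. lattice_less (d0, m0) q} = {d0} \<times> {m\<in>?Z. m0 < m} \<union> {d0<..int L} \<times> ?Z"
    using Cons.prems by (auto simp: lattice_less_def)
  have "nest lattice_less ?A (d0, m0) (map F (y # v)) =
      (\<Sum>q\<in>{d0} \<times> {m\<in>?Z. m0 < m} \<union> {d0<..int L} \<times> ?Z. F y q * nest lattice_less ?A q (map F v))"
    by (simp add: set)
  also have "\<dots> = (\<Sum>q\<in>{d0} \<times> {m\<in>?Z. m0 < m}. F y q * nest lattice_less ?A q (map F v)) +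
      (\<Sum>q\<in>{d0<..int L} \<times> ?Z. F y q * nest lattice_less ?A q (map F v))"
  proof (rule sum.union_disjoint)
    show "finite ({d0} \<times> {m\<in>?Z. m0 < m})"
      by (intro finite_cartesian_product finite_subset[of "{m\<in>?Z. m0 < m}" ?Z]) auto
  qed auto
  also have "(\<Sum>q\<in>{d0} \<times> {m\<in>?Z. m0 < m}. F y q * nest lattice_less ?A q (map F v)) =
      (\<Sum>m\<in>{m\<in>?Z. m0 < m}. h d0 m * R d0 m)"
  proof -
    have "{d0} \<times> {m\<in>?Z. m0 < m} = Pair d0 ` {m\<in>?Z. m0 < m}" by auto
    then have "(\<Sum>q\<in>{d0} \<times> {m\<in>?Z. m0 < m}. F y q * nest lattice_less ?A q (map F v)) =
        (\<Sum>m\<in>{m\<in>?Z. m0 < m}. F y (d0, m) * nest lattice_less ?A (d0, m) (map F v))"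
      by (simp add: sum.reindex inj_on_def)
    also have "\<dots> = (\<Sum>m\<in>{m\<in>?Z. m0 < m}. h d0 m * R d0 m)"
      using Cons.prems by (intro sum.cong refl) (simp add: F IH)
    finally show ?thesis .
  qed
  also have "(\<Sum>q\<in>{d0<..int L} \<times> ?Z. F y q * nest lattice_less ?A q (map F v)) =
      (\<Sum>d\<in>{d0<..int L}. \<Sum>m\<in>?Z. h d m * R d m)"
  proof -
    have "(\<Sum>q\<in>{d0<..int L} \<times> ?Z. F y q * nest lattice_less ?A q (map F v)) =
        (\<Sum>d\<in>{d0<..int L}. \<Sum>m\<in>?Z. F y (d, m) * nest lattice_less ?A (d, m) (map F v))"
      by (simp add: sum.cartesian_product case_prod_beta)
    also have "\<dots> = (\<Sum>d\<in>{d0<..int L}. \<Sum>m\<in>?Z. h d m * R d m)"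
      using Cons.prems by (intro sum.cong refl) (simp add: F IH)
    finally show ?thesis .
  qed
  also have "(\<Sum>d\<in>{d0<..int L}. \<Sum>m\<in>?Z. h d m * R d m) = XX (PsiM x M) (int L) d0 (y # v)"
  proof -
    \<comment> \<open>The column \<open>y\<close> opens the block on level \<open>d\<close>; the
      columns that \<open>R\<close> keeps on this level complete it.\<close>
    have "(\<Sum>m\<in>?Z. h d m * R d m) =
        split_sum (\<lambda>B V. if B = [] then 0 else PsiM x M B d * XX (PsiM x M) (int L) d V) (y # v)" for d
    proof -
      have Z: "{q. q \<le> int M \<and> - int M \<le> q \<and> - int M - 1 < q} = ?Z" by auto
      have P: "PsiM x M (y # v0) d = (\<Sum>m\<in>?Z. h d m * N d m v0)" for v0
        unfolding PsiM_def N_def h_def by (simp add: Z conj_commute) (rule sum.cong, auto)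
      show ?thesis
        by (simp add: P sum_distrib_right split_sum_sum R_def split_sum_mult_left[symmetric] mult.assoc)
    qed
    then show ?thesis by (simp add: XX_nonempty)
  qed
  also have "(\<Sum>m\<in>{m\<in>?Z. m0 < m}. h d0 m * R d0 m) =
      split_sum (\<lambda>v0 v1. N d0 m0 (y # v0) * XX (PsiM x M) (int L) d0 v1) v"
    by (simp add: N_def h_def sum_distrib_right split_sum_sum R_def split_sum_mult_left[symmetric] mult.assoc)
  finally show ?case by (simp add: N_def add.commute)
qed

text \<open>On level 0 the chain stays above \<open>(0, 0)\<close>, which leaves positive
  \<open>m\<close>. All other levels are positive and are traversed without such a bound.\<close>

lemma Eisenstein_partial_levels:
  fixes v :: "'N::finite array"
  shows "Eisenstein_partial v \<tau> L M =
    split_sum (\<lambda>v0 v1. nest (<) {- int M..int M} 0 (map (cfun (\<lambda>m n. lat n 0 m)) v0) *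
      XX (PsiM (\<lambda>d. of_int d * of_nat CARD('N) * \<tau>) M) (int L) 0 v1) v"
proof -
  let ?x = "\<lambda>d. of_int d * of_nat CARD('N) * \<tau>"
  \<comment> \<open>The congruence conditions move from the index set into the summand, as
    zeros.\<close>
  let ?F = "\<lambda>(n, b) (l, m). if inZ m b then lat n (?x l) m else 0"
  let ?A = "{- int L..int L} \<times> {- int M..int M}"
  let ?S = "{ps. length ps = length (map ?F v) \<and> sorted_wrt lattice_less ((0, 0) # ps) \<and> set ps \<subseteq> ?A}"
  let ?good = "\<lambda>ps. \<forall>i<length v. of_int_mod_ring (snd (ps ! i)) = snd (v ! i)"
  let ?G = "\<lambda>ps. \<Prod>i<length (map ?F v). (map ?F v ! i) (ps ! i)"
  have setA: "set ps \<subseteq> ?A \<longleftrightarrow> (\<forall>i<length v. \<bar>fst (ps ! i)\<bar> \<le> int L \<and> \<bar>snd (ps ! i)\<bar> \<le> int M)"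
    if "length ps = length v" for ps
  proof -
    have "p \<in> ?A \<longleftrightarrow> \<bar>fst p\<bar> \<le> int L \<and> \<bar>snd p\<bar> \<le> int M" for p
      by (cases p) (simp add: abs_le_iff, linarith)
    then show ?thesis unfolding subset_iff all_set_conv_all_nth[of ps, unfolded Ball_def] Ball_def[symmetric] that
      by (simp only: all_set_conv_all_nth that)
  qed
  have T: "{ps. length ps = length v \<and> sorted_wrt lattice_less ((0, 0) # ps) \<and>
         (\<forall>i<length v. \<bar>fst (ps ! i)\<bar> \<le> int L \<and> \<bar>snd (ps ! i)\<bar> \<le> int M \<and>
           of_int_mod_ring (snd (ps ! i)) = snd (v ! i))} = {ps\<in>?S. ?good ps}"
    unfolding mem_Collect_eq length_map
  proof (rule Collect_cong)
    fix ps
    show "(length ps = length v \<and> sorted_wrt lattice_less ((0, 0) # ps) \<and>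
         (\<forall>i<length v. \<bar>fst (ps ! i)\<bar> \<le> int L \<and> \<bar>snd (ps ! i)\<bar> \<le> int M \<and>
           of_int_mod_ring (snd (ps ! i)) = snd (v ! i))) =
        ((length ps = length v \<and> sorted_wrt lattice_less ((0, 0) # ps) \<and> set ps \<subseteq> ?A) \<and> ?good ps)"
      using setA[of ps] by blast
  qed
  have fin: "finite ?S"
    by (rule finite_subset[OF _ finite_lists_length_eq[of ?A "length v"]]) auto
  have "Eisenstein_partial v \<tau> L M = (\<Sum>ps\<in>{ps\<in>?S. ?good ps}. ?G ps)"
    unfolding Eisenstein_partial_def T
  proof (rule sum.cong[OF refl], unfold length_map, rule prod.cong[OF refl])
    fix ps i assume "ps \<in> {ps\<in>{ps. length ps = length v \<and> sorted_wrt lattice_less ((0, 0) # ps) \<and> set ps \<subseteq> ?A}. ?good ps}"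
      and i: "i \<in> {..<length v}"
    then have "of_int_mod_ring (snd (ps ! i)) = snd (v ! i)" by blast
    then show "1 / (of_int (fst (ps ! i)) * of_nat CARD('N) * \<tau> + of_int (snd (ps ! i))) ^ fst (v ! i) =
        (map ?F v ! i) (ps ! i)"
      using i by (simp add: case_prod_beta lat_def)
  qed
  also have "\<dots> = (\<Sum>ps\<in>?S. ?G ps)"
  proof (rule sum.mono_neutral_left[OF fin])
    show "\<forall>ps\<in>?S - {ps\<in>?S. ?good ps}. ?G ps = 0"
    proof
      fix ps assume "ps \<in> ?S - {ps\<in>?S. ?good ps}"
      then obtain i where i: "i < length v" "of_int_mod_ring (snd (ps ! i)) \<noteq> snd (v ! i)" by blast
      then have "(map ?F v ! i) (ps ! i) = 0" by (simp add: case_prod_beta)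
      then show "?G ps = 0" using i by (intro prod_zero bexI[of _ i]) simp_all
    qed
  qed blast
  also have "\<dots> = nest lattice_less ?A (0, 0) (map ?F v)"
    by (rule sum_sorted_lists[OF transp_lattice_less]) simp
  also have "\<dots> = split_sum (\<lambda>v0 v1. nest (<) {- int M..int M} 0 (map (cfun (\<lambda>m n. lat n (?x 0) m)) v0) *
      XX (PsiM ?x M) (int L) 0 v1) v"
    by (rule nest_levels) simp_all
  finally show ?thesis by simp
qed

section \<open>Multiple polylogarithms as power series\<close>

text \<open>
  The word is read from its last letter, i.e. the argument is the reversed word; \<open>X\<close> and \<open>Y \<kappa>\<close> stand
  for integration against \<open>dz/z\<close> and against the sum of \<open>z ^ (k - 1) dz\<close> over \<open>k \<equiv> \<kappa>\<close>.
\<close>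

fun plog :: "'N::finite mod_ring letter list \<Rightarrow> nat \<Rightarrow> real" where
  "plog [] n = (if n = 0 then 1 else 0)"
| "plog (X # V) n = plog V n / real n"
| "plog (Y \<kappa> # V) n = (\<Sum>i\<in>{i\<in>{..<n}. inZ (int (n - i)) \<kappa>}. plog V i) / real n"

lemma plog_nonneg: "plog V n \<ge> 0"
  by (induction V n rule: plog.induct) (auto intro!: sum_nonneg divide_nonneg_nonneg)

lemma plog_0: "V \<noteq> [] \<Longrightarrow> plog V 0 = 0"
  by (induction V "0::nat" rule: plog.induct) auto

definition FW :: "'N::finite mod_ring letter list \<Rightarrow> complex fps" where
  "FW W = Abs_fps (\<lambda>n. of_real (plog (rev W) n))"

lemma FW_nth: "fps_nth (FW W) n = of_real (plog (rev W) n)" by (simp add: FW_def)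

lemma FW_Nil [simp]: "FW [] = 1" by (rule fps_ext) (simp add: FW_nth)

text \<open>The Euler operator \<open>z d/dz\<close>; it multiplies the \<open>n\<close>-th
  coefficient by \<open>n\<close>.\<close>

definition theta :: "complex fps \<Rightarrow> complex fps" where
  "theta f = fps_X * fps_deriv f"

lemma theta_nth: "fps_nth (theta f) n = of_nat n * fps_nth f n"
  by (cases n) (simp_all add: theta_def)

lemma theta_mult: "theta (f * g) = theta f * g + f * theta g"
  by (simp add: theta_def algebra_simps)

lemma theta_linear: "theta (f + g) = theta f + theta g" "theta (fps_const c * f) = fps_const c * theta f" "theta 0 = 0"
  by (simp_all add: theta_def algebra_simps)

lemma theta_eqI: "fps_nth f 0 = fps_nth g 0 \<Longrightarrow> theta f = theta g \<Longrightarrow> f = g"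
proof (rule fps_ext)
  fix n assume h: "fps_nth f 0 = fps_nth g 0" "theta f = theta g"
  have "of_nat n * fps_nth f n = of_nat n * fps_nth g n"
    unfolding theta_nth[symmetric] h(2) ..
  then show "fps_nth f n = fps_nth g n"
    using h(1) by (cases "n = 0") (simp_all del: of_nat_Suc)
qed

text \<open>The differential forms of the letters, multiplied by \<open>z\<close> and stripped of
  \<open>dz\<close>.\<close>

fun om :: "'N::finite mod_ring letter \<Rightarrow> complex fps" where
  "om X = 1"
| "om (Y \<kappa>) = Abs_fps (\<lambda>m. if m > 0 \<and> inZ (int m) \<kappa> then 1 else 0)"

lemma theta_FW_snoc: "nonX (W @ [l]) \<Longrightarrow> theta (FW (W @ [l])) = FW W * om l"
proof (cases l)
  case X
  assume "nonX (W @ [l])"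
  \<comment> \<open>For empty \<open>W\<close> the claim fails at the coefficient 0: the left side
    vanishes there, the right side is 1.\<close>
  then have "W \<noteq> []" using X by auto
  then show ?thesis unfolding X
    by (intro fps_ext) (simp add: theta_nth FW_nth plog_0)
next
  case (Y \<kappa>)
  show ?thesis unfolding Y
  proof (rule fps_ext)
    fix n
    have "fps_nth (FW W * om (Y \<kappa>)) n = (\<Sum>i\<in>{..n}. if n - i > 0 \<and> inZ (int (n - i)) \<kappa> then of_real (plog (rev W) i) else 0)"
      by (simp add: fps_mult_nth FW_nth atMost_atLeast0 if_distrib cong: if_cong)
    also have "\<dots> = (\<Sum>i\<in>{i\<in>{..<n}. inZ (int (n - i)) \<kappa>}. of_real (plog (rev W) i))"
      by (rule sum.mono_neutral_cong_right) auto
    also have "\<dots> = fps_nth (theta (FW (W @ [Y \<kappa>]))) n"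
      by (cases n) (simp_all add: theta_nth FW_nth del: of_nat_Suc)
    finally show "fps_nth (theta (FW (W @ [Y \<kappa>]))) n = fps_nth (FW W * om (Y \<kappa>)) n" by simp
  qed
qed

definition zf :: "'N::finite shalg \<Rightarrow> complex fps" where
  "zf f = (\<Sum>U | coef f U \<noteq> 0. fps_const (Rep_cyclotomic (coef f U)) * FW U)"

lemma zf_superset:
  assumes "finite A" "\<And>W. coef f W \<noteq> 0 \<Longrightarrow> W \<in> A"
  shows "zf f = (\<Sum>W\<in>A. fps_const (Rep_cyclotomic (coef f W)) * FW W)"
  unfolding zf_def using assms by (intro sum.mono_neutral_left) (auto simp: Rep_cyclotomic_hom)

lemma zf_add: "zf (f + g) = zf f + zf g"
proof -
  let ?A = "{W. coef f W \<noteq> 0} \<union> {W. coef g W \<noteq> 0}"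
  have A: "finite ?A" using finite_coef by blast
  have "zf (f + g) = (\<Sum>W\<in>?A. fps_const (Rep_cyclotomic (coef (f + g) W)) * FW W)"
    by (rule zf_superset[OF A]) auto
  moreover have "zf f = (\<Sum>W\<in>?A. fps_const (Rep_cyclotomic (coef f W)) * FW W)"
    by (rule zf_superset[OF A]) auto
  moreover have "zf g = (\<Sum>W\<in>?A. fps_const (Rep_cyclotomic (coef g W)) * FW W)"
    by (rule zf_superset[OF A]) auto
  ultimately show ?thesis
    by (simp add: Rep_cyclotomic_hom fps_const_add[symmetric] sum.distrib distrib_right del: fps_const_add)
qed

lemma zf_emb: "zf (emb c * f) = fps_const (Rep_cyclotomic c) * zf f"
proof -
  have "zf (emb c * f) = (\<Sum>W | coef f W \<noteq> 0. fps_const (Rep_cyclotomic (coef (emb c * f) W)) * FW W)"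
    by (rule zf_superset[OF finite_coef]) auto
  then show ?thesis
    by (simp add: zf_def Rep_cyclotomic_hom fps_const_mult[symmetric] sum_distrib_left mult.assoc del: fps_const_mult)
qed

lemma zf_0 [simp]: "zf 0 = 0" by (simp add: zf_def)

lemma zf_sum: "zf (sum f A) = (\<Sum>x\<in>A. zf (f x))"
  by (induction A rule: infinite_finite_induct) (simp_all add: zf_add)

lemma zf_delta: "zf (delta W) = FW W"
proof -
  have "{V. coef (delta W) V \<noteq> (0 :: 'a cyclotomic)} = {W}" by (auto simp: coef_delta)
  then show ?thesis by (simp add: zf_def coef_delta Rep_cyclotomic_hom)
qed

lemma zf_nth_0: "fps_nth (zf f) 0 = Rep_cyclotomic (coef f [])"
proof -
  have "zf f = (\<Sum>W\<in>insert [] {U. coef f U \<noteq> 0}. fps_const (Rep_cyclotomic (coef f W)) * FW W)"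
    by (rule zf_superset) (use finite_coef in auto)
  also have "fps_nth \<dots> 0 = (\<Sum>W\<in>insert [] {U. coef f U \<noteq> 0}. if W = [] then Rep_cyclotomic (coef f W) else 0)"
    unfolding fps_sum_nth by (intro sum.cong refl) (auto simp: FW_nth plog_0)
  also have "\<dots> = Rep_cyclotomic (coef f [])"
    using finite_coef[of f] by (simp add: sum.delta)
  finally show ?thesis .
qed

lemma dr_delta: "dr l (delta (V @ [m])) = (if l = m then delta V else 0)"
  by (rule sh_eqI) (simp add: coef_delta)

text \<open>The hypothesis excludes words such as \<open>[X]\<close>, for which the differential
  equation of \<open>theta_FW_snoc\<close> fails.\<close>

lemma theta_zf:
  assumes "dl X h = 0"
  shows "theta (zf h) = (\<Sum>l\<in>UNIV. zf (dr l h) * om l)"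
proof -
  have W: "theta (FW W) = (\<Sum>l\<in>UNIV. zf (dr l (delta W)) * om l)" if "nonX W" for W :: "'a mod_ring letter list"
  proof (cases W rule: rev_cases)
    case Nil
    have "theta 1 = 0" by (simp add: theta_def)
    then show ?thesis by (simp add: Nil)
  next
    case (snoc V m)
    have "(\<Sum>l\<in>UNIV. zf (dr l (delta W)) * om l) = (\<Sum>l\<in>UNIV. if l = m then FW V * om l else 0)"
      unfolding snoc dr_delta by (intro sum.cong refl) (simp add: zf_delta)
    then show ?thesis using that by (simp add: snoc theta_FW_snoc)
  qed
  let ?A = "{U. coef h U \<noteq> 0}"
  have h: "h = (\<Sum>W\<in>?A. emb (coef h W) * delta W)" by (rule sh_expand[OF finite_coef]) simp
  have th: "theta (sum F A) = (\<Sum>x\<in>A. theta (F x))" for F :: "'a mod_ring letter list \<Rightarrow> _" and A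
    by (induction A rule: infinite_finite_induct) (simp_all add: theta_linear)
  have dsum: "dr l (sum F A) = (\<Sum>x\<in>A. dr l (F x))" for F :: "'a mod_ring letter list \<Rightarrow> 'a shalg" and A l
    by (induction A rule: infinite_finite_induct) simp_all
  have dh: "dr l h = (\<Sum>W\<in>?A. emb (coef h W) * dr l (delta W))" for l
    by (subst h) (simp add: dsum dr_mult)
  have "theta (zf h) = (\<Sum>W\<in>?A. fps_const (Rep_cyclotomic (coef h W)) * theta (FW W))"
    by (simp add: zf_def th theta_linear)
  also have "\<dots> = (\<Sum>W\<in>?A. fps_const (Rep_cyclotomic (coef h W)) * (\<Sum>l\<in>UNIV. zf (dr l (delta W)) * om l))"
    using assms by (intro sum.cong refl) (simp add: W dl_X_eq_0_iff)
  also have "\<dots> = (\<Sum>l\<in>UNIV. \<Sum>W\<in>?A. fps_const (Rep_cyclotomic (coef h W)) * zf (dr l (delta W)) * om l)"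
    by (subst sum.swap) (simp add: sum_distrib_left mult.assoc)
  also have "\<dots> = (\<Sum>l\<in>UNIV. zf (dr l h) * om l)"
    by (simp add: dh zf_sum zf_emb sum_distrib_right)
  finally show ?thesis .
qed

lemma dl_X_delta: "nonX W \<Longrightarrow> dl X (delta W) = 0"
  by (auto simp: dl_X_eq_0_iff coef_delta split: if_splits)

text \<open>Both sides have the same constant term, and \<open>theta\<close> acts on both by a
  Leibniz rule over last letters. Removing a last letter creates no leading \<open>X\<close>, so the
  induction on the total length applies.\<close>

lemma zf_delta_mult:
  assumes "nonX U" "nonX V"
  shows "zf (delta U * delta V) = FW U * FW V"
  using assms
proof (induction "length U + length V" arbitrary: U V rule: less_induct)
  case less
  have left: "zf (dr l (delta U) * delta V) = zf (dr l (delta U)) * FW V" for l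
  proof (cases U rule: rev_cases)
    case (snoc U' m)
    moreover have "nonX U'" using less.prems snoc by (cases U') auto
    ultimately show ?thesis using less by (simp add: dr_delta zf_delta)
  qed simp
  have right: "zf (delta U * dr l (delta V)) = FW U * zf (dr l (delta V))" for l
  proof (cases V rule: rev_cases)
    case (snoc V' m)
    moreover have "nonX V'" using less.prems snoc by (cases V') auto
    ultimately show ?thesis using less by (simp add: dr_delta zf_delta)
  qed simp
  show ?case
  proof (rule theta_eqI)
    show "fps_nth (zf (delta U * delta V)) 0 = fps_nth (FW U * FW V) 0"
      by (auto simp: zf_nth_0 coef_delta FW_nth plog_0 Rep_cyclotomic_hom)
    have "theta (zf (delta U * delta V)) = (\<Sum>l\<in>UNIV. zf (dr l (delta U * delta V)) * om l)"
      using less.prems by (intro theta_zf) (simp add: dl_mult dl_X_delta)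
    also have "\<dots> = (\<Sum>l\<in>UNIV. zf (dr l (delta U)) * om l) * FW V + FW U * (\<Sum>l\<in>UNIV. zf (dr l (delta V)) * om l)"
      by (simp add: dr_mult zf_add left right) (simp add: sum_distrib_left sum_distrib_right sum.distrib distrib_left distrib_right mult_ac)
    also have "\<dots> = theta (FW U * FW V)"
      using theta_zf[OF dl_X_delta[OF less.prems(1)]] theta_zf[OF dl_X_delta[OF less.prems(2)]]
      by (simp add: zf_delta theta_mult)
    finally show "theta (zf (delta U * delta V)) = theta (FW U * FW V)" .
  qed
qed

lemma zf_mult:
  assumes "dl X f = 0" "dl X g = 0"
  shows "zf (f * g) = zf f * zf g"
proof -
  let ?A = "{U. coef f U \<noteq> 0}" and ?B = "{U. coef g U \<noteq> 0}"
  have f: "f = (\<Sum>W\<in>?A. emb (coef f W) * delta W)" and g: "g = (\<Sum>W\<in>?B. emb (coef g W) * delta W)"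
    by (rule sh_expand[OF finite_coef]; simp)+
  have "f * g = (\<Sum>W\<in>?A. emb (coef f W) * delta W) * (\<Sum>W\<in>?B. emb (coef g W) * delta W)"
    by (simp flip: f g)
  also have "\<dots> = (\<Sum>W\<in>?A. \<Sum>V\<in>?B. emb (coef f W) * (emb (coef g V) * (delta W * delta V)))"
    by (simp add: sum_product mult_ac)
  finally have "zf (f * g) = (\<Sum>W\<in>?A. \<Sum>V\<in>?B. fps_const (Rep_cyclotomic (coef f W)) *
      (fps_const (Rep_cyclotomic (coef g V)) * zf (delta W * delta V)))"
    by (simp add: zf_sum zf_emb)
  also have "\<dots> = (\<Sum>W\<in>?A. \<Sum>V\<in>?B. fps_const (Rep_cyclotomic (coef f W)) *
      (fps_const (Rep_cyclotomic (coef g V)) * (FW W * FW V)))"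
    using assms by (intro sum.cong refl) (simp add: zf_delta_mult dl_X_eq_0_iff)
  also have "\<dots> = zf f * zf g"
    unfolding zf_def sum_product by (intro sum.cong refl) (simp only: mult_ac)
  finally show ?thesis .
qed

section \<open>Convergence\<close>

text \<open>Each letter costs at most a factor \<open>n powr \<delta>\<close>. For a letter
  \<open>Y\<close> the sum over smaller indices is compared with the convergent series over
  \<open>i powr (- 1 - \<delta>)\<close>; the division by \<open>n\<close> then restores the
  \<open>- 1\<close> in the exponent.\<close>

lemma plog_bound:
  assumes "\<delta> > 0"
  shows "\<exists>C\<ge>0. \<forall>n\<ge>1. plog V n \<le> C * real n powr (\<delta> * real (length V) - 1)"
proof (induction V)
  case Nil
  show ?case by (rule exI[of _ 0]) auto
next
  case (Cons l V)
  then obtain C where C: "C \<ge> 0" "\<And>n. n \<ge> 1 \<Longrightarrow> plog V n \<le> C * real n powr (\<delta> * real (length V) - 1)" by blast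
  define s where "s = \<delta> * real (length V)"
  have s1: "\<delta> * real (length (l # V)) = s + \<delta>" by (simp add: s_def algebra_simps)
  show ?case
  proof (cases l)
    case X
    have "plog (l # V) n \<le> C * real n powr (s + \<delta> - 1)" if "n \<ge> 1" for n
    proof -
      have "plog (l # V) n \<le> plog V n" using that plog_nonneg[of V n]
        by (simp add: X divide_le_eq mult_le_cancel_left1)
      also have "\<dots> \<le> C * real n powr (s - 1)" using C(2)[OF that] by (simp add: s_def)
      also have "\<dots> \<le> C * real n powr (s + \<delta> - 1)"
        using that C(1) assms by (intro mult_left_mono powr_mono) auto
      finally show ?thesis .
    qed
    then show ?thesis using C(1) unfolding s1 by blast
  next
    case (Y \<kappa>)
    have sm: "summable (\<lambda>n. real n powr (- 1 - \<delta>))" using assms by (simp add: summable_real_powr_iff)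
    define Z where "Z = suminf (\<lambda>n. real n powr (- 1 - \<delta>))"
    have Z0: "Z \<ge> 0" unfolding Z_def by (rule suminf_nonneg[OF sm]) simp
    have "plog (l # V) n \<le> (1 + C * Z) * real n powr (s + \<delta> - 1)" if n: "n \<ge> 1" for n
    proof -
      \<comment> \<open>Absorbs the term \<open>i = 0\<close>, which the inductive bound does not
        cover.\<close>
      have np: "real n powr (s + \<delta>) \<ge> 1" using n assms by (intro ge_one_powr_ge_zero) (auto simp: s_def)
      have "(\<Sum>i\<in>{i\<in>{..<n}. inZ (int (n - i)) \<kappa>}. plog V i) \<le> (\<Sum>i<n. plog V i)"
        by (rule sum_mono2) (auto simp: plog_nonneg)
      also have "\<dots> \<le> (\<Sum>i<n. (if i = 0 then 1 else 0) + C * real n powr (s + \<delta>) * real i powr (- 1 - \<delta>))"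
      proof (rule sum_mono)
        fix i assume i: "i \<in> {..<n}"
        show "plog V i \<le> (if i = 0 then 1 else 0) + C * real n powr (s + \<delta>) * real i powr (- 1 - \<delta>)"
        proof (cases "i = 0")
          case True
          then show ?thesis by (cases "V = []") (simp_all add: plog_0)
        next
          case False
          have "plog V i \<le> C * real i powr (s - 1)" using C(2)[of i] False by (simp add: s_def)
          also have "real i powr (s - 1) = real i powr (s + \<delta>) * real i powr (- 1 - \<delta>)"
            by (simp flip: powr_add)
          also have "C * (real i powr (s + \<delta>) * real i powr (- 1 - \<delta>)) \<le> C * (real n powr (s + \<delta>) * real i powr (- 1 - \<delta>))"
            using i C(1) assms by (intro mult_left_mono mult_right_mono powr_mono2) (auto simp: s_def)
          finally show ?thesis using False by (simp add: mult.assoc)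
        qed
      qed
      also have "\<dots> \<le> 1 + C * real n powr (s + \<delta>) * Z"
      proof -
        have "(\<Sum>i<n. real i powr (- 1 - \<delta>)) \<le> Z" unfolding Z_def by (rule sum_le_suminf[OF sm]) auto
        then have "C * real n powr (s + \<delta>) * (\<Sum>i<n. real i powr (- 1 - \<delta>)) \<le> C * real n powr (s + \<delta>) * Z"
          using C(1) by (intro mult_left_mono) auto
        then show ?thesis by (simp add: sum.distrib sum_distrib_left sum.delta)
      qed
      also have "\<dots> \<le> real n powr (s + \<delta>) * (1 + C * Z)" using np by (simp add: algebra_simps)
      finally have "plog (l # V) n \<le> real n powr (s + \<delta>) * (1 + C * Z) / real n"
        using n by (simp add: Y divide_right_mono)
      then show ?thesis using n by (simp add: powr_diff mult_ac)
    qed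
    moreover have "0 \<le> 1 + C * Z" using C(1) Z0 by simp
    ultimately show ?thesis unfolding s1 by blast
  qed
qed

definition adm :: "'a letter list \<Rightarrow> bool" where
  "adm U \<longleftrightarrow> nonX U \<and> (U = [] \<or> last U = X)"

lemma summable_plog: "adm U \<Longrightarrow> summable (plog (rev U))"
proof (cases U rule: rev_cases)
  case Nil
  have "summable (\<lambda>n. if n = 0 then 1 else 0 :: real)" by simp
  moreover have "plog (rev U) = (\<lambda>n. if n = 0 then 1 else 0)" by (simp add: fun_eq_iff Nil)
  ultimately show ?thesis by (simp only:)
next
  case (snoc U' l)
  assume "adm U"
  then have l: "l = X" by (simp add: adm_def snoc)
  \<comment> \<open>Chosen so that all letters together contribute at most the exponent 1/2; the
    division by \<open>n\<close> for the last letter \<open>X\<close> then leads to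
    \<open>- 3 / 2\<close>.\<close>
  define \<delta> where "\<delta> = 1 / (2 * (real (length U') + 1))"
  have d: "\<delta> > 0" "\<delta> * real (length (rev U')) \<le> 1 / 2" by (auto simp: \<delta>_def field_simps)
  obtain C where C: "C \<ge> 0" "\<And>n. n \<ge> 1 \<Longrightarrow> plog (rev U') n \<le> C * real n powr (\<delta> * real (length (rev U')) - 1)"
    using plog_bound[OF d(1), of "rev U'"] by blast
  have "summable (\<lambda>n. C * real n powr (- 3 / 2))"
    by (intro summable_mult) (simp add: summable_real_powr_iff)
  then show ?thesis
  proof (rule summable_comparison_test'[where N = 1])
    fix n :: nat assume n: "n \<ge> 1"
    have "plog (rev U) n = plog (rev U') n / real n" by (simp add: snoc l)
    also have "\<dots> \<le> C * real n powr (\<delta> * real (length (rev U')) - 1) / real n"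
      using C(2)[OF n] by (intro divide_right_mono) auto
    also have "\<dots> \<le> C * real n powr (- 1 / 2) / real n"
      using d(2) n C(1) by (intro divide_right_mono mult_left_mono powr_mono) auto
    also have "\<dots> = C * real n powr (- 3 / 2)"
    proof -
      have "real n powr (- 1 / 2) / real n = real n powr (- 1 / 2) / real n powr 1" using n by simp
      also have "\<dots> = real n powr (- 3 / 2)" by (subst powr_diff[symmetric]) simp
      finally show ?thesis by (simp only: times_divide_eq_right[symmetric])
    qed
    finally show "norm (plog (rev U) n) \<le> C * real n powr (- 3 / 2)"
      using plog_nonneg[of "rev U" n] by simp
  qed
qed

lemma nest_hom:
  fixes h :: "'r::comm_ring_1 \<Rightarrow> 's::comm_ring_1"
  assumes "\<And>x y. h (x + y) = h x + h y" "\<And>x y. h (x * y) = h x * h y" "h 1 = 1" "h 0 = 0"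
  shows "h (nest lt A p fs) = nest lt A p (map (\<lambda>f q. h (f q)) fs)"
proof -
  have s: "h (sum F B) = (\<Sum>x\<in>B. h (F x))" for F :: "'a \<Rightarrow> 'r" and B
    by (induction B rule: infinite_finite_induct) (simp_all add: assms)
  show ?thesis by (induction fs arbitrary: p) (simp_all add: assms s)
qed

text \<open>Makes the largest variable the outermost one, as needed for inductions over the last
  column.\<close>

lemma nest_less_snoc:
  fixes fs :: "(int \<Rightarrow> 'r::comm_ring_1) list"
  assumes "finite A"
  shows "nest (<) A p (fs @ [f]) = (\<Sum>k\<in>{k\<in>A. p < k}. nest (<) {q\<in>A. q < k} p fs * f k)"
proof (induction fs arbitrary: p)
  case (Cons g fs)
  have "nest (<) A p ((g # fs) @ [f]) = (\<Sum>q\<in>{q\<in>A. p < q}. \<Sum>k\<in>{k\<in>{k\<in>A. p < k}. q < k}. g q * (nest (<) {q\<in>A. q < k} q fs * f k))"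
    by (simp add: Cons.IH sum_distrib_left) (intro sum.cong refl; auto)
  also have "\<dots> = (\<Sum>k\<in>{k\<in>A. p < k}. \<Sum>q\<in>{q\<in>{q\<in>A. p < q}. q < k}. g q * (nest (<) {q\<in>A. q < k} q fs * f k))"
    by (rule sum.swap_restrict) (use assms in auto)
  also have "\<dots> = (\<Sum>k\<in>{k\<in>A. p < k}. nest (<) {q\<in>A. q < k} p (g # fs) * f k)"
    unfolding nest.simps sum_distrib_right by (intro sum.cong refl) (auto simp: mult.assoc)
  finally show ?case .
qed (simp add: assms)

section \<open>Multiple zeta values of words\<close>

definition dword :: "'N::finite array \<Rightarrow> 'N mod_ring letter list" where
  "dword v = rho 0 (word_of X Y v)"

fun lastc :: "'N::finite mod_ring \<Rightarrow> 'N array \<Rightarrow> 'N mod_ring" where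
  "lastc a [] = a" | "lastc a ((n, b) # v) = lastc b v"

lemma lastc_snoc [simp]: "lastc a (v @ [(n, b)]) = b"
  by (induction a v rule: lastc.induct) simp_all

lemma rho_append_word: "rho a (word_of X Y v @ W) = rho a (word_of X Y v) @ rho (lastc a v) W"
  by (induction a v rule: lastc.induct) simp_all

lemma nonX_dword [simp]: "nonX (dword v)" by (simp add: dword_def)

lemma array_of_dword: "is_array v \<Longrightarrow> array_of (Word (irho 0 (dword v))) = v"
  by (simp add: dword_def array_of_Word)

definition zt :: "int \<Rightarrow> 'N::finite array \<Rightarrow> real" where
  "zt K v = nest (<) {1..K} 0 (map (cfun (\<lambda>m n. 1 / of_int m ^ n)) v)"

lemma of_int_mod_ring_diff: "of_int_mod_ring (i - j) = of_int_mod_ring i - (of_int_mod_ring j :: 'N::finite mod_ring)"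
  by transfer (simp add: mod_diff_eq)

lemma of_int_mod_ring_add: "of_int_mod_ring (i + j) = of_int_mod_ring i + (of_int_mod_ring j :: 'N::finite mod_ring)"
  by transfer (simp add: mod_add_eq)

lemma zt_snoc: "zt K (v @ [(n, b)]) = (\<Sum>k\<in>{1..K}. if inZ k b then zt (k - 1) v / of_int k ^ n else 0)"
proof -
  have "zt K (v @ [(n, b)]) = (\<Sum>k\<in>{k\<in>{1..K}. 0 < k}. nest (<) {q\<in>{1..K}. q < k} 0 (map (cfun (\<lambda>m n. 1 / of_int m ^ n)) v) *
      cfun (\<lambda>m n. 1 / of_int m ^ n) (n, b) k)"
    unfolding zt_def map_append list.map by (rule nest_less_snoc) simp
  also have "\<dots> = (\<Sum>k\<in>{1..K}. if inZ k b then zt (k - 1) v / of_int k ^ n else 0)"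
  proof (rule sum.cong)
    fix k assume k: "k \<in> {1..K}"
    then have "{q\<in>{1..K}. q < k} = {1..k - 1}" by auto
    then show "nest (<) {q\<in>{1..K}. q < k} 0 (map (cfun (\<lambda>m n. 1 / of_int m ^ n)) v) *
      cfun (\<lambda>m n. 1 / of_int m ^ n) (n, b) k = (if inZ k b then zt (k - 1) v / of_int k ^ n else 0)"
      by (simp add: zt_def cfun_def)
  qed auto
  finally show ?thesis .
qed

lemma plog_replicate: "plog (replicate k X @ V) n = plog V n / real n ^ k"
  by (induction k) simp_all

lemma sum_nat_int: "(\<Sum>i\<in>{1..int K}. F i) = (\<Sum>i\<in>{1..K}. F (int i))"
  by (rule sum.reindex_bij_witness[of _ int nat]) auto

text \<open>The letters are differences of residues. A condition on \<open>n - i\<close> becomes one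
  on \<open>n\<close> alone once all contributing \<open>i\<close> lie in a single residue class,
  which is why the second claim is carried through the induction.\<close>

lemma sum_plog:
  assumes "is_array v"
  shows "(\<Sum>n\<le>K. plog (rev (dword v)) n) = zt (int K) v \<and>
    (\<forall>n. plog (rev (dword v)) n \<noteq> 0 \<longrightarrow> inZ (int n) (lastc 0 v))"
  using assms
proof (induction v arbitrary: K rule: rev_induct)
  case Nil
  have "(\<Sum>n\<le>K. if n = 0 then 1 else 0 :: real) = 1" by (simp add: sum.delta)
  then show ?case by (simp add: dword_def zt_def)
next
  case (snoc x v)
  obtain m b where x: "x = (m, b)" by (cases x)
  have m: "m \<ge> 1" and v: "is_array v" using snoc.prems by (simp_all add: x)
  have IH: "(\<Sum>n\<le>K. plog (rev (dword v)) n) = zt (int K) v"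
    "plog (rev (dword v)) n \<noteq> 0 \<Longrightarrow> inZ (int n) (lastc 0 v)" for K n
    using snoc.IH[OF v] by blast+
  have w: "rev (dword (v @ [x])) = replicate (m - 1) X @ Y (b - lastc 0 v) # rev (dword v)"
  proof -
    have "rho (lastc 0 v) (replicate (m - 1) X) = replicate (m - 1) X" for c :: "'a mod_ring"
      using rho_replicate[of "lastc 0 v" "m - 1" "[]"] by simp
    moreover have "rho b (replicate (m - 1) X) = replicate (m - 1) X"
      using rho_replicate[of b "m - 1" "[]"] by simp
    ultimately show ?thesis by (simp add: dword_def x rho_append_word)
  qed
  have p: "plog (rev (dword (v @ [x]))) n = (if n \<ge> 1 \<and> inZ (int n) b then zt (int n - 1) v / real n ^ m else 0)" for n
  proof (cases "n \<ge> 1")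
    case False
    then show ?thesis by (simp add: plog_replicate w)
  next
    case True
    have "(\<Sum>i\<in>{i\<in>{..<n}. inZ (int (n - i)) (b - lastc 0 v)}. plog (rev (dword v)) i) =
        (\<Sum>i<n. if inZ (int n) b then plog (rev (dword v)) i else 0)"
    proof (rule sum.mono_neutral_cong_left)
      show "\<forall>i\<in>{..<n} - {i\<in>{..<n}. inZ (int (n - i)) (b - lastc 0 v)}. (if inZ (int n) b then plog (rev (dword v)) i else 0) = 0"
      proof
        fix i assume i: "i \<in> {..<n} - {i\<in>{..<n}. inZ (int (n - i)) (b - lastc 0 v)}"
        then have "\<not> inZ (int n - int i) (b - lastc 0 v)" by (simp add: of_nat_diff)
        then have "\<not> (inZ (int n) b \<and> inZ (int i) (lastc 0 v))" by (auto simp: of_int_mod_ring_diff)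
        then show "(if inZ (int n) b then plog (rev (dword v)) i else 0) = 0" using IH(2)[of i] by auto
      qed
      fix i assume i: "i \<in> {i\<in>{..<n}. inZ (int (n - i)) (b - lastc 0 v)}"
      then have "int (n - i) = int n - int i" "inZ (int (n - i)) (b - lastc 0 v)" by auto
      then have e: "of_int_mod_ring (int n) - of_int_mod_ring (int i) = b - lastc 0 v"
        by (simp only: of_int_mod_ring_diff)
      show "plog (rev (dword v)) i = (if inZ (int n) b then plog (rev (dword v)) i else 0)"
      proof (cases "plog (rev (dword v)) i = 0")
        case False
        from IH(2)[OF this] have "inZ (int n) b" using e by simp
        then show ?thesis by simp
      qed simp
    qed auto
    also have "\<dots> = (if inZ (int n) b then zt (int n - 1) v else 0)"
    proof -
      have "(\<Sum>i<n. plog (rev (dword v)) i) = zt (int (n - 1)) v"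
        using IH(1)[of "n - 1"] True by (simp add: lessThan_Suc_atMost[symmetric])
      then show ?thesis using True by (simp add: of_nat_diff)
    qed
    finally have e: "plog (Y (b - lastc 0 v) # rev (dword v)) n = (if inZ (int n) b then zt (int n - 1) v else 0) / real n"
      by (simp only: plog.simps)
    have "plog (rev (dword (v @ [x]))) n = (if inZ (int n) b then zt (int n - 1) v else 0) / (real n * real n ^ (m - 1))"
      by (simp only: w plog_replicate e divide_divide_eq_left)
    also have "real n * real n ^ (m - 1) = real n ^ m" using m by (simp flip: power_Suc)
    finally show ?thesis using True by simp
  qed
  have "(\<Sum>n\<le>K. plog (rev (dword (v @ [x]))) n) = (\<Sum>n\<in>{1..K}. if inZ (int n) b then zt (int n - 1) v / real n ^ m else 0)"
    unfolding p by (rule sum.mono_neutral_cong_right) auto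
  also have "\<dots> = zt (int K) (v @ [x])"
    unfolding x zt_snoc sum_nat_int by (simp cong: if_cong)
  finally have "(\<Sum>n\<le>K. plog (rev (dword (v @ [x]))) n) = zt (int K) (v @ [x])" .
  moreover have "inZ (int n) b" if "plog (rev (dword (v @ [x]))) n \<noteq> 0" for n
    using that unfolding p by (simp split: if_splits)
  ultimately show ?case by (simp add: x)
qed

text \<open>Links the unordered sum in \<open>zeta_array\<close> with truncated sums; nonnegativity
  turns bounded partial sums into summability.\<close>

lemma has_sum_exhaust:
  fixes f :: "'a \<Rightarrow> real"
  assumes "\<And>x. x \<in> A \<Longrightarrow> f x \<ge> 0" "\<And>K. finite (B K)" "\<And>K. B K \<subseteq> A" "\<And>x. x \<in> A \<Longrightarrow> \<exists>K. x \<in> B K" "mono B"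
    "(\<lambda>K::nat. sum f (B K)) \<longlonglongrightarrow> s0"
  shows "infsum f A = s0"
proof -
  have ex: "\<exists>K. F \<subseteq> B K" if "finite F" "F \<subseteq> A" for F
    using that
  proof (induction F rule: finite_induct)
    case (insert x F)
    have x: "x \<in> A" and F: "F \<subseteq> A" using insert.prems by simp_all
    obtain K where K: "x \<in> B K" using assms(4)[OF x] ..
    obtain K' where "F \<subseteq> B K'" using insert.IH[OF F] ..
    with K have "insert x F \<subseteq> B (max K K')"
      using monoD[OF assms(5), of K "max K K'"] monoD[OF assms(5), of K' "max K K'"] by auto
    then show ?case ..
  qed simp
  have inc: "incseq (\<lambda>K. sum f (B K))"
  proof (rule incseq_SucI, rule sum_mono2[OF assms(2) monoD[OF assms(5)]])
    fix K x assume "x \<in> B (Suc K) - B K"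
    then have "x \<in> A" using assms(3)[of "Suc K"] by blast
    then show "0 \<le> f x" by (rule assms(1))
  qed simp
  have bd: "sum f (B K) \<le> s0" for K by (rule incseq_le[OF inc assms(6)])
  have sm: "f summable_on A"
  proof (rule nonneg_bdd_above_summable_on)
    show "bdd_above (sum f ` {F. F \<subseteq> A \<and> finite F})"
    proof (rule bdd_aboveI2)
      fix F assume F: "F \<in> {F. F \<subseteq> A \<and> finite F}"
      then have "finite F" "F \<subseteq> A" by simp_all
      from ex[OF this] obtain K where K: "F \<subseteq> B K" ..
      have "sum f F \<le> sum f (B K)"
      proof (rule sum_mono2[OF assms(2) K])
        fix x assume "x \<in> B K - F"
        then have "x \<in> A" using assms(3)[of K] by blast
        then show "0 \<le> f x" by (rule assms(1))
      qed
      also have "\<dots> \<le> s0" by (rule bd)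
      finally show "sum f F \<le> s0" .
    qed
  qed (rule assms(1))
  then have "(f has_sum infsum f A) A" by (rule has_sum_infsum)
  then have "(sum f \<longlongrightarrow> infsum f A) (finite_subsets_at_top A)" by (simp add: has_sum_def)
  moreover have "filterlim B (finite_subsets_at_top A) sequentially"
    unfolding filterlim_iff eventually_finite_subsets_at_top
  proof (intro allI impI)
    fix P assume "\<exists>F. finite F \<and> F \<subseteq> A \<and> (\<forall>Y. finite Y \<and> F \<subseteq> Y \<and> Y \<subseteq> A \<longrightarrow> P Y)"
    then obtain F where F: "finite F \<and> F \<subseteq> A \<and> (\<forall>Y. finite Y \<and> F \<subseteq> Y \<and> Y \<subseteq> A \<longrightarrow> P Y)" ..
    note F3 = F[THEN conjunct2, THEN conjunct2, THEN spec, THEN mp]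
    obtain K where K: "F \<subseteq> B K" using ex[OF F[THEN conjunct1] F[THEN conjunct2, THEN conjunct1]] ..
    have "P (B n)" if "n \<ge> K" for n
      by (rule F3, intro conjI) (rule assms(2) subset_trans[OF K monoD[OF assms(5) that]] assms(3))+
    then show "\<forall>\<^sub>F n in sequentially. P (B n)" by (auto simp: eventually_sequentially)
  qed
  ultimately have "(\<lambda>K. sum f (B K)) \<longlonglongrightarrow> infsum f A" by (rule filterlim_compose)
  from LIMSEQ_unique[OF this assms(6)] show ?thesis .
qed

lemma zeta_array_eq:
  assumes "(\<lambda>K. zt (int K) v) \<longlonglongrightarrow> s0"
  shows "zeta_array v = s0"
proof -
  define A where "A = {ks. length ks = length v \<and> sorted_wrt (<) (0 # ks) \<and>
       (\<forall>i<length v. of_int_mod_ring (int (ks ! i)) = snd (v ! i))}"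
  define f where "f ks = (\<Prod>i<length v. 1 / real (ks ! i) ^ fst (v ! i))" for ks :: "nat list"
  define B where "B K = {ks\<in>A. set ks \<subseteq> {1..K}}" for K
  define fs where "fs = map (cfun (\<lambda>m n. 1 / real_of_int m ^ n)) v"
  have sumB: "sum f (B K) = zt (int K) v" for K
  proof -
    let ?R = "{ps. length ps = length fs \<and> sorted_wrt (<) (0 # ps) \<and> set ps \<subseteq> {1..int K}}"
    have good: "(\<Prod>i<length fs. (fs ! i) (ps ! i)) = (if \<forall>i<length v. inZ (ps ! i) (snd (v ! i))
        then (\<Prod>i<length v. 1 / of_int (ps ! i) ^ fst (v ! i)) else 0)" for ps
    proof (cases "\<forall>i<length v. inZ (ps ! i) (snd (v ! i))")
      case False
      then obtain i where i: "i < length v" "\<not> inZ (ps ! i) (snd (v ! i))" by blast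
      then have "(fs ! i) (ps ! i) = 0" by (simp add: fs_def cfun_def case_prod_beta)
      then have "(\<Prod>i<length fs. (fs ! i) (ps ! i)) = 0" using i by (intro prod_zero bexI[of _ i]) (simp_all add: fs_def)
      then show ?thesis unfolding if_not_P[OF False] .
    qed (auto simp: fs_def cfun_def case_prod_beta intro!: prod.cong)
    have fin: "finite ?R"
      by (rule finite_subset[OF _ finite_lists_length_eq[of "{1..int K}" "length fs"]]) auto
    have "zt (int K) v = (\<Sum>ps\<in>?R. \<Prod>i<length fs. (fs ! i) (ps ! i))"
      unfolding zt_def fs_def by (rule sum_sorted_lists[symmetric]) auto
    also have "\<dots> = (\<Sum>ps\<in>{ps\<in>?R. \<forall>i<length v. inZ (ps ! i) (snd (v ! i))}. \<Prod>i<length v. 1 / of_int (ps ! i) ^ fst (v ! i))"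
      unfolding good by (rule sum.inter_filter[symmetric, OF fin])
    also have "\<dots> = sum f (B K)"
    proof (rule sum.reindex_bij_witness[of _ "map int" "map nat"])
      fix ps assume "ps \<in> {ps\<in>?R. \<forall>i<length v. inZ (ps ! i) (snd (v ! i))}"
      then have ps: "length ps = length v" "sorted_wrt (<) ps" "set ps \<subseteq> {1..int K}"
          "\<forall>i<length v. inZ (ps ! i) (snd (v ! i))"
        by (simp_all add: fs_def)
      note len = ps(1)
      have pos: "\<forall>p\<in>set ps. 1 \<le> p" using ps(3) by fastforce
      then show id: "map int (map nat ps) = ps" by (induction ps) auto
      have nt: "int (nat (ps ! i)) = ps ! i" if "i < length v" for i
        using bspec[OF pos nth_mem[of i ps]] that len by simp
      have pos': "1 \<le> map nat ps ! i \<and> map nat ps ! i \<le> K" if "i < length v" for i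
      proof -
        have "ps ! i \<in> {1..int K}" using subsetD[OF ps(3) nth_mem[of i ps]] that len by simp
        then show ?thesis using that len by (simp add: nat_le_iff le_nat_iff)
      qed
      then have mem: "\<forall>x\<in>set (map nat ps). 1 \<le> x \<and> x \<le> K"
        unfolding all_set_conv_all_nth by (simp add: len)
      show "map nat ps \<in> B K"
      proof -
        have "sorted_wrt (<) (map int (map nat ps))" using ps(2) by (simp only: id)
        then have "sorted_wrt (<) (map nat ps)" by (simp only: sorted_wrt_map of_nat_less_iff)
        moreover have "\<forall>x\<in>set (map nat ps). 0 < x" using mem by fastforce
        ultimately have "sorted_wrt (<) (0 # map nat ps)" by simp
        moreover have "set (map nat ps) \<subseteq> {1..K}" using mem by fastforce
        moreover have "\<forall>i<length v. inZ (int (map nat ps ! i)) (snd (v ! i))"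
        proof (intro allI impI)
          fix i assume i: "i < length v"
          have "int (map nat ps ! i) = ps ! i" using nt[OF i] i len by simp
          then show "inZ (int (map nat ps ! i)) (snd (v ! i))" using ps(4) i by simp
        qed
        ultimately show ?thesis unfolding B_def A_def by (simp add: len)
      qed
      show "f (map nat ps) = (\<Prod>i<length v. 1 / of_int (ps ! i) ^ fst (v ! i))"
        unfolding f_def
      proof (intro prod.cong refl)
        fix i assume "i \<in> {..<length v}"
        then have "real (nat (ps ! i)) = of_int (ps ! i)" using nt[of i] by (metis lessThan_iff of_int_of_nat_eq)
        then show "1 / real (map nat ps ! i) ^ fst (v ! i) = 1 / of_int (ps ! i) ^ fst (v ! i)"
          using \<open>i \<in> {..<length v}\<close> len by simp
      qed
    next
      fix ks assume ks: "ks \<in> B K"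
      show "map nat (map int ks) = ks" by (simp add: map_idI)
      have k: "length ks = length v" "sorted_wrt (<) ks" "\<forall>x\<in>set ks. 0 < x" "set ks \<subseteq> {1..K}"
          "\<forall>i<length v. inZ (int (ks ! i)) (snd (v ! i))"
        using ks by (simp_all add: B_def A_def)
      have "set (map int ks) \<subseteq> {1..int K}" using k(4) by fastforce
      then show "map int ks \<in> {ps\<in>?R. \<forall>i<length v. inZ (ps ! i) (snd (v ! i))}"
        using k by (simp add: fs_def sorted_wrt_map)
    qed
    finally show ?thesis by simp
  qed
  have "infsum f A = s0"
  proof (rule has_sum_exhaust[where B = B])
    show "finite (B K)" for K
    proof (rule finite_subset)
      show "B K \<subseteq> {xs. set xs \<subseteq> {1..K} \<and> length xs = length v}" unfolding B_def A_def by blast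
    qed (rule finite_lists_length_eq, simp)
    show "B K \<subseteq> A" for K unfolding B_def by blast
    show "0 \<le> f ks" for ks unfolding f_def by (rule prod_nonneg) simp
    show "\<exists>K. x \<in> B K" if "x \<in> A" for x
    proof (rule exI[of _ "Max (set (0 # x))"])
      have "\<forall>y\<in>set x. 0 < y" using that by (simp add: A_def)
      moreover have "\<forall>y\<in>set x. y \<le> Max (set (0 # x))" by simp
      ultimately have "set x \<subseteq> {1..Max (set (0 # x))}" by fastforce
      then show "x \<in> B (Max (set (0 # x)))" using that by (simp add: B_def)
    qed
    show "mono B"
    proof (rule monoI)
      fix K K' :: nat assume "K \<le> K'"
      then have "{1..K} \<subseteq> {1..K'}" by simp
      then show "B K \<subseteq> B K'" unfolding B_def by blast
    qed
    show "(\<lambda>K. sum f (B K)) \<longlonglongrightarrow> s0" using assms by (simp add: sumB)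
  qed
  then show ?thesis by (simp add: zeta_array_def f_def[abs_def] A_def)
qed

text \<open>The zeta value is the polylogarithm at \<open>z = 1\<close>; by \<open>sum_plog\<close>
  the partial sums are truncated zeta sums.\<close>

lemma zeta_array_adm:
  assumes "adm U"
  shows "plog (rev U) sums zeta_array (array_of (Word (irho 0 U)))"
proof -
  have "nonX (irho 0 U)" using assms by (simp add: adm_def)
  then obtain v where v: "is_array v" "word_of X Y v = irho 0 U" using ex_array_X by blast
  then have U: "U = dword v" by (simp add: dword_def)
  have s: "plog (rev U) sums suminf (plog (rev U))" using summable_plog[OF assms] by (rule summable_sums)
  then have "(\<lambda>K. \<Sum>n\<le>K. plog (rev U) n) \<longlonglongrightarrow> suminf (plog (rev U))" by (simp add: sums_def_le)
  then have "(\<lambda>K. zt (int K) v) \<longlonglongrightarrow> suminf (plog (rev U))"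
    using sum_plog[OF v(1)] by (simp add: U)
  then have "zeta_array v = suminf (plog (rev U))" by (rule zeta_array_eq)
  then show ?thesis using s by (simp add: U array_of_dword v(1))
qed

text \<open>Combinations of words that neither begin with \<open>X\<close> nor end with a letter
  \<open>Y\<close>. In terms of derivations, closure under products is the Leibniz rule.\<close>

definition admissible :: "'N::finite shalg \<Rightarrow> bool" where
  "admissible f \<longleftrightarrow> dl X f = 0 \<and> (\<forall>\<kappa>. dr (Y \<kappa>) f = 0)"

lemma admissible_adm: "admissible f \<Longrightarrow> coef f U \<noteq> 0 \<Longrightarrow> adm U"
proof -
  assume f: "admissible f" "coef f U \<noteq> 0"
  have "last U = X" if "U \<noteq> []"
  proof (cases "last U")
    case (Y \<kappa>)
    have "butlast U @ [Y \<kappa>] = U" using that Y by (metis append_butlast_last_id)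
    then have "coef (dr (Y \<kappa>) f) (butlast U) = coef f U" by (simp only: coef_dr)
    moreover have "dr (Y \<kappa>) f = 0" using f by (simp add: admissible_def)
    ultimately have "coef f U = 0" by (simp only: coef_simps)
    then show ?thesis using f(2) by simp
  qed simp
  then show "adm U" using f by (auto simp: adm_def admissible_def dl_X_eq_0_iff)
qed

lemma admissible_closed: "admissible 0" "admissible 1" "admissible (- 1)"
  "admissible f \<Longrightarrow> admissible g \<Longrightarrow> admissible (f + g)"
  "admissible f \<Longrightarrow> admissible g \<Longrightarrow> admissible (f * g)"
  by (simp_all add: admissible_def dl_mult dr_mult)

lemma admissible_reg_delta: "V = [] \<or> last V = X \<Longrightarrow> admissible (reg (delta V))"
proof -
  assume V: "V = [] \<or> last V = X"
  have "dr (Y \<kappa>) (reg (delta V) :: 'a::finite shalg) = 0" for \<kappa> :: "'a mod_ring"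
  proof -
    have "rd (Y \<kappa>) (delta V :: 'a shalg) = 0"
      using V by (cases V rule: rev_cases) (simp_all add: rd_def dr_delta)
    then show ?thesis by (simp add: dr_reg)
  qed
  then show ?thesis by (simp add: admissible_def dl_X_reg)
qed

lemma zeta_sh_sums:
  assumes "admissible f"
  shows "(\<lambda>n. fps_nth (zf f) n) sums zeta_sh f" "summable (\<lambda>n. norm (fps_nth (zf f) n))"
proof -
  let ?A = "{U. coef f U \<noteq> 0}"
  have n: "fps_nth (zf f) n = (\<Sum>U\<in>?A. Rep_cyclotomic (coef f U) * of_real (plog (rev U) n))" for n
    by (simp add: zf_def fps_sum_nth FW_nth)
  have s: "(\<lambda>n. complex_of_real (plog (rev U) n)) sums of_real (zeta_array (array_of (Word (irho 0 U))))"
    if "coef f U \<noteq> 0" for U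
    by (rule sums_of_real[OF zeta_array_adm]) (rule admissible_adm[OF assms that])
  show "(\<lambda>n. fps_nth (zf f) n) sums zeta_sh f"
    unfolding n zeta_sh_def by (intro sums_sum sums_mult) (simp add: s)
  have "summable (\<lambda>n. \<Sum>U\<in>?A. norm (Rep_cyclotomic (coef f U)) * plog (rev U) n)"
    by (intro summable_sum summable_mult summable_plog) (simp add: admissible_adm[OF assms])
  then show "summable (\<lambda>n. norm (fps_nth (zf f) n))"
  proof (rule summable_comparison_test'[where N = 0])
    fix k
    have "norm (fps_nth (zf f) k) \<le> (\<Sum>U\<in>?A. norm (Rep_cyclotomic (coef f U) * of_real (plog (rev U) k)))"
      unfolding n by (rule norm_sum)
    then show "norm (norm (fps_nth (zf f) k)) \<le> (\<Sum>U\<in>?A. norm (Rep_cyclotomic (coef f U)) * plog (rev U) k)"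
      by (simp add: norm_mult plog_nonneg)
  qed
qed

text \<open>The power series multiply by \<open>zf_mult\<close>, and absolute convergence at 1
  permits the Cauchy product.\<close>

lemma zeta_sh_mult:
  assumes "admissible f" "admissible g"
  shows "zeta_sh (f * g) = zeta_sh f * zeta_sh g"
proof -
  have "(\<lambda>k. \<Sum>i\<le>k. fps_nth (zf f) i * fps_nth (zf g) (k - i)) sums
      (suminf (\<lambda>k. fps_nth (zf f) k) * suminf (\<lambda>k. fps_nth (zf g) k))"
    by (rule Cauchy_product_sums) (rule zeta_sh_sums assms)+
  then have "(\<lambda>k. fps_nth (zf f * zf g) k) sums (zeta_sh f * zeta_sh g)"
    using zeta_sh_sums(1)[OF assms(1)] zeta_sh_sums(1)[OF assms(2)]
    by (simp add: fps_mult_nth sums_iff atMost_atLeast0)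
  moreover have "(\<lambda>k. fps_nth (zf (f * g)) k) sums zeta_sh (f * g)"
    by (rule zeta_sh_sums) (rule admissible_closed assms)+
  ultimately show ?thesis
    using zf_mult[of f g] assms sums_unique2 by (fastforce simp: admissible_def)
qed

lemma zeta_sh_add: "admissible f \<Longrightarrow> admissible g \<Longrightarrow> zeta_sh (f + g) = zeta_sh f + zeta_sh g"
  using sums_add[OF zeta_sh_sums(1)[of f] zeta_sh_sums(1)[of g]] zeta_sh_sums(1)[OF admissible_closed(4)]
  by (metis (no_types, lifting) fps_add_nth sums_cong sums_unique2 zf_add)

lemma zeta_sh_consts: "zeta_sh (0 :: 'a::finite shalg) = 0" "zeta_sh (1 :: 'a shalg) = 1" "zeta_sh (- 1 :: 'a shalg) = - 1"
proof -
  have z: "zeta_sh (emb c) = Rep_cyclotomic c" for c :: "'a cyclotomic"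
  proof (cases "c = 0")
    case False
    then have "{U. coef (emb c :: 'a shalg) U \<noteq> 0} = {[]}" by auto
    moreover have "zeta_array (array_of (Word (irho 0 [])) :: 'a array) = 1"
    proof -
      have "plog (rev ([] :: 'a mod_ring letter list)) sums zeta_array (array_of (Word (irho 0 ([] :: 'a mod_ring letter list))))"
        by (rule zeta_array_adm) (simp add: adm_def)
      moreover have "plog ([] :: 'a mod_ring letter list) sums 1" using sums_single[of 0 "\<lambda>_. 1 :: real"] by (simp add: sums_def)
      ultimately show ?thesis using sums_unique2 by fastforce
    qed
    ultimately show ?thesis by (simp add: zeta_sh_def)
  qed (simp add: zeta_sh_def emb_hom Rep_cyclotomic_hom)
  show "zeta_sh (0 :: 'a shalg) = 0" by (simp add: zeta_sh_def)
  show "zeta_sh (1 :: 'a shalg) = 1" "zeta_sh (- 1 :: 'a shalg) = - 1"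
    using z[of 1] z[of "- 1"] by (simp_all add: emb_hom Rep_cyclotomic_hom)
qed

section \<open>Regularized zeta values with leading \<open>X\<close>\<close>

text \<open>Minus the derivative of a nested sum in a common shift of all denominators: for each
  column in turn the exponent goes up by one and its old value becomes a factor.\<close>

fun raiseS :: "((nat \<times> 'b) list \<Rightarrow> 'r::comm_ring_1) \<Rightarrow> (nat \<times> 'b) list \<Rightarrow> 'r" where
  "raiseS G [] = 0"
| "raiseS G ((n, b) # Q) = of_nat n * G ((n + 1, b) # Q) + raiseS (\<lambda>Q'. G ((n, b) # Q')) Q"

lemma raiseS_linear: "raiseS (\<lambda>Q. F Q + G Q) Q = raiseS F Q + raiseS G Q"
  "raiseS (\<lambda>Q. c * G Q) Q = c * raiseS G Q" "raiseS (\<lambda>Q. 0) Q = 0"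
  by (induction Q arbitrary: F G) (auto simp: algebra_simps)

lemma raiseS_sum: "raiseS (\<lambda>Q. \<Sum>i\<in>I. F i Q) Q = (\<Sum>i\<in>I. raiseS (F i) Q)"
  by (induction I rule: infinite_finite_induct) (simp_all add: raiseS_linear)

lemma raiseS_hom:
  assumes "h 0 = 0" "\<And>x y. h (x + y) = h x + h y" "\<And>n x. h (of_nat n * x) = of_nat n * h x"
  shows "h (raiseS G Q) = raiseS (\<lambda>Q. h (G Q)) Q"
  by (induction Q arbitrary: G) (auto simp: assms)

lemma raiseS_cong:
  assumes "\<And>Q'. is_array Q' \<Longrightarrow> F Q' = G Q'" "is_array Q"
  shows "raiseS F Q = raiseS G Q"
  using assms
proof (induction Q arbitrary: F G)
  case (Cons x Q)
  obtain n b where x: "x = (n, b)" by (cases x)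
  have "raiseS (\<lambda>Q'. F ((n, b) # Q')) Q = raiseS (\<lambda>Q'. G ((n, b) # Q')) Q"
    using Cons.prems by (intro Cons.IH) (auto simp: x)
  then show ?case using Cons.prems by (simp add: x)
qed simp

lemma insert_letter_replicate:
  fixes G :: "'a letter list \<Rightarrow> 'r::comm_ring_1"
  shows "(\<Sum>w\<leftarrow>shuffle_list [X] (replicate m X @ V). G w) =
    of_nat m * G (replicate (Suc m) X @ V) + (\<Sum>w\<leftarrow>shuffle_list [X] V. G (replicate m X @ w))"
  by (induction m arbitrary: G) (simp_all add: o_def algebra_simps)

lemma insert_letter_word:
  fixes G :: "'N::finite mod_ring letter list \<Rightarrow> 'r::comm_ring_1"
  assumes "is_array Q"
  shows "(\<Sum>w\<leftarrow>shuffle_list [X] (rho a (word_of X Y Q)). G w) =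
    G (X # rho a (word_of X Y Q)) + raiseS (\<lambda>Q'. G (rho a (word_of X Y Q'))) Q"
  using assms
proof (induction Q arbitrary: a G)
  case (Cons x Q)
  obtain n b where x: "x = (n, b)" by (cases x)
  have n: "n \<ge> 1" and Q: "is_array Q" using Cons.prems by (simp_all add: x)
  define W where "W = rho b (word_of X Y Q)"
  have r: "replicate n X = X # replicate (n - 1) (X :: 'N mod_ring letter)" using n by (cases n) simp_all
  have c: "of_nat n = 1 + (of_nat (n - 1) :: 'r)" using n by (cases n) simp_all
  have "(\<Sum>w\<leftarrow>shuffle_list [X] (rho a (word_of X Y (x # Q))). G w) =
      G (X # Y (b - a) # replicate (n - 1) X @ W) +
      (of_nat (n - 1) * G (Y (b - a) # replicate n X @ W) +
       (\<Sum>w\<leftarrow>shuffle_list [X] W. G (Y (b - a) # replicate (n - 1) X @ w)))"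
    using insert_letter_replicate[of "\<lambda>w. G (Y (b - a) # w)" "n - 1" W] n by (simp add: x W_def o_def)
  also have "(\<Sum>w\<leftarrow>shuffle_list [X] W. G (Y (b - a) # replicate (n - 1) X @ w)) =
      G (Y (b - a) # replicate n X @ W) +
      raiseS (\<lambda>Q'. G (Y (b - a) # replicate (n - 1) X @ rho b (word_of X Y Q'))) Q"
    unfolding W_def by (subst Cons.IH[OF Q]) (simp add: r replicate_app_Cons_same)
  finally show ?case by (simp add: x W_def c algebra_simps)
qed simp

text \<open>An inserted \<open>X\<close> lengthens either the leading block, at \<open>m + 1\<close>
  places, or the block of a column with upper entry \<open>n\<close>, at \<open>n\<close>
  places.\<close>

lemma delta_X_mult:
  assumes "is_array Q"
  shows "delta [X] * delta (replicate m X @ rho a (word_of X Y Q)) =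
    of_nat (Suc m) * delta (replicate (Suc m) X @ rho a (word_of X Y Q)) +
    raiseS (\<lambda>Q'. delta (replicate m X @ rho a (word_of X Y Q'))) Q"
  unfolding delta_mult insert_letter_replicate insert_letter_word[OF assms]
  by (simp add: replicate_app_Cons_same algebra_simps)

definition zts :: "nat \<Rightarrow> 'N::finite shalg \<Rightarrow> complex" where
  "zts K f = (\<Sum>n\<le>K. fps_nth (zf f) n)"

lemma zts_hom:
  fixes f g :: "'N::finite shalg"
  shows "zts K (0 :: 'N shalg) = 0" "zts K (f + g) = zts K f + zts K g" "zts K (of_nat n * f) = of_nat n * zts K f"
proof -
  show 0: "zts K (0 :: 'N shalg) = 0" by (simp add: zts_def)
  have a: "zts K (f + g) = zts K f + zts K g" for f g :: "'N shalg"
    by (simp add: zts_def zf_add sum.distrib)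
  show "zts K (f + g) = zts K f + zts K g" by (rule a)
  show "zts K (of_nat n * f) = of_nat n * zts K f"
    by (induction n) (simp_all add: 0 a distrib_right)
qed

text \<open>The truncated zeta sum with every denominator \<open>k\<close> replaced by
  \<open>k + X\<close>, expanded in \<open>X\<close>. It serves twice: as the generating function of
  regularized values, and as a factor of the residues.\<close>

definition fz :: "nat \<Rightarrow> int \<Rightarrow> 'N::finite array \<Rightarrow> complex fps" where
  "fz K p Q = nest (<) {1..int K} p (map (cfun (\<lambda>m n. inverse ((fps_X + of_int m) ^ n))) Q)"

lemma fps_deriv_pole:
  assumes "m \<noteq> 0"
  shows "fps_deriv (inverse ((fps_X + of_int m) ^ n)) =
    - (of_nat n * inverse ((fps_X + of_int m) ^ (n + 1) :: complex fps))"
proof -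
  let ?x = "fps_X + of_int m :: complex fps"
  have nz: "fps_nth ?x 0 \<noteq> 0" using assms by simp
  have i: "inverse (?x ^ k) = inverse ?x ^ k" for k by (rule fps_inverse_power)
  have "fps_deriv (inverse ?x) = - (inverse ?x)\<^sup>2" by (subst fps_inverse_deriv[OF nz]) simp
  then show ?thesis unfolding i fps_deriv_power'
    by (cases n) (simp_all add: power2_eq_square mult_ac del: of_nat_Suc)
qed

text \<open>\<open>0 \<le> p\<close> keeps the summation indices away from 0, so that all the series
  \<open>fps_X + of_int q\<close> are invertible.\<close>

lemma fps_deriv_fz: "0 \<le> p \<Longrightarrow> fps_deriv (fz K p Q) = - raiseS (fz K p) Q"
proof (induction Q arbitrary: p)
  case (Cons x Q)
  obtain n b where x: "x = (n, b)" by (cases x)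
  let ?c = "cfun (\<lambda>m n. inverse ((fps_X + of_int m) ^ n) :: complex fps)"
  have Cc: "fz K p (y # Q) = (\<Sum>q\<in>{q\<in>{1..int K}. p < q}. ?c y q * fz K q Q)" for y Q p
    by (simp add: fz_def)
  have "fps_deriv (fz K p (x # Q)) = (\<Sum>q\<in>{q\<in>{1..int K}. p < q}. fps_deriv (?c x q) * fz K q Q - ?c x q * raiseS (fz K q) Q)"
    unfolding Cc fps_deriv_sum
    by (intro sum.cong refl) (use Cons in \<open>simp add: Cons.IH algebra_simps\<close>)
  also have "\<dots> = (\<Sum>q\<in>{q\<in>{1..int K}. p < q}. - (of_nat n * (?c (n + 1, b) q * fz K q Q)) - ?c x q * raiseS (fz K q) Q)"
  proof (intro sum.cong refl)
    fix q assume "q \<in> {q\<in>{1..int K}. p < q}"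
    then have "q \<noteq> 0" by auto
    then have "fps_deriv (?c x q) = - (of_nat n * ?c (n + 1, b) q)"
      using fps_deriv_pole[of q n] by (simp add: cfun_def x)
    then show "fps_deriv (?c x q) * fz K q Q - ?c x q * raiseS (fz K q) Q =
      - (of_nat n * (?c (n + 1, b) q * fz K q Q)) - ?c x q * raiseS (fz K q) Q"
      by (simp add: mult.assoc)
  qed
  also have "\<dots> = - raiseS (fz K p) (x # Q)"
    unfolding x raiseS.simps Cc raiseS_sum raiseS_linear
    by (simp add: sum_subtractf sum_negf sum_distrib_left del: of_nat_Suc)
  finally show ?case .
qed (simp add: fz_def)

lemma fz_nth_0: "fps_nth (fz K 0 Q) 0 = of_real (zt (int K) Q)"
proof -
  have "fps_nth (fz K 0 Q) 0 = nest (<) {1..int K} 0 (map (\<lambda>f q. fps_nth (f q) 0) (map (cfun (\<lambda>m n. inverse ((fps_X + of_int m) ^ n))) Q))"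
    unfolding fz_def by (rule nest_hom) (simp_all add: fps_mult_nth)
  also have "\<dots> = nest (<) {1..int K} 0 (map (\<lambda>f q. complex_of_real (f q)) (map (cfun (\<lambda>m n. 1 / of_int m ^ n)) Q))"
    unfolding map_map o_def
    by (intro arg_cong[where f = "nest (<) {1..int K} 0"] map_cong refl ext)
      (simp add: cfun_def fps_nth_power_0 case_prod_beta divide_inverse)
  also have "\<dots> = of_real (zt (int K) Q)"
    unfolding zt_def by (rule nest_hom[symmetric]) simp_all
  finally show ?thesis .
qed

text \<open>Both sides obey the same recursion in \<open>s\<close>: the left one because
  \<open>reg\<close> kills multiples of \<open>delta [X]\<close>, the right one by differentiating
  the power series. Only linearity of partial sums enters, so the identity holds before the
  limit.\<close>

lemma zts_reg:
  assumes "is_array Q"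
  shows "zts K (reg (delta (replicate s X @ dword Q))) = fps_nth (fz K 0 Q) s"
  using assms
proof (induction s arbitrary: Q)
  case 0
  have F: "fps_nth (fz K 0 Q) 0 = of_real (zt (int K) Q)" by (rule fz_nth_0)
  have "reg (delta (dword Q)) = (delta (dword Q) :: 'a shalg)" by (rule reg_id[OF dl_X_delta]) simp
  then have "zts K (reg (delta (replicate 0 X @ dword Q))) = (\<Sum>n\<le>K. of_real (plog (rev (dword Q)) n))"
    by (simp add: zts_def zf_delta FW_nth)
  also have "\<dots> = of_real (zt (int K) Q)"
    using sum_plog[OF "0.prems", of K] by (simp flip: of_real_sum)
  finally show ?case using F by simp
next
  case (Suc s)
  let ?H = "\<lambda>s Q. zts K (reg (delta (replicate s X @ dword Q)))"
  have "0 = zts K (reg (delta [X] * delta (replicate s X @ dword Q)))"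
    by (simp add: reg_mult zts_hom)
  also have "\<dots> = of_nat (Suc s) * ?H (Suc s) Q + raiseS (?H s) Q"
  proof -
    have rn: "reg (of_nat n * f) = of_nat n * reg f" for n and f :: "'a shalg"
      by (induction n) (simp_all add: distrib_right reg_add)
    have "reg (raiseS G Q) = raiseS (\<lambda>Q. reg (G Q)) Q" for G :: "'a array \<Rightarrow> 'a shalg"
      by (rule raiseS_hom) (simp_all add: reg_add rn)
    moreover have "zts K (raiseS G Q) = raiseS (\<lambda>Q. zts K (G Q)) Q" for G :: "'a array \<Rightarrow> 'a shalg"
      by (rule raiseS_hom) (simp_all only: zts_hom)
    ultimately show ?thesis
      by (simp only: dword_def delta_X_mult[OF Suc.prems] reg_add zts_hom rn)
  qed
  also have "raiseS (?H s) Q = raiseS (\<lambda>Q. fps_nth (fz K 0 Q) s) Q"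
    by (rule raiseS_cong[OF Suc.IH Suc.prems])
  also have "\<dots> = fps_nth (raiseS (fz K 0) Q) s"
  proof -
    have "fps_nth (of_nat n * f) s = of_nat n * fps_nth f s" for n and f :: "complex fps"
      by (induction n) (simp_all add: distrib_right)
    then show ?thesis by (intro raiseS_hom[symmetric]) simp_all
  qed
  also have "raiseS (fz K 0) Q = - fps_deriv (fz K 0 Q)" by (simp add: fps_deriv_fz)
  finally have "of_nat (Suc s) * ?H (Suc s) Q = of_nat (Suc s) * fps_nth (fz K 0 Q) (Suc s)"
    by (simp del: of_nat_Suc)
  then show ?case by (simp del: of_nat_Suc)
qed

definition big :: "'N array \<Rightarrow> bool" where "big Q \<longleftrightarrow> (\<forall>(n, b)\<in>set Q. n \<ge> 2)"

lemma big_simps [simp]: "big []" "big ((n, b) # Q) \<longleftrightarrow> n \<ge> 2 \<and> big Q" "big (P @ Q) \<longleftrightarrow> big P \<and> big Q"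
  by (auto simp: big_def)

lemma big_is_array: "big Q \<Longrightarrow> is_array Q"
  by (fastforce simp: big_def is_array_def)

definition zr :: "nat \<Rightarrow> 'N::finite array \<Rightarrow> complex" where
  "zr s Q = zeta_sh (reg (delta (replicate s X @ dword Q)))"

lemma last_rho_word:
  assumes "big Q"
  shows "replicate s X @ rho a (word_of X Y Q) = [] \<or> last (replicate s X @ rho a (word_of X Y Q)) = X"
proof (cases Q rule: rev_cases)
  case Nil
  then show ?thesis by (cases s rule: nat.exhaust) (simp_all add: last_replicate del: replicate.simps)
next
  case (snoc Q' x)
  obtain n b where x: "x = (n, b)" by (cases x)
  then have "n \<ge> 2" using assms snoc by simp
  then have "n - 1 = Suc (n - 2)" by arith
  then have "replicate (n - 1) X = replicate (n - 2) X @ [X :: 'a mod_ring letter]"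
    by (simp only: replicate_Suc replicate_append_same)
  moreover have "rho b (replicate (n - 1) X) = replicate (n - 1) (X :: 'a mod_ring letter)"
    using rho_replicate[of b "n - 1" "[]"] by simp
  ultimately show ?thesis by (simp add: snoc x rho_append_word)
qed

lemma tendsto_fz:
  assumes "big Q"
  shows "(\<lambda>K. fps_nth (fz K 0 Q) s) \<longlonglongrightarrow> zr s Q"
proof -
  have "admissible (reg (delta (replicate s X @ dword Q)))"
    unfolding dword_def by (rule admissible_reg_delta[OF last_rho_word[OF assms]])
  from zeta_sh_sums(1)[OF this] show ?thesis
    by (simp add: sums_def_le zr_def zts_reg[OF big_is_array[OF assms], symmetric] zts_def)
qed

section \<open>The recursion for the convolution\<close>

abbreviation wd :: "nat \<Rightarrow> 'N::finite mod_ring \<Rightarrow> 'N array \<Rightarrow> 'N mod_ring letter list" where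
  "wd s a Q \<equiv> replicate s X @ rho a (word_of X Y Q)"

text \<open>Lower entries relative to a preceding entry \<open>a\<close>. Words after
  \<open>rho\<close> see only differences, so such a shift turns the start value \<open>a\<close>
  into 0.\<close>

definition down :: "'N::finite mod_ring \<Rightarrow> 'N array \<Rightarrow> 'N array" where
  "down a Q = map (\<lambda>y. (fst y, snd y - a)) Q"

lemma rho_down: "rho (a - c) (word_of X Y (down c Q)) = rho a (word_of X Y Q)"
proof (induction Q arbitrary: a)
  case (Cons y Q)
  then show ?case by (cases y) (simp add: down_def)
qed (simp add: down_def)

lemma rho_dword: "rho a (word_of X Y Q) = dword (down a Q)"
  using rho_down[of a a Q] by (simp add: dword_def)

lemma zeta_sh_wd: "zeta_sh (reg (delta (wd s a Q))) = zr s (down a Q)"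
  by (simp add: zr_def rho_dword)

text \<open>Every letter \<open>Y\<close> is followed by \<open>X\<close>, that is, upper entries
  are at least 2. In this local form the condition controls all pieces that the coproduct cuts
  off.\<close>

fun okw :: "'a letter list \<Rightarrow> bool" where
  "okw [] \<longleftrightarrow> True"
| "okw (X # W) \<longleftrightarrow> okw W"
| "okw (Y k # W) \<longleftrightarrow> (\<exists>V. W = X # V) \<and> okw W"

lemma okw_suffix: "okw (U @ V) \<Longrightarrow> okw V"
  by (induction U rule: okw.induct) auto

lemma okw_last: "okw V \<Longrightarrow> V = [] \<or> last V = X"
  by (induction V rule: okw.induct) auto

lemma okw_prefix: "okw (U @ Y k # V) \<Longrightarrow> U = [] \<or> last U = X"
  by (induction U rule: okw.induct) (auto simp: Cons_eq_append_conv)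

text \<open>Behind a letter \<open>Y\<close> a nonempty piece begins with \<open>X\<close>, so its
  reversal ends with \<open>X\<close> and has a convergent value.\<close>

lemma okw_rev: "okw (Y k # U @ V) \<Longrightarrow> rev U = [] \<or> last (rev U) = X"
  by (cases U) auto

lemma okw_wd: "big Q \<Longrightarrow> okw (wd s a Q)"
proof -
  have rep: "okw (replicate s X @ W) = okw W" for s and W :: "'a mod_ring letter list" by (induction s) simp_all
  have "big Q \<Longrightarrow> okw (rho a (word_of X Y Q))"
  proof (induction Q arbitrary: a)
    case (Cons y Q)
    obtain n b where y: "y = (n, b)" by (cases y)
    obtain m where m: "n - 1 = Suc m" using Cons.prems y by (metis One_nat_def big_simps(2) Suc_diff_le numeral_2_eq_2 diff_Suc_1 le_Suc_ex add_Suc)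
    show ?case using Cons m by (simp add: y rep)
  qed simp
  then show "big Q \<Longrightarrow> okw (wd s a Q)" by (simp add: rep)
qed

lemma admissible_csF: "okw W \<Longrightarrow> admissible (csF W R)"
proof -
  assume W: "okw W"
  have "csF W R \<in> {f. admissible f}"
  proof (rule csF_closed[where P = okw])
    fix U V :: "'a mod_ring letter list" and k
    show "okw (U @ V) \<Longrightarrow> okw V" by (rule okw_suffix)
    show "okw V \<Longrightarrow> reg (delta V) \<in> {f. admissible f}"
      by (rule CollectI, rule admissible_reg_delta, rule okw_last)
    show "okw (U @ Y k # V) \<Longrightarrow> reg (delta U) \<in> {f. admissible f}"
      by (rule CollectI, rule admissible_reg_delta, rule okw_prefix)
    show "okw (Y k # U @ V) \<Longrightarrow> reg (delta (rev U)) \<in> {f. admissible f}"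
      by (rule CollectI, rule admissible_reg_delta, rule okw_rev)
  qed (auto intro: admissible_closed W)
  then show ?thesis by simp
qed

text \<open>\<open>zeta_sh_add\<close> applies to admissible elements, so admissibility of the
  partial sums is proved along with the value.\<close>

lemma zeta_sh_split_sum:
  assumes "\<And>u v. w = u @ v \<Longrightarrow> admissible (f u v)"
  shows "admissible (split_sum f w) \<and> zeta_sh (split_sum f w) = split_sum (\<lambda>u v. zeta_sh (f u v)) w"
  using assms
proof (induction w arbitrary: f)
  case (Cons a w)
  have "admissible (split_sum (\<lambda>u. f (a # u)) w) \<and>
      zeta_sh (split_sum (\<lambda>u. f (a # u)) w) = split_sum (\<lambda>u v. zeta_sh (f (a # u) v)) w"
    by (rule Cons.IH) (simp add: Cons.prems)
  moreover have "admissible (f [] (a # w))" by (rule Cons.prems) simp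
  ultimately show ?case by (simp add: zeta_sh_add admissible_closed)
qed simp

lemma zeta_sh_pick_sum:
  assumes "\<And>u d v. w = u @ d # v \<Longrightarrow> admissible (f u d v)"
  shows "admissible (pick_sum f w) \<and> zeta_sh (pick_sum f w) = pick_sum (\<lambda>u d v. zeta_sh (f u d v)) w"
  using assms
proof (induction w arbitrary: f)
  case (Cons a w)
  have "admissible (pick_sum (\<lambda>u. f (a # u)) w) \<and>
      zeta_sh (pick_sum (\<lambda>u. f (a # u)) w) = pick_sum (\<lambda>u d v. zeta_sh (f (a # u) d v)) w"
    by (rule Cons.IH) (simp add: Cons.prems)
  moreover have "admissible (f [] a w)" by (rule Cons.prems) simp
  ultimately show ?case by (simp add: zeta_sh_add admissible_closed)
qed (simp add: zeta_sh_consts admissible_closed)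

lemma zeta_sh_sign: "admissible f \<Longrightarrow> admissible ((- 1) ^ n * f) \<and> zeta_sh ((- 1) ^ n * f) = (- 1) ^ n * zeta_sh f"
proof (induction n)
  case (Suc n)
  then have a: "admissible ((- 1) ^ n * f)" and z: "zeta_sh ((- 1) ^ n * f) = (- 1) ^ n * zeta_sh f" by simp_all
  have "(- 1) ^ Suc n * f = - 1 * ((- 1) ^ n * f)" by simp
  then show ?case
    using zeta_sh_mult[OF admissible_closed(3) a] admissible_closed(5)[OF admissible_closed(3) a]
    by (simp only: zeta_sh_consts z) simp
qed simp

section \<open>Cuts of a word in terms of the columns of its array\<close>

lemma pick_sum_wd:
  fixes h :: "'N::finite mod_ring letter list \<Rightarrow> 'N mod_ring \<Rightarrow> 'N mod_ring letter list \<Rightarrow> 'b::comm_monoid_add"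
  shows "pick_sum (\<lambda>U l V. case l of X \<Rightarrow> 0 | Y \<kappa> \<Rightarrow> h U \<kappa> V) (wd s a Q) =
    pick_sum (\<lambda>P x P'. h (wd s a P) (snd x - lastc a P) (wd (fst x - 1) (snd x) P')) Q"
proof (induction Q arbitrary: s a h)
  case Nil
  show ?case by (induction s arbitrary: h) simp_all
next
  case (Cons x Q)
  obtain n b where x: "x = (n, b)" by (cases x)
  let ?f = "\<lambda>U l V. case l of X \<Rightarrow> 0 | Y \<kappa> \<Rightarrow> h U \<kappa> V"
  have p: "pick_sum f (replicate s X @ W) = pick_sum (\<lambda>U. f (replicate s X @ U)) W"
    if "\<And>U V. f U X V = 0" for W :: "'N mod_ring letter list" and f :: "_ \<Rightarrow> _ \<Rightarrow> _ \<Rightarrow> 'b"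
    using that by (induction s arbitrary: f) simp_all
  have "pick_sum ?f (wd s a (x # Q)) = pick_sum (\<lambda>U. ?f (replicate s X @ U)) (rho a (word_of X Y (x # Q)))"
    by (rule p) simp
  then show ?case using Cons.IH[of "\<lambda>U. h (replicate s X @ Y (b - a) # U)" "n - 1" b]
    by (simp add: x)
qed

text \<open>The piece that starts behind the letter \<open>Y\<close> of the first column and ends
  after \<open>i\<close> letters \<open>X\<close> of the column with lower entry \<open>b\<close>;
  \<open>P\<close> lists the columns before that one. For empty \<open>P\<close> it is the first
  column itself and only letters \<open>X\<close> remain.\<close>

definition mid :: "'N::finite array \<Rightarrow> 'N mod_ring \<Rightarrow> nat \<Rightarrow> 'N mod_ring letter list" where
  "mid P b i = tl (rho 0 (word_of X Y P @ Y b # replicate i X))"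

lemma rho_replicate_X [simp]: "rho a (replicate n X) = replicate n X"
  using rho_replicate[of a n "[]"] by simp

lemma mid_Nil [simp]: "mid [] b i = replicate i X"
  by (simp add: mid_def)

lemma mid_Cons: "mid ((n, c) # P) b i = wd (n - 1) c P @ Y (b - lastc c P) # replicate i X"
  by (simp add: mid_def rho_append_word)

lemma mid_Cons': "mid ((n, c) # P) b i = replicate (n - 1) X @ Y ((case P of [] \<Rightarrow> b | y # _ \<Rightarrow> snd y) - c) # mid P b i"
  by (cases P) (auto simp: mid_Cons)

text \<open>Every cut lies in exactly one column \<open>x\<close>, after \<open>i\<close> of its
  \<open>fst x - 1\<close> letters \<open>X\<close>.\<close>

lemma split_sum_wd:
  assumes "is_array Q" "n \<ge> 1"
  shows "split_sum F (wd (n - 1) b Q) =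
    pick_sum (\<lambda>P x P'. \<Sum>i<fst x. F (mid P (snd x) i) (wd (fst x - 1 - i) (snd x) P')) ((n, b) # Q)"
  using assms
proof (induction Q arbitrary: n b F)
  case Nil
  have "split_sum F (replicate k X) = (\<Sum>i<Suc k. F (replicate i X) (replicate (k - i) X))" for k and F :: "'a mod_ring letter list \<Rightarrow> 'a mod_ring letter list \<Rightarrow> 'b"
    unfolding split_sum_atMost lessThan_Suc_atMost by (intro sum.cong) auto
  from this[of F "n - 1"] show ?case using Nil by simp
next
  case (Cons x Q)
  obtain m c where x: "x = (m, c)" by (cases x)
  have m: "m \<ge> 1" and Q: "is_array Q" using Cons.prems by (simp_all add: x)
  have s: "split_sum F (replicate k X @ Y e # W) =
     (\<Sum>i<Suc k. F (replicate i X) (replicate (k - i) X @ Y e # W)) + split_sum (\<lambda>U. F (replicate k X @ Y e # U)) W"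
    for k e W and F :: "'a mod_ring letter list \<Rightarrow> 'a mod_ring letter list \<Rightarrow> 'b"
  proof (induction k arbitrary: F)
    case (Suc k)
    show ?case by (simp add: Suc sum.lessThan_Suc_shift[of _ "Suc k"] add.assoc del: sum.lessThan_Suc)
  qed simp
  have "pick_sum (\<lambda>P y P'. \<Sum>i<fst y. F (mid ((n, b) # P) (snd y) i) (wd (fst y - 1 - i) (snd y) P')) ((m, c) # Q) =
      pick_sum (\<lambda>P y P'. \<Sum>i<fst y. F (replicate (n - 1) X @ Y (c - b) # mid P (snd y) i) (wd (fst y - 1 - i) (snd y) P')) ((m, c) # Q)"
  proof (rule pick_sum_cong)
    fix u d v assume "(m, c) # Q = u @ d # v"
    then have "(case u of [] \<Rightarrow> snd d | y # _ \<Rightarrow> snd y) = c" by (cases u) auto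
    then show "(\<Sum>i<fst d. F (mid ((n, b) # u) (snd d) i) (wd (fst d - 1 - i) (snd d) v)) =
        (\<Sum>i<fst d. F (replicate (n - 1) X @ Y (c - b) # mid u (snd d) i) (wd (fst d - 1 - i) (snd d) v))"
      by (simp only: mid_Cons')
  qed
  also have "\<dots> = split_sum (\<lambda>U. F (replicate (n - 1) X @ Y (c - b) # U)) (wd (m - 1) c Q)"
    by (rule Cons.IH[OF Q m, symmetric])
  finally show ?case
    using Cons.prems(2) by (subst pick_sum.simps(2)) (simp add: x s del: pick_sum.simps)
qed

lemma cont_simps' [simp]: "cont (replicate n X @ W) = cont W" "cont (replicate n X) = 0"
  by (induction n) (simp_all add: cont_def)

lemma cont_wd: "cont (rho a (word_of X Y P @ W)) = lastc a P - a + cont (rho (lastc a P) W)"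
proof (induction a P rule: lastc.induct)
  case (2 a n b P)
  have "sum_list (replicate k (0 :: 'a mod_ring)) = 0" for k by (induction k) simp_all
  then show ?case using 2 by (simp add: cont_def algebra_simps)
qed (simp add: cont_def)

text \<open>The letters are differences of lower entries, so their sum telescopes.\<close>

lemma cont_mid: "P @ x # P' = (n, b) # Q \<Longrightarrow> b + cont (mid P (snd x) i) = snd x"
proof (cases P)
  case (Cons y P1)
  assume "P @ x # P' = (n, b) # Q"
  then show ?thesis using Cons cont_wd[of b P1 "[Y (snd x)]"]
    by (simp add: mid_Cons) (simp add: cont_def rho_append_word)
qed simp

lemma length_mid: "is_array P \<Longrightarrow> length (mid P b i) = i + sum_list (map fst P)"
  by (induction P) (auto simp: mid_Cons')

text \<open>A reversed piece is again the word of an array with \<open>i\<close> leading letters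
  \<open>X\<close>: the columns of \<open>P\<close> read backwards, with lower entries measured
  downwards from \<open>b\<close>, have the same differences. On the analytic side this reflects the
  variables at a pole.\<close>

lemma rev_mid: "rev (mid P b i) = replicate i X @ dword (rev (map (\<lambda>y. (fst y, b - snd y)) P))"
proof (induction P)
  case (Cons y P)
  obtain n c where y: "y = (n, c)" by (cases y)
  have "lastc 0 (rev (map (\<lambda>y. (fst y, b - snd y)) P)) = b - (case P of [] \<Rightarrow> b | y # _ \<Rightarrow> snd y)"
    by (cases P) (auto simp: case_prod_beta)
  then show ?case using Cons
    by (simp add: y mid_Cons' dword_def rho_append_word algebra_simps)
qed (simp add: dword_def)

text \<open>Truncated divisor sums of a right word, with one level for each column.
  \<open>Gx\<close> carries the column that is still open, with its upper entry \<open>m\<close> so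
  far and its lower entry \<open>b\<close>. A word with leading \<open>X\<close> belongs to no
  array, hence the 0 in \<open>Gam\<close>.\<close>

fun Gx :: "(nat \<Rightarrow> 'N::finite mod_ring \<Rightarrow> int \<Rightarrow> complex) \<Rightarrow> int \<Rightarrow> int \<Rightarrow> 'N mod_ring \<Rightarrow> nat \<Rightarrow>
    'N mod_ring letter list \<Rightarrow> complex" where
  "Gx E L d0 b m [] = (\<Sum>d\<in>{d0<..L}. E m b d)"
| "Gx E L d0 b m (X # R) = Gx E L d0 b (Suc m) R"
| "Gx E L d0 b m (Y k # R) = (\<Sum>d\<in>{d0<..L}. E m b d * Gx E L d (k + b) 1 R)"

fun Gam :: "(nat \<Rightarrow> 'N::finite mod_ring \<Rightarrow> int \<Rightarrow> complex) \<Rightarrow> int \<Rightarrow> int \<Rightarrow> 'N mod_ring \<Rightarrow>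
    'N mod_ring letter list \<Rightarrow> complex" where
  "Gam E L d0 a [] = 1"
| "Gam E L d0 a (X # R) = 0"
| "Gam E L d0 a (Y k # R) = Gx E L d0 (k + a) 1 R"

lemma Gx_Gam: "Gx E L d0 b m R = (\<Sum>d\<in>{d0<..L}. E m b d * Gam E L d b R) +
    (case R of X # R' \<Rightarrow> Gx E L d0 b (Suc m) R' | _ \<Rightarrow> 0)"
  by (cases R; cases "hd R") simp_all

text \<open>Words with leading \<open>X\<close> are included, so that removing a first letter stays
  within these sets; on them \<open>Gam\<close> vanishes.\<close>

definition AW :: "nat \<Rightarrow> 'N::finite mod_ring letter list set" where "AW N = {R. length R \<le> N}"

lemma finite_AW: "finite (AW N)"
  using finite_lists_length_le[of "UNIV :: 'a mod_ring letter set" N] by (simp add: AW_def)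

lemma sum_AW_Suc: "(\<Sum>R\<in>AW (Suc N). f R) = f [] + ((\<Sum>R\<in>AW N. f (X # R)) + (\<Sum>k\<in>UNIV. \<Sum>R\<in>AW N. f (Y k # R)))"
  for f :: "'N::finite mod_ring letter list \<Rightarrow> 'b::comm_monoid_add"
proof -
  have UN: "UNIV = insert X (range (Y :: 'N mod_ring \<Rightarrow> _))" by (auto intro: letter.exhaust)
  have "AW (Suc N) = insert [] ((\<lambda>(l, R). l # R) ` (UNIV \<times> (AW N :: 'N mod_ring letter list set)))"
  proof (intro equalityI subsetI)
    fix R :: "'N mod_ring letter list" assume "R \<in> AW (Suc N)"
    then show "R \<in> insert [] ((\<lambda>(l, R). l # R) ` (UNIV \<times> AW N))"
      by (cases R) (auto simp: AW_def image_iff)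
  qed (auto simp: AW_def)
  then have "(\<Sum>R\<in>AW (Suc N). f R) = f [] + (\<Sum>R\<in>(\<lambda>(l, R). l # R) ` (UNIV \<times> (AW N :: 'N mod_ring letter list set)). f R)"
    by (simp only:) (rule sum.insert; auto simp: finite_AW)
  also have "(\<Sum>R\<in>(\<lambda>(l, R). l # R) ` (UNIV \<times> (AW N :: 'N mod_ring letter list set)). f R) =
      (\<Sum>l\<in>UNIV. \<Sum>R\<in>AW N. f (l # R))"
    by (subst sum.reindex) (auto simp: inj_on_def sum.cartesian_product case_prod_beta intro!: sum.cong)
  also have "\<dots> = (\<Sum>R\<in>AW N. f (X # R)) + (\<Sum>k\<in>UNIV. \<Sum>R\<in>AW N. f (Y k # R))"
    by (subst UN) (subst sum.insert; auto simp: sum.reindex inj_on_def)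
  finally show ?thesis .
qed

lemma sum_AW_0: "(\<Sum>R\<in>AW 0. f R) = f []" for f :: "'N::finite mod_ring letter list \<Rightarrow> 'b::comm_monoid_add"
proof -
  have "AW 0 = {[] :: 'N mod_ring letter list}" by (auto simp: AW_def)
  then show ?thesis by simp
qed

text \<open>By \<open>csF_X\<close>, leading letters \<open>X\<close> of the right word are matched
  by leading ones of the left word. Stripping \<open>i\<close> of them raises the pending upper
  entry from \<open>m\<close> to \<open>m + i\<close>; \<open>H\<close> evaluates what
  remains.\<close>

lemma sum_strip_X:
  assumes H: "\<And>N t d. length (wd t b P) \<le> N \<Longrightarrow> (\<Sum>R\<in>AW N. zeta_sh (csF (wd t b P) R) * Gam E L d b R) = H t d"
    and "length (wd t b P) \<le> N"
  shows "(\<Sum>R\<in>AW N. zeta_sh (csF (wd t b P) R) * Gx E L d0 b m R) =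
    (\<Sum>i\<le>t. \<Sum>d\<in>{d0<..L}. E (m + i) b d * H (t - i) d)"
  using assms(2)
proof -
  have step: "(\<Sum>R\<in>AW N. zeta_sh (csF (wd t b P) R) * Gx E L d0 b m R) = (\<Sum>d\<in>{d0<..L}. E m b d * H t d) +
      (case t of 0 \<Rightarrow> 0 | Suc t' \<Rightarrow> (\<Sum>R\<in>AW (N - 1). zeta_sh (csF (wd t' b P) R) * Gx E L d0 b (Suc m) R))"
    if len: "length (wd t b P) \<le> N" for t N m
  proof -
  have "(\<Sum>R\<in>AW N. zeta_sh (csF (wd t b P) R) * Gx E L d0 b m R) =
     (\<Sum>R\<in>AW N. \<Sum>d\<in>{d0<..L}. E m b d * (zeta_sh (csF (wd t b P) R) * Gam E L d b R)) +
     (\<Sum>R\<in>AW N. zeta_sh (csF (wd t b P) R) * (case R of X # R' \<Rightarrow> Gx E L d0 b (Suc m) R' | _ \<Rightarrow> 0))"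
    by (subst Gx_Gam) (simp add: distrib_left sum.distrib sum_distrib_left mult_ac)
  also have "(\<Sum>R\<in>AW N. \<Sum>d\<in>{d0<..L}. E m b d * (zeta_sh (csF (wd t b P) R) * Gam E L d b R)) =
      (\<Sum>d\<in>{d0<..L}. E m b d * H t d)"
    by (subst sum.swap) (simp only: sum_distrib_left[symmetric] H[OF len])
  also have "(\<Sum>R\<in>AW N. zeta_sh (csF (wd t b P) R) * (case R of X # R' \<Rightarrow> Gx E L d0 b (Suc m) R' | _ \<Rightarrow> 0)) =
      (case t of 0 \<Rightarrow> 0 | Suc t' \<Rightarrow> (\<Sum>R\<in>AW (N - 1). zeta_sh (csF (wd t' b P) R) * Gx E L d0 b (Suc m) R))"
  proof (cases N)
    case 0
    then show ?thesis using len by (cases t) (simp_all add: sum_AW_0)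
  next
    case (Suc N')
    have "(\<Sum>R\<in>AW N'. zeta_sh (csF (rho b (word_of X Y P)) (X # R)) * Gx E L d0 b (Suc m) R) = 0"
      by (cases P; cases "hd P") (simp_all add: csF_X zeta_sh_consts)
    then show ?thesis unfolding Suc sum_AW_Suc by (cases t) (simp_all add: csF_X)
  qed
  finally show ?thesis .
  qed
  show "length (wd t b P) \<le> N \<Longrightarrow> ?thesis"
  proof (induction t arbitrary: N m)
    case (Suc t)
    have "length (wd t b P) \<le> N - 1" using Suc.prems by simp
    from Suc.IH[OF this, of "Suc m"] show ?case
      by (subst step[OF Suc.prems]) (simp add: sum.atMost_Suc_shift del: sum.atMost_Suc replicate.simps)
  next
    case 0
    show ?case by (subst step[OF 0]) simp
  qed
qed

text \<open>One level on the side of the coproduct: the cut is made in the column \<open>x\<close>,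
  \<open>P\<close> gives the reversed piece and \<open>Q\<close> the piece that follows on the same
  level. \<open>level_poles\<close> has the same shape, with the variable of \<open>x\<close> as the
  pole.\<close>

definition level_sum :: "(nat \<Rightarrow> 'N::finite mod_ring \<Rightarrow> int \<Rightarrow> complex) \<Rightarrow> 'N array \<Rightarrow> int \<Rightarrow> complex" where
  "level_sum E B d = pick_sum (\<lambda>P x Q. \<Sum>i<fst x. \<Sum>m\<le>fst x - 1 - i.
    (- 1) ^ (i + sum_list (map fst P)) * zr i (rev (map (\<lambda>y. (fst y, snd x - snd y)) P)) *
      (E (Suc m) (snd x) d * zr (fst x - 1 - i - m) (down (snd x) Q))) B"

lemma pick_sum_eq_split_sum: "(\<And>P. G P [] = 0) \<Longrightarrow> pick_sum (\<lambda>P x P'. G P (x # P')) Q = split_sum G Q"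
proof (induction Q arbitrary: G)
  case (Cons a Q)
  have "pick_sum (\<lambda>P x P'. G (a # P) (x # P')) Q = split_sum (\<lambda>P. G (a # P)) Q"
    by (rule Cons.IH) (rule Cons.prems)
  then show ?case by simp
qed simp

lemma split_pick_sum:
  "split_sum (\<lambda>B V. pick_sum (\<lambda>P x Q. f P x Q V) B) C = pick_sum (\<lambda>P x R. split_sum (\<lambda>Q V. f P x Q V) R) C"
  by (induction C arbitrary: f) (simp_all add: split_sum_add)

lemma zeta_sh_csF_Y:
  assumes "big Q"
  shows "zeta_sh (csF (wd s a Q) (Y k # R)) = pick_sum (\<lambda>P0 x P1. split_sum (\<lambda>U' V'.
    if snd x - a + cont U' = k then zr s (down a P0) * ((- 1) ^ length U' * zeta_sh (reg (delta (rev U')))) *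
      zeta_sh (csF V' R) else 0) (wd (fst x - 1) (snd x) P1)) Q"
proof -
  have "csF (wd s a Q) (Y k # R) = pick_sum (\<lambda>P0 x P1. split_sum (\<lambda>U' V'.
      if cont (wd s a P0) + (snd x - lastc a P0) + cont U' = k
      then (- 1) ^ length U' * (reg (delta (wd s a P0)) * reg (delta (rev U'))) * csF V' R else 0)
      (wd (fst x - 1) (snd x) P1)) Q"
    unfolding csF_Y by (rule pick_sum_wd)
  also have "\<dots> = pick_sum (\<lambda>P0 x P1. split_sum (\<lambda>U' V'.
      if snd x - a + cont U' = k
      then (- 1) ^ length U' * (reg (delta (wd s a P0)) * reg (delta (rev U'))) * csF V' R else 0)
      (wd (fst x - 1) (snd x) P1)) Q" (is "_ = pick_sum (\<lambda>P0 x P1. split_sum (?f P0 x) (?w x P1)) Q")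
  proof -
    have "cont (wd s a P0) + (c - lastc a P0) = c - a" for P0 :: "'a array" and c
      using cont_wd[of a P0 "[]"] by (simp add: cont_def[of "[]"])
    then show ?thesis by (simp only:)
  qed
  finally have c: "csF (wd s a Q) (Y k # R) = pick_sum (\<lambda>P0 x P1. split_sum (?f P0 x) (?w x P1)) Q" .
  have F: "admissible (?f P0 x U' V') \<and> zeta_sh (?f P0 x U' V') = (if snd x - a + cont U' = k
      then zr s (down a P0) * ((- 1) ^ length U' * zeta_sh (reg (delta (rev U')))) * zeta_sh (csF V' R) else 0)"
    if Q: "Q = P0 @ x # P1" and w: "?w x P1 = U' @ V'" for P0 x P1 U' V'
  proof -
    have b: "big P0" "big (x # P1)" using assms Q by simp_all
    have ok: "okw (Y (snd x) # U' @ V')"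
      using okw_wd[OF b(2), of 0 0] w by (cases x) simp
    have "okw V'" using okw_suffix[of "Y (snd x) # U'" V'] ok by simp
    then have 1: "admissible (csF V' R)" by (rule admissible_csF)
    have 2: "admissible (reg (delta (rev U')) :: 'a shalg)" by (rule admissible_reg_delta[OF okw_rev[OF ok]])
    have 3: "admissible (reg (delta (wd s a P0)) :: 'a shalg)"
      by (rule admissible_reg_delta[OF last_rho_word[OF b(1)]])
    note m = admissible_closed(5)[OF 3 2] zeta_sh_mult[OF 3 2]
    note sg = zeta_sh_sign[OF m(1), of "length U'"]
    have "zeta_sh ((- 1) ^ length U' * (reg (delta (wd s a P0)) * reg (delta (rev U'))) * csF V' R) =
        (- 1) ^ length U' * (zr s (down a P0) * zeta_sh (reg (delta (rev U')))) * zeta_sh (csF V' R)"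
      by (simp only: zeta_sh_mult[OF sg[THEN conjunct1] 1] sg[THEN conjunct2] m(2) zeta_sh_wd)
    also have "\<dots> = zr s (down a P0) * ((- 1) ^ length U' * zeta_sh (reg (delta (rev U')))) * zeta_sh (csF V' R)"
      by (simp only: mult_ac)
    finally show ?thesis
      using admissible_closed(5)[OF sg[THEN conjunct1] 1] by (simp add: admissible_closed zeta_sh_consts)
  qed
  have G: "admissible (split_sum (?f P0 x) (?w x P1)) \<and> zeta_sh (split_sum (?f P0 x) (?w x P1)) =
      split_sum (\<lambda>U' V'. if snd x - a + cont U' = k
      then zr s (down a P0) * ((- 1) ^ length U' * zeta_sh (reg (delta (rev U')))) * zeta_sh (csF V' R) else 0) (?w x P1)"
    if Q: "Q = P0 @ x # P1" for P0 x P1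
  proof -
    have "admissible (split_sum (?f P0 x) (?w x P1)) \<and> zeta_sh (split_sum (?f P0 x) (?w x P1)) =
        split_sum (\<lambda>U' V'. zeta_sh (?f P0 x U' V')) (?w x P1)"
      by (rule zeta_sh_split_sum) (rule F[OF Q, THEN conjunct1])
    moreover have "split_sum (\<lambda>U' V'. zeta_sh (?f P0 x U' V')) (?w x P1) = split_sum (\<lambda>U' V'. if snd x - a + cont U' = k
        then zr s (down a P0) * ((- 1) ^ length U' * zeta_sh (reg (delta (rev U')))) * zeta_sh (csF V' R) else 0) (?w x P1)"
      by (rule split_sum_cong) (rule F[OF Q, THEN conjunct2])
    ultimately show ?thesis by simp
  qed
  have "zeta_sh (csF (wd s a Q) (Y k # R)) = pick_sum (\<lambda>P0 x P1. zeta_sh (split_sum (?f P0 x) (?w x P1))) Q"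
    unfolding c by (rule zeta_sh_pick_sum[THEN conjunct2]) (rule G[THEN conjunct1])
  also have "\<dots> = pick_sum (\<lambda>P0 x P1. split_sum (\<lambda>U' V'.
    if snd x - a + cont U' = k then zr s (down a P0) * ((- 1) ^ length U' * zeta_sh (reg (delta (rev U')))) *
      zeta_sh (csF V' R) else 0) (wd (fst x - 1) (snd x) P1)) Q"
    by (rule pick_sum_cong) (rule G[THEN conjunct2])
  finally show ?thesis .
qed

text \<open>The first letter \<open>Y\<close> of the right word opens the first level: what precedes
  the cut gives the factor \<open>zr\<close>, and the rest has the same form again. A cut consumes
  at least one column, hence the induction on the length of \<open>Q\<close>.\<close>

theorem convolution_levels:
  assumes "big Q" "length (wd s a Q) \<le> N"
  shows "(\<Sum>R\<in>AW N. zeta_sh (csF (wd s a Q) R) * Gam E L d0 a R) =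
    split_sum (\<lambda>Q0 Q1. zr s (down a Q0) * XX (level_sum E) L d0 Q1) Q"
  using assms
proof (induction "length Q" arbitrary: Q s a N d0 rule: less_induct)
  case less
  let ?RR = "\<lambda>s a d Q. split_sum (\<lambda>Q0 Q1. zr s (down a Q0) * XX (level_sum E) L d Q1) Q"
  show ?case
  proof (cases N)
    case 0
    then have "wd s a Q = []" using less.prems by simp
    then have "s = 0" "Q = []" by (simp, cases Q, auto)
    then show ?thesis using 0
      by (simp add: sum_AW_0 csF_Nil zr_def dword_def down_def)
  next
    case (Suc N')
    define A where "A P x i = (- 1) ^ (i + sum_list (map fst P)) * zr i (rev (map (\<lambda>y. (fst y, snd x - snd y)) P))"
      for P :: "'a array" and x :: "nat \<times> 'a mod_ring" and i
    \<comment> \<open>The sum over all continuations once the columns before \<open>C\<close> are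
      left without a level; it will turn out to be \<open>XX\<close> at \<open>C\<close>.\<close>
    define B where "B C = pick_sum (\<lambda>P x P'. \<Sum>i<fst x. A P x i *
        (\<Sum>m\<le>fst x - 1 - i. \<Sum>d\<in>{d0<..L}. E (Suc m) (snd x) d * ?RR (fst x - 1 - i - m) (snd x) d P')) C"
      for C :: "'a array"
    have inner: "split_sum (\<lambda>U' V'. (- 1) ^ length U' * zeta_sh (reg (delta (rev U'))) *
        (\<Sum>R\<in>AW N'. zeta_sh (csF V' R) * Gx E L d0 (snd x + cont U') 1 R)) (wd (fst x - 1) (snd x) P1) = B (x # P1)"
      if Q: "Q = P0 @ x # P1" for P0 x P1
    proof -
      have b: "big (x # P1)" using less.prems(1) Q by simp
      obtain n c where x: "x = (n, c)" by (cases x)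
      have ar: "is_array P1" "n \<ge> 1" using big_is_array[OF b] by (simp_all add: x)
      have "length Q = length P0 + Suc (length P1)" by (simp add: Q)
      have len: "length (wd (n - 1) c P1) \<le> N'"
        using less.prems(2) unfolding Suc by (simp add: Q x)
      have "split_sum (\<lambda>U' V'. (- 1) ^ length U' * zeta_sh (reg (delta (rev U'))) *
          (\<Sum>R\<in>AW N'. zeta_sh (csF V' R) * Gx E L d0 (c + cont U') 1 R)) (wd (n - 1) c P1) =
        pick_sum (\<lambda>P x P'. \<Sum>i<fst x. (- 1) ^ length (mid P (snd x) i) * zeta_sh (reg (delta (rev (mid P (snd x) i)))) *
          (\<Sum>R\<in>AW N'. zeta_sh (csF (wd (fst x - 1 - i) (snd x) P') R) * Gx E L d0 (c + cont (mid P (snd x) i)) 1 R)) ((n, c) # P1)"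
        by (rule split_sum_wd[OF ar])
      also have "\<dots> = B ((n, c) # P1)"
        unfolding B_def
      proof (intro pick_sum_cong sum.cong refl)
        fix P y P' i assume s: "(n, c) # P1 = P @ y # P'" and i: "i \<in> {..<fst y}"
        have "big (P @ y # P')" using b by (simp only: x s)
        then have bP: "big P" "big P'" by (cases y; simp)+
        have c: "c + cont (mid P (snd y) i) = snd y" by (rule cont_mid[OF s[symmetric]])
        have l: "length P' < length Q" using arg_cong[OF s, of length] by (simp add: Q)
        have "length (wd (fst y - 1 - i) (snd y) P') \<le> length (wd (n - 1) c P1)"
        proof -
          have "length (rho 0 (word_of X Y ((n, c) # P1))) = length (rho 0 (word_of X Y (P @ y # P')))" by (simp only: s)
          then show ?thesis by (cases y) simp
        qed
        then have l': "length (wd (fst y - 1 - i) (snd y) P') \<le> N'" using len by (rule order_trans)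
        have "(\<Sum>R\<in>AW N'. zeta_sh (csF (wd (fst y - 1 - i) (snd y) P') R) * Gx E L d0 (snd y) 1 R) =
            (\<Sum>m\<le>fst y - 1 - i. \<Sum>d\<in>{d0<..L}. E (1 + m) (snd y) d * ?RR (fst y - 1 - i - m) (snd y) d P')"
          by (rule sum_strip_X[OF _ l']) (rule less.hyps[OF l bP(2)])
        then show "(- 1) ^ length (mid P (snd y) i) * zeta_sh (reg (delta (rev (mid P (snd y) i)))) *
          (\<Sum>R\<in>AW N'. zeta_sh (csF (wd (fst y - 1 - i) (snd y) P') R) * Gx E L d0 (c + cont (mid P (snd y) i)) 1 R) =
          A P y i * (\<Sum>m\<le>fst y - 1 - i. \<Sum>d\<in>{d0<..L}. E (Suc m) (snd y) d * ?RR (fst y - 1 - i - m) (snd y) d P')"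
          by (simp add: c A_def length_mid[OF big_is_array[OF bP(1)]] rev_mid zr_def)
      qed
      finally show ?thesis by (simp add: x)
    qed
    \<comment> \<open>The prefix of \<open>P'\<close> that the induction hypothesis places before
      the next cut lies on the same level as \<open>P\<close> and \<open>x\<close>. Together they
      form the block of \<open>level_sum\<close>.\<close>
    have B_XX: "B C = XX (level_sum E) L d0 C" if "C \<noteq> []" for C
    proof -
      have "XX (level_sum E) L d0 C = (\<Sum>d\<in>{d0<..L}. split_sum (\<lambda>B V. if B = [] then 0 else level_sum E B d * XX (level_sum E) L d V) C)"
        by (rule XX_nonempty[OF that])
      also have "\<dots> = (\<Sum>d\<in>{d0<..L}. split_sum (\<lambda>B V. level_sum E B d * XX (level_sum E) L d V) C)"
        by (intro sum.cong split_sum_cong refl) (simp add: level_sum_def)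
      also have "\<dots> = (\<Sum>d\<in>{d0<..L}. pick_sum (\<lambda>P x P'. \<Sum>i<fst x. A P x i *
         (\<Sum>m\<le>fst x - 1 - i. E (Suc m) (snd x) d * ?RR (fst x - 1 - i - m) (snd x) d P')) C)"
      proof (intro sum.cong refl)
        fix d
        have "split_sum (\<lambda>B V. level_sum E B d * XX (level_sum E) L d V) C = split_sum (\<lambda>B V. pick_sum (\<lambda>P x Q. \<Sum>i<fst x. A P x i *
          (\<Sum>m\<le>fst x - 1 - i. E (Suc m) (snd x) d * (zr (fst x - 1 - i - m) (down (snd x) Q) * XX (level_sum E) L d V))) B) C"
        proof (rule split_sum_cong)
          fix B V
          show "level_sum E B d * XX (level_sum E) L d V = pick_sum (\<lambda>P x Q. \<Sum>i<fst x. A P x i *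
            (\<Sum>m\<le>fst x - 1 - i. E (Suc m) (snd x) d * (zr (fst x - 1 - i - m) (down (snd x) Q) * XX (level_sum E) L d V))) B"
            unfolding level_sum_def[of E B d] mult.commute[of _ "XX (level_sum E) L d V"] pick_sum_mult_left
            by (intro pick_sum_cong) (simp add: A_def sum_distrib_left mult_ac)
        qed
        then show "split_sum (\<lambda>B V. level_sum E B d * XX (level_sum E) L d V) C = pick_sum (\<lambda>P x P'. \<Sum>i<fst x. A P x i *
          (\<Sum>m\<le>fst x - 1 - i. E (Suc m) (snd x) d * ?RR (fst x - 1 - i - m) (snd x) d P')) C"
          by (simp only: split_pick_sum split_sum_sum split_sum_mult_left)
      qed
      also have "\<dots> = B C"
      proof -
        have "(\<Sum>m\<le>n. \<Sum>d\<in>D. f m d) = (\<Sum>d\<in>D. \<Sum>m\<le>n. f m d)" for n :: nat and D :: "int set" and f :: "nat \<Rightarrow> int \<Rightarrow> complex"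
          by (rule sum.swap)
        moreover have "(\<Sum>i<n. \<Sum>d\<in>D. f i d) = (\<Sum>d\<in>D. \<Sum>i<n. f i d)" for n :: nat and D :: "int set" and f :: "nat \<Rightarrow> int \<Rightarrow> complex"
          by (rule sum.swap)
        ultimately show ?thesis unfolding B_def by (simp only: sum_distrib_left pick_sum_sum)
      qed
      finally show ?thesis by simp
    qed
    have "(\<Sum>R\<in>AW N. zeta_sh (csF (wd s a Q) R) * Gam E L d0 a R) =
       zr s (down a Q) + (\<Sum>k\<in>UNIV. \<Sum>R\<in>AW N'. zeta_sh (csF (wd s a Q) (Y k # R)) * Gx E L d0 (k + a) 1 R)"
      unfolding Suc sum_AW_Suc by (simp add: csF_Nil zeta_sh_wd)
    also have "(\<Sum>k\<in>UNIV. \<Sum>R\<in>AW N'. zeta_sh (csF (wd s a Q) (Y k # R)) * Gx E L d0 (k + a) 1 R) =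
       pick_sum (\<lambda>P0 x P1. split_sum (\<lambda>U' V'. \<Sum>k\<in>UNIV. \<Sum>R\<in>AW N'. (if snd x - a + cont U' = k
          then zr s (down a P0) * ((- 1) ^ length U' * zeta_sh (reg (delta (rev U')))) * zeta_sh (csF V' R) else 0) *
          Gx E L d0 (k + a) 1 R) (wd (fst x - 1) (snd x) P1)) Q"
      unfolding zeta_sh_csF_Y[OF less.prems(1)] split_sum_sum pick_sum_sum
      by (simp only: mult.commute[of _ "Gx _ _ _ _ _ _"] split_sum_mult_left pick_sum_mult_left)
    also have "\<dots> = pick_sum (\<lambda>P0 x P1. zr s (down a P0) * B (x # P1)) Q"
    proof (rule pick_sum_cong)
      fix P0 x P1 assume Q: "Q = P0 @ x # P1"
      have "(\<Sum>k\<in>UNIV. \<Sum>R\<in>AW N'. (if snd x - a + cont U' = k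
          then zr s (down a P0) * ((- 1) ^ length U' * zeta_sh (reg (delta (rev U')))) * zeta_sh (csF V' R) else 0) *
          Gx E L d0 (k + a) 1 R) = zr s (down a P0) * ((- 1) ^ length U' * zeta_sh (reg (delta (rev U'))) *
          (\<Sum>R\<in>AW N'. zeta_sh (csF V' R) * Gx E L d0 (snd x + cont U') 1 R))" for U' V'
      proof -
        have "(\<Sum>k\<in>UNIV. \<Sum>R\<in>AW N'. (if snd x - a + cont U' = k
          then zr s (down a P0) * ((- 1) ^ length U' * zeta_sh (reg (delta (rev U')))) * zeta_sh (csF V' R) else 0) *
          Gx E L d0 (k + a) 1 R) = (\<Sum>k\<in>UNIV. if snd x - a + cont U' = k then (\<Sum>R\<in>AW N'.
            zr s (down a P0) * ((- 1) ^ length U' * zeta_sh (reg (delta (rev U')))) * zeta_sh (csF V' R) *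
          Gx E L d0 (k + a) 1 R) else 0)"
          by (intro sum.cong refl) simp
        also have "\<dots> = (\<Sum>R\<in>AW N'.
            zr s (down a P0) * ((- 1) ^ length U' * zeta_sh (reg (delta (rev U')))) * zeta_sh (csF V' R) *
          Gx E L d0 (snd x - a + cont U' + a) 1 R)"
          by (subst sum.delta') simp_all
        also have "snd x - a + cont U' + a = snd x + cont U'" by simp
        finally show ?thesis by (simp add: sum_distrib_left mult_ac)
      qed
      then show "split_sum (\<lambda>U' V'. \<Sum>k\<in>UNIV. \<Sum>R\<in>AW N'. (if snd x - a + cont U' = k
          then zr s (down a P0) * ((- 1) ^ length U' * zeta_sh (reg (delta (rev U')))) * zeta_sh (csF V' R) else 0) *
          Gx E L d0 (k + a) 1 R) (wd (fst x - 1) (snd x) P1) = zr s (down a P0) * B (x # P1)"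
        by (simp only: split_sum_mult_left inner[OF Q])
    qed
    also have "\<dots> = split_sum (\<lambda>Q0 C. zr s (down a Q0) * B C) Q"
      by (rule pick_sum_eq_split_sum) (simp add: B_def)
    also have "zr s (down a Q) + \<dots> = split_sum (\<lambda>Q0 C. zr s (down a Q0) * XX (level_sum E) L d0 C) Q"
    proof -
      have "split_sum (\<lambda>Q0 C. zr s (down a Q0) * XX (level_sum E) L d0 C) Q =
          split_sum (\<lambda>Q0 C. (if C = [] then zr s (down a Q) else 0) + zr s (down a Q0) * B C) Q"
        by (rule split_sum_cong) (auto simp: B_XX, simp add: B_def)
      also have "\<dots> = split_sum (\<lambda>Q0 C. if C = [] then zr s (down a Q) else 0) Q + split_sum (\<lambda>Q0 C. zr s (down a Q0) * B C) Q"
        by (rule split_sum_add)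
      also have "split_sum (\<lambda>Q0 C. if C = [] then zr s (down a Q) else 0) Q = zr s (down a Q)"
      proof -
        have "split_sum (\<lambda>Q0 C. if C = [] then z else 0) w = z" for z :: complex and w :: "'a array"
          by (induction w) simp_all
        then show ?thesis .
      qed
      finally show ?thesis by simp
    qed
    finally show ?thesis .
  qed
qed

section \<open>Partial fractions\<close>

lemma prod_power_lower:
  fixes v :: "'i \<Rightarrow> 'r::comm_ring_1"
  assumes "finite A" "j \<in> A" "n j \<ge> 1" "u * v j = 1"
  shows "(\<Prod>l\<in>A. v l ^ (n(j := n j - 1)) l) = (\<Prod>l\<in>A. v l ^ n l) * u"
proof -
  have "v j ^ n j * u = v j ^ (n j - 1) * (u * v j)" using assms(3) by (cases "n j") (simp_all add: mult_ac)
  moreover have "(\<Prod>l\<in>A - {j}. v l ^ (n(j := n j - 1)) l) = (\<Prod>l\<in>A - {j}. v l ^ n l)" by (rule prod.cong) auto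
  ultimately have "(\<Prod>l\<in>A. v l ^ (n(j := n j - 1)) l) = v j ^ n j * u * (\<Prod>l\<in>A - {j}. v l ^ n l)"
    using prod.remove[OF assms(1,2), of "\<lambda>l. v l ^ (n(j := n j - 1)) l"] assms(4) by simp
  also have "\<dots> = (\<Prod>l\<in>A. v l ^ n l) * u"
    using prod.remove[OF assms(1,2), of "\<lambda>l. v l ^ n l"] by (simp add: mult_ac)
  finally show ?thesis .
qed

text \<open>\<open>1 / (z - t)\<close> expanded in the local parameter \<open>t\<close> at a pole.
  Below it is multiplied by \<open>fps_X\<close>, so that the coefficient at \<open>n\<close> is the
  residue for a pole of order \<open>n\<close>, and 0 for \<open>n = 0\<close>.\<close>

definition geo :: "complex \<Rightarrow> complex fps" where
  "geo z = Abs_fps (\<lambda>k. inverse z ^ (k + 1))"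

text \<open>The summands are the residues at the poles \<open>- m i\<close> of the product divided by \<open>x - z\<close>.\<close>

lemma partial_fractions_set:
  fixes x :: complex and m :: "'i \<Rightarrow> int"
  assumes I: "finite I" "inj_on m I" and nz: "\<And>i. i \<in> I \<Longrightarrow> x + of_int (m i) \<noteq> 0"
    and n: "\<exists>i\<in>I. n i \<ge> 1"
  shows "(\<Prod>i\<in>I. inverse (x + of_int (m i)) ^ n i) =
    (\<Sum>i\<in>I. fps_nth (fps_X * geo (x + of_int (m i)) *
      (\<Prod>l\<in>I - {i}. inverse (fps_X + of_int (m l - m i)) ^ n l)) (n i))"
  using n
proof (induction "\<Sum>i\<in>I. n i" arbitrary: n rule: less_induct)
  case less
  define u :: "'i \<Rightarrow> 'i \<Rightarrow> complex fps" where "u i l = fps_X + of_int (m l - m i)" for i l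
  define T where "T n i = fps_nth (fps_X * geo (x + of_int (m i)) * (\<Prod>l\<in>I - {i}. inverse (u i l) ^ n l)) (n i)" for n i
  have uv: "u i l * inverse (u i l) = 1" if "i \<in> I" "l \<in> I - {i}" for i l
  proof -
    have "m l \<noteq> m i" using that I(2) by (auto dest: inj_onD)
    then have "fps_nth (u i l) 0 \<noteq> 0" by (simp add: u_def)
    then show ?thesis by (metis inverse_mult_eq_1 mult.commute)
  qed
  show ?case
  proof (cases "\<exists>j\<in>I. \<exists>j'\<in>I. j \<noteq> j' \<and> n j \<ge> 1 \<and> n j' \<ge> 1")
    case True
    then obtain j j' where j: "j \<in> I" "j' \<in> I" "j \<noteq> j'" "n j \<ge> 1" "n j' \<ge> 1" by blast
    \<comment> \<open>The difference of two linear factors is the constant \<open>c\<close>;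
      multiplying by it lowers one exponent or the other. In \<open>st\<close> the residues satisfy
      this relation term by term.\<close>
    define n1 where "n1 = n(j := n j - 1)"
    define n2 where "n2 = n(j' := n j' - 1)"
    have lt: "sum n1 I < sum n I" "sum n2 I < sum n I"
      unfolding n1_def n2_def using j I(1) by (intro sum_strict_mono_ex1; force)+
    have ne: "n1 j' \<ge> 1" "n2 j \<ge> 1" using j by (simp_all add: n1_def n2_def)
    have IH1: "(\<Prod>i\<in>I. inverse (x + of_int (m i)) ^ n1 i) = (\<Sum>i\<in>I. T n1 i)"
      unfolding T_def u_def by (rule less.hyps[OF lt(1)]) (use ne j in blast)
    have IH2: "(\<Prod>i\<in>I. inverse (x + of_int (m i)) ^ n2 i) = (\<Sum>i\<in>I. T n2 i)"
      unfolding T_def u_def by (rule less.hyps[OF lt(2)]) (use ne j in blast)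
    define c where "c = complex_of_int (m j) - of_int (m j')"
    have c: "c \<noteq> 0" using j I(2) by (auto simp: c_def dest: inj_onD)
    have st: "c * T n i = T n1 i - T n2 i" if i: "i \<in> I" for i
    proof -
      let ?P = "\<Prod>l\<in>I - {i}. inverse (u i l) ^ n l"
      let ?G = "fps_X * geo (x + of_int (m i))"
      have P1: "(\<Prod>l\<in>I - {i}. inverse (u i l) ^ n1 l) = ?P * u i j" if "j \<noteq> i"
        unfolding n1_def by (rule prod_power_lower) (use I j that uv[OF i] in auto)
      have P2: "(\<Prod>l\<in>I - {i}. inverse (u i l) ^ n2 l) = ?P * u i j'" if "j' \<noteq> i"
        unfolding n2_def by (rule prod_power_lower) (use I j that uv[OF i] in auto)
      have P1': "(\<Prod>l\<in>I - {i}. inverse (u i l) ^ n1 l) = ?P" if "j = i"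
        unfolding n1_def using that by (intro prod.cong) auto
      have P2': "(\<Prod>l\<in>I - {i}. inverse (u i l) ^ n2 l) = ?P" if "j' = i"
        unfolding n2_def using that by (intro prod.cong) auto
      have cc: "fps_nth (fps_const c * F) k = c * fps_nth F k" for F k by simp
      have Xs: "fps_nth F k = fps_nth (fps_X * F) (Suc k)" for F :: "complex fps" and k by simp
      have oi: "of_int z = fps_const (complex_of_int z)" for z by (simp add: fps_of_int)
      consider "i = j" | "i = j'" | "i \<noteq> j" "i \<noteq> j'" by blast
      then show ?thesis
      proof cases
        case 1
        have "c * T n i = fps_nth (fps_X * (?G * ?P) - ?G * (?P * u i j')) (n i)"
          unfolding T_def cc[symmetric] unfolding u_def 1 c_def
          by (intro arg_cong2[where f = fps_nth] refl) (simp add: oi algebra_simps fps_const_sub[symmetric] del: fps_const_sub)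
        also have "\<dots> = T n1 i - T n2 i"
        proof -
          have k: "n i = Suc (n1 i)" "n2 i = n i" using j 1 by (simp_all add: n1_def n2_def)
          have "T n1 i = fps_nth (fps_X * (?G * ?P)) (n i)"
            unfolding T_def P1'[OF 1[symmetric]] k(1) by (rule Xs)
          moreover have "T n2 i = fps_nth (?G * (?P * u i j')) (n i)"
            unfolding T_def k(2) using P2 j 1 by simp
          ultimately show ?thesis by simp
        qed
        finally show ?thesis .
      next
        case 2
        have "c * T n i = fps_nth (?G * (?P * u i j) - fps_X * (?G * ?P)) (n i)"
          unfolding T_def cc[symmetric] unfolding u_def 2 c_def
          by (intro arg_cong2[where f = fps_nth] refl) (simp add: oi algebra_simps fps_const_sub[symmetric] del: fps_const_sub)
        also have "\<dots> = T n1 i - T n2 i"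
        proof -
          have k: "n i = Suc (n2 i)" "n1 i = n i" using j 2 by (simp_all add: n1_def n2_def)
          have "T n2 i = fps_nth (fps_X * (?G * ?P)) (n i)"
            unfolding T_def P2'[OF 2[symmetric]] k(1) by (rule Xs)
          moreover have "T n1 i = fps_nth (?G * (?P * u i j)) (n i)"
            unfolding T_def k(2) using P1 j 2 by simp
          ultimately show ?thesis by simp
        qed
        finally show ?thesis .
      next
        case 3
        have "c * T n i = fps_nth (?G * (?P * u i j) - ?G * (?P * u i j')) (n i)"
          unfolding T_def cc[symmetric] unfolding u_def c_def
          by (intro arg_cong2[where f = fps_nth] refl) (simp add: oi algebra_simps fps_const_sub[symmetric] del: fps_const_sub)
        also have "\<dots> = T n1 i - T n2 i"
        proof -
          have k: "n1 i = n i" "n2 i = n i" using 3 by (simp_all add: n1_def n2_def)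
          show ?thesis unfolding T_def k using P1 P2 3 by simp
        qed
        finally show ?thesis .
      qed
    qed
    have "c * (\<Prod>i\<in>I. inverse (x + of_int (m i)) ^ n i) =
        (\<Prod>i\<in>I. inverse (x + of_int (m i)) ^ n i) * (x + of_int (m j)) - (\<Prod>i\<in>I. inverse (x + of_int (m i)) ^ n i) * (x + of_int (m j'))"
      by (simp add: c_def algebra_simps)
    also have "\<dots> = (\<Prod>i\<in>I. inverse (x + of_int (m i)) ^ n1 i) - (\<Prod>i\<in>I. inverse (x + of_int (m i)) ^ n2 i)"
    proof -
      let ?v = "\<lambda>i. inverse (x + of_int (m i))"
      have e: "(x + of_int (m j)) * ?v j = 1" "(x + of_int (m j')) * ?v j' = 1" using nz j by simp_all
      show ?thesis unfolding n1_def n2_def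
        prod_power_lower[where n = n and j = j and v = ?v, OF I(1) j(1) j(4) e(1)]
        prod_power_lower[where n = n and j = j' and v = ?v, OF I(1) j(2) j(5) e(2)] ..
    qed
    also have "\<dots> = c * (\<Sum>i\<in>I. T n i)"
      unfolding IH1 IH2 sum_distrib_left sum_subtractf[symmetric] by (intro sum.cong refl) (simp add: st)
    finally show ?thesis using c unfolding T_def u_def by simp
  next
    case False
    \<comment> \<open>Only one pole is left, and all other residues vanish.\<close>
    obtain j where j: "j \<in> I" "n j \<ge> 1" using less.prems by blast
    have z: "n l = 0" if "l \<in> I" "l \<noteq> j" for l using False j that by (metis One_nat_def Suc_leI not_gr_zero)
    have "(\<Sum>i\<in>I. T n i) = (\<Sum>i\<in>I. if i = j then T n j else 0)"
      by (intro sum.cong refl) (auto simp: T_def z)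
    also have "\<dots> = T n j" using I(1) j by (simp add: sum.delta)
    also have "\<dots> = inverse (x + of_int (m j)) ^ n j"
    proof -
      have "(\<Prod>l\<in>I - {j}. inverse (u j l) ^ n l) = 1" by (rule prod.neutral) (simp add: z)
      then show ?thesis using j(2) by (cases "n j") (simp_all add: T_def geo_def)
    qed
    also have "\<dots> = (\<Prod>i\<in>I. inverse (x + of_int (m i)) ^ n i)"
      using prod.remove[OF I(1) j(1), of "\<lambda>i. inverse (x + of_int (m i)) ^ n i"] by (simp add: z)
    finally show ?thesis unfolding T_def u_def by simp
  qed
qed

definition pole :: "int \<Rightarrow> (nat \<times> int) list \<Rightarrow> complex fps" where
  "pole m z = (\<Prod>y\<leftarrow>z. inverse (fps_X + of_int (snd y - m)) ^ fst y)"

lemma pole_simps [simp]: "pole m [] = 1" "pole m (y # z) = inverse (fps_X + of_int (snd y - m)) ^ fst y * pole m z"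
  "pole m (z @ z') = pole m z * pole m z'"
  by (simp_all add: pole_def case_prod_beta)

lemma partial_fractions:
  assumes "distinct (map snd z)" "\<forall>y\<in>set z. x + of_int (snd y) \<noteq> 0" "z \<noteq> []" "\<forall>y\<in>set z. fst y \<ge> 1"
  shows "(\<Prod>y\<leftarrow>z. inverse (x + of_int (snd y)) ^ fst y) =
    pick_sum (\<lambda>P y Q. fps_nth (fps_X * geo (x + of_int (snd y)) * (pole (snd y) P * pole (snd y) Q)) (fst y)) z"
proof -
  let ?k = "length z"
  have z: "z = map ((!) z) [0..<?k]" by (simp add: map_nth)
  have pl: "pole m (map ((!) z) [a..<b]) = (\<Prod>l\<in>{a..<b}. inverse (fps_X + of_int (snd (z ! l) - m)) ^ fst (z ! l))" for m a b
    by (simp add: pole_def case_prod_beta o_def prod.distinct_set_conv_list[symmetric])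
  have "(\<Prod>y\<leftarrow>z. inverse (x + of_int (snd y)) ^ fst y) = (\<Prod>i\<in>{0..<?k}. inverse (x + of_int (snd (z ! i))) ^ fst (z ! i))"
    by (simp add: prod.list_conv_set_nth)
  also have "\<dots> = (\<Sum>i\<in>{0..<?k}. fps_nth (fps_X * geo (x + of_int (snd (z ! i))) *
      (\<Prod>l\<in>{0..<?k} - {i}. inverse (fps_X + of_int (snd (z ! l) - snd (z ! i))) ^ fst (z ! l))) (fst (z ! i)))"
  proof (rule partial_fractions_set)
    show "inj_on (\<lambda>i. snd (z ! i)) {0..<?k}"
    proof (rule inj_onI)
      fix i j assume ij: "i \<in> {0..<?k}" "j \<in> {0..<?k}" "snd (z ! i) = snd (z ! j)"
      then have "map snd z ! i = map snd z ! j" by simp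
      then show "i = j" using ij nth_eq_iff_index_eq[OF assms(1), of i j] by simp
    qed
    show "\<exists>i\<in>{0..<?k}. 1 \<le> fst (z ! i)"
      using bspec[OF assms(4) nth_mem[of 0 z]] assms(3) by (intro bexI[of _ 0]) auto
  qed (use assms in auto)
  also have "\<dots> = (\<Sum>i\<in>{0..<?k}. fps_nth (fps_X * geo (x + of_int (snd (z ! i))) *
      (pole (snd (z ! i)) (map ((!) z) [0..<i]) * pole (snd (z ! i)) (map ((!) z) [Suc i..<?k]))) (fst (z ! i)))"
  proof (intro sum.cong refl)
    fix i assume i: "i \<in> {0..<?k}"
    then have "{0..<?k} - {i} = {0..<i} \<union> {Suc i..<?k}" by auto
    then show "fps_nth (fps_X * geo (x + of_int (snd (z ! i))) *
      (\<Prod>l\<in>{0..<?k} - {i}. inverse (fps_X + of_int (snd (z ! l) - snd (z ! i))) ^ fst (z ! l))) (fst (z ! i)) =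
      fps_nth (fps_X * geo (x + of_int (snd (z ! i))) *
      (pole (snd (z ! i)) (map ((!) z) [0..<i]) * pole (snd (z ! i)) (map ((!) z) [Suc i..<?k]))) (fst (z ! i))"
      unfolding pl by (simp add: prod.union_disjoint)
  qed
  also have "\<dots> = pick_sum (\<lambda>P y Q. fps_nth (fps_X * geo (x + of_int (snd y)) * (pole (snd y) P * pole (snd y) Q)) (fst y)) (map ((!) z) [0..<?k])"
    by (rule pick_sum_map_upt[symmetric])
  finally show ?thesis using z by simp
qed

text \<open>Nested sum of an arbitrary function of the whole tuple. A term of a partial fraction
  expansion couples all variables with the chosen pole, so it is not a product of functions of
  single variables as in \<open>nest\<close>.\<close>

fun tsum :: "int set \<Rightarrow> int \<Rightarrow> 'N::finite array \<Rightarrow> ((nat \<times> int) list \<Rightarrow> 'r::comm_ring_1) \<Rightarrow> 'r" where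
  "tsum A p [] F = F []"
| "tsum A p (x # B) F = (\<Sum>q\<in>{q\<in>A. p < q \<and> inZ q (snd x)}. tsum A q B (\<lambda>z. F ((fst x, q) # z)))"

lemma tsum_linear: "tsum A p B (\<lambda>z. F z + G z) = tsum A p B F + tsum A p B G"
  "tsum A p B (\<lambda>z. c * G z) = c * tsum A p B G" "tsum A p B (\<lambda>z. 0) = 0"
  by (induction B arbitrary: p F G) (simp_all add: sum.distrib sum_distrib_left)

lemma tsum_hom:
  assumes "h 0 = 0" "\<And>x y. h (x + y) = h x + h y"
  shows "h (tsum A p B F) = tsum A p B (\<lambda>z. h (F z))"
proof -
  have s: "h (sum f I) = (\<Sum>i\<in>I. h (f i))" for f and I :: "int set"
    by (induction I rule: infinite_finite_induct) (simp_all add: assms)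
  show ?thesis by (induction B arbitrary: p F) (simp_all add: s)
qed

lemma tsum_cong:
  assumes "\<And>z. sorted_wrt (<) (p # map snd z) \<Longrightarrow> map fst z = map fst B \<Longrightarrow> snd ` set z \<subseteq> A \<Longrightarrow> F z = G z"
  shows "tsum A p B F = tsum A p B G"
  using assms
proof (induction B arbitrary: p F G)
  case (Cons x B)
  show ?case unfolding tsum.simps
  proof (intro sum.cong refl Cons.IH Cons.prems)
    fix q and z :: "(nat \<times> int) list"
    assume q: "q \<in> {q\<in>A. p < q \<and> inZ q (snd x)}" and z: "sorted_wrt (<) (q # map snd z)"
    then have "p < q" by simp
    with z show "sorted_wrt (<) (p # map snd ((fst x, q) # z))" by auto
  qed auto
qed simp

lemma nest_tsum:
  fixes f :: "int \<Rightarrow> nat \<Rightarrow> 'r::comm_ring_1"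
  shows "finite A \<Longrightarrow> nest (<) A p (map (cfun f) B) = tsum A p B (\<lambda>z. \<Prod>y\<leftarrow>z. f (snd y) (fst y))"
proof (induction B arbitrary: p)
  case (Cons x B)
  have "nest (<) A p (map (cfun f) (x # B)) = (\<Sum>q\<in>{q\<in>A. p < q}. if inZ q (snd x) then f q (fst x) * nest (<) A q (map (cfun f) B) else 0)"
    by (simp add: cfun_def case_prod_beta if_distrib cong: if_cong) (intro sum.cong; auto)
  also have "\<dots> = (\<Sum>q\<in>{q\<in>{q\<in>A. p < q}. inZ q (snd x)}. f q (fst x) * nest (<) A q (map (cfun f) B))"
    using Cons.prems by (intro sum.inter_filter[symmetric]) simp
  also have "\<dots> = tsum A p (x # B) (\<lambda>z. \<Prod>y\<leftarrow>z. f (snd y) (fst y))"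
    using Cons by (simp add: tsum_linear)
  finally show ?case .
qed simp

text \<open>Once the chosen variable is fixed at \<open>m\<close>, those before it and those after
  it range independently.\<close>

lemma tsum_pick:
  assumes "finite A"
  shows "tsum A p B (pick_sum (\<lambda>P y Q. H P y Q)) = pick_sum (\<lambda>P x Q. \<Sum>m\<in>{m\<in>A. p < m \<and> inZ m (snd x)}.
    tsum {q\<in>A. q < m} p P (\<lambda>z1. tsum A m Q (\<lambda>z2. H z1 (fst x, m) z2))) B"
proof (induction B arbitrary: p H)
  case (Cons x B)
  let ?C = "{q\<in>A. p < q \<and> inZ q (snd x)}"
  have "tsum A p (x # B) (pick_sum (\<lambda>P y Q. H P y Q)) = (\<Sum>q\<in>?C. tsum A q B (\<lambda>z. H [] (fst x, q) z)) +
      (\<Sum>q\<in>?C. tsum A q B (pick_sum (\<lambda>P y Q. H ((fst x, q) # P) y Q)))"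
    by (simp add: tsum_linear sum.distrib)
  also have "(\<Sum>q\<in>?C. tsum A q B (pick_sum (\<lambda>P y Q. H ((fst x, q) # P) y Q))) =
     pick_sum (\<lambda>P y Q. \<Sum>q\<in>?C. \<Sum>m\<in>{m\<in>{m\<in>A. p < m \<and> inZ m (snd y)}. q < m}. tsum {q\<in>A. q < m} q P (\<lambda>z1. tsum A m Q (\<lambda>z2. H ((fst x, q) # z1) (fst y, m) z2))) B"
    unfolding Cons.IH pick_sum_sum by (intro sum.cong pick_sum_cong refl) auto
  also have "\<dots> = pick_sum (\<lambda>P y Q. \<Sum>m\<in>{m\<in>A. p < m \<and> inZ m (snd y)}. \<Sum>q\<in>{q\<in>?C. q < m}. tsum {q\<in>A. q < m} q P (\<lambda>z1. tsum A m Q (\<lambda>z2. H ((fst x, q) # z1) (fst y, m) z2))) B"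
    by (intro pick_sum_cong sum.swap_restrict) (use assms in auto)
  also have "\<dots> = pick_sum (\<lambda>P y Q. \<Sum>m\<in>{m\<in>A. p < m \<and> inZ m (snd y)}.
    tsum {q\<in>A. q < m} p (x # P) (\<lambda>z1. tsum A m Q (\<lambda>z2. H z1 (fst y, m) z2))) B"
    unfolding tsum.simps by (intro pick_sum_cong sum.cong refl) auto
  finally show ?case by simp
qed simp

lemma nest_cong_set:
  assumes "{q\<in>A. p < q} = {q\<in>A'. p < (q::int)}"
  shows "nest (<) A p fs = nest (<) A' p fs"
  using assms
proof (induction fs arbitrary: p)
  case (Cons f fs)
  have "nest (<) A q fs = nest (<) A' q fs" if "p < q" for q
  proof (rule Cons.IH)
    have "{r\<in>A. q < r} = {r\<in>{r\<in>A. p < r}. q < r}" using that by auto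
    also have "\<dots> = {r\<in>A'. q < r}" unfolding Cons.prems using that by auto
    finally show "{r\<in>A. q < r} = {r\<in>A'. q < r}" .
  qed
  then show ?case unfolding nest.simps Cons.prems by (intro sum.cong refl) simp
qed simp

lemma nest_shift:
  "nest (<) {a..b} p fs = nest (<) {a - c..b - c} (p - c) (map (\<lambda>f k. f (k + c)) fs)" for c :: int
proof (induction fs arbitrary: p)
  case (Cons f fs)
  show ?case unfolding nest.simps list.map
  proof (rule sum.reindex_bij_witness[of _ "\<lambda>k. k + c" "\<lambda>q. q - c"])
    fix q show "f (q - c + c) * nest (<) {a - c..b - c} (q - c) (map (\<lambda>f k. f (k + c)) fs) = f q * nest (<) {a..b} q fs"
      by (simp add: Cons.IH[of q])
  qed auto
qed simp

text \<open>The reflection of the variables at \<open>c\<close> reverses their order and therefore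
  the list of functions.\<close>

lemma nest_reflect:
  "nest (<) {q\<in>{a..b}. q < m} (a - 1) fs = nest (<) {c - b..c - a} (c - m) (rev (map (\<lambda>f k. f (c - k)) fs))" for c :: int
proof (induction fs arbitrary: m rule: rev_induct)
  case (snoc f fs)
  have "nest (<) {q\<in>{a..b}. q < m} (a - 1) (fs @ [f]) =
      (\<Sum>k\<in>{k\<in>{q\<in>{a..b}. q < m}. a - 1 < k}. nest (<) {q\<in>{q\<in>{a..b}. q < m}. q < k} (a - 1) fs * f k)"
    by (rule nest_less_snoc) (rule finite_subset[of _ "{a..b}"], auto)
  also have "\<dots> = (\<Sum>k\<in>{k\<in>{c - b..c - a}. c - m < k}. f (c - k) * nest (<) {c - b..c - a} k (rev (map (\<lambda>f k. f (c - k)) fs)))"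
  proof (rule sum.reindex_bij_witness[of _ "\<lambda>k. c - k" "\<lambda>k. c - k"])
    fix k assume "k \<in> {k\<in>{q\<in>{a..b}. q < m}. a - 1 < k}"
    then have "{q\<in>{q\<in>{a..b}. q < m}. q < k} = {q\<in>{a..b}. q < k}" by auto
    then show "f (c - (c - k)) * nest (<) {c - b..c - a} (c - k) (rev (map (\<lambda>f k. f (c - k)) fs)) =
        nest (<) {q\<in>{q\<in>{a..b}. q < m}. q < k} (a - 1) fs * f k"
      by (simp only: snoc.IH[of k]) (simp add: mult.commute)
  qed auto
  finally show ?case by simp
qed simp

section \<open>The Lipschitz formula\<close>

text \<open>The value at 0 is set to 0 because \<open>0 ^ 0 = 1\<close>, while the series starts
  with \<open>c = 1\<close>.\<close>

definition pc :: "nat \<Rightarrow> nat \<Rightarrow> complex" where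
  "pc j c = (if c = 0 then 0 else of_nat c ^ j)"

definition pw :: "nat \<Rightarrow> complex \<Rightarrow> complex" where
  "pw j w = suminf (\<lambda>c. pc j c * w ^ c)"

lemma pc_Suc: "pc (Suc j) c = of_nat c * pc j c"
  by (simp add: pc_def)

lemma summable_pw: "norm w < 1 \<Longrightarrow> summable (\<lambda>c. pc j c * w ^ c)"
proof (induction j arbitrary: w)
  case 0
  have "summable (\<lambda>c. w ^ Suc c)" using 0 by (simp add: summable_mult summable_geometric)
  then show ?case by (subst summable_Suc_iff[symmetric]) (simp add: pc_def)
next
  case (Suc j)
  have "summable (\<lambda>c. diffs (pc j) c * w ^ c)"
    by (rule termdiff_converges[where K = 1]) (use Suc in simp_all)
  then have "summable (\<lambda>c. w * (diffs (pc j) c * w ^ c))" by (rule summable_mult)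
  then have "summable (\<lambda>c. pc (Suc j) (Suc c) * w ^ Suc c)"
    by (simp add: diffs_def pc_Suc mult_ac del: of_nat_Suc)
  then show ?case by (subst (asm) summable_Suc_iff)
qed

text \<open>Stated without division by \<open>w\<close>, so that it includes \<open>w = 0\<close>,
  where differentiability gives the limit for large imaginary part.\<close>

lemma DERIV_pw:
  assumes "norm w < 1"
  obtains D where "(pw j has_field_derivative D) (at w)" "w * D = pw (Suc j) w"
proof
  obtain K :: real where K: "norm w < K" "K < 1" using assms dense by blast
  then have K': "norm (of_real K :: complex) < 1" "norm w < norm (of_real K :: complex)"
    using norm_ge_zero[of w] by (simp_all add: abs_less_iff del: norm_ge_zero)
  show "(pw j has_field_derivative suminf (\<lambda>c. diffs (pc j) c * w ^ c)) (at w)"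
    unfolding pw_def[abs_def] by (rule termdiffs_strong[OF summable_pw[OF K'(1)] K'(2)])
  have s: "summable (\<lambda>c. diffs (pc j) c * w ^ c)"
    by (rule termdiff_converges[where K = 1]) (use summable_pw assms in simp_all)
  have "w * suminf (\<lambda>c. diffs (pc j) c * w ^ c) = suminf (\<lambda>c. w * (diffs (pc j) c * w ^ c))"
    by (rule suminf_mult[OF s, symmetric])
  also have "\<dots> = suminf (\<lambda>c. pc (Suc j) (Suc c) * w ^ Suc c)"
    by (simp add: diffs_def pc_Suc mult_ac del: of_nat_Suc)
  also have "\<dots> = pw (Suc j) w"
    unfolding pw_def by (subst suminf_split_head[OF summable_pw[OF assms]]) (simp add: pc_def)
  finally show "w * suminf (\<lambda>c. diffs (pc j) c * w ^ c) = pw (Suc j) w" .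
qed

lemma pw_0: "norm w < 1 \<Longrightarrow> pw 0 w = w / (1 - w)"
proof -
  assume w: "norm w < 1"
  have "pw 0 w = suminf (\<lambda>c. pc 0 (Suc c) * w ^ Suc c)"
    unfolding pw_def by (subst suminf_split_head[OF summable_pw[OF w]]) (simp add: pc_def)
  also have "\<dots> = w * suminf (\<lambda>c. w ^ c)"
    using suminf_mult[OF summable_geometric[OF w], of w] by (simp add: pc_def)
  finally show ?thesis by (simp add: suminf_geometric[OF w])
qed

definition Lq :: "nat \<Rightarrow> complex \<Rightarrow> complex" where
  "Lq n z = (- 2 * pi * \<i>) ^ n / fact (n - 1) * pw (n - 1) (exp (2 * pi * \<i> * z))"

lemma norm_exp_less: "Im z > 0 \<Longrightarrow> norm (exp (2 * pi * \<i> * z)) < 1"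
  by (simp add: norm_exp_eq_Re)

lemma DERIV_Lq:
  assumes "Im z > 0" "n \<ge> 1"
  shows "(Lq n has_field_derivative - of_nat n * Lq (Suc n) z) (at z)"
proof -
  let ?w = "exp (2 * pi * \<i> * z)"
  obtain D where D: "(pw (n - 1) has_field_derivative D) (at ?w)" "?w * D = pw (Suc (n - 1)) ?w"
    using DERIV_pw[OF norm_exp_less[OF assms(1)]] by blast
  have "((\<lambda>z. exp (2 * pi * \<i> * z)) has_field_derivative ?w * (2 * pi * \<i>)) (at z)"
    by (auto intro!: derivative_eq_intros)
  from DERIV_cmult[OF DERIV_chain2[OF D(1) this], of "(- 2 * pi * \<i>) ^ n / fact (n - 1)"]
  have "(Lq n has_field_derivative (- 2 * pi * \<i>) ^ n / fact (n - 1) * (D * (?w * (2 * pi * \<i>)))) (at z)"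
    by (simp only: Lq_def[abs_def])
  moreover have "(- 2 * pi * \<i>) ^ n / fact (n - 1) * (D * (?w * (2 * pi * \<i>))) = - of_nat n * Lq (Suc n) z"
  proof -
    obtain k where n: "n = Suc k" using assms(2) by (cases n) auto
    have "(- 2 * pi * \<i>) ^ n / fact (n - 1) * (D * (?w * (2 * pi * \<i>))) = (- 2 * pi * \<i>) ^ n / fact (n - 1) * (2 * pi * \<i>) * (?w * D)"
      by (simp only: mult_ac)
    also have "\<dots> = - of_nat n * ((- 2 * pi * \<i>) ^ Suc n / (of_nat n * fact (n - 1)) * pw n ?w)"
      unfolding D(2) using assms(2) by (simp add: field_simps)
    also have "of_nat n * fact (n - 1) = (fact n :: complex)" using n by simp
    finally show ?thesis by (simp add: Lq_def)
  qed
  ultimately show ?thesis by simp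
qed

text \<open>The sum of the powers \<open>1 / (z + k) ^ n\<close> over \<open>k \<ge> 0\<close>,
  which for \<open>n = 1\<close> is regularized to minus the digamma function.\<close>

definition pg :: "nat \<Rightarrow> complex \<Rightarrow> complex" where
  "pg n z = (- 1) ^ n * Polygamma (n - 1) z / fact (n - 1)"

text \<open>For \<open>n = 1\<close> the logarithms in the limits of the two digamma values
  cancel.\<close>

lemma LIMSEQ_pg:
  assumes "s \<noteq> 0" "t \<noteq> 0" "n \<ge> 1"
  shows "(\<lambda>m. \<Sum>k<m. inverse (s + of_nat k) ^ n - inverse (t + of_nat k) ^ n) \<longlonglongrightarrow> pg n s - pg n t"
proof (cases "n = 1")
  case True
  have "(\<lambda>m. (of_real (ln (real m)) - (\<Sum>n<m. inverse (t + of_nat n))) -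
      (of_real (ln (real m)) - (\<Sum>n<m. inverse (s + of_nat n)))) \<longlonglongrightarrow> Digamma t - Digamma s"
    by (intro tendsto_diff Digamma_LIMSEQ assms)
  then show ?thesis by (simp add: True pg_def sum_subtractf)
next
  case False
  then have n: "n - 1 > 0" "Suc (n - 1) = n" using assms(3) by simp_all
  have "(\<lambda>k. inverse ((s + of_nat k) ^ n)) sums pg n s" "(\<lambda>k. inverse ((t + of_nat k) ^ n)) sums pg n t"
    using Polygamma_LIMSEQ[OF assms(1) n(1)] Polygamma_LIMSEQ[OF assms(2) n(1)] unfolding n(2) pg_def by simp_all
  from sums_diff[OF this] show ?thesis by (simp add: sums_def power_inverse)
qed

text \<open>The regularized sum of \<open>1 / (z + m) ^ n\<close> over all integers; the value at
  \<open>1 - z\<close> accounts for negative \<open>m\<close>.\<close>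

definition Fq :: "nat \<Rightarrow> complex \<Rightarrow> complex" where
  "Fq n z = pg n z + (- 1) ^ n * pg n (1 - z)"

lemma notin_nonpos: "Im z > 0 \<Longrightarrow> z \<notin> \<int>\<^sub>\<le>\<^sub>0" "Im z > 0 \<Longrightarrow> 1 - z \<notin> \<int>\<^sub>\<le>\<^sub>0"
  by (auto elim!: nonpos_Ints_cases' simp: complex_eq_iff)

lemma DERIV_Fq:
  assumes "Im z > 0" "n \<ge> 1"
  shows "(Fq n has_field_derivative - of_nat n * Fq (Suc n) z) (at z)"
proof -
  obtain k where n: "n = Suc k" using assms(2) by (cases n) auto
  have "((\<lambda>z. Polygamma k (1 - z)) has_field_derivative Polygamma (Suc k) (1 - z) * (- 1)) (at z)"
    by (rule DERIV_chain2[where f = "Polygamma k" and g = "\<lambda>z. 1 - z"])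
      (auto intro!: derivative_eq_intros has_field_derivative_Polygamma notin_nonpos(2) assms(1))
  moreover have "(Polygamma k has_field_derivative Polygamma (Suc k) z) (at z)"
    by (rule has_field_derivative_Polygamma[OF notin_nonpos(1)[OF assms(1)]])
  ultimately have "((\<lambda>z. (- 1) ^ n / fact k * Polygamma k z + (- 1) ^ n * ((- 1) ^ n / fact k * Polygamma k (1 - z))) has_field_derivative
     (- 1) ^ n / fact k * Polygamma (Suc k) z + (- 1) ^ n * ((- 1) ^ n / fact k * (Polygamma (Suc k) (1 - z) * (- 1)))) (at z)"
    by (intro DERIV_add DERIV_cmult)
  moreover have "Fq n = (\<lambda>z. (- 1) ^ n / fact k * Polygamma k z + (- 1) ^ n * ((- 1) ^ n / fact k * Polygamma k (1 - z)))"
    by (simp add: fun_eq_iff Fq_def pg_def n)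
  moreover have "(- 1) ^ n / fact k * Polygamma (Suc k) z + (- 1) ^ n * ((- 1) ^ n / fact k * (Polygamma (Suc k) (1 - z) * (- 1))) = - of_nat n * Fq (Suc n) z"
    by (simp add: Fq_def pg_def n field_simps del: of_nat_Suc)
  ultimately show ?thesis by simp
qed

text \<open>Logarithmic derivative of the reflection formula of the Gamma function.\<close>

lemma Digamma_reflection:
  fixes z :: complex
  assumes "Im z > 0"
  shows "Digamma (1 - z) - Digamma z = pi * cos (pi * z) / sin (pi * z)"
proof -
  have G: "(Gamma has_field_derivative Gamma z * Digamma z) (at z)"
    by (rule has_field_derivative_Gamma[OF notin_nonpos(1)[OF assms]])
  have G': "((\<lambda>z. Gamma (1 - z)) has_field_derivative Gamma (1 - z) * Digamma (1 - z) * (- 1)) (at z)"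
    by (rule DERIV_chain2[where f = Gamma and g = "\<lambda>z. 1 - z"])
      (auto intro!: derivative_eq_intros has_field_derivative_Gamma notin_nonpos(2) assms)
  have D1: "((\<lambda>z. Gamma z * Gamma (1 - z)) has_field_derivative
      Gamma z * Gamma (1 - z) * (Digamma z - Digamma (1 - z))) (at z)"
    by (rule DERIV_cong[OF DERIV_mult[OF G G']]) (simp add: algebra_simps)
  have nz: "Gamma z \<noteq> 0" "Gamma (1 - z) \<noteq> 0"
    using notin_nonpos[OF assms] by (simp_all add: Gamma_eq_zero_iff)
  have r: "Gamma z * Gamma (1 - z) = pi / sin (pi * z)" for z :: complex by (rule Gamma_reflection_complex)
  have s: "sin (pi * z) \<noteq> 0" using r[of z] nz by auto
  have D2: "((\<lambda>z. pi / sin (pi * z)) has_field_derivative - (pi / sin (pi * z)) * (pi * cos (pi * z) / sin (pi * z))) (at z)"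
    using s by (auto intro!: derivative_eq_intros simp: field_simps power2_eq_square)
  have "Gamma z * Gamma (1 - z) * (Digamma z - Digamma (1 - z)) = - (pi / sin (pi * z)) * (pi * cos (pi * z) / sin (pi * z))"
    using D1 D2 unfolding r by (rule DERIV_unique)
  then have "Gamma z * Gamma (1 - z) * (Digamma z - Digamma (1 - z) + pi * cos (pi * z) / sin (pi * z)) = 0"
    unfolding r by (simp add: algebra_simps)
  then have "Digamma z - Digamma (1 - z) + pi * cos (pi * z) / sin (pi * z) = 0" using nz by simp
  then show ?thesis by (simp add: algebra_simps eq_neg_iff_add_eq_0)
qed

lemma cot_exp:
  fixes z :: complex
  assumes "Im z > 0"
  shows "pi * cos (pi * z) / sin (pi * z) = - pi * \<i> - 2 * pi * \<i> * (exp (2 * pi * \<i> * z) / (1 - exp (2 * pi * \<i> * z)))"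
proof -
  define e where "e = exp (\<i> * (pi * z))"
  have e0: "e \<noteq> 0" by (simp add: e_def)
  have w: "exp (2 * pi * \<i> * z) = e * e" by (simp add: e_def exp_add[symmetric] algebra_simps)
  have i: "exp (- (\<i> * (pi * z))) = inverse e" by (simp add: e_def exp_minus)
  have ne: "e * e \<noteq> 1" using norm_exp_less[OF assms] unfolding w by auto
  have c: "cos (pi * z) = (e + inverse e) / 2" "sin (pi * z) = (e - inverse e) / (2 * \<i>)"
    unfolding cos_exp_eq sin_exp_eq i by (simp_all add: e_def)
  have d: "e - inverse e \<noteq> 0" "1 - e * e \<noteq> 0" using ne e0 by (auto simp: field_simps)
  show ?thesis unfolding w c using d e0 by (simp add: field_simps)
qed

text \<open>For \<open>n = 1\<close> this is the expansion of the cotangent as a geometric series;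
  larger \<open>n\<close> follow by differentiation on the open half plane, which removes the
  constant \<open>pi * \<i>\<close>.\<close>

lemma Fq_eq_Lq:
  assumes "Im z > 0" "n \<ge> 1"
  shows "Fq n z = Lq n z - (if n = 1 then pi * \<i> else 0)"
  using assms(2,1)
proof (induction n arbitrary: z rule: dec_induct)
  case base
  then show ?case
    using Digamma_reflection[OF base] cot_exp[OF base] pw_0[OF norm_exp_less[OF base]]
    by (simp add: Fq_def pg_def Lq_def)
next
  case (step n)
  have "(Lq n has_field_derivative - of_nat n * Lq (Suc n) z) (at z)"
    by (rule DERIV_Lq) (use step in simp_all)
  from DERIV_diff[OF this DERIV_const] have D: "((\<lambda>z. Lq n z - (if n = 1 then pi * \<i> else 0)) has_field_derivative - of_nat n * Lq (Suc n) z) (at z)"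
    by simp
  have "(Fq n has_field_derivative - of_nat n * Lq (Suc n) z) (at z)"
  proof (rule has_field_derivative_transform_within_open[OF D])
    show "open {z. Im z > 0}" by (rule open_halfspace_Im_gt)
    show "z \<in> {z. Im z > 0}" using step.prems by simp
    fix y assume "y \<in> {z. Im z > 0}"
    then show "Lq n y - (if n = 1 then pi * \<i> else 0) = Fq n y" using step.IH[of y] by simp
  qed
  moreover have "(Fq n has_field_derivative - of_nat n * Fq (Suc n) z) (at z)"
    by (rule DERIV_Fq) (use step in simp_all)
  ultimately have "- of_nat n * Lq (Suc n) z = - of_nat n * Fq (Suc n) z" by (rule DERIV_unique)
  then show ?case using step.hyps by simp
qed

lemma sum_symmetric: "(\<Sum>m\<in>{- int M..int M}. f m) = (\<Sum>k<Suc M. f (int k)) + (\<Sum>k<M. f (- int (Suc k)))"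
  for f :: "int \<Rightarrow> 'b::comm_monoid_add"
proof (induction M)
  case (Suc M)
  have "{- int (Suc M)..int (Suc M)} = insert (- int (Suc M)) (insert (int (Suc M)) {- int M..int M})" by auto
  then have "(\<Sum>m\<in>{- int (Suc M)..int (Suc M)}. f m) = f (- int (Suc M)) + (f (int (Suc M)) + (\<Sum>m\<in>{- int M..int M}. f m))"
    by (simp only:) (subst sum.insert; simp)
  then show ?case by (simp only: Suc.IH sum.lessThan_Suc ac_simps)
qed simp

section \<open>Lattice sums as differences of the values at two points\<close>

definition df :: "nat \<Rightarrow> complex \<Rightarrow> complex \<Rightarrow> int \<Rightarrow> complex" where
  "df n x y m = inverse (x + of_int m) ^ n - inverse (y + of_int m) ^ n"

text \<open>In the difference the constant \<open>pi * \<i>\<close> of the case \<open>n = 1\<close>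
  cancels.\<close>

lemma df_symmetric_limit:
  assumes "Im s > 0" "Im t > 0" "n \<ge> 1"
  shows "(\<lambda>M. \<Sum>m\<in>{- int M..int M}. df n s t m) \<longlonglongrightarrow> Lq n s - Lq n t"
proof -
  have nz: "s \<noteq> 0" "t \<noteq> 0" "1 - s \<noteq> 0" "1 - t \<noteq> 0" using assms by (auto simp: complex_eq_iff)
  have 1: "(\<lambda>M. \<Sum>k<Suc M. inverse (s + of_nat k) ^ n - inverse (t + of_nat k) ^ n) \<longlonglongrightarrow> pg n s - pg n t"
    using LIMSEQ_pg[OF nz(1,2) assms(3)] by (rule LIMSEQ_Suc)
  have neg: "inverse (z + of_int (- int (Suc k))) ^ n = (- 1) ^ n * inverse (1 - z + of_nat k) ^ n" for z :: complex and k
  proof -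
    have "z + of_int (- int (Suc k)) = - (1 - z + of_nat k)" by simp
    then have "inverse (z + of_int (- int (Suc k))) = - inverse (1 - z + of_nat k)" by (simp only: inverse_minus_eq)
    then show ?thesis by (simp only: power_minus[of "inverse _"])
  qed
  have 2: "(\<lambda>M. (- 1) ^ n * (\<Sum>k<M. inverse (1 - s + of_nat k) ^ n - inverse (1 - t + of_nat k) ^ n)) \<longlonglongrightarrow>
      (- 1) ^ n * (pg n (1 - s) - pg n (1 - t))"
    by (intro tendsto_mult tendsto_const LIMSEQ_pg nz assms(3))
  have "(\<Sum>m\<in>{- int M..int M}. df n s t m) = (\<Sum>k<Suc M. inverse (s + of_nat k) ^ n - inverse (t + of_nat k) ^ n) +
      (- 1) ^ n * (\<Sum>k<M. inverse (1 - s + of_nat k) ^ n - inverse (1 - t + of_nat k) ^ n)" for M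
    unfolding sum_symmetric sum_distrib_left df_def neg by (simp add: right_diff_distrib)
  then have "(\<lambda>M. \<Sum>m\<in>{- int M..int M}. df n s t m) \<longlonglongrightarrow> (pg n s - pg n t) + (- 1) ^ n * (pg n (1 - s) - pg n (1 - t))"
    using tendsto_add[OF 1 2] by simp
  also have "(pg n s - pg n t) + (- 1) ^ n * (pg n (1 - s) - pg n (1 - t)) = Fq n s - Fq n t"
    by (simp add: Fq_def algebra_simps)
  also have "\<dots> = Lq n s - Lq n t" using assms by (simp add: Fq_eq_Lq)
  finally show ?thesis .
qed

lemma norm_lattice_ge:
  assumes "Im x > 0"
  shows "\<exists>c>0. \<forall>m. c * (1 + \<bar>real_of_int m\<bar>) \<le> norm (x + of_int m)"
proof -
  \<comment> \<open>If \<open>\<bar>m\<bar>\<close> is at least \<open>2 * norm x + 1\<close>, the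
    triangle inequality gives the bound with 1/4. Otherwise \<open>1 + \<bar>m\<bar>\<close> is
    below \<open>2 * norm x + 2\<close>, and the imaginary part of \<open>x\<close>
    suffices.\<close>
  define c where "c = min (1 / 4) (Im x / (2 * norm x + 2))"
  have np: "2 * norm x + 2 > 0" by (simp add: add_nonneg_pos)
  have c0: "c > 0" unfolding c_def using assms np by simp
  have "c * (1 + \<bar>real_of_int m\<bar>) \<le> norm (x + of_int m)" for m
  proof (cases "\<bar>real_of_int m\<bar> \<ge> 2 * norm x + 1")
    case True
    have "norm (of_int m :: complex) \<le> norm (x + of_int m) + norm x"
      using norm_triangle_ineq4[of "x + of_int m" x] by simp
    then have "\<bar>real_of_int m\<bar> - norm x \<le> norm (x + of_int m)" by simp
    moreover have "c * (1 + \<bar>real_of_int m\<bar>) \<le> 1 / 4 * (1 + \<bar>real_of_int m\<bar>)"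
      unfolding c_def by (intro mult_right_mono min.cobounded1) simp
    moreover have "norm x \<ge> 0" by simp
    ultimately show ?thesis using True by argo
  next
    case False
    have "c * (1 + \<bar>real_of_int m\<bar>) \<le> Im x / (2 * norm x + 2) * (2 * norm x + 2)"
      using False assms np by (intro mult_mono) (simp_all add: c_def)
    also have "\<dots> = Im (x + of_int m)" using np by simp
    also have "\<dots> \<le> norm (x + of_int m)" using abs_Im_le_cmod[of "x + of_int m"] by linarith
    finally show ?thesis .
  qed
  with c0 show ?thesis by blast
qed

definition qd :: "int \<Rightarrow> real" where "qd m = inverse ((1 + \<bar>real_of_int m\<bar>) ^ 2)"

lemma summable_qd: "summable (\<lambda>k. qd (int k))"
proof -
  have "summable (\<lambda>k. inverse (real (Suc k) ^ 2))"
    using inverse_power_summable[of 2, where 'a = real] by (subst summable_Suc_iff) simp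
  then show ?thesis by (simp add: qd_def add.commute)
qed

text \<open>The difference of two simple poles decays quadratically, so even for
  \<open>n = 1\<close> the differences are absolutely summable. Higher powers follow by the product
  rule for differences.\<close>

lemma norm_df_le:
  assumes "Im x > 0" "Im y > 0"
  shows "\<exists>C\<ge>0. \<forall>m. norm (df n x y m) \<le> C * qd m"
proof -
  obtain c where c: "c > 0" "\<And>m. c * (1 + \<bar>real_of_int m\<bar>) \<le> norm (x + of_int m)"
    using norm_lattice_ge[OF assms(1)] by blast
  obtain c' where c': "c' > 0" "\<And>m. c' * (1 + \<bar>real_of_int m\<bar>) \<le> norm (y + of_int m)"
    using norm_lattice_ge[OF assms(2)] by blast
  have nz: "x + of_int m \<noteq> 0" "y + of_int m \<noteq> 0" for m using assms by (auto simp: complex_eq_iff)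
  have b: "norm (inverse (x + of_int m)) \<le> 1 / c" "norm (inverse (y + of_int m)) \<le> 1 / c'" for m
  proof -
    have "c * 1 \<le> c * (1 + \<bar>real_of_int m\<bar>)" using c(1) by (intro mult_left_mono) auto
    then have "c \<le> norm (x + of_int m)" using c(2)[of m] by linarith
    then show "norm (inverse (x + of_int m)) \<le> 1 / c" using c(1) by (simp add: norm_divide inverse_eq_divide frac_le)
    have "c' * 1 \<le> c' * (1 + \<bar>real_of_int m\<bar>)" using c'(1) by (intro mult_left_mono) auto
    then have "c' \<le> norm (y + of_int m)" using c'(2)[of m] by linarith
    then show "norm (inverse (y + of_int m)) \<le> 1 / c'" using c'(1) by (simp add: norm_divide inverse_eq_divide frac_le)
  qed
  have one: "norm (df 1 x y m) \<le> norm (y - x) / (c * c') * qd m" for m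
  proof -
    have "df 1 x y m = (y - x) * (inverse (x + of_int m) * inverse (y + of_int m))"
      using nz[of m] by (simp add: df_def field_simps)
    then have "norm (df 1 x y m) = norm (y - x) / (norm (x + of_int m) * norm (y + of_int m))"
      by (simp add: norm_mult norm_inverse divide_inverse)
    also have "\<dots> \<le> norm (y - x) / ((c * (1 + \<bar>real_of_int m\<bar>)) * (c' * (1 + \<bar>real_of_int m\<bar>)))"
      using c c' by (intro divide_left_mono mult_mono mult_pos_pos) (auto simp: nz intro!: mult_nonneg_nonneg less_imp_le)
    also have "\<dots> = norm (y - x) / (c * c') * qd m"
      by (simp add: qd_def power2_eq_square divide_inverse mult_ac)
    finally show ?thesis .
  qed
  show ?thesis
  proof (induction n)
    case 0
    show ?case by (rule exI[of _ 0]) (simp add: df_def)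
  next
    case (Suc n)
    then obtain C where C: "C \<ge> 0" "\<And>m. norm (df n x y m) \<le> C * qd m" by blast
    define C' where "C' = 1 / c * C + norm (y - x) / (c * c') * (1 / c') ^ n"
    have "norm (df (Suc n) x y m) \<le> C' * qd m" for m
    proof -
      have "df (Suc n) x y m = inverse (x + of_int m) * df n x y m + df 1 x y m * inverse (y + of_int m) ^ n"
        by (simp add: df_def algebra_simps)
      then have "norm (df (Suc n) x y m) \<le> norm (inverse (x + of_int m)) * norm (df n x y m) + norm (df 1 x y m) * norm (inverse (y + of_int m)) ^ n"
        by (metis norm_mult norm_power norm_triangle_ineq)
      also have "\<dots> \<le> 1 / c * (C * qd m) + norm (y - x) / (c * c') * qd m * (1 / c') ^ n"
        using C b one[of m] c c' by (intro add_mono mult_mono power_mono) (auto simp: qd_def)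
      also have "\<dots> = C' * qd m" by (simp add: C'_def algebra_simps)
      finally show ?thesis .
    qed
    moreover have "C' \<ge> 0" using C(1) c(1) c'(1) by (simp add: C'_def)
    ultimately show ?case by blast
  qed
qed

lemma finite_int_subset: "finite F \<Longrightarrow> \<exists>K. \<forall>M\<ge>K. F \<subseteq> {- int M..int M}"
proof (rule exI, intro allI impI)
  fix M assume F: "finite F" and M: "nat (Max (insert 0 (abs ` F))) \<le> M"
  show "F \<subseteq> {- int M..int M}"
  proof
    fix m assume "m \<in> F"
    then have "\<bar>m\<bar> \<le> Max (insert 0 (abs ` F))" using F by (intro Max_ge) auto
    then show "m \<in> {- int M..int M}" using M by auto
  qed
qed

lemma summable_on_int:
  fixes h :: "int \<Rightarrow> complex"
  assumes "\<And>m. norm (h m) \<le> C * qd m" "C \<ge> 0"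
  shows "h summable_on A"
proof -
  have q0: "qd m \<ge> 0" for m by (simp add: qd_def)
  have qs: "(\<Sum>k<n. qd (int k)) \<le> suminf (\<lambda>k. qd (int k))" for n
    by (rule sum_le_suminf[OF summable_qd]) (auto simp: q0)
  have "(\<lambda>m. C * qd m) summable_on UNIV"
  proof (rule nonneg_bdd_above_summable_on)
    show "bdd_above (sum (\<lambda>m. C * qd m) ` {F. F \<subseteq> UNIV \<and> finite F})"
    proof (rule bdd_aboveI2)
      fix F :: "int set" assume "F \<in> {F. F \<subseteq> UNIV \<and> finite F}"
      then have F: "finite F" by simp
      obtain M where "\<forall>M'\<ge>M. F \<subseteq> {- int M'..int M'}" using finite_int_subset[OF F] ..
      then have M: "F \<subseteq> {- int M..int M}" by simp
      have "(\<Sum>m\<in>F. C * qd m) \<le> (\<Sum>m\<in>{- int M..int M}. C * qd m)"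
        by (rule sum_mono2[OF _ M]) (auto simp: q0 assms(2))
      also have "\<dots> = C * ((\<Sum>k<Suc M. qd (int k)) + (\<Sum>k<M. qd (- int (Suc k))))"
        by (simp only: sum_distrib_left[symmetric] sum_symmetric)
      also have "\<dots> \<le> C * (suminf (\<lambda>k. qd (int k)) + suminf (\<lambda>k. qd (int k)))"
      proof (intro mult_left_mono add_mono qs assms(2))
        have "(\<Sum>k<M. qd (- int (Suc k))) \<le> (\<Sum>k<M. qd (int k))"
        proof (rule sum_mono)
          fix k
          have "qd (- int (Suc k)) = inverse ((2 + real k) ^ 2)" "qd (int k) = inverse ((1 + real k) ^ 2)" by (simp_all add: qd_def)
          then show "qd (- int (Suc k)) \<le> qd (int k)" by (simp add: power_mono le_imp_inverse_le)
        qed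
        then show "(\<Sum>k<M. qd (- int (Suc k))) \<le> suminf (\<lambda>k. qd (int k))" using qs[of M] by (rule order_trans)
      qed
      finally show "(\<Sum>m\<in>F. C * qd m) \<le> C * (suminf (\<lambda>k. qd (int k)) + suminf (\<lambda>k. qd (int k)))" .
    qed
  qed (simp add: q0 assms(2))
  then have "(\<lambda>m. C * qd m) summable_on A" by (rule summable_on_subset_banach) simp
  then have "(\<lambda>m. norm (h m)) summable_on A"
    by (rule summable_on_comparison_test) (simp_all add: assms(1))
  then show ?thesis by (rule abs_summable_summable)
qed

lemma infsum_symmetric_limit:
  fixes h :: "int \<Rightarrow> complex"
  assumes "h summable_on UNIV"
  shows "(\<lambda>M. \<Sum>m\<in>{- int M..int M}. h m) \<longlonglongrightarrow> infsum h UNIV"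
proof -
  have "(sum h \<longlongrightarrow> infsum h UNIV) (finite_subsets_at_top UNIV)"
    using has_sum_infsum[OF assms] by (simp add: has_sum_def)
  moreover have "filterlim (\<lambda>M. {- int M..int M}) (finite_subsets_at_top UNIV) sequentially"
    unfolding filterlim_iff eventually_finite_subsets_at_top
  proof (intro allI impI)
    fix P :: "int set \<Rightarrow> bool"
    assume "\<exists>F. finite F \<and> F \<subseteq> UNIV \<and> (\<forall>t. finite t \<and> F \<subseteq> t \<and> t \<subseteq> UNIV \<longrightarrow> P t)"
    then obtain F where F: "finite F" "\<And>t. finite t \<Longrightarrow> F \<subseteq> t \<Longrightarrow> P t" by auto
    obtain K where "\<forall>M\<ge>K. F \<subseteq> {- int M..int M}" using finite_int_subset[OF F(1)] ..
    then show "\<forall>\<^sub>F M in sequentially. P {- int M..int M}"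
      unfolding eventually_sequentially using F(2) by (intro exI[of _ K]) simp
  qed
  ultimately show ?thesis by (rule filterlim_compose)
qed

definition LL :: "nat \<Rightarrow> 'N::finite mod_ring \<Rightarrow> complex \<Rightarrow> complex" where
  "LL n b x = Lq n ((x + of_int (to_int_mod_ring b)) / of_nat CARD('N)) / of_nat CARD('N) ^ n"

lemma inZ_iff: "inZ m (b :: 'N::finite mod_ring) \<longleftrightarrow> (\<exists>k. m = to_int_mod_ring b + int CARD('N) * k)"
proof -
  have "inZ m b \<longleftrightarrow> m mod int CARD('N) = to_int_mod_ring b"
    by (transfer) (auto simp: mod_pos_pos_trivial)
  also have "\<dots> \<longleftrightarrow> (\<exists>k. m = to_int_mod_ring b + int CARD('N) * k)"
  proof
    assume "m mod int CARD('N) = to_int_mod_ring b"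
    then show "\<exists>k. m = to_int_mod_ring b + int CARD('N) * k" by (metis add.commute mult_div_mod_eq)
  next
    have "to_int_mod_ring b \<in> {0..<int CARD('N)}" by (transfer) auto
    then show "\<exists>k. m = to_int_mod_ring b + int CARD('N) * k \<Longrightarrow> m mod int CARD('N) = to_int_mod_ring b" by auto
  qed
  finally show ?thesis .
qed

text \<open>The symmetric ranges of \<open>m\<close> and of \<open>k\<close> in
  \<open>m = b + N k\<close> do not match; absolute convergence of the differences makes the
  rearrangement legitimate. Rescaling by \<open>N\<close> then leads to the sum over all
  integers.\<close>

theorem Lipschitz:
  fixes b :: "'N::finite mod_ring"
  assumes "Im x > 0" "Im y > 0" "n \<ge> 1"
  shows "(\<lambda>M. \<Sum>m\<in>{- int M..int M}. if inZ m b then df n x y m else 0) \<longlonglongrightarrow> LL n b x - LL n b y"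
proof -
  let ?N = "of_nat CARD('N) :: complex" and ?b = "to_int_mod_ring b"
  define s where "s = (x + of_int ?b) / ?N"
  define t where "t = (y + of_int ?b) / ?N"
  have N0: "?N \<noteq> 0" by simp
  have im: "Im s > 0" "Im t > 0" using assms by (simp_all add: s_def t_def Im_divide_of_nat)
  obtain C where C: "C \<ge> 0" "\<And>m. norm (df n x y m) \<le> C * qd m" using norm_df_le[OF assms(1,2)] by blast
  obtain C' where C': "C' \<ge> 0" "\<And>m. norm (df n s t m) \<le> C' * qd m" using norm_df_le[OF im] by blast
  have sm: "(\<lambda>m. if inZ m b then df n x y m else 0) summable_on UNIV"
    by (rule summable_on_int[of _ C]) (use C in \<open>auto simp: qd_def\<close>)
  have "infsum (\<lambda>m. if inZ m b then df n x y m else 0) UNIV = infsum (df n x y) {m. inZ m b}"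
    by (rule infsum_cong_neutral) auto
  also have "{m. inZ m b} = (\<lambda>k. ?b + int CARD('N) * k) ` UNIV" by (auto simp: inZ_iff)
  also have "infsum (df n x y) \<dots> = infsum (df n x y \<circ> (\<lambda>k. ?b + int CARD('N) * k)) UNIV"
    by (rule infsum_reindex) (simp add: inj_on_def)
  also have "\<dots> = infsum (\<lambda>k. df n s t k * inverse (?N ^ n)) UNIV"
  proof (rule infsum_cong)
    fix k
    have e: "z + of_int (?b + int CARD('N) * k) = ?N * ((z + of_int ?b) / ?N + of_int k)" for z :: complex
      using N0 by (simp add: field_simps)
    show "(df n x y \<circ> (\<lambda>k. ?b + int CARD('N) * k)) k = df n s t k * inverse (?N ^ n)"
      unfolding o_def df_def e s_def t_def
      by (simp only: inverse_mult_distrib power_mult_distrib power_inverse left_diff_distrib mult.commute[of "inverse (?N ^ n)"])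
  qed
  also have "\<dots> = infsum (df n s t) UNIV * inverse (?N ^ n)" by (rule infsum_cmult_left')
  also have "infsum (df n s t) UNIV = Lq n s - Lq n t"
    using infsum_symmetric_limit[OF summable_on_int[of _ C', OF C'(2,1)]] df_symmetric_limit[OF im assms(3)]
    by (rule LIMSEQ_unique)
  finally have "infsum (\<lambda>m. if inZ m b then df n x y m else 0) UNIV = LL n b x - LL n b y"
    by (simp add: LL_def s_def t_def divide_inverse algebra_simps)
  with infsum_symmetric_limit[OF sm] show ?thesis by simp
qed

text \<open>The exponential tends to 0 with growing imaginary part, and \<open>pw\<close> is
  continuous at 0 with value 0.\<close>

lemma LL_tendsto_0:
  fixes b :: "'N::finite mod_ring"
  shows "(\<lambda>T. LL n b (x + of_nat T * \<i>)) \<longlonglongrightarrow> 0"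
proof -
  let ?N = "of_nat CARD('N) :: complex" and ?b = "to_int_mod_ring b"
  let ?w = "\<lambda>T. exp (2 * pi * \<i> * ((x + of_nat T * \<i> + of_int ?b) / ?N))"
  have p0: "pw j 0 = 0" for j
  proof -
    have "(\<lambda>c. pc j c * 0 ^ c) = (\<lambda>c. 0)" by (rule ext) (simp add: pc_def)
    then show ?thesis by (simp only: pw_def suminf_zero)
  qed
  obtain D where "(pw (n - 1) has_field_derivative D) (at 0)" using DERIV_pw[of 0] by auto
  then have cont: "isCont (pw (n - 1)) 0" by (rule DERIV_isCont)
  let ?v = "\<lambda>T. exp (2 * pi * \<i> * ((x + of_int ?b) / ?N)) * of_real (exp (- 2 * pi / CARD('N))) ^ T"
  have w: "?w = ?v"
  proof
    fix T
    let ?r = "complex_of_real (- 2 * pi / CARD('N))"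
    have i: "2 * pi * \<i> * (\<i> / ?N) = ?r" by (simp add: mult.assoc)
    have e: "2 * pi * \<i> * ((x + of_nat T * \<i> + of_int ?b) / ?N) = 2 * pi * \<i> * ((x + of_int ?b) / ?N) + of_nat T * ?r"
      unfolding i[symmetric] by (simp add: add_divide_distrib distrib_left mult_ac)
    have "exp (of_nat T * ?r) = of_real (exp (- 2 * pi / CARD('N))) ^ T"
      by (subst exp_of_nat_mult) (rule arg_cong[where f = "\<lambda>z. z ^ T"], rule exp_of_real)
    then show "?w T = ?v T" unfolding e exp_add by (rule arg_cong)
  qed
  have v0: "?v \<longlonglongrightarrow> 0"
    by (rule tendsto_mult_right_zero, rule LIMSEQ_power_zero) simp
  have "((\<lambda>T. pw (n - 1) (?v T)) \<longlongrightarrow> pw (n - 1) 0) sequentially"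
    by (rule isCont_tendsto_compose[where g = "pw (n - 1)" and l = 0 and f = ?v and F = sequentially, OF cont v0])
  then have p: "((\<lambda>T. pw (n - 1) (?w T)) \<longlongrightarrow> 0) sequentially"
    unfolding p0 w[symmetric, THEN fun_cong] .
  define c where "c = (- 2 * pi * \<i>) ^ n / fact (n - 1)"
  have "(\<lambda>T. c * pw (n - 1) (?w T) / ?N ^ n) \<longlonglongrightarrow> c * 0 / ?N ^ n"
    by (intro tendsto_divide tendsto_mult tendsto_const p) simp
  then show ?thesis unfolding LL_def Lq_def c_def by (simp only: mult_zero_right div_0)
qed

section \<open>The levels of the Eisenstein sums\<close>

lemma nest_scale: "nest lt A p (map (\<lambda>y q. c y * f y q) ys) = (\<Prod>y\<leftarrow>ys. c y) * nest lt A p (map f ys)"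
  by (induction ys arbitrary: p) (simp_all add: sum_distrib_left mult_ac)

lemma nest_cong_map:
  assumes "\<And>y q. y \<in> set ys \<Longrightarrow> q \<in> A \<Longrightarrow> p < q \<Longrightarrow> f y q = g y (q :: int)"
  shows "nest (<) A p (map f ys) = nest (<) A p (map g ys)"
  using assms by (induction ys arbitrary: p) (auto intro!: sum.cong arg_cong2[where f = "(*)"])

abbreviation flip :: "complex fps \<Rightarrow> complex fps" where
  "flip f \<equiv> fps_compose f (- fps_X)"

lemma flip_nth: "fps_nth (flip f) n = (- 1) ^ n * fps_nth f n"
  by (simp add: fps_compose_uminus')

lemma flip_hom: "flip (f + g) = flip f + flip g" "flip (f * g) = flip f * flip g" "flip 1 = 1" "flip 0 = 0"
  by (simp_all add: fps_compose_add_distrib fps_compose_mult_distrib)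

lemma flip_power: "flip (f ^ n) = flip f ^ n"
  by (induction n) (simp_all add: flip_hom)

lemma inverse_flip:
  assumes "k \<noteq> 0"
  shows "inverse (fps_X - of_int k) = - flip (inverse (fps_X + of_int k) :: complex fps)"
proof -
  let ?u = "fps_X + of_int k :: complex fps"
  have "fps_nth ?u 0 \<noteq> 0" using assms by simp
  then have "?u * inverse ?u = 1" by (metis inverse_mult_eq_1 mult.commute)
  then have "flip ?u * flip (inverse ?u) = 1" by (metis flip_hom(2,3))
  moreover have "flip ?u = - (fps_X - of_int k)"
    by (simp add: flip_hom flip: fps_of_int)
  moreover have "(fps_X - of_int k) * - flip (inverse ?u) = - (fps_X - of_int k) * flip (inverse ?u)" by (simp add: algebra_simps)
  ultimately have "(fps_X - of_int k) * - flip (inverse ?u) = 1" by simp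
  then show ?thesis by (metis fps_inverse_unique)
qed

text \<open>Measured from the pole \<open>m\<close>, the variables above it run up to
  \<open>int M - m\<close>, which is the truncation of \<open>fz\<close>.\<close>

lemma upper_nest:
  assumes "inZ m b" "m \<in> {- int M..int M}"
  shows "nest (<) {- int M..int M} m (map (cfun (\<lambda>q n. inverse (fps_X + of_int (q - m)) ^ n)) Q) =
    fz (nat (int M - m)) 0 (down b Q)"
proof -
  have "nest (<) {- int M..int M} m (map (cfun (\<lambda>q n. inverse (fps_X + of_int (q - m)) ^ n :: complex fps)) Q) =
      nest (<) {- int M - m..int M - m} 0 (map (\<lambda>y k. cfun (\<lambda>q n. inverse (fps_X + of_int (q - m)) ^ n) y (k + m)) Q)"
    by (subst nest_shift[where c = m]) (simp add: o_def)
  also have "\<dots> = nest (<) {1..int (nat (int M - m))} 0 (map (\<lambda>y k. cfun (\<lambda>q n. inverse (fps_X + of_int (q - m)) ^ n) y (k + m)) Q)"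
    by (rule nest_cong_set) (use assms in auto)
  also have "\<dots> = nest (<) {1..int (nat (int M - m))} 0 (map (\<lambda>y. cfun (\<lambda>m n. inverse ((fps_X + of_int m) ^ n)) (fst y, snd y - b)) Q)"
    by (rule nest_cong_map) (use assms in \<open>auto simp: cfun_def case_prod_beta of_int_mod_ring_add fps_inverse_power eq_diff_eq\<close>)
  finally show ?thesis by (simp add: fz_def down_def o_def)
qed

text \<open>Distances below the pole are counted downwards, which reverses the columns. Each linear
  factor turns into minus itself at \<open>- X\<close>, whence \<open>flip\<close> and the
  sign.\<close>

lemma lower_nest:
  assumes "inZ m b" "m \<in> {- int M..int M}"
  shows "nest (<) {q\<in>{- int M..int M}. q < m} (- int M - 1) (map (cfun (\<lambda>q n. inverse (fps_X + of_int (q - m)) ^ n)) P) =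
    (- 1) ^ sum_list (map fst P) * flip (fz (nat (int M + m)) 0 (rev (map (\<lambda>y. (fst y, b - snd y)) P)))"
proof -
  let ?g = "cfun (\<lambda>m n. inverse ((fps_X + of_int m) ^ n) :: complex fps)"
  let ?A = "{1..int (nat (int M + m))}"
  have "nest (<) {q\<in>{- int M..int M}. q < m} (- int M - 1) (map (cfun (\<lambda>q n. inverse (fps_X + of_int (q - m)) ^ n :: complex fps)) P) =
      nest (<) {m - int M..m + int M} 0 (map (\<lambda>y k. cfun (\<lambda>q n. inverse (fps_X + of_int (q - m)) ^ n) y (m - k)) (rev P))"
    by (subst nest_reflect[where c = m]) (simp add: o_def rev_map)
  also have "\<dots> = nest (<) ?A 0 (map (\<lambda>y k. cfun (\<lambda>q n. inverse (fps_X + of_int (q - m)) ^ n) y (m - k)) (rev P))"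
    by (rule nest_cong_set) (use assms in auto)
  also have "\<dots> = nest (<) ?A 0 (map (\<lambda>y k. (- 1) ^ fst y * flip (?g (fst y, b - snd y) k)) (rev P))"
  proof (rule nest_cong_map)
    fix y :: "nat \<times> 'a mod_ring" and k assume k: "k \<in> ?A"
    have z: "inZ (m - k) (snd y) \<longleftrightarrow> inZ k (b - snd y)"
      using assms(1) by (auto simp: of_int_mod_ring_diff algebra_simps)
    have "inverse (fps_X + of_int (m - k - m)) = - flip (inverse (fps_X + of_int k) :: complex fps)"
      using inverse_flip[of k] k by simp
    then show "cfun (\<lambda>q n. inverse (fps_X + of_int (q - m)) ^ n) y (m - k) = (- 1) ^ fst y * flip (?g (fst y, b - snd y) k)"
      using power_minus[of "flip (inverse (fps_X + of_int k))" "fst y"]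
      by (simp add: cfun_def case_prod_beta z fps_inverse_power flip_power del: of_int_diff)
  qed
  also have "\<dots> = (\<Prod>y\<leftarrow>rev P. (- 1) ^ fst y) * nest (<) ?A 0 (map (\<lambda>y k. flip (?g (fst y, b - snd y) k)) (rev P))"
    by (rule nest_scale)
  also have "(\<Prod>y\<leftarrow>rev P. (- 1) ^ fst y :: complex fps) = (- 1) ^ sum_list (map fst P)"
    by (induction P) (simp_all add: power_add)
  also have "nest (<) ?A 0 (map (\<lambda>y k. flip (?g (fst y, b - snd y) k)) (rev P)) =
      flip (nest (<) ?A 0 (map (\<lambda>y. ?g (fst y, b - snd y)) (rev P)))"
    by (subst nest_hom[where h = flip]) (simp_all only: flip_hom map_map o_def)
  finally show ?thesis by (simp add: fz_def rev_map o_def)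
qed

text \<open>Partial fractions are applied to every chain, then all terms with the same pole are
  collected. The residue is a coefficient of a product of three series: \<open>geo\<close> for the
  evaluation point and one \<open>fz\<close> for either side of the pole.\<close>

lemma level_poles:
  fixes x :: complex and B :: "'N::finite array"
  assumes "Im x > 0" "is_array B" "B \<noteq> []"
  shows "nest (<) {- int M..int M} (- int M - 1) (map (cfun (\<lambda>m n. lat n x m)) B) =
    pick_sum (\<lambda>P y Q. \<Sum>i<fst y. \<Sum>j\<le>fst y - 1 - i. (- 1) ^ (i + sum_list (map fst P)) *
      (\<Sum>m\<in>{m\<in>{- int M..int M}. inZ m (snd y)}.
        fps_nth (fz (nat (int M + m)) 0 (rev (map (\<lambda>y'. (fst y', snd y - snd y')) P))) i *
        fps_nth (fz (nat (int M - m)) 0 (down (snd y) Q)) (fst y - 1 - i - j) * inverse (x + of_int m) ^ (j + 1))) B"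
proof -
  let ?A = "{- int M..int M}" and ?p = "- int M - 1"
  define H where "H P y Q = fps_nth (fps_X * geo (x + of_int (snd y)) * (pole (snd y) P * pole (snd y) Q)) (fst y)"
    for P Q and y :: "nat \<times> int"
  have nz: "x + of_int m \<noteq> 0" for m using assms(1) by (auto simp: complex_eq_iff)
  have l: "(\<lambda>m n. lat n x m) = (\<lambda>m n. inverse (x + of_int m) ^ n)"
    by (simp add: lat_def fun_eq_iff divide_inverse power_inverse)
  have "nest (<) ?A ?p (map (cfun (\<lambda>m n. lat n x m)) B) = tsum ?A ?p B (\<lambda>z. \<Prod>y\<leftarrow>z. inverse (x + of_int (snd y)) ^ fst y)"
    unfolding l by (rule nest_tsum) simp
  also have "\<dots> = tsum ?A ?p B (pick_sum H)"
  proof (rule tsum_cong)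
    fix z :: "(nat \<times> int) list"
    assume z: "sorted_wrt (<) (?p # map snd z)" "map fst z = map fst B"
    show "(\<Prod>y\<leftarrow>z. inverse (x + of_int (snd y)) ^ fst y) = pick_sum H z"
      unfolding H_def
    proof (rule partial_fractions)
      show "distinct (map snd z)" using z(1) by (simp add: strict_sorted_iff)
      show "z \<noteq> []" using z(2) assms(3) by auto
      have "\<forall>n\<in>set (map fst z). n \<ge> 1" unfolding z(2) using assms(2) by (auto simp: is_array_def)
      then show "\<forall>y\<in>set z. 1 \<le> fst y" by simp
    qed (simp add: nz)
  qed
  also have "\<dots> = pick_sum (\<lambda>P y Q. \<Sum>m\<in>{m\<in>?A. ?p < m \<and> inZ m (snd y)}.
    tsum {q\<in>?A. q < m} ?p P (\<lambda>z1. tsum ?A m Q (\<lambda>z2. H z1 (fst y, m) z2))) B"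
    by (rule tsum_pick) simp
  also have "\<dots> = pick_sum (\<lambda>P y Q. \<Sum>i<fst y. \<Sum>j\<le>fst y - 1 - i. (- 1) ^ (i + sum_list (map fst P)) *
      (\<Sum>m\<in>{m\<in>?A. inZ m (snd y)}.
        fps_nth (fz (nat (int M + m)) 0 (rev (map (\<lambda>y'. (fst y', snd y - snd y')) P))) i *
        fps_nth (fz (nat (int M - m)) 0 (down (snd y) Q)) (fst y - 1 - i - j) * inverse (x + of_int m) ^ (j + 1))) B"
  proof (rule pick_sum_cong)
    fix P y Q assume B: "B = P @ y # Q"
    then have n: "fst y \<ge> 1" using assms(2) by (cases y) simp
    let ?F = "\<lambda>m. fz (nat (int M + m)) 0 (rev (map (\<lambda>y'. (fst y', snd y - snd y')) P))"
    let ?G = "\<lambda>m. fz (nat (int M - m)) 0 (down (snd y) Q)"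
    have t: "tsum {q\<in>?A. q < m} ?p P (\<lambda>z1. tsum ?A m Q (\<lambda>z2. H z1 (fst y, m) z2)) =
       (\<Sum>i<fst y. \<Sum>j\<le>fst y - 1 - i. (- 1) ^ (i + sum_list (map fst P)) *
        (fps_nth (?F m) i * fps_nth (?G m) (fst y - 1 - i - j) * inverse (x + of_int m) ^ (j + 1)))"
      if m: "m \<in> ?A" "inZ m (snd y)" for m
    proof -
      let ?g = "fps_X * geo (x + of_int m)"
      have fin: "finite {q\<in>?A. q < m}" by (rule finite_subset[of _ ?A]) auto
      have 1: "tsum ?A m Q (\<lambda>z2. ?g * (pole m z1 * pole m z2)) = ?g * (pole m z1 * ?G m)" for z1
        unfolding upper_nest[OF m(2,1), symmetric] nest_tsum[OF finite_atLeastAtMost_int]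
        by (simp only: tsum_linear(2) pole_def case_prod_beta)
      have 2: "tsum {q\<in>?A. q < m} ?p P (\<lambda>z1. ?g * (pole m z1 * ?G m)) = ?g * ((- 1) ^ sum_list (map fst P) * flip (?F m) * ?G m)"
      proof -
        have "tsum {q\<in>?A. q < m} ?p P (\<lambda>z1. ?g * (pole m z1 * ?G m)) = ?g * ?G m * tsum {q\<in>?A. q < m} ?p P (pole m)"
          unfolding tsum_linear(2)[symmetric] by (simp only: mult_ac)
        also have "tsum {q\<in>?A. q < m} ?p P (pole m) = (- 1) ^ sum_list (map fst P) * flip (?F m)"
          unfolding lower_nest[OF m(2,1), symmetric] nest_tsum[OF fin] by (simp only: pole_def[abs_def] case_prod_beta)
        finally show ?thesis by (simp only: mult_ac)
      qed
      have "tsum {q\<in>?A. q < m} ?p P (\<lambda>z1. tsum ?A m Q (\<lambda>z2. H z1 (fst y, m) z2)) =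
          fps_nth (tsum {q\<in>?A. q < m} ?p P (\<lambda>z1. tsum ?A m Q (\<lambda>z2. ?g * (pole m z1 * pole m z2)))) (fst y)"
        unfolding H_def by (simp add: tsum_hom[where h = "\<lambda>f. fps_nth f (fst y)"])
      also have "\<dots> = fps_nth (fps_X * (flip (?F m) * (fps_const ((- 1) ^ sum_list (map fst P)) * (geo (x + of_int m) * ?G m)))) (fst y)"
        unfolding 1 2 by (simp only: mult_ac fps_const_power[symmetric] fps_const_neg[symmetric] fps_const_1_eq_1)
      also have "\<dots> = fps_nth (flip (?F m) * (fps_const ((- 1) ^ sum_list (map fst P)) * (geo (x + of_int m) * ?G m))) (fst y - 1)"
        using n by simp
      also have "\<dots> = (\<Sum>i\<le>fst y - 1. fps_nth (flip (?F m)) i * ((- 1) ^ sum_list (map fst P) *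
          (\<Sum>j\<le>fst y - 1 - i. inverse (x + of_int m) ^ (j + 1) * fps_nth (?G m) (fst y - 1 - i - j))))"
        by (simp only: fps_mult_nth[of "flip _"] fps_mult_left_const_nth fps_mult_nth[of "geo _"])
          (simp add: atMost_atLeast0 geo_def)
      also have "{..fst y - 1} = {..<fst y}" using n by (simp add: lessThan_Suc_atMost[symmetric])
      finally show ?thesis
        by (simp only: flip_nth sum_distrib_left power_add mult_ac)
    qed
    have "{m\<in>?A. ?p < m \<and> inZ m (snd y)} = {m\<in>?A. inZ m (snd y)}" by auto
    then have "(\<Sum>m\<in>{m\<in>?A. ?p < m \<and> inZ m (snd y)}. tsum {q\<in>?A. q < m} ?p P (\<lambda>z1. tsum ?A m Q (\<lambda>z2. H z1 (fst y, m) z2))) =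
      (\<Sum>m\<in>{m\<in>?A. inZ m (snd y)}. \<Sum>i<fst y. \<Sum>j\<le>fst y - 1 - i. (- 1) ^ (i + sum_list (map fst P)) *
        (fps_nth (?F m) i * fps_nth (?G m) (fst y - 1 - i - j) * inverse (x + of_int m) ^ (j + 1)))"
      by (simp only:) (intro sum.cong refl t; simp)
    also have "\<dots> = (\<Sum>i<fst y. \<Sum>j\<le>fst y - 1 - i. \<Sum>m\<in>{m\<in>?A. inZ m (snd y)}. (- 1) ^ (i + sum_list (map fst P)) *
        (fps_nth (?F m) i * fps_nth (?G m) (fst y - 1 - i - j) * inverse (x + of_int m) ^ (j + 1)))"
      by (subst sum.swap, intro sum.cong refl, rule sum.swap)
    finally show "(\<Sum>m\<in>{m\<in>?A. ?p < m \<and> inZ m (snd y)}. tsum {q\<in>?A. q < m} ?p P (\<lambda>z1. tsum ?A m Q (\<lambda>z2. H z1 (fst y, m) z2))) =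
      (\<Sum>i<fst y. \<Sum>j\<le>fst y - 1 - i. (- 1) ^ (i + sum_list (map fst P)) * (\<Sum>m\<in>{m\<in>?A. inZ m (snd y)}.
        fps_nth (?F m) i * fps_nth (?G m) (fst y - 1 - i - j) * inverse (x + of_int m) ^ (j + 1)))"
      by (simp only: sum_distrib_left)
  qed
  finally show ?thesis .
qed

text \<open>The coefficients depend on the distance of \<open>m\<close> from the ends of the range,
  so they converge for each \<open>m\<close>, but not uniformly. Being bounded, they leave
  \<open>h\<close> as a dominating function, and Tannery's theorem applies.\<close>

lemma boundary_limit:
  fixes F G :: "nat \<Rightarrow> complex" and h :: "int \<Rightarrow> complex"
  assumes F: "F \<longlonglongrightarrow> \<alpha>" and G: "G \<longlonglongrightarrow> \<beta>" and h: "\<And>m. norm (h m) \<le> C * qd m" "C \<ge> 0"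
    and S0: "(\<lambda>M. \<Sum>m\<in>{- int M..int M}. h m) \<longlonglongrightarrow> s0"
  shows "(\<lambda>M. \<Sum>m\<in>{- int M..int M}. F (nat (int M + m)) * G (nat (int M - m)) * h m) \<longlonglongrightarrow> \<alpha> * \<beta> * s0"
proof -
  define e where "e M m = (if \<bar>m\<bar> \<le> int M then F (nat (int M + m)) * G (nat (int M - m)) * h m else 0)" for M and m :: int
  \<comment> \<open>Folds \<open>m\<close> and \<open>- m\<close> into an ordinary series, counting
    0 once.\<close>
  define a where "a k M = e M (int k) + (if k = 0 then 0 else e M (- int k))" for k M
  define h2 where "h2 k = h (int k) + (if k = 0 then 0 else h (- int k))" for k :: nat
  have sym: "(\<Sum>m\<in>{- int M..int M}. f m) = (\<Sum>k\<le>M. f (int k) + (if k = 0 then 0 else f (- int k)))" for f :: "int \<Rightarrow> complex" and M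
  proof -
    have "(\<Sum>k<M. f (- int (Suc k))) = (\<Sum>k<Suc M. if k = 0 then 0 else f (- int k))"
      by (subst sum.lessThan_Suc_shift) simp
    then show ?thesis unfolding sum_symmetric lessThan_Suc_atMost[symmetric] by (simp only: sum.distrib)
  qed
  have sa: "suminf (\<lambda>k. a k M) = (\<Sum>m\<in>{- int M..int M}. F (nat (int M + m)) * G (nat (int M - m)) * h m)" for M
  proof -
    have "suminf (\<lambda>k. a k M) = (\<Sum>k\<le>M. a k M)"
      by (rule suminf_finite) (auto simp: a_def e_def)
    also have "\<dots> = (\<Sum>m\<in>{- int M..int M}. e M m)" unfolding a_def by (rule sym[symmetric])
    also have "\<dots> = (\<Sum>m\<in>{- int M..int M}. F (nat (int M + m)) * G (nat (int M - m)) * h m)"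
      by (intro sum.cong refl) (auto simp: e_def)
    finally show ?thesis .
  qed
  have el: "(\<lambda>M. e M m) \<longlonglongrightarrow> \<alpha> * \<beta> * h m" for m
  proof -
    have f: "filterlim (\<lambda>M. nat (int M + m)) at_top sequentially" "filterlim (\<lambda>M. nat (int M - m)) at_top sequentially"
      unfolding filterlim_at_top eventually_sequentially by (intro allI, rule_tac x = "nat (\<bar>m\<bar> + int Z)" in exI, linarith)+
    have "(\<lambda>M. F (nat (int M + m)) * G (nat (int M - m)) * h m) \<longlonglongrightarrow> \<alpha> * \<beta> * h m"
      by (intro tendsto_mult tendsto_const filterlim_compose[OF F f(1)] filterlim_compose[OF G f(2)])
    moreover have "\<forall>\<^sub>F M in sequentially. F (nat (int M + m)) * G (nat (int M - m)) * h m = e M m"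
      unfolding eventually_sequentially by (intro exI[of _ "nat \<bar>m\<bar>"]) (auto simp: e_def)
    ultimately show ?thesis by (rule Lim_transform_eventually)
  qed
  have al: "(\<lambda>M. a k M) \<longlonglongrightarrow> \<alpha> * \<beta> * h2 k" for k
    using tendsto_add[OF el[of "int k"] el[of "- int k"]] el[of 0] by (auto simp: a_def h2_def distrib_left)
  obtain K where K: "\<And>n. norm (F n) \<le> K"
    using convergent_imp_Bseq[OF convergentI[OF F]] by (auto simp: Bseq_def)
  obtain K' where K': "\<And>n. norm (G n) \<le> K'"
    using convergent_imp_Bseq[OF convergentI[OF G]] by (auto simp: Bseq_def)
  have KK: "K \<ge> 0" "K' \<ge> 0" using K[of 0] K'[of 0] norm_ge_zero order_trans by blast+
  have qn: "qd (- m) = qd m" "qd m \<ge> 0" for m by (simp_all add: qd_def)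
  have eb: "norm (e M m) \<le> K * K' * (C * qd m)" for M m
  proof (cases "\<bar>m\<bar> \<le> int M")
    case True
    then have "norm (e M m) = norm (F (nat (int M + m))) * norm (G (nat (int M - m))) * norm (h m)"
      by (simp add: e_def norm_mult)
    also have "\<dots> \<le> K * K' * (C * qd m)"
      using KK by (intro mult_mono K K' h) auto
    finally show ?thesis .
  qed (use KK h(2) qn in \<open>simp add: e_def\<close>)
  have ab: "norm (a k M) \<le> 2 * (K * K' * C) * qd (int k)" for k M
  proof -
    have "norm (a k M) \<le> norm (e M (int k)) + norm (if k = 0 then 0 else e M (- int k))"
      unfolding a_def by (rule norm_triangle_ineq)
    also have "\<dots> \<le> K * K' * (C * qd (int k)) + K * K' * (C * qd (int k))"
      using eb[of M "int k"] eb[of M "- int k"] KK h(2) qn by (intro add_mono) auto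
    finally show ?thesis by (simp add: mult_ac)
  qed
  have "eventually (\<lambda>M. summable (\<lambda>k. norm (a k M))) sequentially \<and> summable (\<lambda>k. norm (\<alpha> * \<beta> * h2 k)) \<and>
      ((\<lambda>M. suminf (\<lambda>k. a k M)) \<longlongrightarrow> suminf (\<lambda>k. \<alpha> * \<beta> * h2 k)) sequentially"
  proof (rule tannerys_theorem[OF al])
    show "\<forall>\<^sub>F (k, M) in at_top \<times>\<^sub>F sequentially. norm (a k M) \<le> 2 * (K * K' * C) * qd (int k)"
      using ab by (intro always_eventually) auto
    show "summable (\<lambda>k. 2 * (K * K' * C) * qd (int k))" by (intro summable_mult summable_qd)
  qed simp
  then have lim: "(\<lambda>M. \<Sum>m\<in>{- int M..int M}. F (nat (int M + m)) * G (nat (int M - m)) * h m) \<longlonglongrightarrow> suminf (\<lambda>k. \<alpha> * \<beta> * h2 k)"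
    unfolding sa by blast
  have "h2 sums s0" unfolding sums_def_le using S0 unfolding sym h2_def .
  then have "(\<lambda>k. \<alpha> * \<beta> * h2 k) sums (\<alpha> * \<beta> * s0)" by (rule sums_mult)
  then have "suminf (\<lambda>k. \<alpha> * \<beta> * h2 k) = \<alpha> * \<beta> * s0" by (rule sums_unique[symmetric])
  with lim show ?thesis by simp
qed

lemma big_down: "big Q \<Longrightarrow> big (down b Q)" by (auto simp: big_def down_def)

lemma big_reflect: "big P \<Longrightarrow> big (rev (map (\<lambda>y. (fst y, c - snd y)) P))" by (auto simp: big_def)

abbreviation lev :: "nat \<Rightarrow> complex \<Rightarrow> 'N::finite array \<Rightarrow> complex" where
  "lev M x B \<equiv> nest (<) {- int M..int M} (- int M - 1) (map (cfun (\<lambda>m n. lat n x m)) B)"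

text \<open>
  The sums over the simple poles converge only conditionally, and their coefficients depend on the
  truncation. Both effects disappear in the difference of the values at two points.
\<close>

lemma level_difference:
  fixes B :: "'N::finite array"
  assumes "Im x > 0" "Im y > 0" "big B" "B \<noteq> []"
  shows "(\<lambda>M. lev M x B - lev M y B) \<longlonglongrightarrow> level_sum (\<lambda>n b d. LL n b x) B d - level_sum (\<lambda>n b d. LL n b y) B d"
proof -
  define c where "c P z i M m = fps_nth (fz (nat (int M + m)) 0 (rev (map (\<lambda>y'. (fst y', snd z - snd y')) P))) i"
    for P :: "'N array" and z :: "nat \<times> 'N mod_ring" and i M m
  define e where "e z Q s M m = fps_nth (fz (nat (int M - m)) 0 (down (snd z) Q)) s"
    for z :: "nat \<times> 'N mod_ring" and Q s M m
  have ar: "is_array B" by (rule big_is_array[OF assms(3)])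
  have pd: "pick_sum f B - pick_sum g B = pick_sum (\<lambda>P z Q. f P z Q - g P z Q) B" for f g :: "'N array \<Rightarrow> _ \<Rightarrow> _ \<Rightarrow> complex" and B
    by (induction B arbitrary: f g) (simp_all add: algebra_simps)
  have tp: "(\<lambda>M. pick_sum (f M) B) \<longlonglongrightarrow> pick_sum g B"
    if "\<And>P z Q. B = P @ z # Q \<Longrightarrow> (\<lambda>M. f M P z Q) \<longlonglongrightarrow> g P z Q" for f and g :: "'N array \<Rightarrow> _ \<Rightarrow> _ \<Rightarrow> complex" and B
    using that
  proof (induction B arbitrary: f g)
    case (Cons a B)
    have "(\<lambda>M. pick_sum (\<lambda>u. f M (a # u)) B) \<longlonglongrightarrow> pick_sum (\<lambda>u. g (a # u)) B"
      by (rule Cons.IH) (simp add: Cons.prems)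
    moreover have "(\<lambda>M. f M [] a B) \<longlonglongrightarrow> g [] a B" by (rule Cons.prems) simp
    ultimately show ?case by (simp add: tendsto_add)
  qed simp
  have "lev M x B - lev M y B = pick_sum (\<lambda>P z Q. \<Sum>i<fst z. \<Sum>j\<le>fst z - 1 - i. (- 1) ^ (i + sum_list (map fst P)) *
      (\<Sum>m\<in>{- int M..int M}. c P z i M m * e z Q (fst z - 1 - i - j) M m * (if inZ m (snd z) then df (Suc j) x y m else 0))) B" for M
  proof -
    have A: "(\<Sum>m\<in>{m\<in>{- int M..int M}. inZ m b}. F m * (inverse (x + of_int m) ^ (j + 1) - inverse (y + of_int m) ^ (j + 1))) =
        (\<Sum>m\<in>{- int M..int M}. F m * (if inZ m b then df (Suc j) x y m else 0))" for F j and b :: "'N mod_ring"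
    proof -
      have "(\<Sum>m\<in>{- int M..int M}. F m * (if inZ m b then df (Suc j) x y m else 0)) =
          (\<Sum>m\<in>{m\<in>{- int M..int M}. inZ m b}. F m * df (Suc j) x y m)"
        by (subst sum.inter_filter) (auto intro!: sum.cong)
      then show ?thesis by (simp add: df_def)
    qed
    show ?thesis
      unfolding level_poles[OF assms(1) ar assms(4)] level_poles[OF assms(2) ar assms(4)] pd
        sum_subtractf[symmetric] right_diff_distrib[symmetric] A c_def e_def ..
  qed
  moreover have "(\<lambda>M. pick_sum (\<lambda>P z Q. \<Sum>i<fst z. \<Sum>j\<le>fst z - 1 - i. (- 1) ^ (i + sum_list (map fst P)) *
      (\<Sum>m\<in>{- int M..int M}. c P z i M m * e z Q (fst z - 1 - i - j) M m * (if inZ m (snd z) then df (Suc j) x y m else 0))) B)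
    \<longlonglongrightarrow> pick_sum (\<lambda>P z Q. \<Sum>i<fst z. \<Sum>j\<le>fst z - 1 - i. (- 1) ^ (i + sum_list (map fst P)) *
      (zr i (rev (map (\<lambda>y. (fst y, snd z - snd y)) P)) * zr (fst z - 1 - i - j) (down (snd z) Q) *
        (LL (Suc j) (snd z) x - LL (Suc j) (snd z) y))) B"
  proof (rule tp, intro tendsto_sum tendsto_mult[OF tendsto_const])
    fix P z Q i j assume B: "B = P @ z # Q"
    have b: "big P" "big Q" using assms(3) B by (cases z; simp)+
    obtain C where C: "C \<ge> 0" "\<And>m. norm (df (Suc j) x y m) \<le> C * qd m" using norm_df_le[OF assms(1,2)] by blast
    show "(\<lambda>M. \<Sum>m\<in>{- int M..int M}. c P z i M m * e z Q (fst z - 1 - i - j) M m * (if inZ m (snd z) then df (Suc j) x y m else 0))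
      \<longlonglongrightarrow> zr i (rev (map (\<lambda>y. (fst y, snd z - snd y)) P)) * zr (fst z - 1 - i - j) (down (snd z) Q) *
        (LL (Suc j) (snd z) x - LL (Suc j) (snd z) y)"
      unfolding c_def e_def
    proof (rule boundary_limit)
      show "(\<lambda>K. fps_nth (fz K 0 (rev (map (\<lambda>y'. (fst y', snd z - snd y')) P))) i) \<longlonglongrightarrow> zr i (rev (map (\<lambda>y. (fst y, snd z - snd y)) P))"
        by (rule tendsto_fz[OF big_reflect[OF b(1)]])
      show "(\<lambda>K. fps_nth (fz K 0 (down (snd z) Q)) (fst z - 1 - i - j)) \<longlonglongrightarrow> zr (fst z - 1 - i - j) (down (snd z) Q)"
        by (rule tendsto_fz[OF big_down[OF b(2)]])
      show "norm (if inZ m (snd z) then df (Suc j) x y m else 0) \<le> C * qd m" for m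
        using C by (simp add: qd_def)
      show "(\<lambda>M. \<Sum>m\<in>{- int M..int M}. if inZ m (snd z) then df (Suc j) x y m else 0) \<longlonglongrightarrow> LL (Suc j) (snd z) x - LL (Suc j) (snd z) y"
        by (rule Lipschitz[OF assms(1,2)]) simp
    qed (rule C(1))
  qed
  moreover have "level_sum (\<lambda>n b d. LL n b x) B d - level_sum (\<lambda>n b d. LL n b y) B d = pick_sum (\<lambda>P z Q. \<Sum>i<fst z. \<Sum>j\<le>fst z - 1 - i. (- 1) ^ (i + sum_list (map fst P)) *
      (zr i (rev (map (\<lambda>y. (fst y, snd z - snd y)) P)) * zr (fst z - 1 - i - j) (down (snd z) Q) *
        (LL (Suc j) (snd z) x - LL (Suc j) (snd z) y))) B"
    unfolding level_sum_def pd sum_subtractf[symmetric] by (intro pick_sum_cong sum.cong refl) (simp add: algebra_simps)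
  ultimately show ?thesis by simp
qed

lemma level_sum_tendsto_0: "(\<lambda>T. level_sum (\<lambda>n b d. LL n b (x + of_nat T * \<i>)) B d) \<longlonglongrightarrow> 0" for B :: "'N::finite array"
proof -
  have tp: "(\<lambda>M. pick_sum (f M) B) \<longlonglongrightarrow> 0"
    if "\<And>P z Q. (\<lambda>M. f M P z Q) \<longlonglongrightarrow> 0" for f :: "nat \<Rightarrow> 'N array \<Rightarrow> _ \<Rightarrow> _ \<Rightarrow> complex" and B
    using that
  proof (induction B arbitrary: f)
    case (Cons a B)
    have "(\<lambda>M. pick_sum (\<lambda>u. f M (a # u)) B) \<longlonglongrightarrow> 0"
      by (rule Cons.IH) (rule Cons.prems)
    then show ?case using tendsto_add[OF Cons.prems[of "[]" a B]] by fastforce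
  qed simp
  show ?thesis unfolding level_sum_def
    by (rule tp, intro tendsto_null_sum tendsto_mult_right_zero tendsto_mult_left_zero LL_tendsto_0)
qed

section \<open>Decay for large imaginary part and the limit of a level\<close>

lemma norm_nest_le:
  assumes "finite A"
  shows "norm (nest lt A p (fs :: ('p \<Rightarrow> complex) list)) \<le> (\<Prod>f\<leftarrow>fs. \<Sum>q\<in>A. norm (f q))"
proof (induction fs arbitrary: p)
  case (Cons f fs)
  let ?R = "\<Prod>f\<leftarrow>fs. \<Sum>q\<in>A. norm (f q)"
  have R: "?R \<ge> 0" by (intro prod_list_nonneg) (auto intro: sum_nonneg)
  have "norm (nest lt A p (f # fs)) \<le> (\<Sum>q\<in>{q\<in>A. lt p q}. norm (f q * nest lt A q fs))"
    by (simp add: sum_norm_le)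
  also have "\<dots> \<le> (\<Sum>q\<in>{q\<in>A. lt p q}. norm (f q) * ?R)"
    by (intro sum_mono) (simp add: norm_mult Cons.IH mult_left_mono)
  also have "\<dots> \<le> (\<Sum>q\<in>A. norm (f q) * ?R)"
    using assms R by (intro sum_mono2) auto
  finally show ?case by (simp add: sum_distrib_right)
qed simp

text \<open>The exponent 2 is shared out: 3/2 keeps the sum over \<open>m\<close> convergent, and
  1/2 is left for the decay in \<open>T\<close>.\<close>

lemma level_bound:
  assumes "Im x > 0"
  shows "\<exists>K\<ge>0. \<forall>T\<ge>1. \<forall>M n. n \<ge> 2 \<longrightarrow>
    (\<Sum>m\<in>{- int M..int M}. norm (lat n (x + of_nat T * \<i>) m)) \<le> K * real T powr (- 1 / 2)"
proof -
  obtain c where c: "c > 0" "\<And>m. c * (1 + \<bar>real_of_int m\<bar>) \<le> norm (x + of_int m)"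
    using norm_lattice_ge[OF assms] by blast
  define h where "h m = (1 + \<bar>real_of_int m\<bar>) powr (- 3 / 2)" for m
  have h0: "h m \<ge> 0" for m by (simp add: h_def)
  have sh: "summable (\<lambda>k. h (int k))"
  proof -
    have "summable (\<lambda>k. real (Suc k) powr (- 3 / 2))"
      by (subst summable_Suc_iff) (simp add: summable_real_powr_iff)
    then show ?thesis by (simp add: h_def add.commute)
  qed
  have hs: "(\<Sum>k<n. h (int k)) \<le> suminf (\<lambda>k. h (int k))" for n
    by (rule sum_le_suminf[OF sh]) (auto simp: h0)
  have hm: "(\<Sum>m\<in>{- int M..int M}. h m) \<le> 2 * suminf (\<lambda>k. h (int k))" for M
  proof -
    have "(\<Sum>k<M. h (- int (Suc k))) \<le> (\<Sum>k<M. h (int k))"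
      by (intro sum_mono) (simp add: h_def powr_mono2')
    then show ?thesis using hs[of M] hs[of "Suc M"] unfolding sum_symmetric by linarith
  qed
  define K where "K = c powr (- 3 / 2) * (2 * suminf (\<lambda>k. h (int k)))"
  have K0: "K \<ge> 0" unfolding K_def using suminf_nonneg[OF sh h0] by simp
  have "(\<Sum>m\<in>{- int M..int M}. norm (lat n (x + of_nat T * \<i>) m)) \<le> K * real T powr (- 1 / 2)"
    if T: "T \<ge> 1" and n: "n \<ge> 2" for T M n
  proof -
    have t: "norm (lat n (x + of_nat T * \<i>) m) \<le> c powr (- 3 / 2) * h m * real T powr (- 1 / 2)" for m
    proof -
      define r where "r = norm (x + of_nat T * \<i> + of_int m)"
      have r1: "r \<ge> real T" using abs_Im_le_cmod[of "x + of_nat T * \<i> + of_int m"] assms by (simp add: r_def)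
      have "norm (x + of_int m) \<le> r"
        unfolding r_def norm_complex_def using assms by (intro real_sqrt_le_mono) (simp add: power_mono)
      then have r2: "r \<ge> c * (1 + \<bar>real_of_int m\<bar>)" using c(2)[of m] by linarith
      have r0: "r \<ge> 1" using r1 T by linarith
      have cm: "c * (1 + \<bar>real_of_int m\<bar>) > 0" using c(1) by (intro mult_pos_pos) auto
      have "norm (lat n (x + of_nat T * \<i>) m) = inverse (r ^ n)"
        by (simp add: lat_def r_def norm_divide norm_inverse norm_power divide_inverse)
      also have "\<dots> \<le> inverse (r ^ 2)"
        using r0 n by (intro le_imp_inverse_le power_increasing) auto
      also have "\<dots> = r powr (- 2)" using r0 by (simp add: powr_minus powr_numeral)
      also have "\<dots> = r powr (- 3 / 2) * r powr (- 1 / 2)" by (simp flip: powr_add)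
      also have "\<dots> \<le> (c * (1 + \<bar>real_of_int m\<bar>)) powr (- 3 / 2) * real T powr (- 1 / 2)"
        using r1 r2 cm T by (intro mult_mono powr_mono2') auto
      also have "(c * (1 + \<bar>real_of_int m\<bar>)) powr (- 3 / 2) = c powr (- 3 / 2) * h m"
        using c(1) by (simp add: h_def powr_mult)
      finally show ?thesis .
    qed
    have "(\<Sum>m\<in>{- int M..int M}. norm (lat n (x + of_nat T * \<i>) m)) \<le>
        (\<Sum>m\<in>{- int M..int M}. c powr (- 3 / 2) * h m * real T powr (- 1 / 2))"
      by (intro sum_mono t)
    also have "\<dots> = c powr (- 3 / 2) * (\<Sum>m\<in>{- int M..int M}. h m) * real T powr (- 1 / 2)"
      by (simp add: sum_distrib_left sum_distrib_right)
    also have "\<dots> \<le> K * real T powr (- 1 / 2)"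
      unfolding K_def by (intro mult_right_mono mult_left_mono hm) auto
    finally show ?thesis .
  qed
  with K0 show ?thesis by blast
qed

text \<open>\<open>level_difference\<close> leaves only the values at \<open>x + iT\<close> to be
  controlled. Both tend to 0: the level sum because \<open>LL\<close> does, and the nested sum
  uniformly in \<open>M\<close>, since all upper entries are at least 2.\<close>

theorem level_limit:
  fixes B :: "'N::finite array"
  assumes "Im x > 0" "big B" "B \<noteq> []"
  shows "(\<lambda>M. lev M x B) \<longlonglongrightarrow> level_sum (\<lambda>n b d. LL n b x) B d"
proof -
  let ?y = "\<lambda>T. x + of_nat T * \<i>"
  let ?P = "\<lambda>x. level_sum (\<lambda>n b d. LL n b x) B d"
  obtain K where K: "K \<ge> 0" "\<And>T M n. T \<ge> 1 \<Longrightarrow> n \<ge> 2 \<Longrightarrow>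
    (\<Sum>m\<in>{- int M..int M}. norm (lat n (?y T) m)) \<le> K * real T powr (- 1 / 2)"
    using level_bound[OF assms(1)] by blast
  define w where "w T = K * real T powr (- 1 / 2)" for T
  have w0: "w T \<ge> 0" for T using K(1) by (simp add: w_def)
  have bd: "norm (lev M (?y T) B) \<le> w T ^ length B" if "T \<ge> 1" for T M
  proof -
    have "norm (lev M (?y T) B) \<le> (\<Prod>f\<leftarrow>map (cfun (\<lambda>m n. lat n (?y T) m)) B. \<Sum>q\<in>{- int M..int M}. norm (f q))"
      by (rule norm_nest_le) simp
    also have "\<dots> \<le> w T ^ length B"
      using assms(2)
    proof (induction B)
      case (Cons z B)
      obtain n b where z: "z = (n, b)" by (cases z)
      have "(\<Sum>q\<in>{- int M..int M}. norm (cfun (\<lambda>m n. lat n (?y T) m) z q)) \<le> (\<Sum>q\<in>{- int M..int M}. norm (lat n (?y T) q))"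
        by (intro sum_mono) (simp add: cfun_def z)
      also have "\<dots> \<le> w T" unfolding w_def using that Cons.prems z by (intro K(2)) auto
      finally have "(\<Sum>q\<in>{- int M..int M}. norm (cfun (\<lambda>m n. lat n (?y T) m) z q)) \<le> w T" .
      then show ?case using Cons w0[of T] z
        by (simp del: map_map) (intro mult_mono prod_list_nonneg; auto intro: sum_nonneg)
    qed simp
    finally show ?thesis .
  qed
  have "(\<lambda>T. K * real T powr (- 1 / 2)) \<longlonglongrightarrow> K * 0"
    by (intro tendsto_mult tendsto_const tendsto_neg_powr filterlim_real_sequentially) simp
  then have "(\<lambda>T. w T ^ length B) \<longlonglongrightarrow> 0 ^ length B"
    unfolding w_def by (intro tendsto_power) simp
  then have wl: "(\<lambda>T. w T ^ length B) \<longlonglongrightarrow> 0" using assms(3) by (simp add: power_0_left)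
  show ?thesis
  proof (rule LIMSEQ_I)
    fix \<epsilon> :: real assume e: "\<epsilon> > 0"
    have "\<forall>\<^sub>F T in sequentially. norm (?P (?y T) - 0) < \<epsilon> / 3 \<and> norm (w T ^ length B - 0) < \<epsilon> / 3 \<and> T \<ge> 1"
      using e tendstoD[OF level_sum_tendsto_0[of x B d], of "\<epsilon> / 3"] tendstoD[OF wl, of "\<epsilon> / 3"] eventually_ge_at_top[of "1::nat"]
      by (auto simp: dist_norm eventually_conj_iff)
    \<comment> \<open>\<open>T\<close> is fixed before \<open>M\<close>, which is possible because
      \<open>bd\<close> is uniform in \<open>M\<close>.\<close>
    then obtain T where T: "norm (?P (?y T)) < \<epsilon> / 3" "norm (w T ^ length B) < \<epsilon> / 3" "T \<ge> 1"
      by (auto simp: eventually_sequentially)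
    have "Im (?y T) > 0" using assms(1) by simp
    from LIMSEQ_D[OF level_difference[OF assms(1) this assms(2,3), of d], of "\<epsilon> / 3"] e
    obtain M0 where M0: "\<And>M. M \<ge> M0 \<Longrightarrow> norm (lev M x B - lev M (?y T) B - (?P x - ?P (?y T))) < \<epsilon> / 3" by auto
    have "norm (lev M x B - ?P x) < \<epsilon>" if "M \<ge> M0" for M
    proof -
      have "lev M x B - ?P x = (lev M x B - lev M (?y T) B - (?P x - ?P (?y T))) + (lev M (?y T) B - ?P (?y T))" by simp
      then have "norm (lev M x B - ?P x) \<le> norm (lev M x B - lev M (?y T) B - (?P x - ?P (?y T))) + norm (lev M (?y T) B - ?P (?y T))"
        using norm_triangle_ineq by metis
      moreover have "norm (lev M (?y T) B - ?P (?y T)) \<le> norm (lev M (?y T) B) + norm (?P (?y T))" by (rule norm_triangle_ineq4)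
      moreover have "norm (lev M (?y T) B) < \<epsilon> / 3" using bd[OF T(3), of M] T(2) by simp
      ultimately show ?thesis using M0[OF that] T(1) by linarith
    qed
    then show "\<exists>no. \<forall>M\<ge>no. norm (lev M x B - ?P x) < \<epsilon>" by blast
  qed
qed

section \<open>Multiple divisor functions\<close>

definition gcoef :: "nat \<times> 'N::finite mod_ring \<Rightarrow> nat \<Rightarrow> complex" where
  "gcoef y c = eta_pow (snd y) ^ c * of_nat c ^ (fst y - 1) / fact (fst y - 1)"

text \<open>A single level \<open>d\<close> as a series in \<open>q\<close>; the condition
  \<open>0 < k\<close> excludes \<open>c = 0\<close>.\<close>

definition gs :: "nat \<times> 'N::finite mod_ring \<Rightarrow> nat \<Rightarrow> complex fps" where
  "gs y d = Abs_fps (\<lambda>k. if d dvd k \<and> 0 < k then gcoef y (k div d) else 0)"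

fun gn :: "nat \<Rightarrow> nat \<Rightarrow> 'N::finite array \<Rightarrow> complex fps" where
  "gn L p [] = 1"
| "gn L p (y # v) = (\<Sum>d\<in>{p<..L}. gs y d * gn L d v)"

definition dcs :: "nat \<Rightarrow> nat \<Rightarrow> nat \<Rightarrow> (nat list \<times> nat list) set" where
  "dcs p r k = {(ds, cs). length ds = r \<and> length cs = r \<and> sorted_wrt (<) (p # ds) \<and> (\<forall>c\<in>set cs. 0 < c) \<and>
     (\<Sum>i<r. cs ! i * ds ! i) = k}"

lemma dcs_0: "dcs p 0 k = (if k = 0 then {([], [])} else {})"
  by (auto simp: dcs_def)

lemma sum_lessThan_Suc_list: "(\<Sum>i<Suc r. (c # cs) ! i * (d # ds) ! i) = c * d + (\<Sum>i<r. cs ! i * ds ! i)" for c :: nat and cs ds :: "nat list"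
  by (simp add: sum.lessThan_Suc_shift del: sum.lessThan_Suc)

text \<open>\<open>c * d \<le> k\<close> with positive factors bounds both by \<open>k\<close>, so
  restricting \<open>d\<close> to at most \<open>L\<close> loses nothing.\<close>

lemma dcs_Suc:
  assumes "k \<le> L"
  shows "dcs p (Suc r) k = (\<lambda>((d, c), (ds, cs)). (d # ds, c # cs)) `
    Sigma ({p<..L} \<times> {1..k} \<inter> {(d, c). c * d \<le> k}) (\<lambda>(d, c). dcs d r (k - c * d))"
proof (intro equalityI subsetI)
  fix x assume x: "x \<in> dcs p (Suc r) k"
  obtain ds' cs' where x': "x = (ds', cs')" by (cases x)
  have l: "length ds' = Suc r" "length cs' = Suc r" using x by (simp_all add: dcs_def x')
  obtain d ds where ds: "ds' = d # ds" "length ds = r" using l(1) by (auto simp: length_Suc_conv)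
  obtain c cs where cs: "cs' = c # cs" "length cs = r" using l(2) by (auto simp: length_Suc_conv)
  have s: "sorted_wrt (<) (p # d # ds)" "\<forall>c'\<in>set (c # cs). 0 < c'" "(\<Sum>i<Suc r. (c # cs) ! i * (d # ds) ! i) = k"
    using x by (simp_all add: dcs_def x' ds cs del: sum.lessThan_Suc)
  have k: "c * d + (\<Sum>i<r. cs ! i * ds ! i) = k" using s(3) by (simp only: sum_lessThan_Suc_list)
  have c: "0 < c" and d: "p < d" using s by simp_all
  have "c * d \<le> k" using k by simp
  moreover have "d \<le> c * d" "c \<le> c * d" using c d by simp_all
  ultimately have "d \<le> L" "c \<le> k" using assms by linarith+
  moreover have "(ds, cs) \<in> dcs d r (k - c * d)"
    using s(1,2) ds(2) cs(2) k by (auto simp: dcs_def)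
  ultimately have "((d, c), (ds, cs)) \<in> Sigma ({p<..L} \<times> {1..k} \<inter> {(d, c). c * d \<le> k}) (\<lambda>(d, c). dcs d r (k - c * d))"
    using c d \<open>c * d \<le> k\<close> by simp
  then show "x \<in> (\<lambda>((d, c), (ds, cs)). (d # ds, c # cs)) `
    Sigma ({p<..L} \<times> {1..k} \<inter> {(d, c). c * d \<le> k}) (\<lambda>(d, c). dcs d r (k - c * d))"
    unfolding x' ds(1) cs(1) by (rule rev_image_eqI) simp
next
  fix x assume "x \<in> (\<lambda>((d, c), (ds, cs)). (d # ds, c # cs)) `
    Sigma ({p<..L} \<times> {1..k} \<inter> {(d, c). c * d \<le> k}) (\<lambda>(d, c). dcs d r (k - c * d))"
  then obtain d c ds cs where x: "x = (d # ds, c # cs)" "p < d" "1 \<le> c" "c * d \<le> k" "(ds, cs) \<in> dcs d r (k - c * d)"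
    by auto
  have "length ds = r" "length cs = r" "sorted_wrt (<) (d # ds)" "\<forall>c\<in>set cs. 0 < c" "(\<Sum>i<r. cs ! i * ds ! i) = k - c * d"
    using x(5) by (simp_all add: dcs_def)
  moreover from this have "(\<Sum>i<Suc r. (c # cs) ! i * (d # ds) ! i) = k"
    unfolding sum_lessThan_Suc_list using x(4) by simp
  moreover have "sorted_wrt (<) (p # d # ds)" using calculation(3) x(2) by auto
  ultimately show "x \<in> dcs p (Suc r) k" using x(3)
    by (simp add: dcs_def x(1) del: sum.lessThan_Suc)
qed

lemma finite_dcs: "finite (dcs p r k)"
proof (induction r arbitrary: p k)
  case (Suc r)
  show ?case by (subst dcs_Suc[OF order_refl]) (intro finite_imageI finite_SigmaI finite_Int; auto simp: Suc)
qed (simp add: dcs_0)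

lemma gn_nth:
  assumes "k \<le> L"
  shows "fps_nth (gn L p v) k = (\<Sum>(ds, cs)\<in>dcs p (length v) k. \<Prod>i<length v. gcoef (v ! i) (cs ! i))"
  using assms
proof (induction v arbitrary: p k)
  case (Cons y v)
  let ?r = "length v"
  let ?S = "{p<..L} \<times> {1..k} \<inter> {(d, c). c * d \<le> k}"
  let ?P = "\<lambda>v cs. \<Prod>i<length v. gcoef (v ! i) (cs ! i)"
  have inj: "inj_on (\<lambda>((d, c), (ds, cs)). (d # ds, c # cs)) A" for A :: "((nat \<times> nat) \<times> (nat list \<times> nat list)) set"
    by (auto simp: inj_on_def)
  have fS: "finite ?S" by (intro finite_Int) simp
  have "(\<Sum>(ds, cs)\<in>dcs p (length (y # v)) k. ?P (y # v) cs) =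
      (\<Sum>x\<in>Sigma ?S (\<lambda>(d, c). dcs d ?r (k - c * d)). gcoef y (snd (fst x)) * ?P v (snd (snd x)))"
    unfolding length_Cons dcs_Suc[OF Cons.prems] sum.reindex[OF inj] o_def
    by (intro sum.cong refl) (auto simp: prod.lessThan_Suc_shift simp del: prod.lessThan_Suc)
  also have "\<dots> = (\<Sum>z\<in>?S. \<Sum>x\<in>dcs (fst z) ?r (k - snd z * fst z). gcoef y (snd z) * ?P v (snd x))"
    by (subst sum.Sigma) (use fS in \<open>auto simp: finite_dcs case_prod_beta intro!: sum.cong\<close>)
  also have "\<dots> = (\<Sum>z\<in>?S. gcoef y (snd z) * fps_nth (gn L (fst z) v) (k - snd z * fst z))"
    using Cons.prems by (intro sum.cong refl) (simp add: Cons.IH case_prod_beta sum_distrib_left)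
  also have "\<dots> = (\<Sum>z\<in>{p<..L} \<times> {1..k}. if snd z * fst z \<le> k then gcoef y (snd z) * fps_nth (gn L (fst z) v) (k - snd z * fst z) else 0)"
    by (subst sum.inter_restrict) (auto intro!: sum.cong)
  also have "\<dots> = (\<Sum>d\<in>{p<..L}. \<Sum>c\<in>{1..k}. if c * d \<le> k then gcoef y c * fps_nth (gn L d v) (k - c * d) else 0)"
    by (simp add: sum.cartesian_product case_prod_beta)
  also have "\<dots> = (\<Sum>d\<in>{p<..L}. fps_nth (gs y d * gn L d v) k)"
  proof (intro sum.cong refl)
    fix d assume d: "d \<in> {p<..L}"
    have "fps_nth (gs y d * gn L d v) k = (\<Sum>i\<le>k. if d dvd i \<and> 0 < i then gcoef y (i div d) * fps_nth (gn L d v) (k - i) else 0)"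
      unfolding fps_mult_nth atMost_atLeast0 by (intro sum.cong refl) (simp add: gs_def)
    also have "\<dots> = (\<Sum>i\<in>{i\<in>{..k}. d dvd i \<and> 0 < i}. gcoef y (i div d) * fps_nth (gn L d v) (k - i))"
      by (rule sum.inter_filter[symmetric]) simp
    also have "\<dots> = (\<Sum>c\<in>{c\<in>{1..k}. c * d \<le> k}. gcoef y c * fps_nth (gn L d v) (k - c * d))"
    proof (rule sum.reindex_bij_witness[of _ "\<lambda>c. c * d" "\<lambda>i. i div d"])
      fix i assume i: "i \<in> {i\<in>{..k}. d dvd i \<and> 0 < i}"
      then obtain c where c: "i = d * c" by (auto simp: dvd_def)
      with i d have c0: "0 < c" "c \<le> d * c" by auto
      have "d * c \<le> k" using i c by simp
      then have "c \<le> k" using c0(2) by (rule order_trans[rotated])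
      with c0 i c d show "i div d * d = i" "i div d \<in> {c\<in>{1..k}. c * d \<le> k}"
        "gcoef y (i div d) * fps_nth (gn L d v) (k - i div d * d) = gcoef y (i div d) * fps_nth (gn L d v) (k - i)"
        by (auto simp: mult.commute)
    qed (use d in auto)
    also have "\<dots> = (\<Sum>c\<in>{1..k}. if c * d \<le> k then gcoef y c * fps_nth (gn L d v) (k - c * d) else 0)"
      by (rule sum.inter_filter) simp
    finally show "(\<Sum>c\<in>{1..k}. if c * d \<le> k then gcoef y c * fps_nth (gn L d v) (k - c * d) else 0) = fps_nth (gs y d * gn L d v) k" ..
  qed
  finally show ?case by (simp add: fps_sum_nth)
qed (simp add: dcs_0)

definition gfac :: "'N::finite array \<Rightarrow> complex" where
  "gfac v = (- 2 * pi * \<i> / CARD('N)) ^ sum_list (map fst v)"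

lemma g_array_nth: "k \<le> L \<Longrightarrow> fps_nth (g_array v) k = gfac v * fps_nth (gn L 0 v) k"
  by (simp add: g_array_def gfac_def gn_nth dcs_def gcoef_def)

lemma norm_eta_pow: "norm (eta_pow a) = 1"
  by (simp add: eta_pow_def norm_power norm_exp_eq_Re)

lemma norm_gcoef_le: "norm (gcoef y c) \<le> real c ^ (fst y - 1)"
proof -
  have "norm (gcoef y c) = real c ^ (fst y - 1) / fact (fst y - 1)"
    by (simp add: gcoef_def norm_mult norm_divide norm_power norm_eta_pow)
  also have "\<dots> \<le> real c ^ (fst y - 1) / 1" by (intro divide_left_mono) (simp_all add: fact_ge_1)
  finally show ?thesis by simp
qed

text \<open>Crude, but uniform in the truncation \<open>L\<close>. Per column there are at most
  \<open>k + 1\<close> values of \<open>d\<close>, \<open>k + 1\<close> terms of the Cauchy product,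
  and a coefficient of size at most the power \<open>fst y\<close>; hence
  \<open>fst y + 2\<close>.\<close>

lemma gn_bound: "norm (fps_nth (gn L p v) k) \<le> real (Suc k) ^ sum_list (map (\<lambda>y. fst y + 2) v)"
proof (induction v arbitrary: p k)
  case (Cons y v)
  let ?w = "sum_list (map (\<lambda>y. fst y + 2) v)"
  have g: "norm (fps_nth (gs y d) i) \<le> (if d \<le> k then real (Suc k) ^ (fst y) else 0)" if "i \<le> k" for d i
  proof (cases "d dvd i \<and> 0 < i")
    case True
    then have "d \<le> k" using that dvd_imp_le order_trans by blast
    have "norm (gcoef y (i div d)) \<le> real (i div d) ^ (fst y - 1)" by (rule norm_gcoef_le)
    also have "\<dots> \<le> real (Suc k) ^ (fst y - 1)"
      using that div_le_dividend[of i d] by (intro power_mono) linarith+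
    also have "\<dots> \<le> real (Suc k) ^ fst y" by (intro power_increasing) auto
    finally show ?thesis using True \<open>d \<le> k\<close> by (simp add: gs_def)
  qed (auto simp: gs_def)
  have "norm (fps_nth (gn L p (y # v)) k) \<le> (\<Sum>d\<in>{p<..L}. \<Sum>i\<le>k. norm (fps_nth (gs y d) i * fps_nth (gn L d v) (k - i)))"
    by (simp add: fps_sum_nth fps_mult_nth atMost_atLeast0) (intro order_trans[OF norm_sum] sum_mono norm_sum)
  also have "\<dots> \<le> (\<Sum>d\<in>{p<..L}. \<Sum>i\<le>k. (if d \<le> k then real (Suc k) ^ (fst y) else 0) * real (Suc k) ^ ?w)"
  proof (intro sum_mono)
    fix d i assume i: "i \<in> {..k}"
    have "norm (fps_nth (gn L d v) (k - i)) \<le> real (Suc (k - i)) ^ ?w" by (rule Cons.IH)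
    also have "\<dots> \<le> real (Suc k) ^ ?w" by (intro power_mono) auto
    finally show "norm (fps_nth (gs y d) i * fps_nth (gn L d v) (k - i)) \<le> (if d \<le> k then real (Suc k) ^ (fst y) else 0) * real (Suc k) ^ ?w"
      using g[of i d] i unfolding norm_mult by (intro mult_mono) auto
  qed
  also have "\<dots> = (\<Sum>d\<in>{p<..L}. if d \<le> k then real (Suc k) * (real (Suc k) ^ (fst y) * real (Suc k) ^ ?w) else 0)"
    by (intro sum.cong refl) simp
  also have "\<dots> = (\<Sum>d\<in>{d\<in>{p<..L}. d \<le> k}. real (Suc k) * (real (Suc k) ^ (fst y) * real (Suc k) ^ ?w))"
    by (rule sum.inter_filter[symmetric]) simp
  also have "\<dots> \<le> (\<Sum>d\<in>{..k}. real (Suc k) * (real (Suc k) ^ (fst y) * real (Suc k) ^ ?w))"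
    by (rule sum_mono2) auto
  also have "\<dots> = real (Suc k) ^ sum_list (map (\<lambda>y. fst y + 2) (y # v))"
    by (simp add: power_add power2_eq_square mult_ac del: of_nat_Suc)
  finally show ?case .
qed simp

section \<open>Absolutely convergent evaluation of power series\<close>

definition evs :: "complex \<Rightarrow> complex fps \<Rightarrow> bool" where
  "evs q f \<longleftrightarrow> summable (\<lambda>k. norm (fps_nth f k * q ^ k))"

lemma evs_sums: "evs q f \<Longrightarrow> (\<lambda>k. fps_nth f k * q ^ k) sums eval_fps f q"
  unfolding evs_def eval_fps_def by (rule summable_sums) (rule summable_norm_cancel)

lemma evs_add: "evs q f \<Longrightarrow> evs q g \<Longrightarrow> evs q (f + g) \<and> eval_fps (f + g) q = eval_fps f q + eval_fps g q"
proof
  assume f: "evs q f" and g: "evs q g"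
  have "summable (\<lambda>k. norm (fps_nth f k * q ^ k) + norm (fps_nth g k * q ^ k))"
    using f g unfolding evs_def by (rule summable_add)
  then show a: "evs q (f + g)" unfolding evs_def
    by (rule summable_comparison_test'[where N = 0]) (simp add: distrib_right norm_triangle_ineq)
  have "(\<lambda>k. fps_nth (f + g) k * q ^ k) sums (eval_fps f q + eval_fps g q)"
    using sums_add[OF evs_sums[OF f] evs_sums[OF g]] by (simp add: distrib_right)
  then show "eval_fps (f + g) q = eval_fps f q + eval_fps g q" using evs_sums[OF a] sums_unique2 by blast
qed

lemma evs_mult: "evs q f \<Longrightarrow> evs q g \<Longrightarrow> evs q (f * g) \<and> eval_fps (f * g) q = eval_fps f q * eval_fps g q"
proof
  assume f: "evs q f" and g: "evs q g"
  have e: "fps_nth (f * g) k * q ^ k = (\<Sum>i\<le>k. (fps_nth f i * q ^ i) * (fps_nth g (k - i) * q ^ (k - i)))" for k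
  proof -
    have "fps_nth f i * fps_nth g (k - i) * q ^ k = (fps_nth f i * q ^ i) * (fps_nth g (k - i) * q ^ (k - i))" if "i \<le> k" for i
    proof -
      have "q ^ k = q ^ i * q ^ (k - i)" using that by (simp flip: power_add)
      then show ?thesis by simp
    qed
    then show ?thesis unfolding fps_mult_nth sum_distrib_right atMost_atLeast0 by (intro sum.cong refl) auto
  qed
  have "summable (\<lambda>k. \<Sum>i\<le>k. norm (fps_nth f i * q ^ i) * norm (fps_nth g (k - i) * q ^ (k - i)))"
    using summable_Cauchy_product[of "\<lambda>k. norm (fps_nth f k * q ^ k)" "\<lambda>k. norm (fps_nth g k * q ^ k)"] f g
    unfolding evs_def by simp
  then show a: "evs q (f * g)" unfolding evs_def
  proof (rule summable_comparison_test'[where N = 0])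
    fix k show "norm (norm (fps_nth (f * g) k * q ^ k)) \<le> (\<Sum>i\<le>k. norm (fps_nth f i * q ^ i) * norm (fps_nth g (k - i) * q ^ (k - i)))"
      unfolding e by (simp add: sum_norm_le norm_mult)
  qed
  have "(\<lambda>k. fps_nth (f * g) k * q ^ k) sums (eval_fps f q * eval_fps g q)"
    unfolding e eval_fps_def using f g unfolding evs_def by (rule Cauchy_product_sums)
  then show "eval_fps (f * g) q = eval_fps f q * eval_fps g q" using evs_sums[OF a] sums_unique2 by blast
qed

lemma evs_const: "evs q (fps_const c) \<and> eval_fps (fps_const c) q = c"
proof
  have "(\<lambda>k. norm (fps_nth (fps_const c) k * q ^ k)) = (\<lambda>k. if k = 0 then norm c else 0)" by auto
  then show "evs q (fps_const c)" unfolding evs_def by (simp only:) (rule summable_single)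
qed simp

lemma evs_sum: "(\<And>x. x \<in> A \<Longrightarrow> evs q (f x)) \<Longrightarrow> evs q (sum f A) \<and> eval_fps (sum f A) q = (\<Sum>x\<in>A. eval_fps (f x) q)"
  using evs_const[of q 0] by (induction A rule: infinite_finite_induct) (simp_all add: evs_add)

lemma summable_pow_geometric:
  fixes K :: real
  assumes "0 < K" "K < 1"
  shows "summable (\<lambda>k. real (Suc k) ^ j * K ^ k)"
proof -
  have "norm (of_real K :: complex) < 1" using assms by simp
  from summable_pw[OF this, of j] have "summable (\<lambda>k. pc j (Suc k) * of_real K ^ Suc k)"
    by (subst summable_Suc_iff)
  then have "summable (\<lambda>k. complex_of_real (real (Suc k) ^ j * K ^ Suc k))"
    by (simp add: pc_def del: of_nat_Suc power_Suc)
  then have "summable (\<lambda>k. real (Suc k) ^ j * K ^ Suc k)" by (simp only: summable_of_real_iff)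
  then have "summable (\<lambda>k. inverse K * (real (Suc k) ^ j * K ^ Suc k))" by (rule summable_mult)
  moreover have "inverse K * (real (Suc k) ^ j * K ^ Suc k) = real (Suc k) ^ j * K ^ k" for k
    using assms by simp
  ultimately show ?thesis by (simp only:)
qed

lemma evs_bound:
  assumes "norm q < 1" "\<And>k. norm (fps_nth f k) \<le> C * real (Suc k) ^ j"
  shows "evs q f"
proof -
  obtain K where K: "norm q < K" "K < 1" using assms(1) dense by blast
  then have K0: "0 < K" using norm_ge_zero order_le_less_trans by blast
  have "C * real (Suc 0) ^ j \<ge> 0" using assms(2)[of 0] norm_ge_zero order_trans by blast
  then have C: "C \<ge> 0" by simp
  have s: "summable (\<lambda>k. C * (real (Suc k) ^ j * K ^ k))"
    by (intro summable_mult summable_pow_geometric K0 K(2))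
  show ?thesis unfolding evs_def
  proof (rule summable_comparison_test'[OF s, where N = 0])
    fix k
    have "norm (fps_nth f k * q ^ k) \<le> C * real (Suc k) ^ j * K ^ k"
      unfolding norm_mult norm_power using C K(1) by (intro mult_mono assms(2) power_mono) auto
    then show "norm (norm (fps_nth f k * q ^ k)) \<le> C * (real (Suc k) ^ j * K ^ k)"
      by (simp add: mult.assoc)
  qed
qed

lemma gs_bound: "norm (fps_nth (gs y d) k) \<le> 1 * real (Suc k) ^ fst y"
proof (cases "d dvd k \<and> 0 < k")
  case True
  have "norm (gcoef y (k div d)) \<le> real (k div d) ^ (fst y - 1)" by (rule norm_gcoef_le)
  also have "\<dots> \<le> real (Suc k) ^ (fst y - 1)"
    using div_le_dividend[of k d] by (intro power_mono) linarith+
  also have "\<dots> \<le> real (Suc k) ^ fst y" by (intro power_increasing) auto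
  finally show ?thesis using True by (simp add: gs_def)
qed (auto simp: gs_def)

lemma evs_gn: "norm q < 1 \<Longrightarrow> evs q (gn L p v)"
  by (rule evs_bound[where C = 1]) (use gn_bound in auto)

lemma evs_g_array: "norm q < 1 \<Longrightarrow> evs q (g_array v)"
proof (rule evs_bound)
  fix k show "norm (fps_nth (g_array v) k) \<le> norm (gfac v) * real (Suc k) ^ sum_list (map (\<lambda>y. fst y + 2) v)"
    unfolding g_array_nth[OF order_refl] norm_mult by (intro mult_left_mono gn_bound) simp
qed

text \<open>Each coefficient is eventually constant in \<open>L\<close>, and \<open>gn_bound\<close>
  supplies the domination for Tannery's theorem.\<close>

lemma gn_limit:
  assumes "norm q < 1"
  shows "(\<lambda>L. gfac v * eval_fps (gn L 0 v) q) \<longlonglongrightarrow> eval_fps (g_array v) q"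
proof -
  let ?a = "\<lambda>k L. gfac v * (fps_nth (gn L 0 v) k * q ^ k)"
  let ?j = "sum_list (map (\<lambda>y. fst y + 2) v)"
  obtain K where K: "norm q < K" "K < 1" using assms(1) dense by blast
  then have K0: "0 < K" using norm_ge_zero order_le_less_trans by blast
  have al: "(\<lambda>L. ?a k L) \<longlonglongrightarrow> fps_nth (g_array v) k * q ^ k" for k
  proof (rule tendsto_eventually)
    show "\<forall>\<^sub>F L in sequentially. ?a k L = fps_nth (g_array v) k * q ^ k"
      unfolding eventually_sequentially by (intro exI[of _ k]) (simp add: g_array_nth)
  qed
  have "eventually (\<lambda>L. summable (\<lambda>k. norm (?a k L))) sequentially \<and> summable (\<lambda>k. norm (fps_nth (g_array v) k * q ^ k)) \<and>
      ((\<lambda>L. suminf (\<lambda>k. ?a k L)) \<longlongrightarrow> suminf (\<lambda>k. fps_nth (g_array v) k * q ^ k)) sequentially"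
  proof (rule tannerys_theorem[OF al])
    have "norm (?a k L) \<le> norm (gfac v) * (real (Suc k) ^ ?j * K ^ k)" for k L
      unfolding norm_mult norm_power using K(1) by (intro mult_left_mono mult_mono gn_bound power_mono) auto
    then show "\<forall>\<^sub>F (k, L) in at_top \<times>\<^sub>F sequentially. norm (?a k L) \<le> norm (gfac v) * (real (Suc k) ^ ?j * K ^ k)"
      by (intro always_eventually) auto
    show "summable (\<lambda>k. norm (gfac v) * (real (Suc k) ^ ?j * K ^ k))"
      by (intro summable_mult summable_pow_geometric K0 K(2))
  qed simp
  then have "((\<lambda>L. suminf (\<lambda>k. ?a k L)) \<longlongrightarrow> eval_fps (g_array v) q) sequentially"
    unfolding eval_fps_def by blast
  moreover have "suminf (\<lambda>k. ?a k L) = gfac v * eval_fps (gn L 0 v) q" for L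
    by (rule sums_unique[symmetric], rule sums_mult, rule evs_sums, rule evs_gn[OF assms])
  ultimately show ?thesis by simp
qed

text \<open>The sum over \<open>c\<close> is the series of the Lipschitz formula: after adding the
  representative of \<open>b\<close> to \<open>d N \<tau>\<close> and dividing by \<open>N\<close>,
  the exponential equals \<open>q ^ d\<close> times \<open>eta_pow b\<close>.\<close>

lemma eval_gs:
  fixes b :: "'N::finite mod_ring" and \<tau> :: complex
  assumes "Im \<tau> > 0" "d \<ge> 1" "n \<ge> 1"
  defines "q \<equiv> exp (2 * pi * \<i> * \<tau>)"
  shows "(- 2 * pi * \<i> / CARD('N)) ^ n * eval_fps (gs (n, b) d) q = LL n b (of_int (int d) * of_nat CARD('N) * \<tau>)"
proof -
  have q: "norm q < 1" unfolding q_def by (rule norm_exp_less[OF assms(1)])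
  define w where "w = q ^ d * eta_pow b"
  have wn: "norm w < 1" using q assms(2) by (simp add: w_def norm_mult norm_power norm_eta_pow power_Suc_less_one power_less_one_iff)
  have "evs q (gs (n, b) d)" by (rule evs_bound[OF q gs_bound])
  then have 1: "(\<lambda>k. fps_nth (gs (n, b) d) k * q ^ k) sums eval_fps (gs (n, b) d) q" by (rule evs_sums)
  have "(\<lambda>c. 1 / fact (n - 1) * (pc (n - 1) c * w ^ c)) sums (1 / fact (n - 1) * pw (n - 1) w)"
    unfolding pw_def by (intro sums_mult summable_sums summable_pw wn)
  moreover have "1 / fact (n - 1) * (pc (n - 1) c * w ^ c) = fps_nth (gs (n, b) d) (d * c) * q ^ (d * c)" for c
    using assms(2) by (simp add: pc_def gs_def gcoef_def w_def power_mult power_mult_distrib)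
  ultimately have "(\<lambda>c. fps_nth (gs (n, b) d) (d * c) * q ^ (d * c)) sums (1 / fact (n - 1) * pw (n - 1) w)" by simp
  \<comment> \<open>Only exponents divisible by \<open>d\<close> carry coefficients, so the series
    may be reindexed along the multiples of \<open>d\<close>.\<close>
  moreover have "strict_mono (\<lambda>c. d * c)" using assms(2) by (auto simp: strict_mono_def)
  ultimately have "(\<lambda>k. fps_nth (gs (n, b) d) k * q ^ k) sums (1 / fact (n - 1) * pw (n - 1) w)"
    by (subst (asm) sums_mono_reindex) (auto simp: gs_def dvd_def)
  with 1 have ev: "eval_fps (gs (n, b) d) q = 1 / fact (n - 1) * pw (n - 1) w" by (rule sums_unique2)
  have b0: "0 \<le> to_int_mod_ring b" by transfer simp
  have we: "w = exp (2 * pi * \<i> * ((of_int (int d) * of_nat CARD('N) * \<tau> + of_int (to_int_mod_ring b)) / of_nat CARD('N)))"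
  proof -
    have "w = exp (of_nat d * (2 * pi * \<i> * \<tau>)) * exp (of_nat (nat (to_int_mod_ring b)) * (2 * pi * \<i> / CARD('N)))"
      by (simp only: w_def q_def eta_pow_def exp_of_nat_mult)
    also have "of_nat (nat (to_int_mod_ring b)) = complex_of_int (to_int_mod_ring b)" using b0 by simp
    also have "exp (of_nat d * (2 * pi * \<i> * \<tau>)) * exp (complex_of_int (to_int_mod_ring b) * (2 * pi * \<i> / CARD('N))) =
        exp (2 * pi * \<i> * ((of_int (int d) * of_nat CARD('N) * \<tau> + of_int (to_int_mod_ring b)) / of_nat CARD('N)))"
      unfolding exp_add[symmetric] by (rule arg_cong[where f = exp]) (simp add: add_divide_distrib distrib_left mult_ac)
    finally show ?thesis .
  qed
  show ?thesis unfolding ev LL_def Lq_def we[symmetric] power_divide by simp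
qed

lemma Gx_replicate: "Gx E L d0 b m (replicate t X @ R) = Gx E L d0 b (m + t) R"
  by (induction t arbitrary: m) simp_all

text \<open>Gives the level sums on the coproduct side their meaning: with the Lipschitz values for
  \<open>E\<close> they are truncated divisor functions.\<close>

lemma Gam_gn:
  fixes v :: "'N::finite array" and \<tau> :: complex
  assumes "Im \<tau> > 0" "is_array v" and q_def: "q = exp (2 * pi * \<i> * \<tau>)"
  shows "Gam (\<lambda>n b d. LL n b (of_int d * of_nat CARD('N) * \<tau>)) (int L) (int p) a (rho a (word_of X Y v)) =
    gfac v * eval_fps (gn L p v) q"
  using assms(2)
proof (induction v arbitrary: p a)
  case (Cons y v)
  let ?E = "\<lambda>n (b :: 'N mod_ring) d. LL n b (of_int d * of_nat CARD('N) * \<tau>)"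
  have q: "norm q < 1" unfolding q_def by (rule norm_exp_less[OF assms(1)])
  obtain n b where y: "y = (n, b)" by (cases y)
  have n: "n \<ge> 1" and v: "is_array v" using Cons.prems by (simp_all add: y)
  have c: "(case rho b (word_of X Y v) of X # R' \<Rightarrow> Gx ?E (int L) (int p) b (Suc n) R' | _ \<Rightarrow> 0) = 0"
    by (cases v; cases "hd v") simp_all
  have "Gam ?E (int L) (int p) a (rho a (word_of X Y (y # v))) = Gx ?E (int L) (int p) b n (rho b (word_of X Y v))"
    using n by (simp add: y Gx_replicate)
  also have "\<dots> = (\<Sum>d\<in>{int p<..int L}. ?E n b d * Gam ?E (int L) d b (rho b (word_of X Y v)))"
    by (subst Gx_Gam) (simp add: c)
  also have "\<dots> = (\<Sum>d\<in>{p<..L}. ?E n b (int d) * Gam ?E (int L) (int d) b (rho b (word_of X Y v)))"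
    by (rule sum.reindex_bij_witness[of _ int nat]) auto
  also have "\<dots> = (\<Sum>d\<in>{p<..L}. (- 2 * pi * \<i> / CARD('N)) ^ n * eval_fps (gs (n, b) d) q * (gfac v * eval_fps (gn L d v) q))"
    by (intro sum.cong refl arg_cong2[where f = "(*)"] eval_gs[OF assms(1), folded q_def, symmetric] Cons.IH v n) auto
  also have "\<dots> = gfac (y # v) * (\<Sum>d\<in>{p<..L}. eval_fps (gs y d) q * eval_fps (gn L d v) q)"
    by (simp add: y gfac_def power_add sum_distrib_left mult_ac)
  also have "(\<Sum>d\<in>{p<..L}. eval_fps (gs y d) q * eval_fps (gn L d v) q) = eval_fps (gn L p (y # v)) q"
  proof -
    have m: "evs q (gs y d * gn L d v) \<and> eval_fps (gs y d * gn L d v) q = eval_fps (gs y d) q * eval_fps (gn L d v) q" for d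
      by (rule evs_mult[OF evs_bound[OF q gs_bound] evs_gn[OF q]])
    show ?thesis unfolding gn.simps by (subst evs_sum[THEN conjunct2]) (simp_all add: m)
  qed
  finally show ?case .
qed (simp add: gfac_def)

section \<open>Multiple Eisenstein series\<close>

text \<open>For fixed \<open>L\<close> only finitely many levels occur and the limit can be taken in
  each. Level 0 gives a zeta value, the positive levels give \<open>level_sum\<close>, and
  \<open>convolution_levels\<close> reassembles them into the convolution.\<close>

lemma Eisenstein_partial_limit:
  fixes v :: "'N::finite array" and \<tau> :: complex
  assumes "Im \<tau> > 0" "big v"
  defines "E \<equiv> \<lambda>n (b :: 'N mod_ring) d. LL n b (of_int d * of_nat CARD('N) * \<tau>)"
  shows "(\<lambda>M. Eisenstein_partial v \<tau> L M) \<longlonglongrightarrow>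
    (\<Sum>R\<in>AW (length (word_of X Y v)). zeta_sh (csF (dword v) R) * Gam E (int L) 0 0 R)"
proof -
  let ?x = "\<lambda>d. of_int d * of_nat CARD('N) * \<tau>"
  have c: "(\<Sum>R\<in>AW (length (word_of X Y v)). zeta_sh (csF (dword v) R) * Gam E (int L) 0 0 R) =
     split_sum (\<lambda>Q0 Q1. zr 0 Q0 * XX (level_sum E) (int L) 0 Q1) v"
    using convolution_levels[OF assms(2), of 0 0 "length (word_of X Y v)" E "int L" 0]
    by (simp add: dword_def down_def)
  have ts: "(\<lambda>M. split_sum (f M) v) \<longlonglongrightarrow> split_sum g v"
    if "\<And>P Q. v = P @ Q \<Longrightarrow> (\<lambda>M. f M P Q) \<longlonglongrightarrow> g P Q" for f and g :: "'N array \<Rightarrow> 'N array \<Rightarrow> complex" and v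
    using that
  proof (induction v arbitrary: f g)
    case (Cons y v)
    have "(\<lambda>M. split_sum (\<lambda>u. f M (y # u)) v) \<longlonglongrightarrow> split_sum (\<lambda>u. g (y # u)) v"
      by (rule Cons.IH) (simp add: Cons.prems)
    moreover have "(\<lambda>M. f M [] (y # v)) \<longlonglongrightarrow> g [] (y # v)" by (rule Cons.prems) simp
    ultimately show ?case by (simp add: tendsto_add)
  qed simp
  show ?thesis unfolding Eisenstein_partial_levels c
  proof (rule ts, rule tendsto_mult)
    fix P Q assume v: "v = P @ Q"
    then have b: "big P" "big Q" using assms(2) by simp_all
    have "nest (<) {- int M..int M} 0 (map (cfun (\<lambda>m n. lat n 0 m)) P) = fps_nth (fz M 0 P) 0" for M
    proof -
      have l: "lat n 0 m = of_real (1 / of_int m ^ n)" for n m by (simp add: lat_def)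
      have "nest (<) {- int M..int M} 0 (map (cfun (\<lambda>m n. lat n 0 m)) P) =
          nest (<) {1..int M} 0 (map (\<lambda>y q. complex_of_real (cfun (\<lambda>m n. 1 / of_int m ^ n) y q)) P)"
      proof -
        have "nest (<) {- int M..int M} 0 (map (cfun (\<lambda>m n. lat n 0 m)) P) = nest (<) {1..int M} 0 (map (cfun (\<lambda>m n. lat n 0 m)) P)"
          by (rule nest_cong_set) auto
        also have "\<dots> = nest (<) {1..int M} 0 (map (\<lambda>y q. complex_of_real (cfun (\<lambda>m n. 1 / of_int m ^ n) y q)) P)"
          by (rule nest_cong_map) (simp add: cfun_def case_prod_beta l)
        finally show ?thesis .
      qed
      also have "\<dots> = of_real (zt (int M) P)"
        unfolding zt_def by (subst nest_hom[where h = of_real]) (simp_all add: o_def)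
      finally show ?thesis by (simp add: fz_nth_0)
    qed
    then show "(\<lambda>M. nest (<) {- int M..int M} 0 (map (cfun (\<lambda>m n. lat n 0 m)) P)) \<longlonglongrightarrow> zr 0 P"
      using tendsto_fz[OF b(1), of 0] by simp
    show "(\<lambda>M. XX (PsiM ?x M) (int L) 0 Q) \<longlonglongrightarrow> XX (level_sum E) (int L) 0 Q"
    proof (rule tendsto_XX)
      fix B :: "'N array" and d :: int assume B: "B \<noteq> []" "set B \<subseteq> set Q" and d: "d > 0"
      have bB: "big B" using b(2) B(2) unfolding big_def by blast
      have "Im (?x d) > 0" using d assms(1) by simp
      from level_limit[OF this bB B(1), of d]
      show "(\<lambda>M. PsiM ?x M B d) \<longlonglongrightarrow> level_sum E B d"
        by (simp add: PsiM_def level_sum_def E_def)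
    qed
  qed
qed

text \<open>The outer limit touches only the divisor sums, with constant zeta values as
  coefficients. Right words with leading \<open>X\<close> drop out because \<open>Gam\<close>
  vanishes on them.\<close>

lemma Eisenstein_array_eq:
  fixes v :: "'N::finite array" and \<tau> :: complex
  assumes "Im \<tau> > 0" "big v"
  shows "Eisenstein_array v \<tau> = (\<Sum>R\<in>right_words (length (word_of X Y v)).
    zeta_sh (csF (dword v) R) * eval_fps (g_array (array_of (Word (irho 0 R)))) (exp (2 * pi * \<i> * \<tau>)))"
proof -
  let ?N = "length (word_of X Y v)" and ?q = "exp (2 * pi * \<i> * \<tau>)"
  let ?E = "\<lambda>n (b :: 'N mod_ring) d. LL n b (of_int d * of_nat CARD('N) * \<tau>)"
  have q: "norm ?q < 1" by (rule norm_exp_less[OF assms(1)])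
  have "lim (\<lambda>M. Eisenstein_partial v \<tau> L M) = (\<Sum>R\<in>right_words ?N. zeta_sh (csF (dword v) R) * Gam ?E (int L) 0 0 R)" for L
  proof -
    have "lim (\<lambda>M. Eisenstein_partial v \<tau> L M) = (\<Sum>R\<in>AW ?N. zeta_sh (csF (dword v) R) * Gam ?E (int L) 0 0 R)"
      by (rule limI[OF Eisenstein_partial_limit[OF assms]])
    also have "\<dots> = (\<Sum>R\<in>right_words ?N. zeta_sh (csF (dword v) R) * Gam ?E (int L) 0 0 R)"
    proof (rule sum.mono_neutral_right[OF finite_AW])
      show "right_words ?N \<subseteq> (AW ?N :: 'N mod_ring letter list set)" by (auto simp: right_words_def AW_def)
      show "\<forall>R\<in>AW ?N - right_words ?N. zeta_sh (csF (dword v) R) * Gam ?E (int L) 0 0 R = 0"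
      proof
        fix R :: "'N mod_ring letter list" assume "R \<in> AW ?N - right_words ?N"
        then have "\<not> nonX R" by (auto simp: right_words_def AW_def)
        then have "Gam ?E (int L) 0 0 R = 0" by (cases R; cases "hd R") simp_all
        then show "zeta_sh (csF (dword v) R) * Gam ?E (int L) 0 0 R = 0" by simp
      qed
    qed
    finally show ?thesis .
  qed
  then have "Eisenstein_array v \<tau> = lim (\<lambda>L. \<Sum>R\<in>right_words ?N. zeta_sh (csF (dword v) R) * Gam ?E (int L) 0 0 R)"
    by (simp add: Eisenstein_array_def)
  also have "\<dots> = (\<Sum>R\<in>right_words ?N. zeta_sh (csF (dword v) R) * eval_fps (g_array (array_of (Word (irho 0 R)))) ?q)"
  proof (rule limI, intro tendsto_sum tendsto_mult tendsto_const)
    fix R :: "'N mod_ring letter list" assume "R \<in> right_words ?N"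
    then have "nonX (irho 0 R)" by (simp add: right_words_def)
    then obtain u where u: "is_array u" "word_of X Y u = irho 0 R" using ex_array_X by blast
    then have "R = rho 0 (word_of X Y u)" by simp
    moreover have "array_of (Word (irho 0 R)) = u" using array_of_Word[OF u(1)] u(2) by simp
    ultimately show "(\<lambda>L. Gam ?E (int L) 0 0 R) \<longlonglongrightarrow> eval_fps (g_array (array_of (Word (irho 0 R)))) ?q"
      using gn_limit[OF q, of u] Gam_gn[OF assms(1) u(1) refl, of _ 0 0] by simp
  qed
  finally show ?thesis .
qed

theorem theorem1p1:
  fixes w :: "'N::finite H" and \<tau> :: complex
  assumes "w \<in> H2" and "Im \<tau> > 0"
  shows "Eisenstein w \<tau> = eval_fps (zeta_star_g w) (exp (2 * pi * \<i> * \<tau>))"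
proof -
  define q where "q = exp (2 * pi * \<i> * \<tau>)"
  let ?G = "\<lambda>R. g_array (array_of (Word (irho 0 R)))"
  have q: "norm q < 1" unfolding q_def by (rule norm_exp_less[OF assms(2)])
  have H: "\<exists>v. u = Word (word_of X Y v) \<and> big v" if "u \<in> Poly_Mapping.keys w" for u
    using keys_H2[OF assms(1) that] unfolding big_def .
  have "Poly_Mapping.keys w \<subseteq> H1_words"
  proof
    fix u assume "u \<in> Poly_Mapping.keys w"
    from H[OF this] obtain v where "u = Word (word_of X Y v)" by blast
    then show "u \<in> H1_words" unfolding H1_words_def using nonX_word_of by blast
  qed
  note z = zeta_star_g_H1[OF this]
  have "evs q (fps_const c * ?G R) \<and> eval_fps (fps_const c * ?G R) q = c * eval_fps (?G R) q"
    for c and R :: "'N mod_ring letter list"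
    using evs_mult[OF evs_const[THEN conjunct1] evs_g_array[OF q]] evs_const[of q c] by simp
  then have 1: "evs q (\<Sum>R\<in>A. fps_const (c R) * ?G R) \<and>
      eval_fps (\<Sum>R\<in>A. fps_const (c R) * ?G R) q = (\<Sum>R\<in>A. c R * eval_fps (?G R) q)"
    for c and A :: "'N mod_ring letter list set"
    using evs_sum[of A q "\<lambda>R. fps_const (c R) * ?G R"] by simp
  have 2: "evs q (fps_const c * f) \<and> eval_fps (fps_const c * f) q = c * eval_fps f q" if "evs q f" for c f
    using evs_mult[OF evs_const[THEN conjunct1] that] evs_const[of q c] by simp
  have "eval_fps (zeta_star_g w) q = (\<Sum>u\<in>Poly_Mapping.keys w. of_rat (Poly_Mapping.lookup w u) *
    (\<Sum>R\<in>right_words (length (letters u)). zeta_sh (csF (rho 0 (letters u)) R) * eval_fps (?G R) q))"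
    unfolding z by (subst evs_sum[THEN conjunct2]) (simp_all add: 1 2)
  also have "\<dots> = Eisenstein w \<tau>"
    unfolding Eisenstein_def
  proof (intro sum.cong refl arg_cong2[where f = "(*)"])
    fix u assume "u \<in> Poly_Mapping.keys w"
    from H[OF this] obtain v where v: "u = Word (word_of X Y v)" "big v" by blast
    have "array_of u = v" unfolding v(1) by (rule array_of_Word[OF big_is_array[OF v(2)]])
    then show "(\<Sum>R\<in>right_words (length (letters u)). zeta_sh (csF (rho 0 (letters u)) R) * eval_fps (?G R) q) =
        Eisenstein_array (array_of u) \<tau>"
      using Eisenstein_array_eq[OF assms(2) v(2), folded q_def] by (simp add: v(1) dword_def)
  qed
  finally show ?thesis by (simp only: q_def)
qed

end
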